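(* Let $\alpha_1,\dots,\alpha_N\in\mathbb C^r\simeq\mathfrak h$ satisfy, for some non-negative integers $n_1,\dots,n_r$, the neutrality condition $\sum_{k=1}^N\alpha_k-2Q=-\sum_{i=1}^rn_i\gamma e_i$, and assume that the integral defining $\langle\prod_{k=1}^NV_{\alpha_k}(z_k)\rangle_\gamma$ is absolutely convergent. Then for $z_1,\dots,z_N\in\mathbb C$ distinct and $s$ any spin of $\mathfrak g$, $$\Big\langle\mathbf W^{(s)}_{-s}V_{\alpha_1}(z_1)\prod_{k=2}^NV_{\alpha_k}(z_k)\Big\rangle_\gamma=\sum_{k=2}^N\sum_{i=1}^s\frac1{(z_1-z_k)^i}\Big\langle V_{\alpha_1}(z_1)\,\mathbf W^{(s)}_{i-s}V_{\alpha_k}(z_k)\prod_{l\ne1,k}V_{\alpha_l}(z_l)\Big\rangle_\gamma.$$ Moreover, for all $0\le n\le2s-2$, the global Ward identities hold: $$\sum_{k=1}^N\sum_{i=0}^{s-1}\binom niz_k^{n-i}\Big\langle\mathbf W^{(s)}_{i+1-s}V_{\alpha_k}(z_k)\prod_{l\ne k}V_{\alpha_l}(z_l)\Big\rangle_\gamma=0.$$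
   Context: Lie data: $\mathfrak g$ is a finite-dimensional complex simple Lie algebra of rank $r$; $\mathfrak a\simeq\mathbb R^r$ its Euclidean space (longest roots have squared norm $2$), $\mathfrak h=\mathfrak a\otimes\mathbb C$ with bilinear $\langle\cdot,\cdot\rangle$, simple roots $e_i$, $e_i^\vee=2e_i/\langle e_i,e_i\rangle$, $\rho,\rho^\vee$ with $\langle\rho,e_i^\vee\rangle=1=\langle\rho^\vee,e_i\rangle$. Spins of $\mathfrak g$: exponents plus one. $\gamma\in\mathbb C\setminus\{0\}$, $Q=\gamma\rho+\frac2\gamma\rho^\vee$, central charge $\mathbf c=r+6\langle Q,Q\rangle$, assumed generic (in the dense open set where the currents below are constructed). Currents: Let $V_+$ be the algebra of polynomials in the coordinates of $\varphi_n\in\mathfrak h$, $n\ge1$, with $\deg\varphi_n=n$ and $\partial_n$ the gradient in $\varphi_n$. Let $\mathcal M_+\subset V_+$ be the set of $F$ with $\operatorname{Res}_{z=0}\big(e^{\sum_{n\ge1}\langle\gamma e_i,\varphi_n\rangle z^n}e^{\sum_{n\ge1}\frac1{2n}\langle\gamma e_i,\partial_n\rangle z^{-n}}F\big)=0$ for all $1\le i\le r$ (the space of states of the $W$-algebra of $\mathfrak g$ for generic $\mathbf c$). For each spin $s$, the generating current $\mathbf W^{(s)}$ is given by a weighted-homogeneous polynomial $P_s=P_s(\varphi_1,\varphi_2,\dots)\in\mathcal M_+$ of degree $s$: $\mathbf W^{(s)}[\mathbf X](z)=:P_s(\partial\mathbf X(z),\tfrac1{2!}\partial^2\mathbf X(z),\tfrac1{3!}\partial^3\mathbf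 X(z),\dots):$. These generators of the $W$-algebra are chosen so that $P_2=2\langle Q,\varphi_2\rangle-\langle\varphi_1,\varphi_1\rangle$ (stress-energy tensor) and, for the other generators, the modes satisfy $[\mathbf L_n,\mathbf W^{(s)}_m]=((s-1)n-m)\mathbf W^{(s)}_{n+m}$, where the modes are those of the fields obtained by replacing $\partial\mathbf X$ with $\partial\Phi(z)=i\sum_n\mathbf A_nz^{-n-1}$, $[\langle u,\mathbf A_n\rangle,\langle v,\mathbf A_m\rangle]=\frac n2\langle u,v\rangle\delta_{n,-m}$, normally ordered, $\mathbf W^{(s)}(z)=\sum_n\mathbf W^{(s)}_nz^{-n-s}$, $\mathbf L=\mathbf W^{(2)}$. Descendants: $V_\alpha(w)$ is the Wick exponential $:e^{\langle\alpha,\mathbf X(w)\rangle}:$. Substituting in $P_s$ for $\varphi_n$ the expression $\frac1{n!}\partial^n\mathbf X(z)+\frac{(-1)^n}{2n}\frac{\alpha}{(z-w)^n}$ and Taylor-expanding the holomorphic derivatives $\partial^n\mathbf X(z)$ at $w$ gives a series $\sum_{j\ge0}(z-w)^{j-s}\mathbf W^{(s)}_{-j,\alpha}[\mathbf X](w)$, with $\mathbf W^{(s)}_{-j,\alpha}$ polynomial in the $\partial^n\mathbf X(w)$. The descendant field is $\mathbf W^{(s)}_{-j}V_\alpha(w)=:\mathbf W^{(s)}_{-j,\alpha}[\mathbf X](w)V_\alpha(w):$, $0\le j\le s$. Correlation functions: if $\sum_k\beta_k=2Q$ and $y_1,\dots,y_M$ are distinct, $\langle\prod_kV_{\beta_k}(y_k)\rangle_\gamma=\prod_{k<l}|y_k-y_l|^{-\langle\beta_k,\beta_l\rangle}$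 and, for $R$ polynomial in holomorphic derivatives, $\langle:R[\mathbf X](y_1)V_{\beta_1}(y_1):\prod_{k\ge2}V_{\beta_k}(y_k)\rangle_\gamma=R[h](y_1)\prod_{k<l}|y_k-y_l|^{-\langle\beta_k,\beta_l\rangle}$ with $h(x)=\sum_{k\ge2}\beta_k\ln\frac1{|x-y_k|}$ (the value given by Gaussian integration by parts). Under the general neutrality condition, with $n=\sum n_i$, $$\Big\langle\prod_{k=1}^NV_{\alpha_k}(z_k)\Big\rangle_\gamma=\int_{\mathbb C^n}\Big\langle\prod_{i=1}^r\prod_{j=1}^{n_i}V_{\gamma e_i}(x_{i,j})\prod_kV_{\alpha_k}(z_k)\Big\rangle_\gamma\prod_{i,j}d^2x_{i,j},$$ and correlation functions containing one descendant field are defined as the limit as $\varepsilon\to0$ of the analogous integrals over $\mathbb C_\varepsilon^n$, $\mathbb C_\varepsilon=\mathbb C\setminus\bigcup_{k}B(z_k,\varepsilon)$, with the descendant inserted in the integrand. *)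

theory Defs
  imports
    "HOL-Analysis.Analysis"
    "HOL-Library.Poly_Mapping"
    "HOL-Computational_Algebra.Formal_Laurent_Series"
begin

section \<open>Simple Lie algebras and their Euclidean space\<close>

text \<open>
  The space \<open>\<aa>\<close> is \<open>real^'r\<close> and \<open>\<hh> = \<aa> \<otimes> \<complex>\<close> is \<open>complex^'r\<close>, with \<open>r = CARD('r)\<close>.
  The form on \<open>\<hh>\<close> is complex bilinear (not Hermitian), so \<open>(\<bullet>)\<close> cannot be used for it.
\<close>

definition bil :: "complex^'r \<Rightarrow> complex^'r \<Rightarrow> complex" where
  "bil u v = (\<Sum>i\<in>UNIV. vec_nth u i * vec_nth v i)"

definition cvec :: "real^'r \<Rightarrow> complex^'r" where
  "cvec x = (\<chi> i. complex_of_real (vec_nth x i))"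

locale complex_lie_algebra = vector_space scale
  for scale :: "complex \<Rightarrow> 'g::ab_group_add \<Rightarrow> 'g" +
  fixes bracket :: "'g \<Rightarrow> 'g \<Rightarrow> 'g"
  assumes bracket_linear_right: "Vector_Spaces.linear scale scale (bracket x)"
    and bracket_linear_left: "Vector_Spaces.linear scale scale (\<lambda>x. bracket x y)"
    and bracket_self: "bracket x x = 0"
    and jacobi: "bracket x (bracket y w) + bracket y (bracket w x) + bracket w (bracket x y) = 0"
begin

definition lie_ideal :: "'g set \<Rightarrow> bool" where
  "lie_ideal I \<longleftrightarrow> subspace I \<and> (\<forall>x. \<forall>y\<in>I. bracket x y \<in> I)"

definition lie_simple :: bool where
  "lie_simple \<longleftrightarrow> (\<exists>x y. bracket x y \<noteq> 0) \<and> (\<forall>I. lie_ideal I \<longrightarrow> I = {0} \<or> I = UNIV)"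

primrec lower_central :: "'g set \<Rightarrow> nat \<Rightarrow> 'g set" where
  "lower_central H 0 = H"
| "lower_central H (Suc n) = span {bracket x y | x y. x \<in> H \<and> y \<in> lower_central H n}"

text \<open>A Cartan subalgebra is a nilpotent self-normalising subalgebra.\<close>

definition cartan_subalgebra :: "'g set \<Rightarrow> bool" where
  "cartan_subalgebra H \<longleftrightarrow> subspace H \<and> (\<forall>x\<in>H. \<forall>y\<in>H. bracket x y \<in> H)
     \<and> (\<exists>n. lower_central H n = {0})
     \<and> (\<forall>x. (\<forall>y\<in>H. bracket x y \<in> H) \<longrightarrow> x \<in> H)"

definition trace_of :: "('g \<Rightarrow> 'g) \<Rightarrow> complex" where
  "trace_of f = (let B = (SOME B. independent B \<and> span B = UNIV)
     in \<Sum>b\<in>B. representation B (f b) b)"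

definition killing :: "'g \<Rightarrow> 'g \<Rightarrow> complex" where
  "killing x y = trace_of (\<lambda>w. bracket x (bracket y w))"

text \<open>\<open>f\<close> is a weight of the adjoint action of \<open>H\<close> (a root, if it is nonzero on \<open>H\<close>).\<close>

definition adjoint_weight :: "'g set \<Rightarrow> ('g \<Rightarrow> complex) \<Rightarrow> bool" where
  "adjoint_weight H f \<longleftrightarrow> (\<exists>x. x \<noteq> 0 \<and> (\<forall>h\<in>H. bracket h x = scale (f h) x))"

text \<open>
  Roots as vectors of \<open>\<aa>\<close>: given an identification \<open>\<iota>\<close> of \<open>H\<close> with \<open>\<hh>\<close>, the vector \<open>a\<close>
  stands for the functional \<open>h \<mapsto> \<langle>a, \<iota> h\<rangle>\<close>.
\<close>

definition roots :: "'g set \<Rightarrow> ('g \<Rightarrow> complex^'r) \<Rightarrow> (real^'r) set" where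
  "roots H \<iota> = {a. a \<noteq> 0 \<and> adjoint_weight H (\<lambda>h. bil (cvec a) (\<iota> h))}"

end

text \<open>
  A finite-dimensional complex simple Lie algebra with a Cartan subalgebra \<open>H\<close>, an identification
  \<open>\<iota>\<close> of \<open>H\<close> with \<open>\<hh>\<close> under which the form of \<open>\<hh>\<close> is a positive multiple of the Killing form and
  the roots are real vectors, and simple roots \<open>e 1, \<dots>, e r\<close>. The form is normalised by
  the length of the longest roots.
\<close>

locale simple_lie_data = complex_lie_algebra scale bracket
  for scale :: "complex \<Rightarrow> 'g::ab_group_add \<Rightarrow> 'g" and bracket :: "'g \<Rightarrow> 'g \<Rightarrow> 'g" +
  fixes H :: "'g set" and \<iota> :: "'g \<Rightarrow> complex^'r" and e :: "nat \<Rightarrow> real^'r"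
  assumes finite_dimensional: "\<exists>B. finite B \<and> span B = UNIV"
    and simple: lie_simple
    and cartan: "cartan_subalgebra H"
    and iota_bij: "bij_betw \<iota> H UNIV"
    and iota_add: "x \<in> H \<Longrightarrow> y \<in> H \<Longrightarrow> \<iota> (x + y) = \<iota> x + \<iota> y"
    and iota_scale: "x \<in> H \<Longrightarrow> \<iota> (scale c x) = c *s \<iota> x"
    and killing_iota: "\<exists>c>0. \<forall>x\<in>H. \<forall>y\<in>H. killing x y = complex_of_real c * bil (\<iota> x) (\<iota> y)"
    and real_roots: "adjoint_weight H f \<Longrightarrow> \<exists>a. \<forall>h\<in>H. f h = bil (cvec a) (\<iota> h)"
    and long_roots_le: "a \<in> roots H \<iota> \<Longrightarrow> a \<bullet> a \<le> 2"
    and long_roots_eq: "\<exists>a\<in>roots H \<iota>. a \<bullet> a = 2"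
    and simple_roots: "i \<in> {1..CARD('r)} \<Longrightarrow> e i \<in> roots H \<iota>"
    and simple_roots_inj: "inj_on e {1..CARD('r)}"
    and simple_roots_independent: "real_vector.independent (e ` {1..CARD('r)})"
    and simple_roots_base: "a \<in> roots H \<iota> \<Longrightarrow> \<exists>c :: nat \<Rightarrow> int.
          a = (\<Sum>i=1..CARD('r). of_int (c i) *\<^sub>R e i)
          \<and> ((\<forall>i\<in>{1..CARD('r)}. 0 \<le> c i) \<or> (\<forall>i\<in>{1..CARD('r)}. c i \<le> 0))"

definition coroot :: "real^'r \<Rightarrow> real^'r" where
  "coroot a = (2 / (a \<bullet> a)) *\<^sub>R a"

definition weyl_vec :: "(nat \<Rightarrow> real^'r) \<Rightarrow> real^'r" where
  "weyl_vec e = (THE \<rho>. \<forall>i\<in>{1..CARD('r)}. \<rho> \<bullet> coroot (e i) = 1)"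

definition weyl_covec :: "(nat \<Rightarrow> real^'r) \<Rightarrow> real^'r" where
  "weyl_covec e = (THE \<rho>. \<forall>i\<in>{1..CARD('r)}. \<rho> \<bullet> e i = 1)"

definition background :: "(nat \<Rightarrow> real^'r) \<Rightarrow> complex \<Rightarrow> complex^'r" where
  "background e \<gamma> = \<gamma> *s cvec (weyl_vec e) + (2 / \<gamma>) *s cvec (weyl_covec e)"

definition central_charge :: "(nat \<Rightarrow> real^'r) \<Rightarrow> complex \<Rightarrow> complex" where
  "central_charge e \<gamma> = of_nat CARD('r) + 6 * bil (background e \<gamma>) (background e \<gamma>)"

text \<open>
  The exponents are the \<open>m\<close> with \<open>0 < m < h\<close> for which \<open>exp (2 \<pi> \<i> m / h)\<close> is an eigenvalue of a
  Coxeter element, \<open>h\<close> being its order; they are counted with the multiplicity of the eigenvalue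
  (there is a double exponent in type \<open>D\<close> of even rank). A Coxeter element has finite order,
  hence this multiplicity is the dimension of the eigenspace.
\<close>

definition reflection :: "real^'r \<Rightarrow> complex^'r \<Rightarrow> complex^'r" where
  "reflection a v = v - (2 * bil (cvec a) v / bil (cvec a) (cvec a)) *s cvec a"

definition coxeter :: "(nat \<Rightarrow> real^'r) \<Rightarrow> complex^'r \<Rightarrow> complex^'r" where
  "coxeter e = foldr (\<lambda>i f. reflection (e i) \<circ> f) [1..<Suc CARD('r)] id"

definition coxeter_number :: "(nat \<Rightarrow> real^'r) \<Rightarrow> nat" where
  "coxeter_number e = (LEAST h. h > 0 \<and> coxeter e ^^ h = id)"

definition exponent_mult :: "(nat \<Rightarrow> real^'r) \<Rightarrow> nat \<Rightarrow> nat" where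
  "exponent_mult e m = (if 0 < m \<and> m < coxeter_number e
     then vec.dim {v. coxeter e v = exp (2 * complex_of_real pi * \<i> * of_nat m / of_nat (coxeter_number e)) *s v}
     else 0)"


section \<open>The polynomial algebra and the states of the W-algebra\<close>

text \<open>
  The variable \<open>(n, i)\<close> is the \<open>i\<close>-th coordinate of \<open>\<phi>\<^sub>n\<close>. The type also has variables with
  \<open>n = 0\<close>, which \<open>Vplus\<close> excludes.
\<close>

type_synonym 'r dpoly = "((nat \<times> 'r) \<Rightarrow>\<^sub>0 nat) \<Rightarrow>\<^sub>0 complex"

definition Vplus :: "'r dpoly set" where
  "Vplus = {F. \<forall>m\<in>Poly_Mapping.keys F. \<forall>v\<in>Poly_Mapping.keys m. 1 \<le> fst v}"

definition cst :: "complex \<Rightarrow> 'r dpoly" where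
  "cst c = Poly_Mapping.single 0 c"

definition phi :: "nat \<times> 'r \<Rightarrow> 'r dpoly" where
  "phi v = Poly_Mapping.single (Poly_Mapping.single v 1) 1"

definition partial :: "nat \<times> 'r \<Rightarrow> 'r dpoly \<Rightarrow> 'r dpoly" where
  "partial v F = (\<Sum>m\<in>Poly_Mapping.keys F. Poly_Mapping.single (m - Poly_Mapping.single v 1)
     (of_nat (Poly_Mapping.lookup m v) * Poly_Mapping.lookup F m))"

text \<open>Evaluation in a commutative algebra with structure map \<open>c\<close>.\<close>

definition peval :: "(complex \<Rightarrow> 'b) \<Rightarrow> (nat \<times> 'r \<Rightarrow> 'b) \<Rightarrow> 'r dpoly \<Rightarrow> 'b::comm_semiring_1" where
  "peval c f F = (\<Sum>m\<in>Poly_Mapping.keys F. c (Poly_Mapping.lookup F m)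
     * (\<Prod>v\<in>Poly_Mapping.keys m. f v ^ Poly_Mapping.lookup m v))"

definition weighted_homogeneous :: "nat \<Rightarrow> 'r dpoly \<Rightarrow> bool" where
  "weighted_homogeneous s F \<longleftrightarrow> (\<forall>m\<in>Poly_Mapping.keys F.
     (\<Sum>v\<in>Poly_Mapping.keys m. fst v * Poly_Mapping.lookup m v) = s)"

definition phi_dir :: "complex^'r \<Rightarrow> nat \<Rightarrow> 'r dpoly" where
  "phi_dir u n = (\<Sum>i\<in>UNIV. cst (vec_nth u i) * phi (n, i))"

definition partial_dir :: "complex^'r \<Rightarrow> nat \<Rightarrow> 'r dpoly \<Rightarrow> 'r dpoly" where
  "partial_dir u n F = (\<Sum>i\<in>UNIV. cst (vec_nth u i) * partial (n, i) F)"

text \<open>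
  For operators \<open>T 1, T 2, \<dots>\<close>, \<open>series_power T k n\<close> is the coefficient of \<open>t^n\<close> in
  \<open>(\<Sum>j\<ge>1. T j t^j)^k\<close>, and \<open>series_exp T n\<close> the one in the exponential of this series.
\<close>

primrec series_power :: "(nat \<Rightarrow> 'r dpoly \<Rightarrow> 'r dpoly) \<Rightarrow> nat \<Rightarrow> nat \<Rightarrow> 'r dpoly \<Rightarrow> 'r dpoly" where
  "series_power T 0 n F = (if n = 0 then F else 0)"
| "series_power T (Suc k) n F = (\<Sum>j=1..n. T j (series_power T k (n - j) F))"

definition series_exp :: "(nat \<Rightarrow> 'r dpoly \<Rightarrow> 'r dpoly) \<Rightarrow> nat \<Rightarrow> 'r dpoly \<Rightarrow> 'r dpoly" where
  "series_exp T n F = (\<Sum>k\<le>n. cst (1 / fact k) * series_power T k n F)"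

text \<open>
  The residue: the coefficient of \<open>z^b\<close> in the first exponential times that of \<open>z^(-b-1)\<close> in the
  second one. On a polynomial, only finitely many \<open>b\<close> contribute.
\<close>

definition screening :: "complex^'r \<Rightarrow> 'r dpoly \<Rightarrow> 'r dpoly" where
  "screening u F = Sum_any (\<lambda>b. series_exp (\<lambda>n G. phi_dir u n * G) b
     (series_exp (\<lambda>n G. cst (1 / (2 * of_nat n)) * partial_dir u n G) (Suc b) F))"

definition Mplus :: "(nat \<Rightarrow> real^'r) \<Rightarrow> complex \<Rightarrow> 'r dpoly set" where
  "Mplus e \<gamma> = {F \<in> Vplus. \<forall>i\<in>{1..CARD('r)}. screening (\<gamma> *s cvec (e i)) F = 0}"


section \<open>Modes of the currents\<close>

text \<open>
  The Heisenberg algebra \<open>[\<langle>u, A\<^sub>n\<rangle>, \<langle>v, A\<^sub>m\<rangle>] = (n/2) \<langle>u, v\<rangle> \<delta>\<close> on the Fock space of charge \<open>a\<close>: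
  \<open>A\<^sub>0\<close> is the scalar \<open>a\<close>, and \<open>\<phi>\<^sub>n = (\<i>/n) A\<^sub>-\<^sub>n\<close> is the state of the field \<open>\<partial>^n \<Phi> / n!\<close>.
\<close>

definition heisenberg :: "complex^'r \<Rightarrow> 'r \<Rightarrow> int \<Rightarrow> 'r dpoly \<Rightarrow> 'r dpoly" where
  "heisenberg a i k F =
     (if k < 0 then cst (\<i> * of_int k) * phi (nat (- k), i) * F
      else if k = 0 then cst (vec_nth a i) * F
      else cst (\<i> / 2) * partial (nat k, i) F)"

text \<open>
  The coefficient of \<open>z^(-k-n)\<close> in \<open>\<partial>^n \<Phi> / n! = \<partial>^(n-1) (\<i> \<Sum>k. A\<^sub>k z^(-k-1)) / n!\<close>.
\<close>

definition field_mode :: "complex^'r \<Rightarrow> nat \<times> 'r \<Rightarrow> int \<Rightarrow> 'r dpoly \<Rightarrow> 'r dpoly" where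
  "field_mode a v k F =
     cst (\<i> / of_nat (fst v) * ((- of_int k - 1) gchoose (fst v - 1))) * heisenberg a (snd v) k F"

text \<open>
  Modes of the normally ordered product of the fields in a list, by
  \<open>:\<phi> \<Psi>: = \<phi>\<^sup>- :\<Psi>: + :\<Psi>: \<phi>\<^sup>+\<close> with \<open>\<phi>\<^sup>+\<close> the annihilation part. On a polynomial in \<open>Vplus\<close>
  all sums are finite, and the result does not depend on the order of the list.
\<close>

primrec normal_ordered :: "complex^'r \<Rightarrow> (nat \<times> 'r) list \<Rightarrow> int \<Rightarrow> 'r dpoly \<Rightarrow> 'r dpoly" where
  "normal_ordered a [] m F = (if m = 0 then F else 0)"
| "normal_ordered a (v # vs) m F = Sum_any (\<lambda>k.
     if k \<le> 0 then field_mode a v k (normal_ordered a vs (m - k) F)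
     else normal_ordered a vs (m - k) (field_mode a v k F))"

definition mode :: "complex^'r \<Rightarrow> 'r dpoly \<Rightarrow> int \<Rightarrow> 'r dpoly \<Rightarrow> 'r dpoly" where
  "mode a P m F = (\<Sum>M\<in>Poly_Mapping.keys P. cst (Poly_Mapping.lookup P M)
     * normal_ordered a (SOME vs. \<forall>v. count_list vs v = Poly_Mapping.lookup M v) m F)"

definition stress :: "complex^'r \<Rightarrow> 'r dpoly" where
  "stress Q = 2 * phi_dir Q 2 - (\<Sum>i\<in>UNIV. phi (1, i) * phi (1, i))"

inductive_set generated_by :: "(nat \<Rightarrow> 'r dpoly) \<Rightarrow> ('r::finite) dpoly set"
  for P :: "nat \<Rightarrow> ('r::finite) dpoly" where
  vacuum: "1 \<in> generated_by P"
| add: "F \<in> generated_by P \<Longrightarrow> G \<in> generated_by P \<Longrightarrow> F + G \<in> generated_by P"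
| scale: "F \<in> generated_by P \<Longrightarrow> cst c * F \<in> generated_by P"
| mode: "F \<in> generated_by P \<Longrightarrow> j \<in> {1..CARD('r)} \<Longrightarrow> mode 0 (P j) m F \<in> generated_by P"

text \<open>
  The generating currents are numbered by \<open>1, \<dots>, r\<close>, since a spin can occur twice;
  the spins are the exponents plus one. Spin \<open>2\<close> occurs exactly once.
  The commutators are required on all Fock spaces, \<open>A\<^sub>0\<close> being a central element.
\<close>

definition W_currents ::
  "(nat \<Rightarrow> real^'r) \<Rightarrow> complex \<Rightarrow> (nat \<Rightarrow> nat) \<Rightarrow> (nat \<Rightarrow> 'r dpoly) \<Rightarrow> bool" where
  "W_currents e \<gamma> spin P \<longleftrightarrow>
     (\<forall>s. card {j \<in> {1..CARD('r)}. spin j = s} = exponent_mult e (s - 1))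
   \<and> (\<forall>j\<in>{1..CARD('r)}. P j \<in> Mplus e \<gamma> \<and> weighted_homogeneous (spin j) (P j))
   \<and> (\<forall>j\<in>{1..CARD('r)}. spin j = 2 \<longrightarrow> P j = stress (background e \<gamma>))
   \<and> (\<forall>j\<in>{1..CARD('r)}. spin j \<noteq> 2 \<longrightarrow> (\<forall>a n m. \<forall>F\<in>Vplus.
        mode a (stress (background e \<gamma>)) n (mode a (P j) m F)
          - mode a (P j) m (mode a (stress (background e \<gamma>)) n F)
        = cst (of_int ((int (spin j) - 1) * n - m)) * mode a (P j) (n + m) F))
   \<and> generated_by P = Mplus e \<gamma>"

text \<open>Genericity: membership in a dense open set of central charges where currents exist.\<close>

definition generic_charge :: "(nat \<Rightarrow> real^'r) \<Rightarrow> complex \<Rightarrow> bool" where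
  "generic_charge e c \<longleftrightarrow> (\<exists>U. open U \<and> closure U = UNIV \<and> c \<in> U
     \<and> (\<forall>\<gamma>. \<gamma> \<noteq> 0 \<longrightarrow> central_charge e \<gamma> \<in> U \<longrightarrow> (\<exists>spin P. W_currents e \<gamma> spin P)))"


section \<open>Descendants and correlation functions\<close>

text \<open>
  The substituted \<open>\<phi>\<^sub>n\<close> as a Laurent series in \<open>z - w\<close>: by Taylor expansion
  \<open>\<partial>^n X(z) / n! = \<Sum>l. ((n+l) choose n) (\<partial>^(n+l) X(w) / (n+l)!) (z-w)^l\<close>, the variable \<open>phi\<close> standing
  for the normalised derivatives at \<open>w\<close>.
\<close>

definition shifted_phi :: "complex^'r \<Rightarrow> nat \<times> 'r \<Rightarrow> 'r dpoly fls" where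
  "shifted_phi \<alpha> v =
     fps_to_fls (Abs_fps (\<lambda>l. of_nat ((fst v + l) choose fst v) * phi (fst v + l, snd v)))
   + fls_const (cst ((-1) ^ fst v / (2 * of_nat (fst v)) * vec_nth \<alpha> (snd v)))
       * fls_X_intpow (- int (fst v))"

text \<open>The polynomial of \<open>W\<^sup>(\<^sup>s\<^sup>)\<^sub>-\<^sub>j\<^sub>,\<^sub>\<alpha>\<close>, for the current of spin \<open>s\<close> given by \<open>P\<close>.\<close>

definition descendant :: "nat \<Rightarrow> 'r dpoly \<Rightarrow> nat \<Rightarrow> complex^'r \<Rightarrow> 'r dpoly" where
  "descendant s P j \<alpha> =
     fls_nth (peval (\<lambda>c. fls_const (cst c)) (shifted_phi \<alpha>) P) (int j - int s)"

definition wirtinger :: "(complex \<Rightarrow> complex) \<Rightarrow> complex \<Rightarrow> complex" where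
  "wirtinger f x = (frechet_derivative f (at x) 1 - \<i> * frechet_derivative f (at x) \<i>) / 2"

definition eval_field :: "'r dpoly \<Rightarrow> (complex \<Rightarrow> complex^'r) \<Rightarrow> complex \<Rightarrow> complex" where
  "eval_field R h x =
     peval id (\<lambda>v. (wirtinger ^^ fst v) (\<lambda>y. vec_nth (h y) (snd v)) x / fact (fst v)) R"

text \<open>Insertions are lists of pairs of a charge and a point.\<close>

definition free_corr :: "((complex^'r) \<times> complex) list \<Rightarrow> complex" where
  "free_corr ys = (\<Prod>l<length ys. \<Prod>k<l.
     complex_of_real (cmod (snd (ys ! k) - snd (ys ! l))) powr (- bil (fst (ys ! k)) (fst (ys ! l))))"

definition log_potential :: "((complex^'r) \<times> complex) list \<Rightarrow> complex \<Rightarrow> complex^'r" where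
  "log_potential ys x = (\<Sum>(\<beta>, y)\<leftarrow>ys. complex_of_real (ln (1 / cmod (x - y))) *s \<beta>)"

text \<open>The polynomial \<open>R\<close> in the derivatives of the field is inserted at the point \<open>y\<close>.\<close>

definition free_corr_desc ::
  "'r dpoly \<Rightarrow> (complex^'r) \<times> complex \<Rightarrow> ((complex^'r) \<times> complex) list \<Rightarrow> complex" where
  "free_corr_desc R y ys = eval_field R (log_potential ys) (snd y) * free_corr (y # ys)"

definition screening_index :: "nat \<Rightarrow> (nat \<Rightarrow> nat) \<Rightarrow> (nat \<times> nat) set" where
  "screening_index r ns = (SIGMA i:{1..r}. {1..ns i})"

definition screening_charges :: "(nat \<Rightarrow> real^'r) \<Rightarrow> complex \<Rightarrow> (nat \<Rightarrow> nat)
    \<Rightarrow> (nat \<times> nat \<Rightarrow> complex) \<Rightarrow> ((complex^'r) \<times> complex) list" where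
  "screening_charges e \<gamma> ns x = concat (map (\<lambda>i. map (\<lambda>j. (\<gamma> *s cvec (e i), x (i, j))) [1..<Suc (ns i)])
     [1..<Suc CARD('r)])"

definition screening_measure :: "nat \<Rightarrow> (nat \<Rightarrow> nat) \<Rightarrow> (nat \<times> nat \<Rightarrow> complex) measure" where
  "screening_measure r ns = PiM (screening_index r ns) (\<lambda>_. lborel)"

definition corr_integrand :: "(nat \<Rightarrow> real^'r) \<Rightarrow> complex \<Rightarrow> (nat \<Rightarrow> nat) \<Rightarrow> nat
    \<Rightarrow> (nat \<Rightarrow> complex^'r) \<Rightarrow> (nat \<Rightarrow> complex) \<Rightarrow> (nat \<times> nat \<Rightarrow> complex) \<Rightarrow> complex" where
  "corr_integrand e \<gamma> ns N \<alpha> z x =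
     free_corr (screening_charges e \<gamma> ns x @ map (\<lambda>k. (\<alpha> k, z k)) [1..<Suc N])"

text \<open>The integrand with the descendant \<open>W\<^sup>(\<^sup>s\<^sup>)\<^sub>-\<^sub>j V\<^sub>\<alpha>\<^sub>k(z\<^sub>k)\<close> in place of \<open>V\<^sub>\<alpha>\<^sub>k(z\<^sub>k)\<close>.\<close>

definition corr_desc_integrand :: "(nat \<Rightarrow> real^'r) \<Rightarrow> complex \<Rightarrow> (nat \<Rightarrow> nat) \<Rightarrow> nat
    \<Rightarrow> (nat \<Rightarrow> complex^'r) \<Rightarrow> (nat \<Rightarrow> complex) \<Rightarrow> nat \<Rightarrow> 'r dpoly \<Rightarrow> nat \<Rightarrow> nat
    \<Rightarrow> (nat \<times> nat \<Rightarrow> complex) \<Rightarrow> complex" where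
  "corr_desc_integrand e \<gamma> ns N \<alpha> z s P j k x =
     free_corr_desc (descendant s P j (\<alpha> k)) (\<alpha> k, z k)
       (map (\<lambda>l. (\<alpha> l, z l)) (filter (\<lambda>l. l \<noteq> k) [1..<Suc N]) @ screening_charges e \<gamma> ns x)"

definition cut_domain :: "nat \<Rightarrow> (nat \<Rightarrow> nat) \<Rightarrow> nat \<Rightarrow> (nat \<Rightarrow> complex) \<Rightarrow> real
    \<Rightarrow> (nat \<times> nat \<Rightarrow> complex) set" where
  "cut_domain r ns N z \<epsilon> =
     {x \<in> space (screening_measure r ns). \<forall>p\<in>screening_index r ns. x p \<notin> (\<Union>l\<in>{1..N}. ball (z l) \<epsilon>)}"

definition corr_desc_reg :: "(nat \<Rightarrow> real^'r) \<Rightarrow> complex \<Rightarrow> (nat \<Rightarrow> nat) \<Rightarrow> nat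
    \<Rightarrow> (nat \<Rightarrow> complex^'r) \<Rightarrow> (nat \<Rightarrow> complex) \<Rightarrow> nat \<Rightarrow> 'r dpoly \<Rightarrow> nat \<Rightarrow> nat \<Rightarrow> real \<Rightarrow> complex" where
  "corr_desc_reg e \<gamma> ns N \<alpha> z s P j k \<epsilon> =
     (LINT x : cut_domain CARD('r) ns N z \<epsilon> | screening_measure CARD('r) ns.
        corr_desc_integrand e \<gamma> ns N \<alpha> z s P j k x)"

definition corr_desc_exists :: "(nat \<Rightarrow> real^'r) \<Rightarrow> complex \<Rightarrow> (nat \<Rightarrow> nat) \<Rightarrow> nat
    \<Rightarrow> (nat \<Rightarrow> complex^'r) \<Rightarrow> (nat \<Rightarrow> complex) \<Rightarrow> nat \<Rightarrow> 'r dpoly \<Rightarrow> nat \<Rightarrow> nat \<Rightarrow> bool" where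
  "corr_desc_exists e \<gamma> ns N \<alpha> z s P j k \<longleftrightarrow>
     (\<forall>\<epsilon>>0. set_integrable (screening_measure CARD('r) ns) (cut_domain CARD('r) ns N z \<epsilon>)
        (corr_desc_integrand e \<gamma> ns N \<alpha> z s P j k))
   \<and> (\<exists>L. (corr_desc_reg e \<gamma> ns N \<alpha> z s P j k \<longlongrightarrow> L) (at_right 0))"

text \<open>This is meaningful only when \<open>corr_desc_exists\<close> holds.\<close>

definition corr_desc :: "(nat \<Rightarrow> real^'r) \<Rightarrow> complex \<Rightarrow> (nat \<Rightarrow> nat) \<Rightarrow> nat
    \<Rightarrow> (nat \<Rightarrow> complex^'r) \<Rightarrow> (nat \<Rightarrow> complex) \<Rightarrow> nat \<Rightarrow> 'r dpoly \<Rightarrow> nat \<Rightarrow> nat \<Rightarrow> complex" where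
  "corr_desc e \<gamma> ns N \<alpha> z s P j k = Lim (at_right 0) (corr_desc_reg e \<gamma> ns N \<alpha> z s P j k)"

end

theory Submission
  imports Defs "HOL-Complex_Analysis.Complex_Analysis"
begin

text \<open>
  At a configuration of distinct points, \<open>W(\<zeta>)\<close>, the polynomial \<open>P\<close> evaluated at the field created by all
  charges, is a rational function of \<open>\<zeta>\<close>. It is \<open>O(\<zeta>^(-2s))\<close> at infinity: the commutator \<open>[L\<^sub>1, W\<^sub>-\<^sub>s]\<close> on the
  vacuum gives \<open>L\<^sub>1 P = 0\<close>, which by neutrality makes the value of \<open>P\<close> invariant under translations of the
  inverse distances \<open>1/(X b - \<zeta>)\<close>. So the residues of \<open>f W\<close> add up to zero for \<open>f = 1/(z\<^sub>1 - \<zeta>)\<close> and for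
  \<open>f = \<zeta>^n\<close>, \<open>n \<le> 2s-2\<close>. The residue at \<open>z\<^sub>k\<close> is a combination of descendants, and the residue at a
  screening charge, times the Coulomb weight, is a total derivative because the screening operator kills \<open>P\<close>.

  The singular integrals need not converge absolutely, and the boundary terms have to be controlled.
  If \<open>D\<close> is a polynomial in the inverse distances from one point \<open>p\<close>, then rotating clusters of points about
  \<open>p\<close> by a common phase \<open>u\<close> preserves the measure, and on each zone of the configuration space the
  integrand extends holomorphically from \<open>|u| = 1\<close> to \<open>1 \<le> |u| \<le> 2\<close>. On the outer circle all clusters are separated by
  fixed factors, \<open>D\<close> is bounded, and the mean value over the circle is bounded by the weight alone.
  This works uniformly for the sharp cutoff by balls and for the smooth regulator \<open>exp (- \<eta> V)\<close>, so both have the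
  same limit, and with the smooth regulator the integration by parts has no boundary terms.
\<close>

section \<open>Rotations preserve Lebesgue measure\<close>

text \<open>Absolute convergence of the Coulomb integral gives no control of the integrand with a
  descendant: it has poles at one point \<open>p\<close>, and many charges may collide with
  \<open>p\<close> at unrelated rates. Rotating one of them is not enough. Each point therefore
  receives its own power of the common phase \<open>u\<close>, with an exponent that grows as its
  scale shrinks; on \<open>|u| = 2\<close> this lifts every distance from \<open>p\<close> back to a
  fixed size. Exponents are read off from dyadic levels, which the rotation does not change, so each
  set of configurations with given levels is invariant and carries one genuine measure-preserving
  action. Rounding to levels costs a factor 2, and gaps of ten octaves leave the ratio 512 used
  throughout; it keeps the continued squared distances within a relative error 1 / 2, where
  logarithms, inverses and the regulator are under control. Every residue has this star shape, and
  the regulator does not depend on \<open>p\<close>, so that residues with different centers can be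
  added before the limit.\<close>

lemma lborel_complex_eq_distr:
  "(lborel :: complex measure) = distr (lborel \<Otimes>\<^sub>M lborel) borel (\<lambda>(x, y). Complex x y)"
proof (rule lborel_eqI)
  have [measurable]: "(\<lambda>(x, y). Complex x y) \<in> borel_measurable (lborel \<Otimes>\<^sub>M lborel)"
    unfolding case_prod_beta Complex_eq by measurable
  fix l u :: complex
  assume lu: "\<And>b. b \<in> Basis \<Longrightarrow> l \<bullet> b \<le> u \<bullet> b"
  from lu[of 1] lu[of \<i>] have lu': "Re l \<le> Re u" "Im l \<le> Im u"
    by (auto simp: Basis_complex_def inner_complex_def)
  have vimage: "(\<lambda>(x, y). Complex x y) -` box l u \<inter> space (lborel \<Otimes>\<^sub>M lborel)
      = box (Re l) (Re u) \<times> box (Im l) (Im u)"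
    by (auto simp: box_def Basis_complex_def inner_complex_def space_pair_measure)
  have "emeasure (distr (lborel \<Otimes>\<^sub>M lborel) borel (\<lambda>(x, y). Complex x y)) (box l u)
      = emeasure (lborel \<Otimes>\<^sub>M lborel) (box (Re l) (Re u) \<times> box (Im l) (Im u))"
    by (subst emeasure_distr) (auto simp: vimage)
  also have "\<dots> = ennreal (Re u - Re l) * ennreal (Im u - Im l)"
    by (subst lborel.emeasure_pair_measure_Times) (auto simp: lu')
  also have "\<dots> = ennreal (\<Prod>b\<in>Basis. (u - l) \<bullet> b)"
    using lu' by (simp add: Basis_complex_def inner_complex_def ennreal_mult)
  finally show "emeasure (distr (lborel \<Otimes>\<^sub>M lborel) borel (\<lambda>(x, y). Complex x y)) (box l u)
      = ennreal (\<Prod>b\<in>Basis. (u - l) \<bullet> b)" .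
qed simp

lemma nn_integral_lborel_complex:
  assumes [measurable]: "f \<in> borel_measurable borel"
  shows "(\<integral>\<^sup>+ w. f w \<partial>lborel) = (\<integral>\<^sup>+ x. \<integral>\<^sup>+ y. f (Complex x y) \<partial>lborel \<partial>lborel)"
    and "(\<integral>\<^sup>+ w. f w \<partial>lborel) = (\<integral>\<^sup>+ y. \<integral>\<^sup>+ x. f (Complex x y) \<partial>lborel \<partial>lborel)"
proof -
  have [measurable]: "(\<lambda>(x, y). Complex x y) \<in> borel_measurable (lborel \<Otimes>\<^sub>M lborel)"
    unfolding case_prod_beta Complex_eq by measurable
  have [measurable]: "(\<lambda>p. Complex (fst p) (snd p)) \<in> borel_measurable (lborel \<Otimes>\<^sub>M lborel)"
    unfolding Complex_eq by measurable
  have "(\<integral>\<^sup>+ w. f w \<partial>lborel) = (\<integral>\<^sup>+ p. f (Complex (fst p) (snd p)) \<partial>(lborel \<Otimes>\<^sub>M lborel))"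
    by (subst lborel_complex_eq_distr) (simp add: nn_integral_distr case_prod_beta)
  then show "(\<integral>\<^sup>+ w. f w \<partial>lborel) = (\<integral>\<^sup>+ x. \<integral>\<^sup>+ y. f (Complex x y) \<partial>lborel \<partial>lborel)"
    and "(\<integral>\<^sup>+ w. f w \<partial>lborel) = (\<integral>\<^sup>+ y. \<integral>\<^sup>+ x. f (Complex x y) \<partial>lborel \<partial>lborel)"
    using lborel.nn_integral_fst[of "\<lambda>p. f (Complex (fst p) (snd p))" lborel]
      lborel_pair.nn_integral_snd[of "\<lambda>p. f (Complex (fst p) (snd p))"]
    by (simp_all add: case_prod_beta)
qed

lemma nn_integral_lborel_shift:
  fixes f :: "real \<Rightarrow> ennreal"
  assumes [measurable]: "f \<in> borel_measurable borel"
  shows "(\<integral>\<^sup>+ x. f (x + t) \<partial>lborel) = (\<integral>\<^sup>+ x. f x \<partial>lborel)"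
  using nn_integral_real_affine[of f 1 t] by (simp add: add.commute)

lemma nn_integral_shear:
  assumes [measurable]: "f \<in> borel_measurable borel"
  shows "(\<integral>\<^sup>+ w. f (w + complex_of_real (t * Im w)) \<partial>lborel) = (\<integral>\<^sup>+ w. f w \<partial>lborel)"
    and "(\<integral>\<^sup>+ w. f (w + \<i> * complex_of_real (t * Re w)) \<partial>lborel) = (\<integral>\<^sup>+ w. f w \<partial>lborel)"
proof -
  have [measurable]: "(\<lambda>x. Complex x y) \<in> borel_measurable borel" for y
    unfolding Complex_eq by measurable
  have [measurable]: "(\<lambda>y. Complex x y) \<in> borel_measurable borel" for x
    unfolding Complex_eq by measurable
  have "(\<integral>\<^sup>+ w. f (w + complex_of_real (t * Im w)) \<partial>lborel)
      = (\<integral>\<^sup>+ y. \<integral>\<^sup>+ x. f (Complex (x + t * y) y) \<partial>lborel \<partial>lborel)"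
    by (subst nn_integral_lborel_complex(2)) (auto intro!: nn_integral_cong simp: Complex_eq algebra_simps)
  also have "\<dots> = (\<integral>\<^sup>+ y. \<integral>\<^sup>+ x. f (Complex x y) \<partial>lborel \<partial>lborel)"
    by (intro nn_integral_cong nn_integral_lborel_shift[of "\<lambda>x. f (Complex x _)"]) measurable
  also have "\<dots> = (\<integral>\<^sup>+ w. f w \<partial>lborel)"
    by (simp add: nn_integral_lborel_complex(2))
  finally show "(\<integral>\<^sup>+ w. f (w + complex_of_real (t * Im w)) \<partial>lborel) = (\<integral>\<^sup>+ w. f w \<partial>lborel)" .
  have "(\<integral>\<^sup>+ w. f (w + \<i> * complex_of_real (t * Re w)) \<partial>lborel)
      = (\<integral>\<^sup>+ x. \<integral>\<^sup>+ y. f (Complex x (y + t * x)) \<partial>lborel \<partial>lborel)"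
    by (subst nn_integral_lborel_complex(1)) (auto intro!: nn_integral_cong simp: Complex_eq algebra_simps)
  also have "\<dots> = (\<integral>\<^sup>+ x. \<integral>\<^sup>+ y. f (Complex x y) \<partial>lborel \<partial>lborel)"
    by (intro nn_integral_cong nn_integral_lborel_shift[of "\<lambda>y. f (Complex _ y)"]) measurable
  also have "\<dots> = (\<integral>\<^sup>+ w. f w \<partial>lborel)"
    by (simp add: nn_integral_lborel_complex(1))
  finally show "(\<integral>\<^sup>+ w. f (w + \<i> * complex_of_real (t * Re w)) \<partial>lborel) = (\<integral>\<^sup>+ w. f w \<partial>lborel)" .
qed

text \<open>A rotation that is not \<open>1\<close> or \<open>-1\<close> is a product of three shears.\<close>

lemma nn_integral_rotate:
  assumes [measurable]: "f \<in> borel_measurable borel" and v: "cmod v = 1"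
  shows "(\<integral>\<^sup>+ w. f (v * w) \<partial>lborel) = (\<integral>\<^sup>+ w. f w \<partial>lborel)"
proof -
  have shears: "(\<integral>\<^sup>+ w. f (v * w) \<partial>lborel) = (\<integral>\<^sup>+ w. f w \<partial>lborel)"
    if [measurable]: "f \<in> borel_measurable borel" and v: "cmod v = 1" and s: "Im v \<noteq> 0" for v f
  proof -
    \<comment> \<open>With \<open>v = exp (\<i> \<theta>)\<close> this is
      \<open>t = - tan (\<theta> / 2)\<close>, the parameter of the two outer shears; the middle one
      has parameter \<open>sin \<theta>\<close>.\<close>
    define s c t where "s = Im v" and "c = Re v" and "t = - ((1 - c) / s)"
    define A where "A = (\<lambda>w. w + complex_of_real (t * Im w))"
    define B where "B = (\<lambda>w. w + \<i> * complex_of_real (s * Re w))"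
    have [measurable]: "A \<in> borel_measurable borel" "B \<in> borel_measurable borel"
      unfolding A_def B_def by measurable
    have cs: "c\<^sup>2 + s\<^sup>2 = 1" and s0: "s \<noteq> 0"
      using v s unfolding c_def s_def cmod_def by (auto simp: real_sqrt_eq_1_iff)
    have st: "s * t = c - 1" using s0 by (simp add: t_def field_simps)
    have "t * (1 + c) = - s"
    proof -
      have "s * (t * (1 + c)) = s * (- s)"
      proof -
        have "s * (t * (1 + c)) = (c - 1) * (1 + c)"
          using st by (metis mult.assoc)
        also have "\<dots> = s * (- s)" using cs by (simp add: algebra_simps power2_eq_square)
        finally show ?thesis .
      qed
      then show ?thesis using s0 mult_left_cancel by blast
    qed
    then have t2: "t + t * c = - s" by (simp add: algebra_simps)
    have rot: "A (B (A w)) = v * w" for w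
    proof (rule complex_eqI)
      have "Re (A (B (A w))) = Re w * (1 + s * t) + Im w * (t + t * (1 + s * t))"
        by (simp add: A_def B_def algebra_simps)
      also have "\<dots> = c * Re w - s * Im w"
        unfolding st using t2 by (simp add: algebra_simps)
      finally show "Re (A (B (A w))) = Re (v * w)" by (simp add: c_def s_def)
      have "Im (A (B (A w))) = s * Re w + Im w * (1 + s * t)"
        by (simp add: A_def B_def algebra_simps)
      then show "Im (A (B (A w))) = Im (v * w)"
        unfolding st by (simp add: c_def s_def algebra_simps)
    qed
    have sA: "(\<integral>\<^sup>+ w. g (A w) \<partial>lborel) = (\<integral>\<^sup>+ w. g w \<partial>lborel)"
      and sB: "(\<integral>\<^sup>+ w. g (B w) \<partial>lborel) = (\<integral>\<^sup>+ w. g w \<partial>lborel)"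
      if "g \<in> borel_measurable borel" for g
      using nn_integral_shear[of g] that unfolding A_def B_def by blast+
    have "(\<integral>\<^sup>+ w. f (v * w) \<partial>lborel) = (\<integral>\<^sup>+ w. f (A (B (A w))) \<partial>lborel)" by (simp add: rot)
    also have "\<dots> = (\<integral>\<^sup>+ w. f (A (B w)) \<partial>lborel)"
      by (rule sA[of "\<lambda>w. f (A (B w))"]) measurable
    also have "\<dots> = (\<integral>\<^sup>+ w. f (A w) \<partial>lborel)"
      by (rule sB[of "\<lambda>w. f (A w)"]) measurable
    also have "\<dots> = (\<integral>\<^sup>+ w. f w \<partial>lborel)"
      by (rule sA) measurable
    finally show ?thesis .
  qed
  show ?thesis
  proof (cases "Im v = 0")
    case True
    then have "v = 1 \<or> v = -1"
      using v by (auto simp: complex_eq_iff cmod_def)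
    \<comment> \<open>The excluded rotation by -1 is the rotation by \<open>\<i>\<close> applied
      twice.\<close>
    moreover have "(\<integral>\<^sup>+ w. f (- w) \<partial>lborel) = (\<integral>\<^sup>+ w. f w \<partial>lborel)"
      using shears[of "\<lambda>w. f (\<i> * w)" \<i>] shears[of f \<i>] by (simp flip: mult.assoc)
    ultimately show ?thesis by auto
  qed (use shears[of f v] v assms in auto)
qed

lemma nn_integral_rotate_shift:
  assumes [measurable]: "f \<in> borel_measurable borel" and v: "cmod v = 1"
  shows "(\<integral>\<^sup>+ w. f (v * w + b) \<partial>lborel) = (\<integral>\<^sup>+ w. f w \<partial>(lborel :: complex measure))"
proof -
  have "(\<integral>\<^sup>+ w. f (v * w + b) \<partial>lborel) = (\<integral>\<^sup>+ w. f (b + w) \<partial>lborel)"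
    using nn_integral_rotate[of "\<lambda>w. f (b + w)" v] v by (simp add: add.commute)
  also have "\<dots> = (\<integral>\<^sup>+ w. f w \<partial>distr lborel borel ((+) b))"
    by (subst nn_integral_distr) auto
  finally show ?thesis by (simp add: lborel_distr_plus)
qed

section \<open>Measure-preserving maps of a product of planes\<close>

definition measure_preserving :: "'a measure \<Rightarrow> ('a \<Rightarrow> 'a) \<Rightarrow> bool" where
  "measure_preserving M T \<longleftrightarrow> T \<in> measurable M M \<and> distr M M T = M"

lemma measure_preserving_comp:
  assumes "measure_preserving M S" "measure_preserving M T"
  shows "measure_preserving M (\<lambda>x. S (T x))"
  using assms distr_distr[of S M M T M] unfolding measure_preserving_def comp_def
  by (auto intro: measurable_compose)

lemma measure_preserving_cong:
  assumes "\<And>x. x \<in> space M \<Longrightarrow> S x = T x" "measure_preserving M S"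
  shows "measure_preserving M T"
  using assms distr_cong[of M M M M S T] measurable_cong[of M S T M]
  unfolding measure_preserving_def by auto

lemma nn_integral_measure_preserving:
  assumes "measure_preserving M T" and [measurable]: "f \<in> borel_measurable M"
  shows "(\<integral>\<^sup>+ x. f (T x) \<partial>M) = (\<integral>\<^sup>+ x. f x \<partial>M)"
proof -
  have [measurable]: "T \<in> measurable M M" and "distr M M T = M"
    using assms by (auto simp: measure_preserving_def)
  then show ?thesis
    using nn_integral_distr[of T M M f] by auto
qed

lemma integral_measure_preserving:
  fixes f :: "'a \<Rightarrow> 'b::{banach, second_countable_topology}"
  assumes "measure_preserving M T" and [measurable]: "f \<in> borel_measurable M"
  shows "(\<integral> x. f (T x) \<partial>M) = (\<integral> x. f x \<partial>M)"
proof -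
  have [measurable]: "T \<in> measurable M M" and "distr M M T = M"
    using assms by (auto simp: measure_preserving_def)
  then show ?thesis
    using integral_distr[of T M M f] by auto
qed

interpretation lborel_product: product_sigma_finite "\<lambda>_. lborel :: complex measure"
  by standard

text \<open>Fubini with the coordinate \<open>q\<close> innermost: since \<open>h\<close> ignores
  that coordinate, the inner integral sees a plane rotation followed by a constant
  translation.\<close>

lemma measure_preserving_PiM_rotate_shift:
  fixes h :: "('i \<Rightarrow> complex) \<Rightarrow> complex"
  assumes I: "finite I" "q \<in> I" and v: "cmod v = 1"
    and [measurable]: "h \<in> borel_measurable (PiM I (\<lambda>_. lborel))"
    and h: "\<And>x y. h (x(q := y)) = h x"
  shows "measure_preserving (PiM I (\<lambda>_. lborel)) (\<lambda>x. x(q := v * x q + h x))"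
    (is "measure_preserving ?M ?T")
proof -
  have T [measurable]: "?T \<in> measurable ?M ?M"
  proof (rule measurable_PiM_single')
    fix i assume "i \<in> I"
    then show "(\<lambda>x. (?T x) i) \<in> measurable ?M lborel" using I(2)
      by (cases "i = q") auto
  qed (use I(2) in \<open>auto simp: space_PiM PiE_def extensional_def\<close>)
  define I' where "I' = I - {q}"
  have I': "I = insert q I'" "finite I'" "q \<notin> I'" using I by (auto simp: I'_def)
  have "distr ?M ?M ?T = ?M"
  proof (rule measure_eqI)
    fix A assume "A \<in> sets (distr ?M ?M ?T)"
    then have A [measurable]: "A \<in> sets ?M" by simp
    let ?f = "indicator A :: _ \<Rightarrow> ennreal"
    have "emeasure (distr ?M ?M ?T) A = (\<integral>\<^sup>+ x. ?f (?T x) \<partial>?M)"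
      by (simp add: nn_integral_distr flip: nn_integral_indicator)
    also have "\<dots> = (\<integral>\<^sup>+ x. \<integral>\<^sup>+ y. ?f (?T (x(q := y))) \<partial>lborel \<partial>PiM I' (\<lambda>_. lborel))"
      unfolding I'(1)
      by (rule lborel_product.product_nn_integral_insert[OF I'(2,3)]) (simp flip: I'(1))
    also have "\<dots> = (\<integral>\<^sup>+ x. \<integral>\<^sup>+ y. ?f (x(q := y)) \<partial>lborel \<partial>PiM I' (\<lambda>_. lborel))"
    proof (rule nn_integral_cong)
      fix x assume x: "x \<in> space (PiM I' (\<lambda>_. lborel :: complex measure))"
      have m: "(\<lambda>y. ?f (x(q := y))) \<in> borel_measurable borel"
      proof -
        have [measurable]: "(\<lambda>y. x(q := y)) \<in> measurable borel ?M"
          using measurable_component_update[OF x I'(3)] unfolding I'(1) by simp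
        show ?thesis by measurable
      qed
      have "(\<integral>\<^sup>+ y. ?f (?T (x(q := y))) \<partial>lborel) = (\<integral>\<^sup>+ y. ?f (x(q := v * y + h x)) \<partial>lborel)"
        by (simp add: h)
      also have "\<dots> = (\<integral>\<^sup>+ y. ?f (x(q := y)) \<partial>lborel)"
        by (rule nn_integral_rotate_shift[OF m v])
      finally show "(\<integral>\<^sup>+ y. ?f (?T (x(q := y))) \<partial>lborel) = (\<integral>\<^sup>+ y. ?f (x(q := y)) \<partial>lborel)" .
    qed
    also have "\<dots> = (\<integral>\<^sup>+ x. ?f x \<partial>?M)"
      unfolding I'(1)
      by (rule lborel_product.product_nn_integral_insert[OF I'(2,3), symmetric]) (simp flip: I'(1))
    finally show "emeasure (distr ?M ?M ?T) A = emeasure ?M A" by simp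
  qed simp
  with T show ?thesis by (simp add: measure_preserving_def)
qed

definition circle_mean :: "(complex \<Rightarrow> complex) \<Rightarrow> real \<Rightarrow> complex" where
  "circle_mean \<Phi> r = integral {0..1} (\<lambda>t::real. \<Phi> (r * exp (2 * pi * \<i> * t)))"

section \<open>Averages over rotations\<close>

definition annulus :: "complex set" where
  "annulus = {u. 1 \<le> cmod u \<and> cmod u \<le> 2}"

lemma circle_mean_eq_contour_integral:
  assumes "r > 0"
  shows "contour_integral (circlepath 0 r) (\<lambda>u. \<Phi> u / u) = 2 * pi * \<i> * circle_mean \<Phi> r"
proof -
  have "contour_integral (circlepath 0 r) (\<lambda>u. \<Phi> u / u)
      = integral {0..1} (\<lambda>x. \<Phi> (circlepath 0 r x) / circlepath 0 r x
          * vector_derivative (circlepath 0 r) (at x))"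
    by (simp add: contour_integral_integral)
  also have "\<dots> = integral {0..1} (\<lambda>x::real. 2 * pi * \<i> * \<Phi> (r * exp (2 * pi * \<i> * x)))"
    using assms
    by (intro integral_cong) (auto simp: vector_derivative_circlepath, auto simp: circlepath)
  also have "\<dots> = 2 * pi * \<i> * circle_mean \<Phi> r"
    unfolding circle_mean_def by (rule integral_mult_right)
  finally show ?thesis .
qed

text \<open>The mean over a circle is a contour integral of \<open>\<Phi> u / u\<close>; the two
  circles are homotopic through radial segments in the annulus, away from the pole at 0.\<close>

lemma circle_mean_annulus:
  assumes "open S" "annulus \<subseteq> S" "\<Phi> holomorphic_on S"
  shows "circle_mean \<Phi> 1 = circle_mean \<Phi> 2"
proof -
  let ?S = "S - {0}"
  have S: "annulus \<subseteq> ?S" using assms(2) by (auto simp: annulus_def)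
  have "homotopic_loops ?S (circlepath 0 1) (circlepath 0 2)"
  proof (rule homotopic_loops_linear)
    fix t :: real assume "t \<in> {0..1}"
    have "closed_segment (circlepath 0 1 t) (circlepath 0 2 t) \<subseteq> annulus"
    proof
      fix w assume "w \<in> closed_segment (circlepath 0 1 t) (circlepath 0 2 t)"
      then obtain s where s: "0 \<le> s" "s \<le> 1"
        and w: "w = (1 - s) *\<^sub>R circlepath 0 1 t + s *\<^sub>R circlepath 0 2 t"
        by (auto simp: closed_segment_def)
      have "w = of_real (1 + s) * exp (2 * of_real pi * \<i> * of_real t)"
        unfolding w by (simp add: circlepath scaleR_conv_of_real algebra_simps)
      then have "cmod w = 1 + s" using s
        by (simp add: norm_mult norm_exp_eq_Re del: of_real_add)
      then show "w \<in> annulus" using s by (simp add: annulus_def)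
    qed
    then show "closed_segment (circlepath 0 1 t) (circlepath 0 2 t) \<subseteq> ?S" using S by blast
  qed auto
  then have "contour_integral (circlepath 0 1) (\<lambda>u. \<Phi> u / u)
      = contour_integral (circlepath 0 2) (\<lambda>u. \<Phi> u / u)"
    by (rule Cauchy_theorem_homotopic_loops)
      (use assms in \<open>auto intro!: holomorphic_intros open_delete elim: holomorphic_on_subset\<close>)
  then show ?thesis by (simp add: circle_mean_eq_contour_integral)
qed

text \<open>Only values on the unit circle come from actual rotations; the bound is asked on the
  outer circle alone, because the mean over the unit circle equals the mean over that one. The
  notion is stable under sums and products, so integrands can be treated factor by factor.\<close>

definition annulus_ext :: "(complex \<Rightarrow> complex) \<Rightarrow> real \<Rightarrow> bool" where
  "annulus_ext \<phi> B \<longleftrightarrow> (\<exists>S \<Phi>. open S \<and> annulus \<subseteq> S \<and> \<Phi> holomorphic_on S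
     \<and> (\<forall>u. cmod u = 1 \<longrightarrow> \<Phi> u = \<phi> u) \<and> (\<forall>u. cmod u = 2 \<longrightarrow> cmod (\<Phi> u) \<le> B))"

lemma annulus_ext_nonneg: "annulus_ext \<phi> B \<Longrightarrow> 0 \<le> B"
  unfolding annulus_ext_def by (metis norm_ge_zero norm_numeral order_trans)

lemma annulus_ext_cong:
  assumes "annulus_ext \<phi> B" "\<And>u. cmod u = 1 \<Longrightarrow> \<phi> u = \<psi> u"
  shows "annulus_ext \<psi> B"
  using assms unfolding annulus_ext_def by metis

lemma annulus_ext_mono: "annulus_ext \<phi> B \<Longrightarrow> B \<le> C \<Longrightarrow> annulus_ext \<phi> C"
  unfolding annulus_ext_def by (meson order_trans)

lemma annulus_ext_const: "cmod c \<le> B \<Longrightarrow> annulus_ext (\<lambda>_. c) B"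
  unfolding annulus_ext_def by (intro exI[of _ UNIV] exI[of _ "\<lambda>_. c"]) auto

lemma annulus_ext_add:
  assumes "annulus_ext \<phi> B" "annulus_ext \<psi> C"
  shows "annulus_ext (\<lambda>u. \<phi> u + \<psi> u) (B + C)"
proof -
  from assms obtain S \<Phi> T \<Psi> where *:
    "open S" "annulus \<subseteq> S" "\<Phi> holomorphic_on S" "\<forall>u. cmod u = 1 \<longrightarrow> \<Phi> u = \<phi> u"
    "\<forall>u. cmod u = 2 \<longrightarrow> cmod (\<Phi> u) \<le> B"
    "open T" "annulus \<subseteq> T" "\<Psi> holomorphic_on T" "\<forall>u. cmod u = 1 \<longrightarrow> \<Psi> u = \<psi> u"
    "\<forall>u. cmod u = 2 \<longrightarrow> cmod (\<Psi> u) \<le> C"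
    unfolding annulus_ext_def by metis
  then show ?thesis unfolding annulus_ext_def
    by (intro exI[of _ "S \<inter> T"] exI[of _ "\<lambda>u. \<Phi> u + \<Psi> u"])
      (auto intro!: holomorphic_intros norm_triangle_mono elim: holomorphic_on_subset)
qed

lemma annulus_ext_mult:
  assumes "annulus_ext \<phi> B" "annulus_ext \<psi> C"
  shows "annulus_ext (\<lambda>u. \<phi> u * \<psi> u) (B * C)"
proof -
  have B: "0 \<le> B" using assms(1) by (rule annulus_ext_nonneg)
  from assms obtain S \<Phi> T \<Psi> where *:
    "open S" "annulus \<subseteq> S" "\<Phi> holomorphic_on S" "\<forall>u. cmod u = 1 \<longrightarrow> \<Phi> u = \<phi> u"
    "\<forall>u. cmod u = 2 \<longrightarrow> cmod (\<Phi> u) \<le> B"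
    "open T" "annulus \<subseteq> T" "\<Psi> holomorphic_on T" "\<forall>u. cmod u = 1 \<longrightarrow> \<Psi> u = \<psi> u"
    "\<forall>u. cmod u = 2 \<longrightarrow> cmod (\<Psi> u) \<le> C"
    unfolding annulus_ext_def by metis
  then show ?thesis unfolding annulus_ext_def
    by (intro exI[of _ "S \<inter> T"] exI[of _ "\<lambda>u. \<Phi> u * \<Psi> u"])
      (auto intro!: holomorphic_intros mult_mono B simp: norm_mult elim: holomorphic_on_subset)
qed

lemma annulus_ext_prod:
  assumes "\<And>i. i \<in> A \<Longrightarrow> annulus_ext (\<phi> i) (B i)"
  shows "annulus_ext (\<lambda>u. \<Prod>i\<in>A. \<phi> i u) (\<Prod>i\<in>A. B i)"
  using assms
  by (induction A rule: infinite_finite_induct) (auto intro: annulus_ext_const annulus_ext_mult)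

lemma norm_circle_mean_le:
  assumes "annulus_ext \<phi> B"
  shows "norm (circle_mean \<phi> 1) \<le> B"
    and "(\<lambda>t::real. \<phi> (exp (2 * pi * \<i> * t))) integrable_on {0..1}"
proof -
  obtain S \<Phi> where *: "open S" "annulus \<subseteq> S" "\<Phi> holomorphic_on S"
    "\<And>u. cmod u = 1 \<Longrightarrow> \<Phi> u = \<phi> u" "\<And>u. cmod u = 2 \<Longrightarrow> cmod (\<Phi> u) \<le> B"
    using assms unfolding annulus_ext_def by metis
  have cont: "continuous_on {0..1} (\<lambda>t::real. \<Phi> (of_real r * exp (2 * of_real pi * \<i> * of_real t)))"
    if "1 \<le> r" "r \<le> 2" for r
    using *(2) that
    by (intro continuous_on_compose2[OF holomorphic_on_imp_continuous_on[OF *(3)]] continuous_intros)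
      (auto simp: annulus_def norm_mult norm_exp_eq_Re)
  have eq: "\<phi> (exp (2 * pi * \<i> * t)) = \<Phi> (of_real 1 * exp (2 * pi * \<i> * t))" for t :: real
    using *(4)[of "exp (2 * pi * \<i> * t)"] by (simp add: norm_exp_eq_Re)
  have "circle_mean \<phi> 1 = circle_mean \<Phi> 1" unfolding circle_mean_def using eq by simp
  also have "\<dots> = circle_mean \<Phi> 2" by (rule circle_mean_annulus) fact+
  also have "norm \<dots> \<le> B * (1 - 0)"
    unfolding circle_mean_def
    by (rule integral_bound) (use cont[of 2] *(5) in \<open>auto simp: norm_mult norm_exp_eq_Re\<close>)
  finally show "norm (circle_mean \<phi> 1) \<le> B" by simp
  show "(\<lambda>t::real. \<phi> (exp (2 * pi * \<i> * t))) integrable_on {0..1}"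
    unfolding eq using cont[of 1] by (intro integrable_continuous_interval) auto
qed

text \<open>Averaging over the rotations and moving the circle of averaging from radius 1 to radius 2.\<close>

lemma rotation_average_bound:
  fixes f :: "'a \<Rightarrow> complex"
  assumes "sigma_finite_measure M"
    and mp: "\<And>u. cmod u = 1 \<Longrightarrow> measure_preserving M (\<Theta> u)"
    and \<Theta>m: "(\<lambda>(t, x). \<Theta> (exp (2 * pi * \<i> * complex_of_real t)) x) \<in> measurable (lborel \<Otimes>\<^sub>M M) M"
    and f: "integrable M f" and \<beta>: "integrable M \<beta>"
    and ext: "\<And>x. x \<in> space M \<Longrightarrow> annulus_ext (\<lambda>u. f (\<Theta> u x)) (\<beta> x)"
  shows "norm (integral\<^sup>L M f) \<le> integral\<^sup>L M \<beta>"
proof -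
  interpret sigma_finite_measure M by fact
  define L where "L = restrict_space lborel {0..1::real}"
  have L1: "emeasure L (space L) = 1"
    unfolding L_def by (simp add: emeasure_restrict_space space_restrict_space)
  interpret L: finite_measure L
    by (rule finite_measureI) (simp add: L1)
  interpret P: pair_sigma_finite L M ..
  define E where "E t = exp (2 * pi * \<i> * complex_of_real t)" for t
  have E: "cmod (E t) = 1" for t by (simp add: E_def norm_exp_eq_Re)
  have [measurable]: "f \<in> borel_measurable M" using f by auto
  have \<Theta>2: "(\<lambda>p. \<Theta> (E (fst p)) (snd p)) \<in> measurable (L \<Otimes>\<^sub>M M) M"
  proof -
    have [measurable]: "(\<lambda>t. t) \<in> measurable L lborel"
      unfolding L_def by (simp add: measurable_restrict_space1)
    have "(\<lambda>p. (fst p, snd p)) \<in> measurable (L \<Otimes>\<^sub>M M) (lborel \<Otimes>\<^sub>M M)" by measurable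
    from measurable_compose[OF this \<Theta>m] show ?thesis
      by (simp add: E_def case_prod_beta)
  qed
  have fm [measurable]: "(\<lambda>p. f (\<Theta> (E (fst p)) (snd p))) \<in> borel_measurable (L \<Otimes>\<^sub>M M)"
    by (rule measurable_compose[OF \<Theta>2]) simp
  have inv: "(\<integral> x. f (\<Theta> (E t) x) \<partial>M) = integral\<^sup>L M f" for t
    by (rule integral_measure_preserving[OF mp[OF E]]) simp
  \<comment> \<open>Tonelli: every rotated copy of \<open>f\<close> has the same integral of the
    norm, and the circle has total mass 1.\<close>
  have int: "integrable (L \<Otimes>\<^sub>M M) (\<lambda>p. f (\<Theta> (E (fst p)) (snd p)))"
  proof (rule integrableI_bounded)
    have "(\<integral>\<^sup>+ p. ennreal (norm (f (\<Theta> (E (fst p)) (snd p)))) \<partial>(L \<Otimes>\<^sub>M M))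
        = (\<integral>\<^sup>+ t. \<integral>\<^sup>+ x. ennreal (norm (f (\<Theta> (E t) x))) \<partial>M \<partial>L)"
      by (subst nn_integral_fst[symmetric]) auto
    also have "\<dots> = (\<integral>\<^sup>+ t. \<integral>\<^sup>+ x. ennreal (norm (f x)) \<partial>M \<partial>L)"
      by (intro nn_integral_cong nn_integral_measure_preserving mp E) auto
    also have "\<dots> = (\<integral>\<^sup>+ x. ennreal (norm (f x)) \<partial>M)"
      by (simp add: L1)
    also have "\<dots> < \<infinity>" using f by (simp add: integrable_iff_bounded)
    finally show "(\<integral>\<^sup>+ p. ennreal (norm (f (\<Theta> (E (fst p)) (snd p)))) \<partial>(L \<Otimes>\<^sub>M M)) < \<infinity>" .
  qed fact
  have "integral\<^sup>L M f = (\<integral> t. (\<integral> x. f (\<Theta> (E t) x) \<partial>M) \<partial>L)"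
    by (simp add: inv measure_def L1)
  also have "\<dots> = (\<integral> x. (\<integral> t. f (\<Theta> (E t) x) \<partial>L) \<partial>M)"
    using P.Fubini_integral[of "\<lambda>t x. f (\<Theta> (E t) x)"] int
    by (simp add: case_prod_beta[abs_def])
  also have "norm \<dots> \<le> (\<integral> x. norm (\<integral> t. f (\<Theta> (E t) x) \<partial>L) \<partial>M)"
    by (rule integral_norm_bound)
  also have "\<dots> \<le> integral\<^sup>L M \<beta>"
  proof (intro integral_mono integrable_norm)
    show "integrable M (\<lambda>x. \<integral> t. f (\<Theta> (E t) x) \<partial>L)"
      using P.integrable_snd[of "\<lambda>t x. f (\<Theta> (E t) x)"] int
      by (simp add: case_prod_beta[abs_def])
    fix x assume x: "x \<in> space M"
    have b: "norm (circle_mean (\<lambda>u. f (\<Theta> u x)) 1) \<le> \<beta> x"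
      and *: "(\<lambda>t. f (\<Theta> (E t) x)) integrable_on {0..1}"
      using norm_circle_mean_le[OF ext[OF x]] by (auto simp: E_def)
    show "norm (\<integral> t. f (\<Theta> (E t) x) \<partial>L) \<le> \<beta> x"
    proof (cases "integrable L (\<lambda>t. f (\<Theta> (E t) x))")
      case True
      then have "set_integrable lborel {0..1} (\<lambda>t. f (\<Theta> (E t) x))"
        unfolding L_def set_integrable_def by (simp add: integrable_restrict_space)
      then have "(\<integral> t. f (\<Theta> (E t) x) \<partial>L) = circle_mean (\<lambda>u. f (\<Theta> u x)) 1"
        unfolding L_def circle_mean_def
        by (simp add: integral_restrict_space set_lebesgue_integral_def[symmetric]
            set_borel_integral_eq_integral(2) E_def)
      then show ?thesis using b by simp
    next
      case False
      \<comment> \<open>A section that is not integrable has Bochner integral 0 by default, and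
        \<open>\<beta> x\<close> is nonnegative.\<close>
      then show ?thesis using annulus_ext_nonneg[OF ext[OF x]] by (simp add: not_integrable_integral_eq)
    qed
  qed (rule \<beta>)
  finally show ?thesis .
qed

section \<open>Dyadic levels and weights\<close>

definition lev :: "real \<Rightarrow> nat" where
  "lev t = nat \<lfloor>log 2 t\<rfloor>"

lemma lev_bounds:
  assumes "t > 0"
  shows "t < 2 * 2 ^ lev t" and "lev t > 0 \<Longrightarrow> 2 ^ lev t \<le> t"
proof -
  have "log 2 t < real (lev t) + 1"
    unfolding lev_def by linarith
  then have "t < 2 powr (real (lev t) + 1)" using assms by (simp add: log_less_iff)
  then show "t < 2 * 2 ^ lev t" by (simp add: powr_add powr_realpow)
  assume "lev t > 0"
  then have "real (lev t) \<le> log 2 t" unfolding lev_def by linarith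
  then have "2 powr real (lev t) \<le> t" using assms by (simp add: le_log_iff)
  then show "2 ^ lev t \<le> t" by (simp add: powr_realpow)
qed

text \<open>The case \<open>t = 0\<close> rests on \<open>log 2 0 = 0\<close> and matters: with
  \<open>d / 0 = 0\<close>, a point at distance 0 from the center gets level 0.\<close>

lemma lev_eq_0:
  assumes "0 \<le> t" "t < 2"
  shows "lev t = 0"
proof (cases "t = 0")
  case True
  then show ?thesis by (simp add: lev_def log_def)
next
  case False
  then have "2 ^ lev t < (2::real)" if "lev t > 0" using lev_bounds(2)[of t] that assms by auto
  then show ?thesis using self_le_power[of "2::real" "lev t"] by fastforce
qed

text \<open>Each scale \<open>m\<close> that is at least ten octaves away from all levels above it counts as a free
  one, and the weight of a level is the number of free scales below it. So points with comparable
  levels have the same weight, and weight differences stay below level differences.\<close>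

definition wt :: "('a \<Rightarrow> nat) \<Rightarrow> 'a set \<Rightarrow> nat \<Rightarrow> nat" where
  "wt l S t = card {m \<in> {1..t}. \<forall>b\<in>S. l b \<notin> {m..<m + 10}}"

lemma wt_0 [simp]: "wt l S 0 = 0"
  by (simp add: wt_def)

text \<open>No scale less than ten below \<open>l a\<close> is free, because \<open>a\<close> itself
  blocks it. So free scales above \<open>t\<close> are at most \<open>l a - 10\<close>: either there
  are none, or the level gap exceeds the weight gap by at least ten.\<close>

lemma wt_gap:
  assumes "a \<in> S" "t \<le> l a"
  shows "wt l S (l a) = wt l S t
    \<or> (wt l S t < wt l S (l a) \<and> wt l S (l a) + t + 10 \<le> wt l S t + l a)"
proof -
  let ?f = "\<lambda>m. \<forall>b\<in>S. l b \<notin> {m..<m + 10}"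
  have "{m \<in> {1..l a}. ?f m} = {m \<in> {1..t}. ?f m} \<union> {m \<in> {t<..l a}. ?f m}"
    using assms(2) by auto
  then have "wt l S (l a) = wt l S t + card {m \<in> {t<..l a}. ?f m}"
    unfolding wt_def by (simp only:) (rule card_Un_disjoint, auto)
  moreover have "{m \<in> {t<..l a}. ?f m} \<subseteq> {t<..l a - 10}"
  proof safe
    fix m assume "m \<in> {t<..l a}" "?f m"
    then have "l a \<notin> {m..<m + 10}" "t < m" "m \<le> l a" using assms(1) by auto
    then show "m \<in> {t<..l a - 10}" by auto
  qed
  then have "card {m \<in> {t<..l a}. ?f m} \<le> l a - 10 - t"
    using card_mono[of "{t<..l a - 10}"] by fastforce
  ultimately show ?thesis by linarith
qed

text \<open>Each point blocks at most ten scales, so a weight lags behind its level by a constant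
  that depends only on the number of points. This makes the final bounds uniform in the
  configuration.\<close>

lemma le_wt:
  assumes "finite S"
  shows "t \<le> wt l S t + 10 * card S"
proof -
  let ?f = "\<lambda>m. \<forall>b\<in>S. l b \<notin> {m..<m + 10}"
  have "{1..t} \<subseteq> {m \<in> {1..t}. ?f m} \<union> (\<Union>b\<in>S. {m. l b \<in> {m..<m + 10}})"
    by auto
  moreover have fin: "finite {m. l b \<in> {m..<m + 10}}" for b
    by (rule finite_subset[of _ "{..l b}"]) auto
  ultimately have "card {1..t} \<le> card ({m \<in> {1..t}. ?f m} \<union> (\<Union>b\<in>S. {m. l b \<in> {m..<m + 10}}))"
    using assms by (intro card_mono) auto
  also have "\<dots> \<le> wt l S t + card (\<Union>b\<in>S. {m. l b \<in> {m..<m + 10}})"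
    unfolding wt_def by (rule card_Un_le)
  also have "card (\<Union>b\<in>S. {m. l b \<in> {m..<m + 10}}) \<le> (\<Sum>b\<in>S. card {m. l b \<in> {m..<m + 10}})"
    by (rule card_UN_le[OF assms])
  also have "\<dots> \<le> (\<Sum>b\<in>S. 10)"
  proof (rule sum_mono)
    fix b
    have "card {m. l b \<in> {m..<m + 10}} \<le> card {l b - 9..l b}"
      by (rule card_mono) auto
    also have "\<dots> \<le> 10" by simp
    finally show "card {m. l b \<in> {m..<m + 10}} \<le> 10" .
  qed
  finally show ?thesis by simp
qed

text \<open>For distances \<open>x\<close>, \<open>y\<close> that get factors
  \<open>u powi s\<close>, \<open>u powi t\<close>: the one with the larger exponent is so much
  shorter that on \<open>|u| = 2\<close> it is still 512 times shorter.\<close>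

definition sep :: "int \<Rightarrow> int \<Rightarrow> real \<Rightarrow> real \<Rightarrow> bool" where
  "sep s t x y \<longleftrightarrow> s = t \<or> (t < s \<and> 512 * 2 ^ nat (s - t) * x \<le> y)
     \<or> (s < t \<and> 512 * 2 ^ nat (t - s) * y \<le> x)"

lemma sep_minus_inverse:
  assumes "x > 0" "y > 0" "sep s t (1 / x) (1 / y)"
  shows "sep (- s) (- t) x y"
  using assms unfolding sep_def by (auto simp: field_simps)

locale weights =
  fixes S :: "'a set" and r :: "'a \<Rightarrow> real" and d :: real
  assumes fin: "finite S" and d: "d > 0"
begin

abbreviation "level a \<equiv> lev (d / r a)"
abbreviation "weight a \<equiv> wt level S (level a)"

lemma weight_upper:
  assumes "a \<in> S" "r a > 0" "0 < weight a"
  shows "512 * 2 ^ weight a * r a \<le> d"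
proof -
  have w: "weight a + 10 \<le> level a"
    using wt_gap[OF assms(1), of 0 level] assms(3) by simp
  then have "2 ^ level a \<le> d / r a"
    using lev_bounds(2)[of "d / r a"] assms d by auto
  have "512 * 2 ^ weight a * r a \<le> 2 ^ (weight a + 10) * r a"
    using assms(2) by (simp add: power_add)
  also have "\<dots> \<le> 2 ^ level a * r a"
    using w assms(2) by (intro mult_right_mono power_increasing) auto
  also have "\<dots> \<le> d" using \<open>2 ^ level a \<le> d / r a\<close> assms(2) by (simp add: field_simps)
  finally show ?thesis .
qed

text \<open>By \<open>le_wt\<close>, the factor \<open>2 ^ weight\<close> brings every distance back
  to \<open>d\<close> up to a constant; no configuration can make a lifted distance small.\<close>

lemma weight_lower:
  assumes "r a > 0"
  shows "d \<le> 2 ^ (10 * card S + 1) * 2 ^ weight a * r a"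
proof -
  have "d / r a < 2 * 2 ^ level a" using lev_bounds(1) d assms by auto
  also have "\<dots> \<le> 2 * 2 ^ (weight a + 10 * card S)"
    using le_wt[OF fin] by (intro mult_left_mono power_increasing) auto
  finally show ?thesis using assms by (simp add: field_simps power_add)
qed

text \<open>Different weights force, by \<open>wt_gap\<close>, a level gap of ten more than the
  weight gap; rounding distances to levels loses one factor 2, leaving
  \<open>2 ^ 9 = 512\<close>.\<close>

lemma weight_sep_aux:
  assumes "a \<in> S" "r a > 0" "r b > 0" "level b \<le> level a" "weight a \<noteq> weight b"
  shows "weight b < weight a \<and> 512 * 2 ^ (weight a - weight b) * r a \<le> r b"
proof -
  have *: "weight b < weight a" "weight a + level b + 10 \<le> weight b + level a"
    using wt_gap[OF assms(1), of "level b" level] assms by auto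
  then have "level a > 0" by linarith
  then have a: "2 ^ level a * r a \<le> d"
    using lev_bounds(2)[of "d / r a"] assms d by (simp add: field_simps)
  have b: "d < 2 * 2 ^ level b * r b"
    using lev_bounds(1)[of "d / r b"] assms d by (simp add: field_simps)
  have "512 * 2 ^ (weight a - weight b) * r a * (2 * 2 ^ level b)
      = 2 ^ (weight a - weight b + level b + 10) * r a"
    by (simp add: power_add)
  also have "\<dots> \<le> 2 ^ level a * r a"
    using * assms(2) by (intro mult_right_mono power_increasing) auto
  also have "\<dots> \<le> r b * (2 * 2 ^ level b)" using a b by (simp add: mult_ac)
  finally have "512 * 2 ^ (weight a - weight b) * r a \<le> r b"
    by (simp add: mult.assoc mult.commute[of _ "r a"])
  with * show ?thesis by simp
qed

lemma weight_sep:
  assumes "a \<in> S" "b \<in> S" "r a > 0" "r b > 0"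
  shows "sep (int (weight a)) (int (weight b)) (r a) (r b)"
proof (cases "weight a = weight b")
  case False
  then show ?thesis
    using weight_sep_aux[of a b] weight_sep_aux[of b a] assms
    unfolding sep_def by (cases "level b \<le> level a") (auto simp: nat_diff_distrib')
qed (simp add: sep_def)

end

section \<open>Differences of rotated points as holomorphic functions of the phase\<close>

text \<open>A dominant monomial with two small corrections: the difference of an inner and an outer
  point has up to three monomials in \<open>u\<close>, other differences have fewer. The number
  \<open>l\<close> bounds the dominant term from below on \<open>|u| = 2\<close>.\<close>

definition diff_form :: "(complex \<Rightarrow> complex) \<Rightarrow> real \<Rightarrow> bool" where
  "diff_form \<Delta> l \<longleftrightarrow> (\<exists>m L c1 n1 c2 n2. L \<noteq> 0 \<and> l \<le> 2 powi m * cmod L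
     \<and> cmod c1 * 2 ^ n1 \<le> 1 / 512 \<and> cmod c2 * 2 ^ n2 \<le> 1 / 512
     \<and> (\<forall>u. u \<noteq> 0 \<longrightarrow> \<Delta> u = u powi m * L * (1 + c1 * u ^ n1 + c2 * u ^ n2)))"

lemma diff_formI:
  assumes "L \<noteq> 0" "l \<le> 2 powi m * cmod L"
    "cmod c1 * 2 ^ n1 \<le> 1 / 512" "cmod c2 * 2 ^ n2 \<le> 1 / 512"
    "\<And>u. u \<noteq> 0 \<Longrightarrow> \<Delta> u = u powi m * L * (1 + c1 * u ^ n1 + c2 * u ^ n2)"
  shows "diff_form \<Delta> l"
  unfolding diff_form_def using assms by metis

lemma diff_form_minus: "diff_form \<Delta> l \<Longrightarrow> diff_form (\<lambda>u. - \<Delta> u) l"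
  unfolding diff_form_def
proof (elim exE conjE)
  fix m L c1 n1 c2 n2
  assume "L \<noteq> 0" "l \<le> 2 powi m * cmod L" "cmod c1 * 2 ^ n1 \<le> 1 / 512" "cmod c2 * 2 ^ n2 \<le> 1 / 512"
    "\<forall>u. u \<noteq> 0 \<longrightarrow> \<Delta> u = u powi m * L * (1 + c1 * u ^ n1 + c2 * u ^ n2)"
  then show "\<exists>m L c1 n1 c2 n2. L \<noteq> 0 \<and> l \<le> 2 powi m * cmod L
     \<and> cmod c1 * 2 ^ n1 \<le> 1 / 512 \<and> cmod c2 * 2 ^ n2 \<le> 1 / 512
     \<and> (\<forall>u. u \<noteq> 0 \<longrightarrow> - \<Delta> u = u powi m * L * (1 + c1 * u ^ n1 + c2 * u ^ n2))"
    by (intro exI[of _ m] exI[of _ "- L"] exI[of _ c1] exI[of _ n1] exI[of _ c2] exI[of _ n2]) auto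
qed

lemma diff_form_exact:
  assumes "L \<noteq> 0" "l \<le> 2 powi m * cmod L" "\<And>u. u \<noteq> 0 \<Longrightarrow> \<Delta> u = u powi m * L"
  shows "diff_form \<Delta> l"
  by (rule diff_formI[of L l m 0 0 0 0]) (use assms in auto)

lemma powi_eq_mult_power:
  fixes u :: complex
  assumes "u \<noteq> 0" "t \<le> s"
  shows "u powi s = u powi t * u ^ nat (s - t)"
proof -
  have "u powi s = u powi (t + int (nat (s - t)))" using assms(2) by simp
  also have "\<dots> = u powi t * u ^ nat (s - t)"
    using assms(1) by (subst power_int_add) (auto simp del: int_nat_eq)
  finally show ?thesis .
qed

lemma small_ratio:
  assumes "512 * 2 ^ n * cmod x \<le> cmod y" "y \<noteq> 0"
  shows "cmod (x / y) * 2 ^ n \<le> 1 / 512" "cmod (- (x / y)) * 2 ^ n \<le> 1 / 512"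
  using assms by (simp_all add: norm_divide field_simps)

lemma diff_form_sep_less:
  assumes "t < s" "512 * 2 ^ nat (s - t) * cmod x \<le> cmod y" "y \<noteq> 0" "l \<le> 2 powi t * cmod y"
  shows "diff_form (\<lambda>u. u powi t * y - u powi s * x) l"
proof (rule diff_formI[of y l t "- (x / y)" "nat (s - t)" 0 0])
  fix u :: complex assume u: "u \<noteq> 0"
  show "u powi t * y - u powi s * x = u powi t * y * (1 + - (x / y) * u ^ nat (s - t) + 0 * u ^ 0)"
    unfolding powi_eq_mult_power[OF u less_imp_le[OF assms(1)]] using assms by (simp add: field_simps)
qed (use assms small_ratio in auto)

lemma diff_form_sep:
  assumes "sep s t (cmod x) (cmod y)" "x \<noteq> 0" "y \<noteq> 0" "x \<noteq> y"
    and "s = t \<Longrightarrow> l \<le> 2 powi s * cmod (x - y)"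
    and "t < s \<Longrightarrow> l \<le> 2 powi t * cmod y" and "s < t \<Longrightarrow> l \<le> 2 powi s * cmod x"
  shows "diff_form (\<lambda>u. u powi s * x - u powi t * y) l"
proof -
  consider "s = t" | "t < s" "512 * 2 ^ nat (s - t) * cmod x \<le> cmod y"
    | "s < t" "512 * 2 ^ nat (t - s) * cmod y \<le> cmod x"
    using assms(1) unfolding sep_def by auto
  then show ?thesis
  proof cases
    case 1
    then show ?thesis using assms
      by (intro diff_form_exact[of "x - y" l s]) (auto simp: algebra_simps)
  next
    case 2
    then show ?thesis
      using diff_form_minus[OF diff_form_sep_less[of t s x y l]] assms by simp
  next
    case 3
    then show ?thesis using diff_form_sep_less[of s t y x l] assms by simp
  qed
qed

text \<open>The second bound concerns the reflected corrections, with conjugate coefficients and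
  \<open>inverse u\<close>: on the unit circle they are the conjugates of the corrections
  themselves. The slack from 1 / 512 to 1 / 64 pays for an open neighbourhood of the closed
  annulus.\<close>

lemma diff_form_nbhd:
  assumes "cmod c1 * 2 ^ n1 \<le> 1 / 512" "cmod c2 * 2 ^ n2 \<le> 1 / 512"
  obtains S where "open S" "annulus \<subseteq> S"
    "\<And>u. u \<in> S \<Longrightarrow> u \<noteq> 0 \<and> cmod (c1 * u ^ n1 + c2 * u ^ n2) \<le> 1 / 32
       \<and> cmod (cnj c1 * inverse u ^ n1 + cnj c2 * inverse u ^ n2) \<le> 1 / 32"
proof
  define S where "S = {u. 1 / 2 < cmod u} \<inter> {u. cmod c1 * cmod u ^ n1 < 1 / 64} \<inter> {u. cmod c2 * cmod u ^ n2 < 1 / 64}"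
  show "open S" unfolding S_def
    by (intro open_Int open_Collect_less continuous_intros)
  show "annulus \<subseteq> S"
  proof
    fix u assume "u \<in> annulus"
    then have u: "1 \<le> cmod u" "cmod u \<le> 2" by (auto simp: annulus_def)
    then have "cmod c1 * cmod u ^ n1 \<le> cmod c1 * 2 ^ n1" "cmod c2 * cmod u ^ n2 \<le> cmod c2 * 2 ^ n2"
      by (intro mult_left_mono power_mono; simp)+
    then show "u \<in> S" unfolding S_def using u assms by auto
  qed
  fix u assume "u \<in> S"
  then have u: "1 / 2 < cmod u" "cmod c1 * cmod u ^ n1 < 1 / 64" "cmod c2 * cmod u ^ n2 < 1 / 64"
    unfolding S_def by auto
  have "inverse (cmod u) \<le> inverse (1 / 2)"
    using u(1) by (intro le_imp_inverse_le) auto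
  then have "inverse (cmod u) \<le> 2" by simp
  then have "cmod c1 * inverse (cmod u) ^ n1 \<le> cmod c1 * 2 ^ n1" "cmod c2 * inverse (cmod u) ^ n2 \<le> cmod c2 * 2 ^ n2"
    by (intro mult_left_mono power_mono; simp)+
  then have "cmod (cnj c1 * inverse u ^ n1) \<le> 1 / 64" "cmod (cnj c2 * inverse u ^ n2) \<le> 1 / 64"
    using assms by (auto simp: norm_mult norm_power norm_inverse)
  moreover have "cmod (c1 * u ^ n1) \<le> 1 / 64" "cmod (c2 * u ^ n2) \<le> 1 / 64"
    using u by (auto simp: norm_mult norm_power)
  ultimately show "u \<noteq> 0 \<and> cmod (c1 * u ^ n1 + c2 * u ^ n2) \<le> 1 / 32
       \<and> cmod (cnj c1 * inverse u ^ n1 + cnj c2 * inverse u ^ n2) \<le> 1 / 32"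
    using u(1) norm_triangle_ineq[of "c1 * u ^ n1" "c2 * u ^ n2"]
      norm_triangle_ineq[of "cnj c1 * inverse u ^ n1" "cnj c2 * inverse u ^ n2"]
    by (intro conjI; (linarith | force))
qed

lemma annulus_ext_inverse_diff_form:
  assumes "diff_form \<Delta> l" "l > 0"
  shows "annulus_ext (\<lambda>u. inverse (\<Delta> u)) (2 / l)"
proof -
  obtain m L c1 n1 c2 n2 where *: "L \<noteq> 0" "l \<le> 2 powi m * cmod L"
    "cmod c1 * 2 ^ n1 \<le> 1 / 512" "cmod c2 * 2 ^ n2 \<le> 1 / 512"
    "\<And>u. u \<noteq> 0 \<Longrightarrow> \<Delta> u = u powi m * L * (1 + c1 * u ^ n1 + c2 * u ^ n2)"
    using assms(1) unfolding diff_form_def by metis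
  obtain S where S: "open S" "annulus \<subseteq> S"
    "\<And>u. u \<in> S \<Longrightarrow> u \<noteq> 0 \<and> cmod (c1 * u ^ n1 + c2 * u ^ n2) \<le> 1 / 32"
    using diff_form_nbhd[OF *(3,4)] by metis
  define \<nu> where "\<nu> u = 1 + c1 * u ^ n1 + c2 * u ^ n2" for u
  have \<nu>: "1 / 2 \<le> cmod (\<nu> u)" if "u \<in> S" for u
  proof -
    have "cmod 1 \<le> cmod (\<nu> u) + cmod (- (c1 * u ^ n1 + c2 * u ^ n2))"
      using norm_triangle_ineq[of "\<nu> u" "- (c1 * u ^ n1 + c2 * u ^ n2)"] unfolding \<nu>_def by simp
    then show ?thesis using S(3)[OF that] by (simp only: norm_minus_cancel norm_one) linarith
  qed
  then have \<nu>0: "\<nu> u \<noteq> 0" if "u \<in> S" for u using that by fastforce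
  show ?thesis unfolding annulus_ext_def
  proof (intro exI conjI allI impI)
    let ?\<Phi> = "\<lambda>u. inverse (u powi m * L * \<nu> u)"
    show "open S" "annulus \<subseteq> S" by fact+
    show "?\<Phi> holomorphic_on S" using S(3) \<nu>0 *(1)
      unfolding \<nu>_def by (intro holomorphic_intros) auto
    show "?\<Phi> u = inverse (\<Delta> u)" if "cmod u = 1" for u
    proof -
      have "u \<noteq> 0" using that by auto
      then show ?thesis using *(5) by (simp add: \<nu>_def)
    qed
    fix u :: complex assume u: "cmod u = 2"
    then have "u \<in> S" using S(2) by (auto simp: annulus_def)
    have "l * (1 / 2) \<le> (2 powi m * cmod L) * cmod (\<nu> u)"
      by (rule mult_mono) (use * \<nu>[OF \<open>u \<in> S\<close>] assms(2) in auto)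
    then have "l / 2 \<le> cmod (u powi m * L * \<nu> u)"
      by (simp add: norm_mult norm_power_int u)
    then have "inverse (cmod (u powi m * L * \<nu> u)) \<le> inverse (l / 2)"
      using assms(2) by (intro le_imp_inverse_le) auto
    then show "cmod (?\<Phi> u) \<le> 2 / l" by (simp only: norm_inverse) (simp add: field_simps)
  qed
qed

section \<open>Continuation of moduli and of the regulator\<close>

text \<open>A modulus is not holomorphic, but where \<open>cnj u = inverse u\<close> its square
  agrees with a holomorphic function. Being within 1 / 2 of 1, the ratio \<open>q\<close> has a
  logarithm and a positive real part.\<close>

definition sq_ext :: "(complex \<Rightarrow> complex) \<Rightarrow> real \<Rightarrow> bool" where
  "sq_ext \<Delta> d \<longleftrightarrow> (\<exists>S q. open S \<and> annulus \<subseteq> S \<and> q holomorphic_on S \<and> (\<forall>u\<in>S. cmod (q u - 1) < 1 / 2)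
     \<and> (\<forall>u. cmod u = 1 \<longrightarrow> complex_of_real ((cmod (\<Delta> u))\<^sup>2) = of_real (d\<^sup>2) * q u))"

lemma sq_ext_diff_form:
  assumes "diff_form \<Delta> l"
  shows "sq_ext \<Delta> (cmod (\<Delta> 1))"
proof -
  obtain m L c1 n1 c2 n2 where *: "L \<noteq> 0"
    "cmod c1 * 2 ^ n1 \<le> 1 / 512" "cmod c2 * 2 ^ n2 \<le> 1 / 512"
    "\<And>u. u \<noteq> 0 \<Longrightarrow> \<Delta> u = u powi m * L * (1 + c1 * u ^ n1 + c2 * u ^ n2)"
    using assms unfolding diff_form_def by metis
  obtain S where S: "open S" "annulus \<subseteq> S"
    "\<And>u. u \<in> S \<Longrightarrow> u \<noteq> 0 \<and> cmod (c1 * u ^ n1 + c2 * u ^ n2) \<le> 1 / 32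
       \<and> cmod (cnj c1 * inverse u ^ n1 + cnj c2 * inverse u ^ n2) \<le> 1 / 32"
    using diff_form_nbhd[OF *(2,3)] by metis
  define \<nu> \<nu>' where "\<nu> u = c1 * u ^ n1 + c2 * u ^ n2"
    and "\<nu>' u = cnj c1 * inverse u ^ n1 + cnj c2 * inverse u ^ n2" for u
  have \<nu>: "cmod (\<nu> u) \<le> 1 / 32" "cmod (\<nu>' u) \<le> 1 / 32" "u \<noteq> 0" if "u \<in> S" for u
    using S(3)[OF that] by (auto simp: \<nu>_def \<nu>'_def)
  have small: "cmod ((1 + \<nu> u) * (1 + \<nu>' u) - 1) \<le> 1 / 10" if "u \<in> S" for u
  proof -
    have "(1 + \<nu> u) * (1 + \<nu>' u) - 1 = \<nu> u + \<nu>' u + \<nu> u * \<nu>' u" by (simp add: algebra_simps)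
    also have "cmod \<dots> \<le> cmod (\<nu> u) + cmod (\<nu>' u) + cmod (\<nu> u) * cmod (\<nu>' u)"
      by (metis norm_mult norm_triangle_ineq add_right_mono order_trans)
    also have "\<dots> \<le> 1 / 32 + 1 / 32 + 1 / 32 * (1 / 32)"
      using \<nu>[OF that] by (intro add_mono mult_mono) auto
    finally show ?thesis by simp
  qed
  have 1: "(1::complex) \<in> S" using S(2) by (auto simp: annulus_def)
  have cnj: "\<nu>' u = cnj (\<nu> u)" if "cmod u = 1" for u
  proof -
    have "inverse u = cnj u" using that
      by (metis complex_norm_square inverse_unique of_real_1 one_power2)
    then show ?thesis by (simp add: \<nu>_def \<nu>'_def)
  qed
  define D where "D = (cmod (1 + \<nu> 1))\<^sup>2"
  have D: "complex_of_real D = (1 + \<nu> 1) * (1 + \<nu>' 1)"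
    unfolding D_def complex_norm_square by (simp add: cnj)
  have "\<bar>D - 1\<bar> \<le> 1 / 10"
    using small[OF 1] unfolding D[symmetric] by (metis norm_of_real of_real_1 of_real_diff)
  then have D9: "D \<ge> 9 / 10" "D \<le> 11 / 10" by linarith+
  \<comment> \<open>Division by \<open>D\<close> normalises \<open>q\<close> to 1 at
    \<open>u = 1\<close>, the configuration itself. The product and \<open>D\<close> lie within 1 /
    10 of 1, so \<open>q\<close> stays within \<open>(2 / 10) / (9 / 10) = 2 / 9\<close> of
    1.\<close>
  define q where "q u = (1 + \<nu> u) * (1 + \<nu>' u) / of_real D" for u
  have "cmod (q u - 1) < 1 / 2" if "u \<in> S" for u
  proof -
    have "q u - 1 = ((1 + \<nu> u) * (1 + \<nu>' u) - 1 - ((1 + \<nu> 1) * (1 + \<nu>' 1) - 1)) / of_real D"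
      using D9 unfolding q_def D[symmetric] by (simp add: field_simps)
    also have "cmod \<dots> \<le> (1 / 10 + 1 / 10) / (9 / 10)"
      unfolding norm_divide
      using D9 by (intro frac_le order_trans[OF norm_triangle_ineq4] add_mono small 1 that) auto
    finally show ?thesis by simp
  qed
  moreover have "q holomorphic_on S" unfolding q_def \<nu>_def \<nu>'_def
    using D9 S(3) by (intro holomorphic_intros) auto
  moreover have "complex_of_real ((cmod (\<Delta> u))\<^sup>2) = of_real ((cmod (\<Delta> 1))\<^sup>2) * q u" if u: "cmod u = 1" for u
  proof -
    have "u \<noteq> 0" using u by auto
    then have "(cmod (\<Delta> u))\<^sup>2 = (cmod L)\<^sup>2 * (cmod (1 + \<nu> u))\<^sup>2"
      using *(4) u by (simp add: norm_mult norm_power_int power_mult_distrib \<nu>_def add.assoc)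
    moreover have "(cmod (\<Delta> 1))\<^sup>2 = (cmod L)\<^sup>2 * D"
      using *(4)[of 1] unfolding D_def by (simp add: norm_mult power_mult_distrib \<nu>_def add.assoc)
    moreover have "complex_of_real ((cmod (1 + \<nu> u))\<^sup>2) = (1 + \<nu> u) * (1 + \<nu>' u)"
      unfolding complex_norm_square by (simp add: cnj u)
    ultimately show ?thesis using D9 unfolding q_def
      by (simp only: of_real_mult) (simp add: field_simps)
  qed
  ultimately show ?thesis using S unfolding sq_ext_def by blast
qed

lemma annulus_ext_powr:
  assumes "sq_ext \<Delta> d" "d \<ge> 0"
  shows "annulus_ext (\<lambda>u. complex_of_real (cmod (\<Delta> u)) powr c) (exp (cmod c) * cmod (complex_of_real d powr c))"
proof -
  obtain S q where S: "open S" "annulus \<subseteq> S" "q holomorphic_on S" "\<And>u. u \<in> S \<Longrightarrow> cmod (q u - 1) < 1 / 2"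
    and q: "\<And>u. cmod u = 1 \<Longrightarrow> complex_of_real ((cmod (\<Delta> u))\<^sup>2) = of_real (d\<^sup>2) * q u"
    using assms(1) unfolding sq_ext_def by metis
  show ?thesis
  proof (cases "d = 0")
    \<comment> \<open>At a collision both sides vanish, as \<open>0 powr c = 0\<close> for every
      \<open>c\<close>.\<close>
    case True
    then have "cmod (\<Delta> u) = 0" if "cmod u = 1" for u using q[OF that] by simp
    then show ?thesis using True
      by (intro annulus_ext_cong[OF annulus_ext_const[of 0]]) auto
  next
    case False
    then have d: "d > 0" using assms(2) by simp
    have qpos: "q u \<notin> \<real>\<^sub>\<le>\<^sub>0" if "u \<in> S" for u
    proof
      assume "q u \<in> \<real>\<^sub>\<le>\<^sub>0"
      then have "Re (q u) \<le> 0" by (simp add: complex_nonpos_Reals_iff)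
      then show False using S(4)[OF that] abs_Re_le_cmod[of "q u - 1"] by simp
    qed
    show ?thesis unfolding annulus_ext_def
    proof (intro exI conjI allI impI)
      \<comment> \<open>Half of the exponent, since \<open>q\<close> extends the square of the
        modulus. On the outer circle \<open>cmod (q u - 1) < 1 / 2\<close> gives
        \<open>cmod (Ln (q u)) \<le> 1\<close>.\<close>
      let ?\<Phi> = "\<lambda>u. complex_of_real d powr c * exp (c / 2 * Ln (q u))"
      show "open S" "annulus \<subseteq> S" by fact+
      show "?\<Phi> holomorphic_on S" using S(3) qpos by (auto intro!: holomorphic_intros)
      show "?\<Phi> u = complex_of_real (cmod (\<Delta> u)) powr c" if u: "cmod u = 1" for u
      proof -
        have uS: "u \<in> S" using u S(2) by (auto simp: annulus_def)
        define t where "t = (cmod (\<Delta> u) / d)\<^sup>2"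
        have qt: "q u = of_real t"
          using q[OF u] d unfolding t_def by (simp add: field_simps power_divide)
        have t: "t > 0" using qpos[OF uS] unfolding qt by (simp add: complex_nonpos_Reals_iff)
        have \<Delta>: "cmod (\<Delta> u) = d * sqrt t" unfolding t_def using d by simp
        have "complex_of_real (cmod (\<Delta> u)) powr c = exp (c * of_real (ln d + ln t / 2))"
          unfolding \<Delta> powr_def using d t by (simp add: Ln_of_real ln_mult ln_sqrt flip: of_real_mult)
        also have "\<dots> = ?\<Phi> u" unfolding powr_def qt using d t
          by (simp add: Ln_of_real algebra_simps flip: exp_add)
        finally show ?thesis by simp
      qed
      fix u :: complex assume "cmod u = 2"
      then have "u \<in> S" using S(2) by (auto simp: annulus_def)
      then have "cmod (Ln (1 + (q u - 1))) \<le> 2 * cmod (q u - 1)" using S(4) by (intro norm_Ln_le)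
      then have "cmod (Ln (q u)) \<le> 1" using S(4)[OF \<open>u \<in> S\<close>] by simp
      then have "cmod (c / 2 * Ln (q u)) \<le> cmod c / 2 * 1"
        unfolding norm_mult by (intro mult_mono) (auto simp: norm_divide)
      also have "\<dots> \<le> cmod c" by simp
      finally have "cmod (exp (c / 2 * Ln (q u))) \<le> exp (cmod c)"
        using norm_exp[of "c / 2 * Ln (q u)"] by (meson exp_le_cancel_iff order_trans)
      then show "cmod (?\<Phi> u) \<le> exp (cmod c) * cmod (complex_of_real d powr c)"
        unfolding norm_mult by (subst mult.commute) (rule mult_right_mono, auto)
    qed
  qed
qed

text \<open>Extensions with values in a sector of the right half plane, so that the regulator
  \<open>exp (- \<eta> \<phi>)\<close> stays bounded after the rotation has become complex.\<close>

definition pos_ext :: "(complex \<Rightarrow> complex) \<Rightarrow> real \<Rightarrow> bool" where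
  "pos_ext \<phi> v \<longleftrightarrow> (\<exists>S \<Phi>. open S \<and> annulus \<subseteq> S \<and> \<Phi> holomorphic_on S \<and> (\<forall>u. cmod u = 1 \<longrightarrow> \<Phi> u = \<phi> u)
     \<and> (\<forall>u. cmod u = 2 \<longrightarrow> 2 / 9 * v \<le> Re (\<Phi> u) \<and> cmod (\<Phi> u) \<le> 2 * v))"

lemma pos_ext_add:
  assumes "pos_ext \<phi> v" "pos_ext \<psi> w"
  shows "pos_ext (\<lambda>u. \<phi> u + \<psi> u) (v + w)"
proof -
  from assms obtain S \<Phi> T \<Psi> where *:
    "open S" "annulus \<subseteq> S" "\<Phi> holomorphic_on S" "\<forall>u. cmod u = 1 \<longrightarrow> \<Phi> u = \<phi> u"
    "\<forall>u. cmod u = 2 \<longrightarrow> 2 / 9 * v \<le> Re (\<Phi> u) \<and> cmod (\<Phi> u) \<le> 2 * v"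
    "open T" "annulus \<subseteq> T" "\<Psi> holomorphic_on T" "\<forall>u. cmod u = 1 \<longrightarrow> \<Psi> u = \<psi> u"
    "\<forall>u. cmod u = 2 \<longrightarrow> 2 / 9 * w \<le> Re (\<Psi> u) \<and> cmod (\<Psi> u) \<le> 2 * w"
    unfolding pos_ext_def by metis
  show ?thesis unfolding pos_ext_def
  proof (intro exI[of _ "S \<inter> T"] exI[of _ "\<lambda>u. \<Phi> u + \<Psi> u"] conjI allI impI)
    show "(\<lambda>u. \<Phi> u + \<Psi> u) holomorphic_on S \<inter> T"
      using * by (auto intro!: holomorphic_intros elim: holomorphic_on_subset)
    fix u :: complex assume "cmod u = 2"
    then have "2 / 9 * v \<le> Re (\<Phi> u)" "cmod (\<Phi> u) \<le> 2 * v" "2 / 9 * w \<le> Re (\<Psi> u)" "cmod (\<Psi> u) \<le> 2 * w"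
      using *(5,10) by auto
    then show "2 / 9 * (v + w) \<le> Re (\<Phi> u + \<Psi> u)" "cmod (\<Phi> u + \<Psi> u) \<le> 2 * (v + w)"
      using norm_triangle_ineq[of "\<Phi> u" "\<Psi> u"] by auto
  qed (use * in auto)
qed

lemma pos_ext_0: "pos_ext (\<lambda>_. 0) 0"
  unfolding pos_ext_def by (intro exI[of _ UNIV] exI[of _ "\<lambda>_. 0"]) auto

lemma pos_ext_sum:
  "(\<And>i. i \<in> A \<Longrightarrow> pos_ext (\<phi> i) (v i)) \<Longrightarrow> pos_ext (\<lambda>u. \<Sum>i\<in>A. \<phi> i u) (\<Sum>i\<in>A. v i)"
  by (induction A rule: infinite_finite_induct) (auto intro: pos_ext_0 pos_ext_add)

lemma pos_ext_sq:
  assumes "sq_ext \<Delta> d"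
  shows "pos_ext (\<lambda>u. complex_of_real ((cmod (\<Delta> u))\<^sup>2)) (d\<^sup>2)"
    and "pos_ext (\<lambda>u. complex_of_real (1 / (cmod (\<Delta> u))\<^sup>2)) (1 / d\<^sup>2)"
proof -
  obtain S q where S: "open S" "annulus \<subseteq> S" "q holomorphic_on S" "\<And>u. u \<in> S \<Longrightarrow> cmod (q u - 1) < 1 / 2"
    and q: "\<And>u. cmod u = 1 \<Longrightarrow> complex_of_real ((cmod (\<Delta> u))\<^sup>2) = of_real (d\<^sup>2) * q u"
    using assms(1) unfolding sq_ext_def by metis
  have b: "1 / 2 \<le> Re (q u)" "cmod (q u) \<le> 3 / 2" "1 / 2 \<le> cmod (q u)" "q u \<noteq> 0" if "u \<in> S" for u
    using S(4)[OF that] abs_Re_le_cmod[of "q u - 1"] abs_Re_le_cmod[of "q u"]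
      norm_triangle_ineq2[of "q u" 1] by auto
  have in_S: "u \<in> S" if "cmod u = 2" for u using S(2) that by (auto simp: annulus_def)
  show "pos_ext (\<lambda>u. complex_of_real ((cmod (\<Delta> u))\<^sup>2)) (d\<^sup>2)"
    unfolding pos_ext_def
  proof (intro exI[of _ S] exI[of _ "\<lambda>u. of_real (d\<^sup>2) * q u"] conjI allI impI)
    fix u :: complex assume u: "cmod u = 2"
    have "d\<^sup>2 * (2 / 9) \<le> d\<^sup>2 * Re (q u)" "d\<^sup>2 * cmod (q u) \<le> d\<^sup>2 * 2"
      using b[OF in_S[OF u]] by (intro mult_left_mono; simp)+
    then show "2 / 9 * d\<^sup>2 \<le> Re (of_real (d\<^sup>2) * q u)" "cmod (of_real (d\<^sup>2) * q u) \<le> 2 * d\<^sup>2"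
      by (simp_all add: norm_mult mult_ac norm_power)
  qed (use S q in \<open>auto intro!: holomorphic_intros\<close>)
  show "pos_ext (\<lambda>u. complex_of_real (1 / (cmod (\<Delta> u))\<^sup>2)) (1 / d\<^sup>2)"
    unfolding pos_ext_def
  proof (intro exI[of _ S] exI[of _ "\<lambda>u. of_real (1 / d\<^sup>2) * inverse (q u)"] conjI allI impI)
    fix u :: complex
    show "of_real (1 / d\<^sup>2) * inverse (q u) = complex_of_real (1 / (cmod (\<Delta> u))\<^sup>2)" if "cmod u = 1"
      using q[OF that] by (simp add: divide_inverse)
    assume u: "cmod u = 2"
    note b = b[OF in_S[OF u]]
    \<comment> \<open>The real part of \<open>1 / q\<close> is \<open>Re q / |q|^2\<close>, with
      \<open>Re q\<close> at least 1 / 2 and \<open>|q|\<close> at most 3 / 2: this is the origin of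
      the constant in \<open>pos_ext\<close>.\<close>
    have "2 / 9 \<le> Re (inverse (q u))"
    proof -
      have "Re (inverse (q u)) = Re (q u) / (cmod (q u))\<^sup>2" by (simp add: cmod_def)
      moreover have "(cmod (q u))\<^sup>2 \<le> (3 / 2)\<^sup>2" using b by (intro power_mono) auto
      then have "(1 / 2) / (3 / 2)\<^sup>2 \<le> Re (q u) / (cmod (q u))\<^sup>2"
        using b by (intro frac_le) auto
      moreover have "(1 / 2) / (3 / 2)\<^sup>2 = (2 / 9 :: real)" by (simp add: power2_eq_square)
      ultimately show ?thesis by linarith
    qed
    moreover have "cmod (inverse (q u)) \<le> 2"
    proof -
      have "inverse (cmod (q u)) \<le> inverse (1 / 2)" using b by (intro le_imp_inverse_le) auto
      then show ?thesis by (simp add: norm_inverse)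
    qed
    ultimately have "1 / d\<^sup>2 * (2 / 9) \<le> 1 / d\<^sup>2 * Re (inverse (q u))" "1 / d\<^sup>2 * cmod (inverse (q u)) \<le> 1 / d\<^sup>2 * 2"
      by (intro mult_left_mono; simp)+
    then show "2 / 9 * (1 / d\<^sup>2) \<le> Re (of_real (1 / d\<^sup>2) * inverse (q u))"
        "cmod (of_real (1 / d\<^sup>2) * inverse (q u)) \<le> 2 * (1 / d\<^sup>2)"
      by (simp_all add: norm_mult norm_power norm_divide mult_ac del: Re_divide inverse_complex.sel)
  qed (use S b in \<open>auto intro!: holomorphic_intros\<close>)
qed

text \<open>Small when \<open>\<eta> * v\<close> is small and bounded in any case:
  \<open>min 9 (2 * \<eta> * v)\<close> is the error majorant of the regulator, made for dominated
  convergence as \<open>\<eta>\<close> tends to 0. The third part is for derivatives of the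
  regulator.\<close>

lemma annulus_ext_exp:
  assumes "pos_ext \<phi> v" "\<eta> \<ge> 0" "v \<ge> 0"
  shows "annulus_ext (\<lambda>u. exp (- of_real \<eta> * \<phi> u)) 1"
    and "annulus_ext (\<lambda>u. 1 - exp (- of_real \<eta> * \<phi> u)) (min 9 (2 * \<eta> * v))"
    and "pos_ext \<psi> w \<Longrightarrow> w \<le> v \<Longrightarrow>
      annulus_ext (\<lambda>u. of_real \<eta> * \<psi> u * exp (- of_real \<eta> * \<phi> u)) (min 9 (2 * \<eta> * v))"
proof -
  obtain S \<Phi> where S: "open S" "annulus \<subseteq> S" "\<Phi> holomorphic_on S" "\<And>u. cmod u = 1 \<Longrightarrow> \<Phi> u = \<phi> u"
    and b: "\<And>u. cmod u = 2 \<Longrightarrow> 2 / 9 * v \<le> Re (\<Phi> u) \<and> cmod (\<Phi> u) \<le> 2 * v"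
    using assms(1) unfolding pos_ext_def by metis
  have e: "cmod (exp (- of_real \<eta> * \<Phi> u)) \<le> exp (- (2 / 9 * \<eta> * v))" if "cmod u = 2" for u
  proof -
    have "\<eta> * (2 / 9 * v) \<le> \<eta> * Re (\<Phi> u)" using b[OF that] assms by (intro mult_left_mono) auto
    then show ?thesis by (simp add: norm_exp_eq_Re)
  qed
  have e1: "cmod (exp (- of_real \<eta> * \<Phi> u)) \<le> 1" if "cmod u = 2" for u
    using e[OF that] assms by (smt (verit) exp_le_one_iff mult_nonneg_nonneg zero_le_divide_iff)
  show "annulus_ext (\<lambda>u. exp (- of_real \<eta> * \<phi> u)) 1"
    unfolding annulus_ext_def
    by (intro exI[of _ S] exI[of _ "\<lambda>u. exp (- of_real \<eta> * \<Phi> u)"])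
      (use S e1 in \<open>auto intro!: holomorphic_intros\<close>)
  show "annulus_ext (\<lambda>u. 1 - exp (- of_real \<eta> * \<phi> u)) (min 9 (2 * \<eta> * v))"
    unfolding annulus_ext_def
  proof (intro exI[of _ S] exI[of _ "\<lambda>u. 1 - exp (- of_real \<eta> * \<Phi> u)"] conjI allI impI)
    fix u :: complex assume u: "cmod u = 2"
    have "cmod (1 - exp (- of_real \<eta> * \<Phi> u)) \<le> 2"
      using norm_triangle_ineq4[of 1 "exp (- of_real \<eta> * \<Phi> u)"] e1[OF u]
      by (simp del: norm_exp_eq_Re)
    moreover have "cmod (1 - exp (- of_real \<eta> * \<Phi> u)) \<le> cmod (of_real \<eta> * \<Phi> u)"
    proof -
      have "Re (\<Phi> u) \<ge> 0" using b[OF u] assms(3) by linarith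
      then have "norm (exp (- (of_real \<eta> * \<Phi> u)) - 1) \<le> 1 * norm (- (of_real \<eta> * \<Phi> u) - 0)"
        by (subst exp_zero[symmetric], intro field_differentiable_bound[of "{z. Re z \<le> 0}" exp exp])
          (use assms(2) in \<open>auto simp: convex_halfspace_Re_le norm_exp_eq_Re intro!: DERIV_subset[OF DERIV_exp]\<close>)
      then show ?thesis by (simp add: norm_minus_commute)
    qed
    moreover have "cmod (of_real \<eta> * \<Phi> u) \<le> 2 * \<eta> * v"
      using mult_left_mono[of "cmod (\<Phi> u)" "2 * v" \<eta>] b[OF u] assms(2) by (simp add: norm_mult)
    ultimately show "cmod (1 - exp (- of_real \<eta> * \<Phi> u)) \<le> min 9 (2 * \<eta> * v)" by auto
  qed (use S in \<open>auto intro!: holomorphic_intros\<close>)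
  assume "pos_ext \<psi> w" and wv: "w \<le> v"
  then obtain T \<Psi> where T: "open T" "annulus \<subseteq> T" "\<Psi> holomorphic_on T" "\<And>u. cmod u = 1 \<Longrightarrow> \<Psi> u = \<psi> u"
    and bT: "\<And>u. cmod u = 2 \<Longrightarrow> 2 / 9 * w \<le> Re (\<Psi> u) \<and> cmod (\<Psi> u) \<le> 2 * w"
    unfolding pos_ext_def by metis
  show "annulus_ext (\<lambda>u. of_real \<eta> * \<psi> u * exp (- of_real \<eta> * \<phi> u)) (min 9 (2 * \<eta> * v))"
    unfolding annulus_ext_def
  proof (intro exI[of _ "S \<inter> T"] exI[of _ "\<lambda>u. of_real \<eta> * \<Psi> u * exp (- of_real \<eta> * \<Phi> u)"] conjI allI impI)
    show "(\<lambda>u. of_real \<eta> * \<Psi> u * exp (- of_real \<eta> * \<Phi> u)) holomorphic_on S \<inter> T"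
      using S T by (auto intro!: holomorphic_intros elim: holomorphic_on_subset)
    fix u :: complex assume u: "cmod u = 2"
    have \<Psi>: "cmod (of_real \<eta> * \<Psi> u) \<le> 2 * \<eta> * v"
    proof -
      have "cmod (\<Psi> u) \<le> 2 * v" using bT[OF u] wv by linarith
      then show ?thesis using mult_left_mono[of "cmod (\<Psi> u)" "2 * v" \<eta>] assms(2) by (simp add: norm_mult)
    qed
    have "cmod (of_real \<eta> * \<Psi> u * exp (- of_real \<eta> * \<Phi> u)) \<le> 2 * \<eta> * v * exp (- (2 / 9 * \<eta> * v))"
      unfolding norm_mult[of "of_real \<eta> * \<Psi> u"] using assms by (intro mult_mono \<Psi> e[OF u]) auto
    \<comment> \<open>The elementary bound is \<open>t * exp (- t) \<le> 1\<close>; the decay rate 2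
      / 9 turns the prefactor 2 into 9.\<close>
    also have "\<dots> = 9 * ((2 / 9 * \<eta> * v) * exp (- (2 / 9 * \<eta> * v)))" by simp
    also have "\<dots> \<le> 9 * 1"
    proof (intro mult_left_mono)
      define t where "t = 2 / 9 * \<eta> * v"
      have "t \<le> exp t" using exp_ge_add_one_self[of t] by linarith
      then have "t * exp (- t) \<le> 1" by (simp add: exp_minus field_simps)
      then show "2 / 9 * \<eta> * v * exp (- (2 / 9 * \<eta> * v)) \<le> 1" by (simp add: t_def)
    qed simp
    finally have 1: "cmod (of_real \<eta> * \<Psi> u * exp (- of_real \<eta> * \<Phi> u)) \<le> 9" by simp
    have "cmod (of_real \<eta> * \<Psi> u * exp (- of_real \<eta> * \<Phi> u)) \<le> 2 * \<eta> * v * 1"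
      unfolding norm_mult[of "of_real \<eta> * \<Psi> u"] using assms by (intro mult_mono \<Psi> e1[OF u]) auto
    with 1 show "cmod (of_real \<eta> * \<Psi> u * exp (- of_real \<eta> * \<Phi> u)) \<le> min 9 (2 * \<eta> * v)" by simp
  qed (use S T in auto)
qed

section \<open>Cluster rotations\<close>

text \<open>A hierarchy of two centers: outer clusters turn about \<open>c\<close>, and the inner
  clusters are carried along with \<open>p\<close> while turning about \<open>p\<close> in addition.
  The exponents \<open>\<sigma>\<close> may be negative, so that distances near infinity can be
  shrunk.\<close>

definition rotY :: "complex \<Rightarrow> ('a \<Rightarrow> int) \<Rightarrow> 'a \<Rightarrow> ('a \<Rightarrow> nat) \<Rightarrow> ('a \<Rightarrow> complex) \<Rightarrow> complex \<Rightarrow> 'a \<Rightarrow> complex" where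
  "rotY c \<sigma> p j X u a = (if j a = 0 then c + u powi \<sigma> a * (X a - c)
     else c + u powi \<sigma> p * (X p - c + u ^ j a * (X a - X p)))"

lemma rotY_1 [simp]: "rotY c \<sigma> p j X 1 a = X a"
  by (simp add: rotY_def)

lemma rotY_inverse:
  assumes "u \<noteq> 0" "j p = 0"
  shows "rotY c \<sigma> p j (rotY c \<sigma> p j X u) (inverse u) a = X a"
proof -
  define Y where "Y = rotY c \<sigma> p j X u"
  have i1: "inverse u powi s * (u powi s * w) = w" for s w
    using assms(1) by (simp add: power_int_inverse)
  have i2: "inverse u ^ n * (u ^ n * w) = w" for n w
    using assms(1) by (simp add: power_inverse)
  have Yp: "Y p - c = u powi \<sigma> p * (X p - c)"
    using assms(2) by (simp add: rotY_def Y_def)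
  show ?thesis
  proof (cases "j a = 0")
    case True
    then have "Y a - c = u powi \<sigma> a * (X a - c)" by (simp add: rotY_def Y_def)
    then show ?thesis using True unfolding Y_def[symmetric] by (simp add: rotY_def i1)
  next
    case False
    then have Yap: "Y a - Y p = u powi \<sigma> p * (u ^ j a * (X a - X p))"
      using assms(2) by (simp add: rotY_def Y_def algebra_simps)
    have "inverse u powi \<sigma> p * (Y p - c + inverse u ^ j a * (Y a - Y p))
       = inverse u powi \<sigma> p * (u powi \<sigma> p * (X p - c) + u powi \<sigma> p * (inverse u ^ j a * (u ^ j a * (X a - X p))))"
      unfolding Yap Yp by (simp only: mult.left_commute[of "inverse u ^ j a" "u powi \<sigma> p"])
    also have "\<dots> = X a - c" by (simp only: i1 i2 flip: distrib_left) simp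
    finally show ?thesis using False unfolding Y_def[symmetric] by (simp add: rotY_def)
  qed
qed

lemma lead_factor:
  fixes L :: complex
  assumes "L \<noteq> 0"
  shows "m * L * (1 + y / L * A + - (x / L) * B) = m * (L + y * A - x * B)"
    and "m * - L * (1 + - (x / L) * A + - (y / L) * B) = m * (x * A + y * B - L)"
  using assms by (simp_all add: field_simps)

lemma diff_form_add_power:
  assumes "512 * 2 ^ n * cmod y \<le> cmod L" "L \<noteq> 0"
  shows "diff_form (\<lambda>u. u powi m * (L + u ^ n * y)) 0"
  by (rule diff_formI[of L 0 m "y / L" n 0 0])
    (use assms small_ratio(1)[OF assms] in \<open>auto simp: field_simps\<close>)

text \<open>Separations that leave one dominant monomial in every difference of two points. Turns
  about \<open>p\<close> must stay well inside the distances from \<open>p\<close> to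
  \<open>c\<close> and to all other outer points.\<close>

locale rotation =
  fixes S :: "'a set" and X :: "'a \<Rightarrow> complex" and c :: complex
    and \<sigma> :: "'a \<Rightarrow> int" and p :: 'a and j :: "'a \<Rightarrow> nat"
  assumes p: "p \<in> S" "j p = 0" "X p \<noteq> c" and inj: "inj_on X S"
    and outer: "\<And>a b. a \<in> S \<Longrightarrow> b \<in> S \<Longrightarrow> j a = 0 \<Longrightarrow> j b = 0 \<Longrightarrow> X a \<noteq> c \<Longrightarrow> X b \<noteq> c \<Longrightarrow>
      sep (\<sigma> a) (\<sigma> b) (cmod (X a - c)) (cmod (X b - c))"
    and inner: "\<And>a b. a \<in> S \<Longrightarrow> b \<in> S \<Longrightarrow> j a > 0 \<Longrightarrow> j b > 0 \<Longrightarrow>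
      sep (int (j a)) (int (j b)) (cmod (X a - X p)) (cmod (X b - X p))"
    and inner_center: "\<And>a. a \<in> S \<Longrightarrow> j a > 0 \<Longrightarrow> 512 * 2 ^ j a * cmod (X a - X p) \<le> cmod (X p - c)"
    and inner_outer: "\<And>a b. a \<in> S \<Longrightarrow> b \<in> S \<Longrightarrow> j a > 0 \<Longrightarrow> j b = 0 \<Longrightarrow> b \<noteq> p \<Longrightarrow>
      512 * 2 ^ j a * cmod (X a - X p) \<le> cmod (X b - X p)"
begin

abbreviation "Y \<equiv> rotY c \<sigma> p j X"

lemma diff_form_outer:
  assumes a: "a \<in> S" "j a = 0" and b: "b \<in> S" "j b = 0" and ab: "a \<noteq> b"
    and l: "X a \<noteq> c \<Longrightarrow> X b \<noteq> c \<Longrightarrow> \<sigma> a = \<sigma> b \<Longrightarrow> l \<le> 2 powi \<sigma> a * cmod (X a - X b)"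
      "X b \<noteq> c \<Longrightarrow> X a = c \<or> \<sigma> b < \<sigma> a \<Longrightarrow> l \<le> 2 powi \<sigma> b * cmod (X b - c)"
      "X a \<noteq> c \<Longrightarrow> X b = c \<or> \<sigma> a < \<sigma> b \<Longrightarrow> l \<le> 2 powi \<sigma> a * cmod (X a - c)"
  shows "diff_form (\<lambda>u. Y u a - Y u b) l"
proof -
  have Xab: "X a \<noteq> X b" using inj ab a b by (auto simp: inj_on_def)
  have eq: "Y u a - Y u b = u powi \<sigma> a * (X a - c) - u powi \<sigma> b * (X b - c)" for u
    using a b by (simp add: rotY_def)
  show ?thesis
  proof (cases "X a = c \<or> X b = c")
    case True
    then show ?thesis
    proof
      assume "X a = c"
      then show ?thesis unfolding eq using l(2) Xab
        by (intro diff_form_exact[of "c - X b" l "\<sigma> b"]) (auto simp: norm_minus_commute algebra_simps)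
    next
      assume "X b = c"
      then show ?thesis unfolding eq using l(3) Xab
        by (intro diff_form_exact[of "X a - c" l "\<sigma> a"]) auto
    qed
  next
    case False
    then show ?thesis unfolding eq
      using outer[of a b] a b l Xab by (intro diff_form_sep) auto
  qed
qed

text \<open>The three monomials belong to the vectors from \<open>c\<close> to \<open>p\<close>,
  from \<open>p\<close> to \<open>a\<close> and from \<open>c\<close> to \<open>b\<close>. For
  \<open>b = p\<close> only the second survives; otherwise the dominant one depends on whether
  \<open>b\<close> turns together with \<open>p\<close>, nearer to \<open>c\<close>, or farther
  out.\<close>

lemma diff_form_inner_outer:
  assumes a: "a \<in> S" "j a > 0" and b: "b \<in> S" "j b = 0"
  shows "\<exists>l. diff_form (\<lambda>u. Y u a - Y u b) l"
proof -
  define y where "y = X a - X p"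
  have ap: "a \<noteq> p" using a p by auto
  have y0: "y \<noteq> 0" using inj ap a p by (auto simp: y_def inj_on_def)
  have eq: "Y u a - Y u b = u powi \<sigma> p * (X p - c) + u powi \<sigma> p * u ^ j a * y - u powi \<sigma> b * (X b - c)" for u
    using a b by (simp add: rotY_def y_def algebra_simps)
  have center: "512 * 2 ^ j a * cmod y \<le> cmod (X p - c)" using inner_center a by (simp add: y_def)
  have pc: "X p - c \<noteq> 0" using p by simp
  show ?thesis
  proof (cases "b = p")
    case True
    show ?thesis
      by (rule exI[of _ 0], rule diff_formI[of y 0 "\<sigma> p + int (j a)" 0 0 0 0])
        (use y0 eq[unfolded True] in \<open>auto simp: power_int_add True\<close>)
  next
    case False
    show ?thesis
    proof (cases "X b = c")
      case True
      show ?thesis using diff_form_add_power[OF center pc, of "\<sigma> p"]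
        by (intro exI[of _ 0]) (simp add: eq True algebra_simps)
    next
      case bc: False
      consider "\<sigma> b = \<sigma> p" | "\<sigma> p < \<sigma> b" "512 * 2 ^ nat (\<sigma> b - \<sigma> p) * cmod (X b - c) \<le> cmod (X p - c)"
        | "\<sigma> b < \<sigma> p" "512 * 2 ^ nat (\<sigma> p - \<sigma> b) * cmod (X p - c) \<le> cmod (X b - c)"
        using outer[of b p] p b bc unfolding sep_def by auto
      then show ?thesis
      proof cases
        case 1
        have Xb: "X b \<noteq> X p" using inj False b p by (auto simp: inj_on_def)
        have "512 * 2 ^ j a * cmod y \<le> cmod (X p - X b)"
          using inner_outer[of a b] a b False by (simp add: y_def norm_minus_commute)
        from diff_form_add_power[OF this, of "\<sigma> p"] Xb show ?thesis
          by (intro exI[of _ 0]) (simp add: eq 1 algebra_simps)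
      next
        case 2
        show ?thesis
        proof (rule exI[of _ 0], rule diff_formI[of "X p - c" 0 "\<sigma> p" "y / (X p - c)" "j a"
              "- ((X b - c) / (X p - c))" "nat (\<sigma> b - \<sigma> p)"])
          fix u :: complex assume u: "u \<noteq> 0"
          show "Y u a - Y u b = u powi \<sigma> p * (X p - c)
              * (1 + y / (X p - c) * u ^ j a + - ((X b - c) / (X p - c)) * u ^ nat (\<sigma> b - \<sigma> p))"
            unfolding eq powi_eq_mult_power[OF u less_imp_le[OF 2(1)]] lead_factor[OF pc]
            by (simp add: algebra_simps)
        qed (use pc small_ratio(1)[OF center pc] small_ratio(2)[OF 2(2) pc] in auto)
      next
        \<comment> \<open>Here \<open>b\<close> is farther out than \<open>p\<close> and dominates;
          the vector from \<open>p\<close> to \<open>a\<close> is subordinate to that of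
          \<open>p\<close>, hence its exponent \<open>?n + j a\<close>.\<close>
        case 3
        have bc': "X b - c \<noteq> 0" using bc by simp
        let ?n = "nat (\<sigma> p - \<sigma> b)"
        have "512 * 2 ^ (?n + j a) * cmod y \<le> 2 ^ ?n * cmod (X p - c)"
          using mult_left_mono[OF center, of "2 ^ ?n"] by (simp add: power_add mult_ac)
        also have "\<dots> \<le> cmod (X b - c)"
        proof -
          have "0 \<le> 2 ^ ?n * cmod (X p - c)" by simp
          then show ?thesis using 3(2) unfolding mult.assoc by linarith
        qed
        finally have s: "512 * 2 ^ (?n + j a) * cmod y \<le> cmod (X b - c)" .
        show ?thesis
        proof (rule exI[of _ 0], rule diff_formI[of "- (X b - c)" 0 "\<sigma> b" "- ((X p - c) / (X b - c))" ?n
              "- (y / (X b - c))" "?n + j a"])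
          fix u :: complex assume u: "u \<noteq> 0"
          show "Y u a - Y u b = u powi \<sigma> b * - (X b - c)
              * (1 + - ((X p - c) / (X b - c)) * u ^ ?n + - (y / (X b - c)) * u ^ (?n + j a))"
            unfolding eq powi_eq_mult_power[OF u less_imp_le[OF 3(1)]] lead_factor[OF bc']
            by (simp add: algebra_simps power_add)
        qed (use bc' small_ratio(2)[OF 3(2) bc'] small_ratio(2)[OF s bc'] in auto)
      qed
    qed
  qed
qed

lemma diff_form_inner:
  assumes a: "a \<in> S" "j a > 0" and b: "b \<in> S" "j b > 0" and ab: "a \<noteq> b"
  shows "\<exists>l. diff_form (\<lambda>u. Y u a - Y u b) l"
proof -
  have ne: "X a \<noteq> X p" "X b \<noteq> X p" "X a \<noteq> X b" using inj a b p ab by (auto simp: inj_on_def)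
  have eq: "Y u a - Y u b = u powi \<sigma> p * (u ^ j a * (X a - X p) - u ^ j b * (X b - X p))" for u
    using a b by (simp add: rotY_def algebra_simps)
  define m where "m = min (2 powi (\<sigma> p + int (j a)) * cmod (X a - X b))
     (min (2 powi (\<sigma> p + int (j b)) * cmod (X b - X p)) (2 powi (\<sigma> p + int (j a)) * cmod (X a - X p)))"
  have "sep (\<sigma> p + int (j a)) (\<sigma> p + int (j b)) (cmod (X a - X p)) (cmod (X b - X p))"
    using inner[OF a(1) b(1) a(2) b(2)] unfolding sep_def by simp
  then have "diff_form (\<lambda>u. u powi (\<sigma> p + int (j a)) * (X a - X p) - u powi (\<sigma> p + int (j b)) * (X b - X p)) m"
    using ne by (intro diff_form_sep) (auto simp: m_def)
  then obtain k L c1 n1 c2 n2 where *: "L \<noteq> 0" "m \<le> 2 powi k * cmod L"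
    "cmod c1 * 2 ^ n1 \<le> 1 / 512" "cmod c2 * 2 ^ n2 \<le> 1 / 512"
    "\<And>u. u \<noteq> 0 \<Longrightarrow> u powi (\<sigma> p + int (j a)) * (X a - X p) - u powi (\<sigma> p + int (j b)) * (X b - X p)
       = u powi k * L * (1 + c1 * u ^ n1 + c2 * u ^ n2)"
    unfolding diff_form_def by metis
  have "Y u a - Y u b = u powi k * L * (1 + c1 * u ^ n1 + c2 * u ^ n2)" if "u \<noteq> 0" for u
    using *(5)[OF that] that unfolding eq by (simp add: power_int_add algebra_simps)
  then show ?thesis using * by (intro exI[of _ m] diff_formI[of L m k c1 n1 c2 n2]) auto
qed

text \<open>Pairs without \<open>p\<close> enter later only through moduli relative to their initial
  value, so the lower bound may stay existential.\<close>

lemma diff_form_pair: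
  assumes "a \<in> S" "b \<in> S" "a \<noteq> b"
  shows "\<exists>l. diff_form (\<lambda>u. Y u a - Y u b) l"
proof -
  consider "j a = 0" "j b = 0" | "j a > 0" "j b = 0" | "j a = 0" "j b > 0" | "j a > 0" "j b > 0"
    by auto
  then show ?thesis
  proof cases
    case 1
    let ?l = "min (2 powi \<sigma> a * cmod (X a - X b)) (min (2 powi \<sigma> b * cmod (X b - c)) (2 powi \<sigma> a * cmod (X a - c)))"
    show ?thesis using assms 1 by (intro exI[of _ ?l] diff_form_outer) auto
  next
    case 2
    then show ?thesis using diff_form_inner_outer assms by blast
  next
    case 3
    then show ?thesis using diff_form_inner_outer[of b a] assms
        diff_form_minus[of "\<lambda>u. Y u b - Y u a"] by auto
  next
    case 4
    then show ?thesis using diff_form_inner assms by blast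
  qed
qed

lemma diff_form_star:
  assumes a: "a \<in> S" "a \<noteq> p"
    and l: "l \<le> 2 powi \<sigma> p * cmod (X p - c)" "l \<le> 2 powi \<sigma> p * 2 ^ j a * cmod (X a - X p)"
  shows "diff_form (\<lambda>u. Y u a - Y u p) l"
proof (cases "j a = 0")
  case True
  show ?thesis
  proof (rule diff_form_outer[OF a(1) True p(1,2) a(2)])
    \<comment> \<open>Since \<open>a\<close> is farther from \<open>c\<close> than \<open>p\<close>,
      its term dominates; the separation shows that it exceeds the lifted distance of
      \<open>p\<close>, which bounds \<open>l\<close>.\<close>
    assume "X a \<noteq> c" "X p = c \<or> \<sigma> a < \<sigma> p"
    then have *: "\<sigma> a < \<sigma> p" "512 * 2 ^ nat (\<sigma> p - \<sigma> a) * cmod (X p - c) \<le> cmod (X a - c)"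
      using outer[of a p] p a True unfolding sep_def by auto
    have "2 powi \<sigma> p = 2 powi \<sigma> a * (2::real) ^ nat (\<sigma> p - \<sigma> a)"
      using *(1) by (simp flip: power_int_of_nat power_int_add)
    then have "2 powi \<sigma> p * cmod (X p - c) \<le> 2 powi \<sigma> a * (512 * 2 ^ nat (\<sigma> p - \<sigma> a) * cmod (X p - c))"
      by simp
    also have "\<dots> \<le> 2 powi \<sigma> a * cmod (X a - c)" using *(2) by (intro mult_left_mono) auto
    finally show "l \<le> 2 powi \<sigma> a * cmod (X a - c)" using l(1) by simp
  qed (use l True p in auto)
next
  case False
  have "X a \<noteq> X p" using inj a p by (auto simp: inj_on_def)
  then show ?thesis using False l p
    by (intro diff_formI[of "X a - X p" l "\<sigma> p + int (j a)" 0 0 0 0])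
      (auto simp: rotY_def power_int_add algebra_simps)
qed

end

section \<open>Configurations of points and their cluster rotations\<close>

abbreviation config_measure :: "'i set \<Rightarrow> ('i \<Rightarrow> complex) measure" where
  "config_measure I \<equiv> PiM I (\<lambda>_. lborel)"

definition pos :: "('j \<Rightarrow> complex) \<Rightarrow> ('i \<Rightarrow> complex) \<Rightarrow> 'i + 'j \<Rightarrow> complex" where
  "pos z x a = case_sum x z a"

lemma pos_simps [simp]: "pos z x (Inl q) = x q" "pos z x (Inr l) = z l"
  by (simp_all add: pos_def)

definition rot_config :: "'i set \<Rightarrow> ('j \<Rightarrow> complex) \<Rightarrow> complex \<Rightarrow> ('i + 'j \<Rightarrow> int) \<Rightarrow> 'i + 'j
    \<Rightarrow> ('i + 'j \<Rightarrow> nat) \<Rightarrow> complex \<Rightarrow> ('i \<Rightarrow> complex) \<Rightarrow> 'i \<Rightarrow> complex" where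
  "rot_config I z c \<sigma> p j u x = (\<lambda>q\<in>I. rotY c \<sigma> p j (pos z x) u (Inl q))"

text \<open>One coordinate is moved at a time, each step being a rotation plus a shift that depends
  on other coordinates. The center \<open>p\<close> moves last, because the turns about it refer to
  its original position.\<close>

lemma measure_preserving_rot_config:
  fixes I :: "'i set"
  assumes I: "finite I" and p: "p \<in> Inl ` I \<or> p \<in> range Inr" and j: "j p = 0" and u: "cmod u = 1"
  shows "measure_preserving (config_measure I) (rot_config I z c \<sigma> p j u)"
proof -
  define T where "T Q x = (\<lambda>q\<in>I. if q \<in> Q then rotY c \<sigma> p j (pos z x) u (Inl q) else x q)" for Q and x :: "'i \<Rightarrow> complex"
  define v h where "v q = (if j (Inl q) = 0 then u powi \<sigma> (Inl q) else u powi \<sigma> p * u ^ j (Inl q))"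
    and "h q x = (if j (Inl q) = 0 then c - u powi \<sigma> (Inl q) * c
       else c + u powi \<sigma> p * (pos z x p - c - u ^ j (Inl q) * pos z x p))"
    for q and x :: "'i \<Rightarrow> complex"
  have v: "cmod (v q) = 1" for q
    using u by (simp add: v_def norm_mult norm_power norm_power_int)
  have pm: "(\<lambda>x. pos z x p) \<in> borel_measurable (config_measure I)"
    using p by (auto simp: pos_def)
  have hm: "h q \<in> borel_measurable (config_measure I)" for q
    unfolding h_def using pm by (cases "j (Inl q) = 0") simp_all
  have hq: "h q (x(q := y)) = h q x" for q x y
    using j by (cases p) (auto simp: h_def pos_def)
  have step_mp: "measure_preserving (config_measure I) (\<lambda>x. x(q := v q * x q + h q x))" if "q \<in> I" for q
    by (rule measure_preserving_PiM_rotate_shift[OF I that v hm hq])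
  have step: "measure_preserving (config_measure I) (T (insert q Q))"
    if "measure_preserving (config_measure I) (T Q)" "q \<in> I" "q \<notin> Q" "p \<notin> Inl ` Q" for q Q
  proof (rule measure_preserving_cong[OF _ measure_preserving_comp[OF step_mp[OF that(2)] that(1)]])
    fix x assume "x \<in> space (config_measure I)"
    have pp: "pos z (T Q x) p = pos z x p"
      using that(4) p by (cases p) (auto simp: T_def)
    show "(T Q x)(q := v q * T Q x q + h q (T Q x)) = T (insert q Q) x"
    proof
      fix q'
      show "((T Q x)(q := v q * T Q x q + h q (T Q x))) q' = T (insert q Q) x q'"
      proof (cases "q' = q")
        case True
        have "T Q x q = x q" "T (insert q Q) x q = rotY c \<sigma> p j (pos z x) u (Inl q)"
          using that(2,3) by (simp_all add: T_def)
        moreover have "h q (T Q x) = h q x" unfolding h_def pp ..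
        ultimately show ?thesis using True
          by (simp add: h_def v_def rotY_def algebra_simps)
      next
        case False
        then show ?thesis by (auto simp: T_def)
      qed
    qed
  qed
  have base: "measure_preserving (config_measure I) (T {})"
  proof (rule measure_preserving_cong)
    show "measure_preserving (config_measure I) (\<lambda>x. x)"
      by (simp add: measure_preserving_def distr_id)
    show "x = T {} x" if "x \<in> space (config_measure I)" for x
      using that by (auto simp: T_def space_PiM fun_eq_iff PiE_def extensional_def)
  qed
  have *: "finite Q \<Longrightarrow> Q \<subseteq> I \<Longrightarrow> p \<notin> Inl ` Q \<Longrightarrow> measure_preserving (config_measure I) (T Q)" for Q
    by (induction Q rule: finite_induct) (auto intro: base step)
  have "measure_preserving (config_measure I) (T I)"
  proof (cases p)
    case (Inl q0)
    with p have q0: "q0 \<in> I" by auto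
    have "measure_preserving (config_measure I) (T (insert q0 (I - {q0})))"
      using I Inl q0 by (intro step *) auto
    then show ?thesis using q0 by (simp add: insert_absorb)
  qed (use * I in auto)
  then show ?thesis
    by (rule measure_preserving_cong[rotated]) (auto simp: T_def rot_config_def fun_eq_iff)
qed

lemma measurable_rot_config:
  assumes "p \<in> Inl ` I \<or> p \<in> range Inr"
    and [measurable]: "w \<in> borel_measurable M" "g \<in> measurable M (config_measure I)"
    and w: "\<And>t. w t \<noteq> 0"
  shows "(\<lambda>t. rot_config I z c \<sigma> p j (w t) (g t)) \<in> measurable M (config_measure I)"
proof -
  have pm [measurable]: "(\<lambda>t. pos z (g t) p) \<in> borel_measurable M"
    using assms(1) by (auto simp: pos_def intro: measurable_compose[OF assms(3)])
  have wm [measurable]: "(\<lambda>t. w t powi k) \<in> borel_measurable M" for k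
    by (cases "k \<ge> 0") (auto simp: power_int_def)
  show ?thesis unfolding rot_config_def
  proof (rule measurable_restrict)
    fix q assume q: "q \<in> I"
    have [measurable]: "(\<lambda>t. g t q) \<in> borel_measurable M"
      using measurable_compose[OF assms(3) measurable_component_singleton[OF q]] by simp
    show "(\<lambda>t. rotY c \<sigma> p j (pos z (g t)) (w t) (Inl q)) \<in> measurable M lborel"
      by (cases "j (Inl q) = 0") (auto simp: rotY_def)
  qed
qed

lemma wt_cong: "(\<And>b. b \<in> S \<Longrightarrow> l b = l' b) \<Longrightarrow> wt l S t = wt l' S t"
  by (simp add: wt_def cong: Collect_cong)

text \<open>Where the center lies: close to a fixed point, beyond all of them, or neither. Only in
  the first two cases must the position of the center itself be lifted.\<close>

datatype 'j zone = Bulk | Near 'j | Far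

text \<open>
  The point \<open>p\<close> is the center of a singularity. Near infinity, or near some other \<open>z l\<close>, the clusters
  of points at scales above the distance of \<open>p\<close> rotate about \<open>z l\<close> (about \<open>z j1\<close> in the case of
  infinity), and the clusters at smaller scales rotate about \<open>p\<close>.
\<close>

locale star_config =
  fixes I :: "'i set" and J :: "'j set" and z :: "'j \<Rightarrow> complex" and j1 :: 'j
    and \<delta> R :: real and p :: "'i + 'j"
  assumes finite_I: "finite I" and finite_J: "finite J" and j1: "j1 \<in> J"
    and \<delta>: "\<delta> > 0" and \<delta>_sep: "\<And>l m. l \<in> J \<Longrightarrow> m \<in> J \<Longrightarrow> l \<noteq> m \<Longrightarrow> 4 * \<delta> < cmod (z l - z m)"
    and \<delta>R: "2 * \<delta> \<le> R" and R: "\<And>l. l \<in> J \<Longrightarrow> 2 * cmod (z l - z j1) < R"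
    and p: "p \<in> Inl ` I \<union> Inr ` J"
begin

abbreviation "Pts \<equiv> Inl ` I \<union> Inr ` J"

text \<open>Coincidences are excluded pointwise rather than almost everywhere; the Coulomb weight
  takes the value 0 there.\<close>

definition Dst :: "('i \<Rightarrow> complex) set" where
  "Dst = {x \<in> space (config_measure I). inj_on (pos z x) Pts}"

text \<open>In the bulk nothing turns about this point; it only has to be at distance at least
  \<open>\<delta>\<close> from \<open>p\<close>, hence the artificial choice
  \<open>z k + \<delta>\<close> when \<open>p\<close> is the fixed point \<open>z k\<close>.\<close>

definition ctr :: "'j zone \<Rightarrow> complex" where
  "ctr Z = (case Z of Bulk \<Rightarrow> (case p of Inl _ \<Rightarrow> z j1 | Inr k \<Rightarrow> z k + of_real \<delta>) | Near l \<Rightarrow> z l | Far \<Rightarrow> z j1)"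

definition in_zone :: "'j zone \<Rightarrow> ('i \<Rightarrow> complex) \<Rightarrow> bool" where
  "in_zone Z x \<longleftrightarrow> (case Z of
      Bulk \<Rightarrow> (\<forall>l\<in>J. Inr l \<noteq> p \<longrightarrow> \<delta> \<le> cmod (pos z x p - z l)) \<and> (isl p \<longrightarrow> cmod (pos z x p - z j1) \<le> R)
    | Near l \<Rightarrow> isl p \<and> l \<in> J \<and> cmod (pos z x p - z l) < \<delta>
    | Far \<Rightarrow> isl p \<and> R < cmod (pos z x p - z j1))"

definition rho :: "'j zone \<Rightarrow> ('i \<Rightarrow> complex) \<Rightarrow> real" where
  "rho Z x = (if Z = Bulk then \<delta> else cmod (pos z x p - ctr Z))"

definition rin :: "('i \<Rightarrow> complex) \<Rightarrow> 'i + 'j \<Rightarrow> real" where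
  "rin x a = cmod (pos z x a - pos z x p)"

text \<open>The factor 1 / 4 leaves every fixed point at level 0, as its distance from
  \<open>p\<close> is at least \<open>rho / 4\<close> in each zone unless it is \<open>p\<close>
  itself; so the insertions do not move.\<close>

definition lin :: "'j zone \<Rightarrow> ('i \<Rightarrow> complex) \<Rightarrow> 'i + 'j \<Rightarrow> nat" where
  "lin Z x a = lev (rho Z x / 4 / rin x a)"

definition jn :: "'j zone \<Rightarrow> ('i \<Rightarrow> complex) \<Rightarrow> 'i + 'j \<Rightarrow> nat" where
  "jn Z x a = wt (lin Z x) Pts (lin Z x a)"

text \<open>The value 0 produces level 0 through \<open>d / 0 = 0\<close>: nothing turns about
  \<open>ctr\<close> in the bulk, and inner points do not block outer scales. Near infinity inverse
  distances are used, so that far away means small.\<close>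

definition rout :: "'j zone \<Rightarrow> ('i \<Rightarrow> complex) \<Rightarrow> 'i + 'j \<Rightarrow> real" where
  "rout Z x a = (if Z = Bulk \<or> jn Z x a \<noteq> 0 then 0
     else if Z = Far then inverse (cmod (pos z x a - ctr Z)) else cmod (pos z x a - ctr Z))"

definition dout :: "'j zone \<Rightarrow> real" where
  "dout Z = (if Z = Far then 1 / R else \<delta>)"

definition lou :: "'j zone \<Rightarrow> ('i \<Rightarrow> complex) \<Rightarrow> 'i + 'j \<Rightarrow> nat" where
  "lou Z x a = lev (dout Z / rout Z x a)"

text \<open>Near infinity a point is lifted by shrinking its distance, hence the negative
  exponents.\<close>

definition zsgn :: "'j zone \<Rightarrow> int" where
  "zsgn Z = (if Z = Far then - 1 else 1)"

definition sig :: "'j zone \<Rightarrow> ('i \<Rightarrow> complex) \<Rightarrow> 'i + 'j \<Rightarrow> int" where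
  "sig Z x a = zsgn Z * int (wt (lou Z x) Pts (lou Z x a))"

definition zones :: "'j zone set" where
  "zones = insert Bulk (insert Far (Near ` J))"

lemma finite_Pts: "finite Pts"
  using finite_I finite_J by simp

lemma R_pos: "R > 0"
  using \<delta> \<delta>R by linarith

lemma zone_exists:
  assumes "x \<in> Dst"
  shows "\<exists>Z\<in>zones. in_zone Z x"
proof (cases p)
  case (Inl q)
  show ?thesis
  proof (cases "\<exists>l\<in>J. cmod (pos z x p - z l) < \<delta>")
    case True
    then show ?thesis unfolding in_zone_def zones_def using Inl by auto
  next
    case False
    then show ?thesis unfolding in_zone_def zones_def using Inl
      by (cases "R < cmod (pos z x p - z j1)") (auto simp: not_less)
  qed
next
  case (Inr k)
  have "\<delta> \<le> cmod (z k - z l)" if "l \<in> J" "l \<noteq> k" for l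
    using \<delta>_sep[of k l] that Inr p \<delta> by auto
  then show ?thesis unfolding in_zone_def zones_def using Inr by auto
qed

text \<open>Balls of radius \<open>\<delta>\<close> about the fixed points are disjoint by the
  separation \<open>4 * \<delta>\<close>, and they lie within \<open>R\<close> of
  \<open>z j1\<close>, because \<open>2 * \<delta> \<le> R\<close> and fixed points lie within
  \<open>R / 2\<close> of it.\<close>

lemma zone_unique:
  assumes "in_zone Z x" "in_zone Z' x"
  shows "Z = Z'"
proof -
  have 1: "l = m" if "l \<in> J" "m \<in> J" "cmod (w - z l) < \<delta>" "cmod (w - z m) < \<delta>" for l m w
  proof (rule ccontr)
    assume "l \<noteq> m"
    then have "4 * \<delta> < cmod (z l - z m)" using \<delta>_sep that by blast
    also have "\<dots> \<le> cmod (w - z m) + cmod (w - z l)"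
      using norm_triangle_ineq4[of "w - z m" "w - z l"] by simp
    finally show False using that \<delta> by linarith
  qed
  have 2: "cmod (w - z j1) \<le> R" if "l \<in> J" "cmod (w - z l) < \<delta>" for l w
    using norm_triangle_ineq[of "w - z l" "z l - z j1"] R[OF that(1)] that(2) \<delta>R by simp
  define w where "w = pos z x p"
  have zB: "(\<forall>l\<in>J. Inr l \<noteq> p \<longrightarrow> \<delta> \<le> cmod (w - z l)) \<and> (isl p \<longrightarrow> cmod (w - z j1) \<le> R)"
    if "in_zone Bulk x" using that unfolding in_zone_def w_def by simp
  have zN: "isl p \<and> l \<in> J \<and> cmod (w - z l) < \<delta>" if "in_zone (Near l) x" for l
    using that unfolding in_zone_def w_def by simp
  have zF: "isl p \<and> R < cmod (w - z j1)" if "in_zone Far x"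
    using that unfolding in_zone_def w_def by simp
  have BN: False if "in_zone Bulk x" "in_zone (Near l) x" for l
    using zB[OF that(1)] zN[OF that(2)] by (metis isl_def not_less sum.disc(2))
  have BF: False if "in_zone Bulk x" "in_zone Far x"
    using zB[OF that(1)] zF[OF that(2)] by linarith
  have NF: False if "in_zone (Near l) x" "in_zone Far x" for l
    using 2[of l w] zN[OF that(1)] zF[OF that(2)] by linarith
  have NN: "l = m" if "in_zone (Near l) x" "in_zone (Near m) x" for l m
    using 1[of l m w] zN[OF that(1)] zN[OF that(2)] by blast
  show ?thesis using assms BN BF NF NN by (cases Z; cases Z') blast+
qed

lemma finite_zones: "finite zones"
  using finite_J by (simp add: zones_def)

lemma in_zones: "in_zone Z x \<Longrightarrow> Z \<in> zones"
  by (cases Z) (auto simp: in_zone_def zones_def)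

lemma rin_center [simp]: "rin x p = 0"
  by (simp add: rin_def)

lemma lin_center [simp]: "lin Z x p = 0"
  by (simp add: lin_def lev_eq_0)

lemma jn_center [simp]: "jn Z x p = 0"
  by (simp add: jn_def)

context
  fixes Z :: "'j zone" and x :: "'i \<Rightarrow> complex"
  assumes x: "x \<in> Dst" and Z: "in_zone Z x"
begin

lemma inj_pos: "inj_on (pos z x) Pts"
  using x by (simp add: Dst_def)

lemma center_ne: "pos z x p \<noteq> ctr Z"
proof (cases Z)
  case Bulk
  then show ?thesis using Z \<delta> j1 unfolding in_zone_def ctr_def by (cases p) auto
next
  case (Near l)
  then have "l \<in> J" "isl p" using Z by (auto simp: in_zone_def)
  then have "Inr l \<in> Pts" "p \<noteq> Inr l" by auto
  then have "pos z x p \<noteq> pos z x (Inr l)" using inj_onD[OF inj_pos _ p] by metis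
  then show ?thesis by (simp add: Near ctr_def)
next
  case Far
  then show ?thesis using Z R_pos by (auto simp: in_zone_def ctr_def)
qed

lemma rho_bounds: "rho Z x > 0" "rho Z x \<le> cmod (pos z x p - ctr Z)"
proof -
  show "rho Z x > 0" using center_ne \<delta> by (simp add: rho_def)
  show "rho Z x \<le> cmod (pos z x p - ctr Z)"
    using Z j1 \<delta> unfolding rho_def in_zone_def ctr_def by (cases p; cases Z) auto
qed

interpretation wi: weights Pts "rin x" "rho Z x / 4"
  using finite_Pts rho_bounds by unfold_locales auto

interpretation wo: weights Pts "rout Z x" "dout Z"
  using finite_Pts \<delta> R_pos by unfold_locales (auto simp: dout_def)

lemma jn_weight: "jn Z x a = wi.weight a"
  by (simp add: jn_def lin_def[abs_def])

lemma lou_weight: "wt (lou Z x) Pts (lou Z x a) = wo.weight a"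
  by (simp add: lou_def[abs_def])

lemma rin_pos: "a \<in> Pts \<Longrightarrow> a \<noteq> p \<Longrightarrow> rin x a > 0"
  using inj_onD[OF inj_pos _ _ p, of a] by (auto simp: rin_def)

lemma lin_0: "rin x a \<ge> rho Z x / 4 \<Longrightarrow> lin Z x a = 0"
proof -
  assume *: "rin x a \<ge> rho Z x / 4"
  then have "rin x a > 0" using rho_bounds(1) by linarith
  then have "rho Z x / 4 / rin x a \<le> 1" "0 \<le> rho Z x / 4 / rin x a"
    using * rho_bounds(1) by (simp_all only: divide_le_eq_1 zero_le_divide_iff) auto
  then show ?thesis unfolding lin_def by (intro lev_eq_0) auto
qed

lemma lin_Inr: "l \<in> J \<Longrightarrow> lin Z x (Inr l) = 0"
proof -
  assume l: "l \<in> J"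
  show ?thesis
  proof (cases "Inr l = p")
    case False
    have "rho Z x / 4 \<le> rin x (Inr l)"
    proof (cases Z)
      case Bulk
      then show ?thesis using Z l False \<delta>
        by (auto simp: rin_def rho_def in_zone_def norm_minus_commute)
    next
      case (Near m)
      then have m: "m \<in> J" "cmod (pos z x p - z m) < \<delta>" using Z by (auto simp: in_zone_def)
      show ?thesis
      proof (cases "l = m")
        case False
        then have "4 * \<delta> < cmod (z l - z m)" using \<delta>_sep l m by blast
        then show ?thesis using m Near norm_triangle_ineq[of "z l - pos z x p" "pos z x p - z m"]
          using \<delta> by (simp add: rho_def ctr_def rin_def)
      qed (simp add: Near rho_def ctr_def rin_def norm_minus_commute)
    next
      case Far
      then have "R < cmod (pos z x p - z j1)" using Z by (auto simp: in_zone_def)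
      then show ?thesis using R[OF l] Far R_pos norm_triangle_ineq[of "pos z x p - z l" "z l - z j1"]
        by (simp add: rho_def ctr_def rin_def norm_minus_commute)
    qed
    then show ?thesis by (rule lin_0)
  qed (metis lin_center)
qed

lemma jn_Inr: "l \<in> J \<Longrightarrow> jn Z x (Inr l) = 0"
  by (simp add: jn_def lin_Inr)

text \<open>Fixed points sit at macroscopic distance from \<open>ctr\<close>: more than
  \<open>4 * \<delta>\<close> apart from each other, and within \<open>R / 2\<close> of
  \<open>z j1\<close>. The one that is \<open>ctr\<close> has distance 0, hence level 0 as
  well.\<close>

lemma lou_Inr: "l \<in> J \<Longrightarrow> lou Z x (Inr l) = 0"
proof -
  assume l: "l \<in> J"
  have "dout Z / rout Z x (Inr l) < 2"
  proof (cases Z)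
    case (Near m)
    then have m: "m \<in> J" using Z by (auto simp: in_zone_def)
    show ?thesis
    proof (cases "l = m")
      case False
      then have "4 * \<delta> < cmod (z l - z m)" using \<delta>_sep l m by blast
      then have "\<delta> / cmod (z l - z m) < 2" using \<delta> by (subst divide_less_eq) auto
      then show ?thesis using Near jn_Inr[OF l] by (simp add: dout_def rout_def ctr_def)
    qed (simp add: Near dout_def rout_def ctr_def)
  next
    case Far
    then show ?thesis using R[OF l] R_pos jn_Inr[OF l] by (simp add: dout_def rout_def ctr_def field_simps)
  qed (simp add: rout_def)
  moreover have "dout Z / rout Z x (Inr l) \<ge> 0"
    using \<delta> R_pos by (simp add: dout_def rout_def)
  ultimately show ?thesis unfolding lou_def by (intro lev_eq_0) auto
qed

lemma sig_Inr: "l \<in> J \<Longrightarrow> sig Z x (Inr l) = 0"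
  by (simp add: sig_def lou_Inr)

lemma sig_Bulk: "Z = Bulk \<Longrightarrow> sig Z x a = 0"
  by (simp add: sig_def lou_def rout_def lev_eq_0)

lemma rotation: "rotation Pts (pos z x) (ctr Z) (sig Z x) p (jn Z x)"
proof
  fix a b assume ab: "a \<in> Pts" "b \<in> Pts" and j: "jn Z x a = 0" "jn Z x b = 0"
    and ne: "pos z x a \<noteq> ctr Z" "pos z x b \<noteq> ctr Z"
  show "sep (sig Z x a) (sig Z x b) (cmod (pos z x a - ctr Z)) (cmod (pos z x b - ctr Z))"
  proof (cases "Z = Bulk")
    case True
    then show ?thesis unfolding sig_Bulk[OF True] by (simp add: sep_def)
  next
    case False
    have "rout Z x a > 0" "rout Z x b > 0" using False j ne by (auto simp: rout_def)
    note sep = wo.weight_sep[OF ab this]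
    have sep': "sep (int (wt (lou Z x) Pts (lou Z x a))) (int (wt (lou Z x) Pts (lou Z x b))) (rout Z x a) (rout Z x b)"
      using sep unfolding lou_weight .
    show ?thesis
    proof (cases "Z = Far")
      case True
      \<comment> \<open>Weights near infinity were computed from inverse distances; passing to
        distances reverses the order and thus the sign of the exponents.\<close>
      have "sep (- int (wt (lou Z x) Pts (lou Z x a))) (- int (wt (lou Z x) Pts (lou Z x b)))
          (cmod (pos z x a - ctr Z)) (cmod (pos z x b - ctr Z))"
        by (rule sep_minus_inverse) (use sep' True False j ne in \<open>simp_all add: rout_def inverse_eq_divide\<close>)
      then show ?thesis unfolding sig_def zsgn_def using True by simp
    next
      case False
      then show ?thesis using sep' \<open>Z \<noteq> Bulk\<close> j unfolding sig_def zsgn_def by (simp add: rout_def)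
    qed
  qed
next
  fix a b assume ab: "a \<in> Pts" "b \<in> Pts" and j: "jn Z x a > 0" "jn Z x b > 0"
  then have "rin x a > 0" "rin x b > 0" using rin_pos by (metis jn_center less_irrefl)+
  from wi.weight_sep[OF ab this]
  show "sep (int (jn Z x a)) (int (jn Z x b)) (cmod (pos z x a - pos z x p)) (cmod (pos z x b - pos z x p))"
    by (simp add: jn_weight rin_def)
next
  fix a assume a: "a \<in> Pts" and j: "jn Z x a > 0"
  then have "rin x a > 0" using rin_pos by (metis jn_center less_irrefl)
  from wi.weight_upper[OF a this] j rho_bounds
  show "512 * 2 ^ jn Z x a * cmod (pos z x a - pos z x p) \<le> cmod (pos z x p - ctr Z)"
    unfolding jn_weight rin_def[symmetric] by linarith
  fix b assume b: "b \<in> Pts" and jb: "jn Z x b = 0" and bp: "b \<noteq> p"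
  from wi.weight_sep[OF a b \<open>rin x a > 0\<close> rin_pos[OF b bp]] j jb
  show "512 * 2 ^ jn Z x a * cmod (pos z x a - pos z x p) \<le> cmod (pos z x b - pos z x p)"
    unfolding jn_weight by (auto simp: sep_def rin_def)
qed (use p inj_pos center_ne in auto)

abbreviation "Yc \<equiv> rotY (ctr Z) (sig Z x) p (jn Z x) (pos z x)"

definition xrot :: "complex \<Rightarrow> 'i \<Rightarrow> complex" where
  "xrot u = rot_config I z (ctr Z) (sig Z x) p (jn Z x) u x"

lemma Yc_Inr: "l \<in> J \<Longrightarrow> u \<noteq> 0 \<Longrightarrow> Yc u (Inr l) = z l"
  by (simp add: rotY_def jn_Inr sig_Inr)

lemma pos_xrot: "a \<in> Pts \<Longrightarrow> u \<noteq> 0 \<Longrightarrow> pos z (xrot u) a = Yc u a"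
  using Yc_Inr by (auto simp: xrot_def rot_config_def)

lemma xrot_space: "xrot u \<in> space (config_measure I)"
  by (simp add: xrot_def rot_config_def space_PiM)

lemma Yc_dist_ctr:
  assumes "cmod u = 1" "jn Z x a = 0"
  shows "cmod (Yc u a - ctr Z) = cmod (pos z x a - ctr Z)"
  using assms by (simp add: rotY_def norm_mult norm_power_int)

lemma Yc_dist_center:
  assumes u: "cmod u = 1" and a: "a \<in> Pts"
    and *: "jn Z x a > 0 \<or> pos z x a = ctr Z \<or> sig Z x a = sig Z x p"
  shows "cmod (Yc u a - Yc u p) = cmod (pos z x a - pos z x p)"
proof (cases "jn Z x a > 0")
  case True
  have "Yc u a - Yc u p = u powi sig Z x p * u ^ jn Z x a * (pos z x a - pos z x p)"
    using True by (simp add: rotY_def algebra_simps)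
  then show ?thesis using u by (simp add: norm_mult norm_power norm_power_int)
next
  case False
  then consider "pos z x a = ctr Z" | "sig Z x a = sig Z x p" using * by auto
  then show ?thesis
  proof cases
    case 1
    then have "Yc u a - Yc u p = u powi sig Z x p * (pos z x a - pos z x p)"
      using False by (simp add: rotY_def algebra_simps)
    then show ?thesis using u by (simp add: norm_mult norm_power_int)
  next
    case 2
    then have "Yc u a - Yc u p = u powi sig Z x p * (pos z x a - pos z x p)"
      using False by (simp add: rotY_def algebra_simps)
    then show ?thesis using u by (simp add: norm_mult norm_power_int)
  qed
qed

lemma xrot_in_zone:
  assumes u: "cmod u = 1"
  shows "in_zone Z (xrot u)" "rho Z (xrot u) = rho Z x"
proof -
  have u0: "u \<noteq> 0" using u by auto
  have d: "cmod (pos z (xrot u) p - ctr Z) = cmod (pos z x p - ctr Z)"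
    using Yc_dist_ctr[OF u, of p] pos_xrot[OF p u0] by simp
  then show "rho Z (xrot u) = rho Z x" by (simp add: rho_def)
  show "in_zone Z (xrot u)"
  proof (cases Z)
    case Bulk
    then have "pos z (xrot u) p = pos z x p"
      unfolding pos_xrot[OF p u0] rotY_def sig_Bulk[OF Bulk] by simp
    then show ?thesis using Z Bulk by (simp add: in_zone_def)
  qed (use Z d in \<open>auto simp: in_zone_def ctr_def\<close>)
qed

text \<open>The squared distance after rotation is the old one times \<open>q u\<close>, and
  \<open>q u\<close> is too close to 1 to vanish.\<close>

lemma xrot_Dst:
  assumes u: "cmod u = 1"
  shows "xrot u \<in> Dst"
proof -
  interpret rotation Pts "pos z x" "ctr Z" "sig Z x" p "jn Z x" by (rule rotation)
  have u0: "u \<noteq> 0" using u by auto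
  have "Yc u a \<noteq> Yc u b" if ab: "a \<in> Pts" "b \<in> Pts" "a \<noteq> b" for a b
  proof -
    obtain l where "diff_form (\<lambda>u. Yc u a - Yc u b) l" using diff_form_pair[OF ab] by blast
    from sq_ext_diff_form[OF this] obtain S q where S: "annulus \<subseteq> S" "\<forall>u\<in>S. cmod (q u - 1) < 1 / 2"
      and q: "\<forall>u. cmod u = 1 \<longrightarrow> complex_of_real ((cmod (Yc u a - Yc u b))\<^sup>2)
        = of_real ((cmod (pos z x a - pos z x b))\<^sup>2) * q u"
      unfolding sq_ext_def by auto
    have "u \<in> S" using S(1) u by (auto simp: annulus_def)
    then have "q u \<noteq> 0" using S(2) by fastforce
    moreover have "pos z x a \<noteq> pos z x b" using inj_onD[OF inj_pos _ ab(1,2)] ab(3) by blast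
    ultimately have "complex_of_real ((cmod (Yc u a - Yc u b))\<^sup>2) \<noteq> 0" using q u by simp
    then show ?thesis by auto
  qed
  then have "inj_on (pos z (xrot u)) Pts"
    unfolding inj_on_def using pos_xrot[OF _ u0] by metis
  then show ?thesis using xrot_space by (simp add: Dst_def)
qed

lemma rin_xrot:
  assumes "a \<in> Pts" "cmod u = 1"
  shows "rin (xrot u) a = cmod (Yc u a - Yc u p)"
proof -
  have u: "u \<noteq> 0" using assms(2) by auto
  show ?thesis unfolding rin_def pos_xrot[OF assms(1) u] pos_xrot[OF p u] ..
qed

end

text \<open>Either the rotation preserves the distance from \<open>a\<close> to \<open>p\<close>, or
  \<open>a\<close> and \<open>p\<close> turn about \<open>ctr\<close> with different exponents. Then
  their distances from \<open>ctr\<close> differ by a factor of at least 512 before and after, which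
  keeps them \<open>rho / 4\<close> apart and the level at 0.\<close>

lemma lin_xrot:
  assumes x: "x \<in> Dst" and Z: "in_zone Z x" and u: "cmod u = 1" and a: "a \<in> Pts"
  shows "lin Z (xrot Z x u) a = lin Z x a"
proof (cases "jn Z x a > 0 \<or> pos z x a = ctr Z \<or> sig Z x a = sig Z x p")
  case True
  then have "rin (xrot Z x u) a = rin x a"
    using Yc_dist_center[OF x Z u a True] rin_xrot[OF x Z a u] by (simp add: rin_def)
  then show ?thesis by (simp add: lin_def xrot_in_zone[OF x Z u])
next
  case False
  interpret rotation Pts "pos z x" "ctr Z" "sig Z x" p "jn Z x" by (rule rotation[OF x Z])
  let ?c = "ctr Z"
  have far: "rho Z x / 4 \<le> cmod (A - B)"
    if "cmod A = cmod (pos z x a - ?c)" "cmod B = cmod (pos z x p - ?c)" for A B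
  proof -
    have pow: "w \<le> 2 ^ n * w" if "w \<ge> 0" for w :: real and n
      using that mult_right_mono[of 1 "2 ^ n" w] by simp
    from outer[of a p] False a p have
      "512 * 2 ^ nat (sig Z x a - sig Z x p) * cmod A \<le> cmod B \<or> 512 * 2 ^ nat (sig Z x p - sig Z x a) * cmod B \<le> cmod A"
      using center_ne[OF x Z] that unfolding sep_def by auto
    then have "512 * cmod A \<le> cmod B \<or> 512 * cmod B \<le> cmod A"
      using pow[of "cmod A" "nat (sig Z x a - sig Z x p)"] pow[of "cmod B" "nat (sig Z x p - sig Z x a)"]
      by (simp add: mult.assoc) linarith
    then have "cmod B / 4 \<le> cmod (A - B)"
      using norm_triangle_ineq2[of A B] norm_triangle_ineq2[of B A]
      by (auto simp: norm_minus_commute)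
    then show ?thesis using rho_bounds(2)[OF x Z] that by simp
  qed
  have 1: "rho Z x / 4 \<le> rin x a"
    using far[of "pos z x a - ?c" "pos z x p - ?c"] by (simp add: rin_def)
  have "rho Z x / 4 \<le> cmod ((Y u a - ?c) - (Y u p - ?c))"
    using False by (intro far Yc_dist_ctr[OF x Z u]) auto
  then have 2: "rho Z x / 4 \<le> rin (xrot Z x u) a"
    by (simp add: rin_xrot[OF x Z a u])
  show ?thesis
    using lin_0[OF x Z 1] lin_0[OF xrot_Dst[OF x Z u] xrot_in_zone(1)[OF x Z u], of a] 2
      xrot_in_zone(2)[OF x Z u] by simp
qed

lemma jn_xrot:
  assumes x: "x \<in> Dst" and Z: "in_zone Z x" and u: "cmod u = 1" and a: "a \<in> Pts"
  shows "jn Z (xrot Z x u) a = jn Z x a"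
  unfolding jn_def lin_xrot[OF assms] by (rule wt_cong) (rule lin_xrot[OF x Z u])

lemma lou_xrot:
  assumes x: "x \<in> Dst" and Z: "in_zone Z x" and u: "cmod u = 1" and a: "a \<in> Pts"
  shows "lou Z (xrot Z x u) a = lou Z x a"
proof -
  have "u \<noteq> 0" using u by auto
  then show ?thesis
    using Yc_dist_ctr[OF x Z u, of a] pos_xrot[OF x Z a, of u]
    by (auto simp: lou_def rout_def jn_xrot[OF assms])
qed

end

context star_config
begin

section \<open>Uniform bounds along the rotations\<close>

definition scaleM :: real where
  "scaleM = 2 ^ (10 * card Pts + 1)"

text \<open>The loss \<open>scaleM\<close> from \<open>weight_lower\<close> enters twice, for the
  turn about \<open>ctr\<close> and for the turn about \<open>p\<close>; the reference distance
  \<open>rho / 4\<close> of the latter supplies the 4.\<close>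

definition star_lower :: real where
  "star_lower = min \<delta> R / scaleM / (4 * scaleM)"

text \<open>Three contributions: inverse lifted distances from \<open>p\<close>, the lifted distance
  from \<open>p\<close> to \<open>ctr\<close>, and the distance from \<open>ctr\<close> to
  \<open>z j1\<close>.\<close>

definition star_bound :: real where
  "star_bound = 2 / star_lower + (\<delta> + R * scaleM) + (R + \<delta>)"

lemma scaleM: "scaleM \<ge> 1"
  unfolding scaleM_def by (rule one_le_power) simp

lemma star_lower: "star_lower > 0"
  using scaleM \<delta> R_pos by (simp add: star_lower_def)

lemma star_bound: "star_bound \<ge> 0"
  using star_lower scaleM \<delta> R_pos unfolding star_bound_def by (intro add_nonneg_nonneg) auto

text \<open>All that later estimates see of the rotation; zones and levels are hidden behind it. The
  last clause serves the sharp cutoff: if the center is a fixed point \<open>z k\<close>, distances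
  from it are preserved and only points within \<open>\<delta>\<close> of it move.\<close>

definition adm :: "('i \<Rightarrow> complex) \<Rightarrow> (complex \<Rightarrow> 'i + 'j \<Rightarrow> complex) \<Rightarrow> bool" where
  "adm x Y \<longleftrightarrow> (\<forall>l\<in>J. \<forall>u. u \<noteq> 0 \<longrightarrow> Y u (Inr l) = z l)
    \<and> (\<forall>a\<in>Pts. \<forall>b\<in>Pts. a \<noteq> b \<longrightarrow> sq_ext (\<lambda>u. Y u a - Y u b) (cmod (pos z x a - pos z x b)))
    \<and> (\<forall>a\<in>Pts. a \<noteq> p \<longrightarrow> annulus_ext (\<lambda>u. inverse (Y u a - Y u p)) star_bound)
    \<and> annulus_ext (\<lambda>u. Y u p - z j1) star_bound
    \<and> (\<forall>k. p = Inr k \<longrightarrow> (\<forall>u. cmod u = 1 \<longrightarrow> (\<forall>a\<in>Pts. cmod (Y u a - z k) = cmod (pos z x a - z k)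
         \<and> (Y u a = pos z x a \<or> cmod (pos z x a - z k) \<le> \<delta>))))"

context
  fixes Z :: "'j zone" and x :: "'i \<Rightarrow> complex"
  assumes x: "x \<in> Dst" and Z: "in_zone Z x"
begin

interpretation wi: weights Pts "rin x" "rho Z x / 4"
  using finite_Pts rho_bounds[OF x Z] by unfold_locales auto

interpretation wo: weights Pts "rout Z x" "dout Z"
  using finite_Pts \<delta> R_pos by unfold_locales (auto simp: dout_def)

text \<open>On \<open>|u| = 2\<close> the center is lifted to a distance of order
  \<open>\<delta>\<close> from a nearby fixed point, or of order \<open>R\<close> near infinity:
  \<open>weight_lower\<close> limits the loss to a constant, and \<open>weight_upper\<close>
  prevents overshooting.\<close>

lemma sig_center_bounds:
  shows "min \<delta> R / scaleM \<le> 2 powi sig Z x p * rho Z x"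
    and "2 powi sig Z x p * cmod (pos z x p - ctr Z) \<le> \<delta> + R * scaleM"
proof -
  let ?r = "cmod (pos z x p - ctr Z)" and ?w = "wt (lou Z x) Pts (lou Z x p)"
  have r: "?r > 0" using center_ne[OF x Z] by simp
  have w: "?w = wo.weight p" by (rule lou_weight[OF x Z])
  have m: "min \<delta> R / scaleM \<le> min \<delta> R"
    using scaleM \<delta> R_pos divide_left_mono[of 1 scaleM "min \<delta> R"] by simp
  have M0: "scaleM > 0" using scaleM by linarith
  have RM: "R \<le> R * scaleM" using scaleM R_pos by simp
  have pow: "y \<le> 2 ^ n * y" if "y \<ge> 0" for y :: real and n
    using that mult_right_mono[of 1 "2 ^ n" y] by simp
  have "min \<delta> R / scaleM \<le> 2 powi sig Z x p * rho Z x \<and> 2 powi sig Z x p * ?r \<le> \<delta> + R * scaleM"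
  proof (cases Z)
    case Bulk
    then have "rho Z x = \<delta>" by (simp add: rho_def)
    moreover have "?r \<le> R + \<delta>"
      using Z Bulk \<delta> R_pos unfolding in_zone_def ctr_def by (cases p) auto
    moreover have "2 powi sig Z x p = (1::real)" using sig_Bulk[OF x Z Bulk] by simp
    ultimately show ?thesis using m RM by auto
  next
    case (Near l)
    have s: "sig Z x p = int (wo.weight p)" by (simp add: sig_def zsgn_def Near w[unfolded Near])
    have ro: "rout Z x p = ?r" by (simp add: rout_def Near)
    have rh: "rho Z x = ?r" by (simp add: rho_def Near)
    have d: "dout Z = \<delta>" by (simp add: dout_def Near)
    have "\<delta> \<le> scaleM * 2 ^ wo.weight p * ?r"
      using wo.weight_lower[of p] r unfolding ro d scaleM_def by simp
    then have "\<delta> / scaleM \<le> 2 ^ wo.weight p * ?r" using M0 by (simp add: field_simps)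
    moreover have "min \<delta> R / scaleM \<le> \<delta> / scaleM" using M0 by (intro divide_right_mono) auto
    moreover have "2 ^ wo.weight p * ?r \<le> \<delta>"
    proof (cases "wo.weight p = 0")
      case True
      then show ?thesis using Z Near by (simp add: in_zone_def ctr_def)
    next
      case False
      then have "512 * 2 ^ wo.weight p * ?r \<le> \<delta>"
        using wo.weight_upper[OF p] r unfolding ro d by simp
      moreover have "0 \<le> 2 ^ wo.weight p * ?r" by simp
      ultimately show ?thesis by linarith
    qed
    ultimately show ?thesis unfolding s rh using RM R_pos
      by (simp only: power_int_of_nat) linarith
  next
    case Far
    have s: "sig Z x p = - int (wo.weight p)" by (simp add: sig_def zsgn_def Far w[unfolded Far])
    have ro: "rout Z x p = inverse ?r" by (simp add: rout_def Far)
    have rh: "rho Z x = ?r" by (simp add: rho_def Far)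
    have d: "dout Z = 1 / R" by (simp add: dout_def Far)
    have e: "2 powi (- int n) * ?r = ?r / 2 ^ n" for n
      by (simp add: power_int_minus field_simps)
    have "1 / R \<le> scaleM * 2 ^ wo.weight p * inverse ?r"
      using wo.weight_lower[of p] r unfolding ro d scaleM_def by simp
    then have "?r / 2 ^ wo.weight p \<le> R * scaleM" using R_pos r by (simp add: field_simps)
    moreover have "R \<le> ?r / 2 ^ wo.weight p"
    proof (cases "wo.weight p = 0")
      case True
      then show ?thesis using Z Far by (simp add: in_zone_def ctr_def)
    next
      case False
      then have "512 * 2 ^ wo.weight p * inverse ?r \<le> 1 / R"
        using wo.weight_upper[OF p] r unfolding ro d by simp
      moreover have "0 \<le> 2 ^ wo.weight p * inverse ?r" by simp
      ultimately have "2 ^ wo.weight p * inverse ?r \<le> 1 / R" by linarith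
      then show ?thesis using R_pos r by (simp add: field_simps)
    qed
    ultimately show ?thesis unfolding s rh e using m \<delta> by auto
  qed
  then show "min \<delta> R / scaleM \<le> 2 powi sig Z x p * rho Z x"
    and "2 powi sig Z x p * ?r \<le> \<delta> + R * scaleM" by auto
qed

lemma star_lower_le:
  shows "star_lower \<le> 2 powi sig Z x p * cmod (pos z x p - ctr Z)"
    and "a \<in> Pts \<Longrightarrow> a \<noteq> p \<Longrightarrow> star_lower \<le> 2 powi sig Z x p * 2 ^ jn Z x a * cmod (pos z x a - pos z x p)"
proof -
  have M0: "scaleM > 0" using scaleM by linarith
  have "star_lower \<le> min \<delta> R / scaleM"
    using scaleM \<delta> R_pos divide_left_mono[of 1 "4 * scaleM" "min \<delta> R / scaleM"]
    unfolding star_lower_def by simp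
  also note sig_center_bounds(1)
  also have "2 powi sig Z x p * rho Z x \<le> 2 powi sig Z x p * cmod (pos z x p - ctr Z)"
    by (intro mult_left_mono rho_bounds x Z) auto
  finally show "star_lower \<le> 2 powi sig Z x p * cmod (pos z x p - ctr Z)" .
  assume a: "a \<in> Pts" "a \<noteq> p"
  have "rho Z x / 4 \<le> scaleM * 2 ^ jn Z x a * rin x a"
    using wi.weight_lower[of a] rin_pos[OF x Z a] unfolding scaleM_def jn_weight[OF x Z] by simp
  then have *: "rho Z x / (4 * scaleM) \<le> 2 ^ jn Z x a * rin x a" using M0 by (simp add: field_simps)
  have "star_lower \<le> 2 powi sig Z x p * rho Z x / (4 * scaleM)"
    unfolding star_lower_def using sig_center_bounds(1) M0 by (intro divide_right_mono) auto
  also have "\<dots> \<le> 2 powi sig Z x p * (2 ^ jn Z x a * rin x a)"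
    using mult_left_mono[OF *, of "2 powi sig Z x p"] by simp
  finally show "star_lower \<le> 2 powi sig Z x p * 2 ^ jn Z x a * cmod (pos z x a - pos z x p)"
    by (simp add: rin_def mult.assoc)
qed

lemma ctr_bound: "cmod (ctr Z - z j1) \<le> R + \<delta>"
proof (cases Z)
  case Bulk
  show ?thesis
  proof (cases p)
    case (Inr k)
    then have "k \<in> J" using p by auto
    have "ctr Z = z k + of_real \<delta>" unfolding ctr_def Bulk using Inr by simp
    then have "cmod (ctr Z - z j1) \<le> cmod (z k - z j1) + \<delta>"
      using norm_triangle_ineq[of "z k - z j1" "of_real \<delta>"] \<delta> by (simp add: algebra_simps)
    then show ?thesis using R[OF \<open>k \<in> J\<close>] R_pos by linarith
  next
    case (Inl q)
    then have "ctr Z = z j1" unfolding ctr_def Bulk by simp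
    then show ?thesis using R_pos \<delta> by simp
  qed
next
  case (Near l)
  then have "l \<in> J" using Z by (auto simp: in_zone_def)
  then show ?thesis using R[of l] R_pos \<delta> by (simp add: Near ctr_def)
qed (use R_pos \<delta> in \<open>simp add: ctr_def\<close>)

lemma adm_rotY: "adm x (rotY (ctr Z) (sig Z x) p (jn Z x) (pos z x))" (is "adm x ?Y")
  unfolding adm_def
proof (intro conjI ballI allI impI)
  interpret rotation Pts "pos z x" "ctr Z" "sig Z x" p "jn Z x" by (rule rotation[OF x Z])
  have ann: "annulus_ext \<phi> star_bound" if "annulus_ext \<phi> (2 / star_lower)" for \<phi>
    using that
  proof (rule annulus_ext_mono)
    show "2 / star_lower \<le> star_bound" unfolding star_bound_def
      using scaleM \<delta> R_pos by (simp add: add.assoc)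
  qed
  show "?Y u (Inr l) = z l" if "l \<in> J" "u \<noteq> 0" for l u
    using Yc_Inr[OF x Z that] .
  show "sq_ext (\<lambda>u. ?Y u a - ?Y u b) (cmod (pos z x a - pos z x b))"
    if "a \<in> Pts" "b \<in> Pts" "a \<noteq> b" for a b
    using diff_form_pair[OF that] sq_ext_diff_form by fastforce
  show "annulus_ext (\<lambda>u. inverse (?Y u a - ?Y u p)) star_bound" if "a \<in> Pts" "a \<noteq> p" for a
    using that star_lower
    by (intro ann annulus_ext_inverse_diff_form diff_form_star star_lower_le) auto
  show "annulus_ext (\<lambda>u. ?Y u p - z j1) star_bound"
  proof -
    have eq: "?Y u p - z j1 = u powi sig Z x p * (pos z x p - ctr Z) + (ctr Z - z j1)" for u
      by (simp add: rotY_def)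
    have "annulus_ext (\<lambda>u. u powi sig Z x p * (pos z x p - ctr Z)) (\<delta> + R * scaleM)"
      unfolding annulus_ext_def
      using sig_center_bounds(2)
      by (intro exI[of _ "- {0}"] exI[of _ "\<lambda>u. u powi sig Z x p * (pos z x p - ctr Z)"])
        (auto simp: annulus_def norm_mult norm_power_int intro!: holomorphic_intros)
    from annulus_ext_add[OF this annulus_ext_const[OF ctr_bound]]
    show ?thesis unfolding eq
      by (rule annulus_ext_mono) (use star_lower in \<open>simp add: star_bound_def\<close>)
  qed
  fix k u a assume k: "p = Inr k" and u: "cmod u = 1" and a: "a \<in> Pts"
  \<comment> \<open>A fixed point as center is always in the bulk, since the other zones require an
    integration variable; so nothing turns about \<open>ctr\<close>.\<close>
  have Bulk: "Z = Bulk" using Z k unfolding in_zone_def by (cases Z) auto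
  have Yp: "?Y u p = pos z x p" unfolding rotY_def sig_Bulk[OF x Z Bulk] by simp
  have pk: "pos z x p = z k" using k by simp
  show "cmod (?Y u a - z k) = cmod (pos z x a - z k)"
    using Yc_dist_center[OF x Z u a] sig_Bulk[OF x Z Bulk] Yp unfolding pk by auto
  show "?Y u a = pos z x a \<or> cmod (pos z x a - z k) \<le> \<delta>"
  proof (cases "jn Z x a = 0")
    case True
    then show ?thesis unfolding rotY_def sig_Bulk[OF x Z Bulk] by simp
  next
    case False
    have "512 * 2 ^ jn Z x a * rin x a \<le> rho Z x / 4"
      using wi.weight_upper[OF a] rin_pos[OF x Z a] False jn_center[of Z x] unfolding jn_weight[OF x Z]
      by (metis neq0_conv)
    moreover have "rin x a \<le> 2 ^ jn Z x a * rin x a"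
      using mult_right_mono[of 1 "2 ^ jn Z x a" "rin x a"] by (simp add: rin_def)
    moreover have "rin x a \<ge> 0" by (simp add: rin_def)
    ultimately have "rin x a \<le> rho Z x" by simp
    then show ?thesis by (simp add: rin_def pk rho_def Bulk)
  qed
qed

end

section \<open>Decomposition into invariant pieces\<close>

text \<open>Fixing zone and levels makes all exponents constant, so that the configuration-dependent
  rotation becomes a single map on such a set.\<close>

definition piece :: "'j zone \<times> ('i + 'j \<Rightarrow> nat) \<times> ('i + 'j \<Rightarrow> nat) \<Rightarrow> ('i \<Rightarrow> complex) set" where
  "piece = (\<lambda>(Z, li, lo). {x \<in> Dst. in_zone Z x \<and> (\<forall>a\<in>Pts. lin Z x a = li a) \<and> (\<forall>a\<in>Pts. lou Z x a = lo a)})"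

text \<open>Labels are extensional functions, so that a configuration has at most one label. The
  bound \<open>L\<close> keeps the family finite; it is removed by dominated convergence.\<close>

definition pieces :: "nat \<Rightarrow> ('j zone \<times> ('i + 'j \<Rightarrow> nat) \<times> ('i + 'j \<Rightarrow> nat)) set" where
  "pieces L = zones \<times> PiE Pts (\<lambda>_. {..L}) \<times> PiE Pts (\<lambda>_. {..L})"

lemma finite_pieces: "finite (pieces L)"
  unfolding pieces_def using finite_zones finite_Pts by (intro finite_cartesian_product finite_PiE) auto

lemma measurable_pos [measurable (raw)]:
  "a \<in> Pts \<Longrightarrow> (\<lambda>x. pos z x a) \<in> borel_measurable (config_measure I)"
  by auto

lemma Dst_sets [measurable]: "Dst \<in> sets (config_measure I)"
proof -
  have "Dst = {x \<in> space (config_measure I). \<forall>a\<in>Pts. \<forall>b\<in>Pts. a \<noteq> b \<longrightarrow> pos z x a \<noteq> pos z x b}"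
    unfolding Dst_def inj_on_def by blast
  also have "\<dots> \<in> sets (config_measure I)"
  proof (intro sets.sets_Collect_finite_All finite_Pts)
    fix a b assume "a \<in> Pts" "b \<in> Pts"
    then have "{x \<in> space (config_measure I). pos z x a = pos z x b} \<in> sets (config_measure I)"
      using measurable_sets[OF borel_measurable_diff[OF measurable_pos measurable_pos], of a b "{0}"]
      by (simp add: vimage_def Int_def conj_commute)
    then show "{x \<in> space (config_measure I). a \<noteq> b \<longrightarrow> pos z x a \<noteq> pos z x b} \<in> sets (config_measure I)"
      by (cases "a = b") (simp_all add: sets.sets_Collect_neg)
  qed
  finally show ?thesis .
qed

lemma measurable_lev [measurable]: "lev \<in> measurable borel (count_space UNIV)"
  unfolding lev_def by measurable

lemma measurable_levels:
  assumes "a \<in> Pts"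
  shows "(\<lambda>x. lin Z x a) \<in> measurable (config_measure I) (count_space UNIV)"
    and "(\<lambda>x. lou Z x a) \<in> measurable (config_measure I) (count_space UNIV)"
proof -
  note [measurable] = measurable_pos[OF p] measurable_pos
  have l: "(\<lambda>x. lin Z x b) \<in> measurable (config_measure I) (count_space UNIV)" if b: "b \<in> Pts" for b
    unfolding lin_def rho_def rin_def using b by (cases "Z = Bulk") (simp_all, measurable)
  show "(\<lambda>x. lin Z x a) \<in> measurable (config_measure I) (count_space UNIV)" by (rule l) fact
  have jm: "{x \<in> space (config_measure I). jn Z x a \<noteq> 0} \<in> sets (config_measure I)"
  proof -
    \<comment> \<open>A weight depends on all levels at once, but it is a function of finitely many
      discrete variables and thus measurable without inspecting \<open>wt\<close>.\<close>
    have "(\<lambda>x. \<lambda>b\<in>Pts. lin Z x b) \<in> measurable (config_measure I) (PiM Pts (\<lambda>_. count_space UNIV))"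
      by (intro measurable_restrict l)
    also have "PiM Pts (\<lambda>_. count_space (UNIV :: nat set)) = count_space (PiE Pts (\<lambda>_. UNIV))"
      by (rule count_space_PiM_finite[OF finite_Pts]) simp
    finally have m: "(\<lambda>x. \<lambda>b\<in>Pts. lin Z x b) \<in> measurable (config_measure I) (count_space (PiE Pts (\<lambda>_. UNIV)))" .
    have eq: "jn Z x a = wt (\<lambda>b\<in>Pts. lin Z x b) Pts ((\<lambda>b\<in>Pts. lin Z x b) a)" for x
      using assms unfolding jn_def by (auto intro: wt_cong)
    show ?thesis unfolding eq
      using measurable_compose[OF m, of "\<lambda>l. wt l Pts (l a)" "count_space UNIV"] by simp
  qed
  have "{x \<in> space (config_measure I). Z = Bulk \<or> jn Z x a \<noteq> 0} \<in> sets (config_measure I)"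
    using jm by (cases "Z = Bulk") auto
  then have "(\<lambda>x. rout Z x a) \<in> borel_measurable (config_measure I)"
    unfolding rout_def using measurable_pos[OF assms]
    by (intro measurable_If) (cases "Z = Far", simp_all)
  then show "(\<lambda>x. lou Z x a) \<in> measurable (config_measure I) (count_space UNIV)"
    unfolding lou_def
    by (intro measurable_compose[OF _ measurable_lev] borel_measurable_divide borel_measurable_const)
qed

lemma in_zone_sets: "{x \<in> space (config_measure I). in_zone Z x} \<in> sets (config_measure I)"
proof -
  note [measurable] = measurable_pos[OF p] measurable_pos
  have fl: "{x \<in> space (config_measure I). \<forall>l\<in>J. Inr l \<noteq> p \<longrightarrow> \<delta> \<le> cmod (pos z x p - z l)} \<in> sets (config_measure I)"
    using finite_J by (intro sets.sets_Collect_finite_All) auto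
  have 1: "{x \<in> space (config_measure I). cmod (pos z x p - w) \<le> R} \<in> sets (config_measure I)"
    "{x \<in> space (config_measure I). R < cmod (pos z x p - w)} \<in> sets (config_measure I)"
    "{x \<in> space (config_measure I). cmod (pos z x p - w) < \<delta>} \<in> sets (config_measure I)" for w
    by measurable
  show ?thesis
  proof (cases Z)
    case Bulk
    then show ?thesis using fl 1 unfolding in_zone_def
      by (cases "isl p") (simp_all add: sets.sets_Collect_conj)
  next
    case (Near l)
    then show ?thesis using 1 unfolding in_zone_def by (cases "isl p \<and> l \<in> J") auto
  next
    case Far
    then show ?thesis using 1 unfolding in_zone_def by (cases "isl p") auto
  qed
qed

lemma measurable_sets_Collect_eq:
  "f \<in> measurable M (count_space UNIV) \<Longrightarrow> {x \<in> space M. f x = c} \<in> sets M"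
  by measurable

lemma piece_sets [measurable]: "piece d \<in> sets (config_measure I)"
proof -
  obtain Z li lo where d: "d = (Z, li, lo)" by (cases d)
  have *: "{x \<in> space (config_measure I). \<forall>a\<in>Pts. lin Z x a = li a} \<in> sets (config_measure I)"
    "{x \<in> space (config_measure I). \<forall>a\<in>Pts. lou Z x a = lo a} \<in> sets (config_measure I)"
    by (intro sets.sets_Collect_finite_All finite_Pts measurable_sets_Collect_eq measurable_levels; assumption)+
  have "piece d = Dst \<inter> {x \<in> space (config_measure I). in_zone Z x}
    \<inter> {x \<in> space (config_measure I). \<forall>a\<in>Pts. lin Z x a = li a} \<inter> {x \<in> space (config_measure I). \<forall>a\<in>Pts. lou Z x a = lo a}"
    unfolding piece_def d Dst_def by auto
  then show ?thesis using * in_zone_sets by auto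
qed

end

lemma integrable_indicator_mult:
  fixes f :: "'a \<Rightarrow> 'b::{banach, second_countable_topology, real_normed_algebra_1}"
  assumes "A \<in> sets M" "integrable M f"
  shows "integrable M (\<lambda>x. indicator A x * f x)"
proof -
  have "(\<lambda>x. indicator A x * f x) = (\<lambda>x. indicator A x *\<^sub>R f x)"
    by (auto simp: indicator_def fun_eq_iff)
  then show ?thesis using integrable_mult_indicator[OF assms] by simp
qed

context star_config
begin

lemma rot_config_cong:
  assumes "\<And>a. a \<in> Pts \<Longrightarrow> \<sigma> a = \<sigma>' a" "\<And>a. a \<in> Pts \<Longrightarrow> j a = j' a"
  shows "rot_config I z c \<sigma> p j u x = rot_config I z c \<sigma>' p j' u x"
  unfolding rot_config_def rotY_def using assms p by (intro restrict_ext) auto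

text \<open>The exponents of the piece, frozen, define rotations of the whole space that map the
  piece to itself. Its indicator is therefore constant along orbits, and
  \<open>rotation_average_bound\<close> applies to the product.\<close>

lemma piece_bound:
  fixes f :: "('i \<Rightarrow> complex) \<Rightarrow> complex"
  assumes f: "integrable (config_measure I) f" and \<beta>: "integrable (config_measure I) \<beta>"
    and ext: "\<And>x Y. x \<in> Dst \<Longrightarrow> adm x Y \<Longrightarrow> annulus_ext (\<lambda>u. f (\<lambda>q\<in>I. Y u (Inl q))) (\<beta> x)"
  shows "norm (\<integral> x. indicator (piece d) x * f x \<partial>config_measure I)
    \<le> (\<integral> x. indicator (piece d) x * \<beta> x \<partial>config_measure I)"
proof (cases "piece d = {}")
  case False
  then obtain x0 where x0: "x0 \<in> piece d" by blast
  obtain Z li lo where d: "d = (Z, li, lo)" by (cases d)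
  define \<sigma> j where "\<sigma> a = zsgn Z * int (wt lo Pts (lo a))" and "j a = wt li Pts (li a)" for a
  define \<Theta> where "\<Theta> = rot_config I z (ctr Z) \<sigma> p j"
  have pieceD: "x \<in> Dst" "in_zone Z x" "\<And>a. a \<in> Pts \<Longrightarrow> lin Z x a = li a" "\<And>a. a \<in> Pts \<Longrightarrow> lou Z x a = lo a"
    if "x \<in> piece d" for x using that by (auto simp: piece_def d)
  have sj: "sig Z x a = \<sigma> a" "jn Z x a = j a" if "x \<in> piece d" "a \<in> Pts" for x a
    using pieceD(3,4)[OF that(1)] that(2) unfolding sig_def jn_def \<sigma>_def j_def
    by (auto intro!: wt_cong arg_cong[where f = int])
  have jp: "j p = 0" using sj(2)[OF x0 p] by simp
  have zfix: "\<sigma> (Inr l) = 0" "j (Inr l) = 0" if "l \<in> J" for l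
    using sj[OF x0, of "Inr l"] sig_Inr[OF pieceD(1,2)[OF x0] that] jn_Inr[OF pieceD(1,2)[OF x0] that] that
    by auto
  have \<Theta>_xrot: "\<Theta> u x = xrot Z x u" if "x \<in> piece d" for x u
    unfolding \<Theta>_def xrot_def[OF pieceD(1,2)[OF that]] by (intro rot_config_cong) (simp_all add: sj[OF that])
  have inv: "\<Theta> u x \<in> piece d" if x: "x \<in> piece d" and u: "cmod u = 1" for x u
    unfolding \<Theta>_xrot[OF x] piece_def d
    using xrot_Dst[OF pieceD(1,2)[OF x] u] xrot_in_zone(1)[OF pieceD(1,2)[OF x] u]
      lin_xrot[OF pieceD(1,2)[OF x] u] lou_xrot[OF pieceD(1,2)[OF x] u] pieceD(3,4)[OF x] by auto
  have p': "p \<in> Inl ` I \<or> p \<in> range Inr" using p by auto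
  have pos_\<Theta>: "pos z (\<Theta> u x) a = rotY (ctr Z) \<sigma> p j (pos z x) u a" if "a \<in> Pts" "u \<noteq> 0" for u x a
    using that zfix by (auto simp: \<Theta>_def rot_config_def rotY_def)
  have undo: "\<Theta> (inverse u) (\<Theta> u x) = x" if x: "x \<in> space (config_measure I)" and u: "u \<noteq> 0" for u x
  proof
    fix q
    show "\<Theta> (inverse u) (\<Theta> u x) q = x q"
    proof (cases "q \<in> I")
      case True
      have "rotY (ctr Z) \<sigma> p j (pos z (\<Theta> u x)) (inverse u) (Inl q)
          = rotY (ctr Z) \<sigma> p j (rotY (ctr Z) \<sigma> p j (pos z x) u) (inverse u) (Inl q)"
        using pos_\<Theta>[of "Inl q" u x] pos_\<Theta>[of p u x] True p u by (simp only: rotY_def) auto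
      then show ?thesis using True rotY_inverse[where j = j, OF u jp]
        by (simp add: \<Theta>_def[abs_def] rot_config_def)
    next
      case False
      then show ?thesis using x by (auto simp: \<Theta>_def rot_config_def space_PiM PiE_def extensional_def)
    qed
  qed
  show ?thesis
  proof (rule rotation_average_bound[where \<Theta> = \<Theta>])
    show "sigma_finite_measure (config_measure I)"
      by (rule lborel_product.sigma_finite[OF finite_I])
    show "measure_preserving (config_measure I) (\<Theta> u)" if "cmod u = 1" for u
      unfolding \<Theta>_def by (rule measure_preserving_rot_config[where j = j, OF finite_I p' jp that])
    show "(\<lambda>(t, x). \<Theta> (exp (2 * pi * \<i> * complex_of_real t)) x)
        \<in> measurable (lborel \<Otimes>\<^sub>M config_measure I) (config_measure I)"
      unfolding \<Theta>_def case_prod_beta by (rule measurable_rot_config[OF p']) auto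
    show "integrable (config_measure I) (\<lambda>x. indicator (piece d) x * f x)"
      by (intro integrable_indicator_mult piece_sets f)
    show "integrable (config_measure I) (\<lambda>x. indicator (piece d) x * \<beta> x)"
      by (intro integrable_indicator_mult piece_sets \<beta>)
    fix x assume x: "x \<in> space (config_measure I)"
    show "annulus_ext (\<lambda>u. indicator (piece d) (\<Theta> u x) * f (\<Theta> u x)) (indicator (piece d) x * \<beta> x)"
    proof (cases "x \<in> piece d")
      case True
      have "annulus_ext (\<lambda>u. f (\<Theta> u x)) (\<beta> x)"
        using ext[OF pieceD(1)[OF True] adm_rotY[OF pieceD(1,2)[OF True]]]
        unfolding \<Theta>_xrot[OF True] xrot_def[OF pieceD(1,2)[OF True]] rot_config_def .
      then have "annulus_ext (\<lambda>u. indicator (piece d) (\<Theta> u x) * f (\<Theta> u x)) (\<beta> x)"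
        by (rule annulus_ext_cong) (use inv[OF True] in simp)
      then show ?thesis using True by simp
    next
      case False
      \<comment> \<open>An orbit that meets the piece stays in it: turning back by
        \<open>inverse u\<close> would put \<open>x\<close> there.\<close>
      have "\<Theta> u x \<notin> piece d" if u: "cmod u = 1" for u
      proof
        assume "\<Theta> u x \<in> piece d"
        from inv[OF this, of "inverse u"] have "\<Theta> (inverse u) (\<Theta> u x) \<in> piece d"
          using u by (simp add: norm_inverse)
        moreover have "u \<noteq> 0" using u by auto
        ultimately show False using undo[OF x] False by simp
      qed
      then have "annulus_ext (\<lambda>u. indicator (piece d) (\<Theta> u x) * f (\<Theta> u x)) 0"
        by (intro annulus_ext_cong[OF annulus_ext_const[of 0]]) auto
      then show ?thesis using False by simp
    qed
  qed
qed simp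

text \<open>Integrability of \<open>f\<close> serves only Fubini and the limit over pieces; the
  bound involves \<open>\<beta>\<close> alone, which is why it can be uniform in a cutoff contained
  in \<open>f\<close>. Pieces are added after the estimate, since cancellation takes place within
  orbits.\<close>

theorem star_estimate:
  fixes f :: "('i \<Rightarrow> complex) \<Rightarrow> complex"
  assumes f: "integrable (config_measure I) f" and \<beta>: "integrable (config_measure I) \<beta>"
    and \<beta>0: "\<And>x. \<beta> x \<ge> 0"
    and f0: "\<And>x. x \<in> space (config_measure I) \<Longrightarrow> x \<notin> Dst \<Longrightarrow> f x = 0"
    and ext: "\<And>x Y. x \<in> Dst \<Longrightarrow> adm x Y \<Longrightarrow> annulus_ext (\<lambda>u. f (\<lambda>q\<in>I. Y u (Inl q))) (\<beta> x)"
  shows "norm (\<integral> x. f x \<partial>config_measure I) \<le> (\<integral> x. \<beta> x \<partial>config_measure I)"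
proof -
  let ?M = "config_measure I"
  define s where "s L x = (\<Sum>d\<in>pieces L. indicator (piece d) x :: real)" for L x
  define dx where "dx x = (let Z = (THE Z. in_zone Z x) in (Z, restrict (lin Z x) Pts, restrict (lou Z x) Pts))" for x
  have dx: "d = dx x" if "d \<in> pieces L" "x \<in> piece d" for d L x
  proof -
    obtain Z li lo where d: "d = (Z, li, lo)" by (cases d)
    have *: "in_zone Z x" "\<And>a. a \<in> Pts \<Longrightarrow> lin Z x a = li a" "\<And>a. a \<in> Pts \<Longrightarrow> lou Z x a = lo a"
      using that by (auto simp: piece_def d)
    have "(THE Z. in_zone Z x) = Z" using *(1) zone_unique by blast
    moreover have "restrict (lin Z x) Pts = li" "restrict (lou Z x) Pts = lo"
      using * that(1) unfolding pieces_def d by (auto simp: fun_eq_iff PiE_def extensional_def)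
    ultimately show ?thesis by (simp add: dx_def d)
  qed
  \<comment> \<open>By \<open>dx\<close> a configuration determines its label, so at most one
    summand is nonzero.\<close>
  have s1: "s L x \<le> 1" "s L x \<ge> 0" for L x
  proof -
    have "s L x = (\<Sum>d\<in>pieces L \<inter> {dx x}. indicator (piece d) x)"
      unfolding s_def using dx finite_pieces by (intro sum.mono_neutral_right) (auto simp: indicator_def)
    also have "\<dots> \<le> 1"
      by (cases "dx x \<in> pieces L"; cases "x \<in> piece (dx x)") auto
    finally show "s L x \<le> 1" .
    show "s L x \<ge> 0" unfolding s_def by (intro sum_nonneg) auto
  qed
  have s_lim: "eventually (\<lambda>L. s L x = 1) sequentially" if x: "x \<in> Dst" for x
  proof -
    obtain Z where Z: "in_zone Z x" using zone_exists[OF x] by blast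
    define L0 where "L0 = Max (lin Z x ` Pts \<union> lou Z x ` Pts)"
    have L0: "lin Z x a \<le> L0" "lou Z x a \<le> L0" if "a \<in> Pts" for a
      unfolding L0_def using that finite_Pts by (auto intro!: Max_ge)
    let ?d = "(Z, restrict (lin Z x) Pts, restrict (lou Z x) Pts)"
    have "s L x = 1" if "L \<ge> L0" for L
    proof -
      have "restrict (lin Z x) Pts \<in> PiE Pts (\<lambda>_. {..L})" "restrict (lou Z x) Pts \<in> PiE Pts (\<lambda>_. {..L})"
        using order_trans[OF L0(1) that] order_trans[OF L0(2) that]
        by (simp_all only: restrict_PiE_iff atMost_iff) blast+
      then have "?d \<in> pieces L" unfolding pieces_def using in_zones[OF Z] by blast
      moreover have "x \<in> piece ?d" using x Z by (auto simp: piece_def)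
      ultimately have "indicator (piece ?d) x \<le> s L x"
        unfolding s_def using finite_pieces by (intro member_le_sum) auto
      then show ?thesis using s1[of L x] \<open>x \<in> piece ?d\<close> by simp
    qed
    then show ?thesis by (auto simp: eventually_sequentially)
  qed
  have [measurable]: "f \<in> borel_measurable ?M" using f by auto
  have [measurable]: "s L \<in> borel_measurable ?M" for L
    unfolding s_def by measurable
  have fi: "integrable ?M (\<lambda>x. indicator (piece d) x * f x)" "integrable ?M (\<lambda>x. indicator (piece d) x * \<beta> x)" for d
    by (intro integrable_indicator_mult piece_sets f \<beta>)+
  have bound: "norm (\<integral> x. s L x * f x \<partial>?M) \<le> (\<integral> x. \<beta> x \<partial>?M)" for L
  proof -
    have "(\<integral> x. s L x * f x \<partial>?M) = (\<integral> x. (\<Sum>d\<in>pieces L. indicator (piece d) x * f x) \<partial>?M)"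
      by (intro Bochner_Integration.integral_cong) (auto simp: s_def sum_distrib_right indicator_def intro!: sum.cong)
    also have "\<dots> = (\<Sum>d\<in>pieces L. \<integral> x. indicator (piece d) x * f x \<partial>?M)"
      by (rule Bochner_Integration.integral_sum) (rule fi)
    also have "norm \<dots> \<le> (\<Sum>d\<in>pieces L. \<integral> x. indicator (piece d) x * \<beta> x \<partial>?M)"
      by (intro sum_norm_le piece_bound f \<beta> ext)
    also have "\<dots> = (\<integral> x. (\<Sum>d\<in>pieces L. indicator (piece d) x * \<beta> x) \<partial>?M)"
      by (rule Bochner_Integration.integral_sum[symmetric]) (rule fi)
    also have "\<dots> \<le> (\<integral> x. \<beta> x \<partial>?M)"
    proof (intro integral_mono)
      show "integrable ?M (\<lambda>x. \<Sum>d\<in>pieces L. indicator (piece d) x * \<beta> x)"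
        by (intro Bochner_Integration.integrable_sum fi)
      show "(\<Sum>d\<in>pieces L. indicator (piece d) x * \<beta> x) \<le> \<beta> x" for x
        using mult_right_mono[OF s1(1)[of L x] \<beta>0[of x]] by (simp add: s_def sum_distrib_right)
    qed (rule \<beta>)
    finally show ?thesis .
  qed
  have "(\<lambda>L. \<integral> x. s L x * f x \<partial>?M) \<longlonglongrightarrow> (\<integral> x. f x \<partial>?M)"
  proof (rule integral_dominated_convergence[where w = "\<lambda>x. norm (f x)"])
    show "AE x in ?M. (\<lambda>L. s L x * f x) \<longlonglongrightarrow> f x"
    proof (rule AE_I2)
      fix x assume x: "x \<in> space ?M"
      show "(\<lambda>L. s L x * f x) \<longlonglongrightarrow> f x"
      proof (cases "x \<in> Dst")
        case True
        then show ?thesis using s_lim by (intro tendsto_eventually) (auto elim: eventually_mono)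
      qed (simp add: f0[OF x])
    qed
    show "AE x in ?M. norm (s L x * f x) \<le> norm (f x)" for L
      using s1[of L] by (intro AE_I2) (auto simp: norm_mult intro!: mult_left_le_one_le)
  qed (use f in auto)
  then have "(\<lambda>L. norm (\<integral> x. s L x * f x \<partial>?M)) \<longlonglongrightarrow> norm (\<integral> x. f x \<partial>?M)"
    by (rule tendsto_norm)
  then show ?thesis using bound by (intro LIMSEQ_le_const2) auto
qed

end

section \<open>The Coulomb weight and its regulators\<close>

definition pairprod :: "('a \<Rightarrow> 'a \<Rightarrow> 'b::comm_monoid_mult) \<Rightarrow> 'a list \<Rightarrow> 'b" where
  "pairprod h as = (\<Prod>l<length as. \<Prod>k<l. h (as ! k) (as ! l))"

definition pairsum :: "('a \<Rightarrow> 'a \<Rightarrow> 'b::comm_monoid_add) \<Rightarrow> 'a list \<Rightarrow> 'b" where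
  "pairsum h as = (\<Sum>l<length as. \<Sum>k<l. h (as ! k) (as ! l))"

definition coulomb :: "('j \<Rightarrow> complex) \<Rightarrow> ('i + 'j \<Rightarrow> 'i + 'j \<Rightarrow> complex) \<Rightarrow> ('i + 'j) list \<Rightarrow> ('i \<Rightarrow> complex) \<Rightarrow> complex" where
  "coulomb z c as x = pairprod (\<lambda>a b. complex_of_real (cmod (pos z x a - pos z x b)) powr c a b) as"

text \<open>It blows up at every collision and at infinity, so
  \<open>exp (- \<eta> * cutoff)\<close> absorbs any power of inverse distances. Squares and inverse
  squares are used because they have continuations with positive real part.\<close>

definition cutoff :: "'i set \<Rightarrow> ('j \<Rightarrow> complex) \<Rightarrow> 'j \<Rightarrow> ('i + 'j) list \<Rightarrow> ('i \<Rightarrow> complex) \<Rightarrow> real" where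
  "cutoff I z j1 as x = pairsum (\<lambda>a b. 1 / (cmod (pos z x a - pos z x b))\<^sup>2) as
     + (\<Sum>q\<in>I. (cmod (x q - z j1))\<^sup>2)"

definition cut_set :: "'i set \<Rightarrow> 'j set \<Rightarrow> ('j \<Rightarrow> complex) \<Rightarrow> real \<Rightarrow> ('i \<Rightarrow> complex) set" where
  "cut_set I J z \<epsilon> = {x \<in> space (config_measure I). \<forall>q\<in>I. x q \<notin> (\<Union>l\<in>J. ball (z l) \<epsilon>)}"

lemma pos_ext_cong:
  "pos_ext \<phi> v \<Longrightarrow> (\<And>u. cmod u = 1 \<Longrightarrow> \<phi> u = \<psi> u) \<Longrightarrow> pos_ext \<psi> v"
  unfolding pos_ext_def by metis

lemma pairsum_nonneg: "(\<And>a b. 0 \<le> h a b) \<Longrightarrow> 0 \<le> (pairsum h as :: real)"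
  unfolding pairsum_def by (intro sum_nonneg) auto

lemma pairsum_member_le:
  fixes h :: "'a \<Rightarrow> 'a \<Rightarrow> real"
  assumes "\<And>a b. 0 \<le> h a b" "\<And>a b. h a b = h b a" "a \<in> set as" "b \<in> set as" "a \<noteq> b"
  shows "h a b \<le> pairsum h as"
proof -
  obtain k l where kl: "k < length as" "l < length as" "a = as ! k" "b = as ! l"
    using assms(3,4) by (metis in_set_conv_nth)
  have *: "h (as ! k) (as ! l) \<le> pairsum h as" if "k < l" "l < length as" for k l
  proof -
    have "h (as ! k) (as ! l) \<le> (\<Sum>k<l. h (as ! k) (as ! l))"
      using that assms(1) by (intro member_le_sum) auto
    also have "\<dots> \<le> pairsum h as"
      unfolding pairsum_def using that assms(1)
      by (intro member_le_sum[of l _ "\<lambda>l. \<Sum>k<l. h (as ! k) (as ! l)"] sum_nonneg) auto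
    finally show ?thesis .
  qed
  have "k \<noteq> l" using kl assms(5) by auto
  then consider "k < l" | "l < k" by linarith
  then show ?thesis using * kl assms(2) by cases metis+
qed

text \<open>Comparing \<open>G m\<close> and \<open>G n\<close> through one
  \<open>A \<epsilon>\<close> with small \<open>\<epsilon>\<close> shows that \<open>G\<close> is
  Cauchy; no convergence of \<open>A\<close> is presupposed.\<close>

lemma common_limit:
  fixes A :: "real \<Rightarrow> 'a::complete_space"
  assumes "\<delta> > 0" and "\<And>\<epsilon> n. 0 < \<epsilon> \<Longrightarrow> \<epsilon> \<le> \<delta> \<Longrightarrow> dist (A \<epsilon>) (G n) \<le> C * (e \<epsilon> + r n)"
    and "(e \<longlongrightarrow> 0) (at_right 0)" "r \<longlonglongrightarrow> 0"
  shows "\<exists>L. (A \<longlongrightarrow> L) (at_right 0) \<and> G \<longlonglongrightarrow> L"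
proof -
  have e: "((\<lambda>\<epsilon>. C * e \<epsilon>) \<longlongrightarrow> 0) (at_right 0)"
    using tendsto_mult_left[OF assms(3), of C] by simp
  have r: "(\<lambda>n. C * r n) \<longlonglongrightarrow> 0"
    using tendsto_mult_left[OF assms(4), of C] by simp
  have ev: "eventually (\<lambda>\<epsilon>. \<epsilon> \<in> {0<..<\<delta>}) (at_right 0)"
    by (rule eventually_at_right_real) (rule assms(1))
  have GG: "dist (G m) (G n) \<le> C * r m + C * r n" for m n
  proof (rule field_le_epsilon)
    fix t :: real assume "t > 0"
    then have "eventually (\<lambda>\<epsilon>. C * e \<epsilon> < t / 2) (at_right 0)" using order_tendstoD(2)[OF e, of "t / 2"] by simp
    then obtain \<epsilon> where "0 < \<epsilon>" "\<epsilon> \<le> \<delta>" "C * e \<epsilon> < t / 2"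
      using eventually_happens'[OF trivial_limit_at_right_real eventually_conj[OF ev]]
      by (metis greaterThanLessThan_iff less_imp_le)
    then show "dist (G m) (G n) \<le> C * r m + C * r n + t"
      using assms(2)[of \<epsilon> m] assms(2)[of \<epsilon> n] dist_triangle2[of "G m" "G n" "A \<epsilon>"]
      by (simp add: algebra_simps dist_commute)
  qed
  have "Cauchy G"
  proof (rule metric_CauchyI)
    fix t :: real assume "t > 0"
    then obtain N where "\<And>n. n \<ge> N \<Longrightarrow> C * r n < t / 2"
      using order_tendstoD(2)[OF r, of "t / 2"] by (auto simp: eventually_sequentially)
    then show "\<exists>N. \<forall>m\<ge>N. \<forall>n\<ge>N. dist (G m) (G n) < t"
    proof (intro exI[of _ N] allI impI)
      fix m n assume "N \<le> m" "N \<le> n"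
      then have "C * r m < t / 2" "C * r n < t / 2" using \<open>\<And>n. n \<ge> N \<Longrightarrow> C * r n < t / 2\<close> by blast+
      then show "dist (G m) (G n) < t" using GG[of m n] by linarith
    qed
  qed
  then obtain L where L: "G \<longlonglongrightarrow> L" using Cauchy_convergent convergent_def by blast
  have AL: "dist (A \<epsilon>) L \<le> C * e \<epsilon>" if "0 < \<epsilon>" "\<epsilon> \<le> \<delta>" for \<epsilon>
  proof -
    have "(\<lambda>n. dist (A \<epsilon>) (G n)) \<longlonglongrightarrow> dist (A \<epsilon>) L" by (intro tendsto_intros L)
    moreover have "(\<lambda>n. C * e \<epsilon> + C * r n) \<longlonglongrightarrow> C * e \<epsilon> + 0" by (intro tendsto_intros r)
    ultimately have "dist (A \<epsilon>) L \<le> C * e \<epsilon> + 0"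
      by (rule LIMSEQ_le) (use assms(2)[OF that] in \<open>auto simp: algebra_simps\<close>)
    then show ?thesis by simp
  qed
  have "(A \<longlongrightarrow> L) (at_right 0)"
  proof (rule tendsto_dist_iff[THEN iffD2], rule tendsto_sandwich[OF _ _ tendsto_const e])
    show "eventually (\<lambda>\<epsilon>. dist (A \<epsilon>) L \<le> C * e \<epsilon>) (at_right 0)"
      using ev by eventually_elim (use AL in auto)
  qed simp
  then show ?thesis using L by blast
qed

text \<open>The list fixes an order in which pairs are multiplied, as in \<open>free_corr\<close>.
  The weight itself does not depend on the center \<open>p\<close>.\<close>

locale coulomb_star = star_config I J z j1 \<delta> R p
  for I :: "'i set" and J :: "'j set" and z j1 \<delta> R and p :: "'i + 'j" +
  fixes as :: "('i + 'j) list" and c :: "'i + 'j \<Rightarrow> 'i + 'j \<Rightarrow> complex"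
  assumes as: "set as = Inl ` I \<union> Inr ` J" "distinct as"
    and F_integrable: "integrable (config_measure I) (coulomb z c as)"
begin

abbreviation "F \<equiv> coulomb z c as"
abbreviation "V \<equiv> cutoff I z j1 as"

definition cfg :: "('i + 'j \<Rightarrow> complex) \<Rightarrow> 'i \<Rightarrow> complex" where
  "cfg Y = (\<lambda>q\<in>I. Y (Inl q))"

lemma adm_sq_ext:
  assumes "adm x Y" "a \<in> Pts" "b \<in> Pts" "a \<noteq> b"
  shows "sq_ext (\<lambda>u. Y u a - Y u b) (cmod (pos z x a - pos z x b))"
proof -
  have "\<forall>a\<in>Pts. \<forall>b\<in>Pts. a \<noteq> b \<longrightarrow> sq_ext (\<lambda>u. Y u a - Y u b) (cmod (pos z x a - pos z x b))"
    using assms(1) unfolding adm_def by (elim conjE)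
  then show ?thesis using assms(2-) by (elim ballE impE) auto
qed

lemma pos_cfg: "adm x Y \<Longrightarrow> a \<in> Pts \<Longrightarrow> u \<noteq> 0 \<Longrightarrow> pos z (cfg (Y u)) a = Y u a"
  unfolding adm_def cfg_def by auto

lemma as_nth: "k < length as \<Longrightarrow> as ! k \<in> Pts"
  using as(1) nth_mem by metis

lemma V_nonneg: "0 \<le> V x"
  unfolding cutoff_def by (intro add_nonneg_nonneg pairsum_nonneg sum_nonneg) auto

text \<open>At a coincidence one factor is \<open>0 powr c\<close>, which is 0 for every complex
  \<open>c\<close> by convention, even where the Coulomb factor is infinite in the limit.\<close>

lemma F_Dst: 
  assumes "x \<in> space (config_measure I)" "x \<notin> Dst"
  shows "F x = 0"
proof -
  from assms obtain a b where ab: "a \<in> Pts" "b \<in> Pts" "a \<noteq> b" "pos z x a = pos z x b"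
    unfolding Dst_def inj_on_def by blast
  then obtain k l where kl: "k < length as" "l < length as" "a = as ! k" "b = as ! l"
    using as(1) by (metis in_set_conv_nth)
  have *: "F x = 0" if "k < l" "l < length as" "pos z x (as ! k) = pos z x (as ! l)" for k l
  proof -
    have "(\<Prod>k'<l. complex_of_real (cmod (pos z x (as ! k') - pos z x (as ! l))) powr c (as ! k') (as ! l)) = 0"
      by (rule prod_zero) (use that in \<open>auto intro!: bexI[of _ k]\<close>)
    then show ?thesis unfolding coulomb_def pairprod_def
      by (intro prod_zero) (use that in auto)
  qed
  have "k \<noteq> l" using kl ab(3) by auto
  then consider "k < l" | "l < k" by linarith
  then show ?thesis using * kl ab(4) by cases metis+
qed

definition F_const :: real where
  "F_const = pairprod (\<lambda>a b. exp (cmod (c a b))) as"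

lemma F_const_pos: "F_const > 0"
  unfolding F_const_def pairprod_def by (intro prod_pos) auto

lemma annulus_ext_F:
  assumes "x \<in> Dst" "adm x Y"
  shows "annulus_ext (\<lambda>u. F (cfg (Y u))) (F_const * cmod (F x))"
proof -
  have "annulus_ext (\<lambda>u. pairprod (\<lambda>a b. complex_of_real (cmod (Y u a - Y u b)) powr c a b) as)
     (pairprod (\<lambda>a b. exp (cmod (c a b)) * cmod (complex_of_real (cmod (pos z x a - pos z x b)) powr c a b)) as)"
    unfolding pairprod_def
  proof (intro annulus_ext_prod annulus_ext_powr)
    fix l k assume lk: "l \<in> {..<length as}" "k \<in> {..<l}"
    then have "as ! k \<in> Pts" "as ! l \<in> Pts" "as ! k \<noteq> as ! l"
      using as_nth as(2) by (auto simp: nth_eq_iff_index_eq)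
    then show "sq_ext (\<lambda>u. Y u (as ! k) - Y u (as ! l)) (cmod (pos z x (as ! k) - pos z x (as ! l)))"
      by (rule adm_sq_ext[OF assms(2)])
  qed auto
  moreover have "pairprod (\<lambda>a b. exp (cmod (c a b)) * cmod (complex_of_real (cmod (pos z x a - pos z x b)) powr c a b)) as
     = F_const * cmod (F x)"
    by (simp add: pairprod_def F_const_def coulomb_def prod.distrib flip: prod_norm)
  ultimately have "annulus_ext (\<lambda>u. pairprod (\<lambda>a b. complex_of_real (cmod (Y u a - Y u b)) powr c a b) as)
     (F_const * cmod (F x))" by simp
  then show ?thesis
  proof (rule annulus_ext_cong)
    fix u :: complex assume "cmod u = 1"
    then have "u \<noteq> 0" by auto
    then show "pairprod (\<lambda>a b. complex_of_real (cmod (Y u a - Y u b)) powr c a b) as = F (cfg (Y u))"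
      unfolding coulomb_def pairprod_def using pos_cfg[OF assms(2) as_nth]
      by (intro prod.cong refl) auto
  qed
qed

lemma pos_ext_pair:
  assumes "adm x Y" "a \<in> Pts" "b \<in> Pts" "a \<noteq> b"
  shows "pos_ext (\<lambda>u. complex_of_real (1 / (cmod (pos z (cfg (Y u)) a - pos z (cfg (Y u)) b))\<^sup>2)) (1 / (cmod (pos z x a - pos z x b))\<^sup>2)"
    and "pos_ext (\<lambda>u. complex_of_real ((cmod (pos z (cfg (Y u)) a - pos z (cfg (Y u)) b))\<^sup>2)) ((cmod (pos z x a - pos z x b))\<^sup>2)"
proof -
  note * = pos_ext_sq[OF adm_sq_ext[OF assms]]
  have eq: "Y u a = pos z (cfg (Y u)) a" "Y u b = pos z (cfg (Y u)) b" if "cmod u = 1" for u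
  proof -
    have "u \<noteq> 0" using that by auto
    then show "Y u a = pos z (cfg (Y u)) a" "Y u b = pos z (cfg (Y u)) b"
      using pos_cfg[OF assms(1)] assms(2,3) by metis+
  qed
  show "pos_ext (\<lambda>u. complex_of_real (1 / (cmod (pos z (cfg (Y u)) a - pos z (cfg (Y u)) b))\<^sup>2)) (1 / (cmod (pos z x a - pos z x b))\<^sup>2)"
    by (rule pos_ext_cong[OF *(2)]) (simp add: eq)
  show "pos_ext (\<lambda>u. complex_of_real ((cmod (pos z (cfg (Y u)) a - pos z (cfg (Y u)) b))\<^sup>2)) ((cmod (pos z x a - pos z x b))\<^sup>2)"
    by (rule pos_ext_cong[OF *(1)]) (simp add: eq)
qed

lemma pos_ext_V:
  assumes "adm x Y"
  shows "pos_ext (\<lambda>u. complex_of_real (V (cfg (Y u)))) (V x)"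
proof -
  have 1: "pos_ext (\<lambda>u. \<Sum>l<length as. \<Sum>k<l. complex_of_real (1 / (cmod (pos z (cfg (Y u)) (as ! k) - pos z (cfg (Y u)) (as ! l)))\<^sup>2))
     (pairsum (\<lambda>a b. 1 / (cmod (pos z x a - pos z x b))\<^sup>2) as)"
    unfolding pairsum_def
  proof (intro pos_ext_sum pos_ext_pair assms)
    fix l k assume "l \<in> {..<length as}" "k \<in> {..<l}"
    then show "as ! k \<in> Pts" "as ! l \<in> Pts" "as ! k \<noteq> as ! l"
      using as_nth as(2) by (auto simp: nth_eq_iff_index_eq)
  qed
  \<comment> \<open>Distances from \<open>z j1\<close> are distances to the fixed point
    \<open>Inr j1\<close>, so the estimate for pairs covers the part of the cutoff at
    infinity.\<close>
  have 2: "pos_ext (\<lambda>u. \<Sum>q\<in>I. complex_of_real ((cmod (pos z (cfg (Y u)) (Inl q) - pos z (cfg (Y u)) (Inr j1)))\<^sup>2))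
     (\<Sum>q\<in>I. (cmod (pos z x (Inl q) - pos z x (Inr j1)))\<^sup>2)"
    by (intro pos_ext_sum pos_ext_pair(2) assms) (use j1 in auto)
  show ?thesis
    using pos_ext_add[OF 1 2] unfolding cutoff_def pairsum_def by simp
qed

lemma inverse_dist_le_V:
  assumes "a \<in> Pts" "b \<in> Pts" "a \<noteq> b"
  shows "1 / (cmod (pos z x a - pos z x b))\<^sup>2 \<le> V x"
proof -
  have "1 / (cmod (pos z x a - pos z x b))\<^sup>2 \<le> pairsum (\<lambda>a b. 1 / (cmod (pos z x a - pos z x b))\<^sup>2) as"
    using assms as(1) by (intro pairsum_member_le) (auto simp: norm_minus_commute)
  then show ?thesis unfolding cutoff_def by (simp add: add_increasing2 sum_nonneg)
qed

lemma dist_le_V: "q \<in> I \<Longrightarrow> (cmod (x q - z j1))\<^sup>2 \<le> V x"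
proof -
  assume "q \<in> I"
  then have "(cmod (x q - z j1))\<^sup>2 \<le> (\<Sum>q\<in>I. (cmod (x q - z j1))\<^sup>2)"
    using finite_I by (intro member_le_sum) auto
  then show ?thesis unfolding cutoff_def by (simp add: add_increasing pairsum_nonneg)
qed

lemma measurable_V [measurable]: "V \<in> borel_measurable (config_measure I)"
proof -
  have "(\<lambda>x. 1 / (cmod (pos z x (as ! k) - pos z x (as ! l)))\<^sup>2) \<in> borel_measurable (config_measure I)"
    if "k < length as" "l < length as" for k l
  proof -
    note [measurable] = measurable_pos[OF as_nth[OF that(1)]] measurable_pos[OF as_nth[OF that(2)]]
    show ?thesis by measurable
  qed
  then show ?thesis
    unfolding cutoff_def[abs_def] pairsum_def
    by (intro borel_measurable_add borel_measurable_sum) auto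
qed

lemma measurable_F [measurable]: "F \<in> borel_measurable (config_measure I)"
  using F_integrable by auto

section \<open>The star algebra of a center\<close>

text \<open>Inverse distances from \<open>p\<close> are uniformly bounded once lifted; an inverse
  distance between two other points is not, as both may turn with the same exponent. The position of
  \<open>p\<close> is a generator for the sake of test functions like
  \<open>\<zeta> ^ n\<close>.\<close>

inductive_set salg :: "(('i \<Rightarrow> complex) \<Rightarrow> complex) set" where
  const: "(\<lambda>_. w) \<in> salg"
| tinv: "a \<in> Pts \<Longrightarrow> a \<noteq> p \<Longrightarrow> (\<lambda>x. inverse (pos z x a - pos z x p)) \<in> salg"
| center: "(\<lambda>x. pos z x p - z j1) \<in> salg"
| add: "A \<in> salg \<Longrightarrow> B \<in> salg \<Longrightarrow> (\<lambda>x. A x + B x) \<in> salg"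
| mult: "A \<in> salg \<Longrightarrow> B \<in> salg \<Longrightarrow> (\<lambda>x. A x * B x) \<in> salg"

lemma salg_sum: "(\<And>i. i \<in> S \<Longrightarrow> f i \<in> salg) \<Longrightarrow> (\<lambda>x. \<Sum>i\<in>S. f i x) \<in> salg"
  by (induction S rule: infinite_finite_induct) (auto intro: salg.intros)

lemma salg_prod: "(\<And>i. i \<in> S \<Longrightarrow> f i \<in> salg) \<Longrightarrow> (\<lambda>x. \<Prod>i\<in>S. f i x) \<in> salg"
  by (induction S rule: infinite_finite_induct) (auto intro: salg.intros)

lemma salg_power: "f \<in> salg \<Longrightarrow> (\<lambda>x. f x ^ n) \<in> salg"
  by (induction n) (auto intro: salg.intros)

lemma salg_measurable: "D \<in> salg \<Longrightarrow> D \<in> borel_measurable (config_measure I)"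
proof (induction rule: salg.induct)
  case (tinv a)
  then show ?case using measurable_pos[OF tinv(1)] measurable_pos[OF p]
    by (intro borel_measurable_inverse borel_measurable_diff)
next
  case center
  then show ?case using measurable_pos[OF p] by (intro borel_measurable_diff) auto
qed auto

text \<open>The constant is independent of the configuration, as all generators are bounded by
  \<open>star_bound\<close> on the outer circle. This replaces a pointwise bound on
  \<open>D\<close>, which does not exist in general.\<close>

lemma salg_ext: "D \<in> salg \<Longrightarrow> \<exists>C. \<forall>x Y. x \<in> Dst \<longrightarrow> adm x Y \<longrightarrow> annulus_ext (\<lambda>u. D (cfg (Y u))) C"
proof (induction rule: salg.induct)
  case (const w)
  then show ?case by (intro exI[of _ "cmod w"]) (auto intro: annulus_ext_const)
next
  case (tinv a)
  show ?case
  proof (intro exI[of _ star_bound] allI impI)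
    fix x Y assume Y: "adm x Y"
    then have "annulus_ext (\<lambda>u. inverse (Y u a - Y u p)) star_bound"
      using tinv unfolding adm_def by blast
    then show "annulus_ext (\<lambda>u. inverse (pos z (cfg (Y u)) a - pos z (cfg (Y u)) p)) star_bound"
    proof (rule annulus_ext_cong)
      fix u :: complex assume "cmod u = 1"
      then have u: "u \<noteq> 0" by auto
      show "inverse (Y u a - Y u p) = inverse (pos z (cfg (Y u)) a - pos z (cfg (Y u)) p)"
        unfolding pos_cfg[OF Y tinv(1) u] pos_cfg[OF Y p u] ..
    qed
  qed
next
  case center
  show ?case
  proof (intro exI[of _ star_bound] allI impI)
    fix x Y assume Y: "adm x Y"
    then have "annulus_ext (\<lambda>u. Y u p - z j1) star_bound" unfolding adm_def by blast
    then show "annulus_ext (\<lambda>u. pos z (cfg (Y u)) p - z j1) star_bound"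
    proof (rule annulus_ext_cong)
      fix u :: complex assume "cmod u = 1"
      then have u: "u \<noteq> 0" by auto
      show "Y u p - z j1 = pos z (cfg (Y u)) p - z j1" unfolding pos_cfg[OF Y p u] ..
    qed
  qed
next
  case (add A B)
  then obtain C D where "\<forall>x Y. x \<in> Dst \<longrightarrow> adm x Y \<longrightarrow> annulus_ext (\<lambda>u. A (cfg (Y u))) C"
    "\<forall>x Y. x \<in> Dst \<longrightarrow> adm x Y \<longrightarrow> annulus_ext (\<lambda>u. B (cfg (Y u))) D" by blast
  then show ?case by (intro exI[of _ "C + D"]) (auto intro: annulus_ext_add)
next
  case (mult A B)
  then obtain C D where "\<forall>x Y. x \<in> Dst \<longrightarrow> adm x Y \<longrightarrow> annulus_ext (\<lambda>u. A (cfg (Y u))) C"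
    "\<forall>x Y. x \<in> Dst \<longrightarrow> adm x Y \<longrightarrow> annulus_ext (\<lambda>u. B (cfg (Y u))) D" by blast
  then show ?case by (intro exI[of _ "C * D"]) (auto intro: annulus_ext_mult)
qed

lemma sqrt_le_1_plus:
  assumes "t\<^sup>2 \<le> v" "0 \<le> t"
  shows "t \<le> 1 + (v :: real)"
proof -
  have "0 \<le> (t - 1)\<^sup>2" by simp
  then have "2 * t \<le> 1 + t\<^sup>2" by (simp add: power2_eq_square algebra_simps)
  then show ?thesis using assms by linarith
qed

text \<open>Every generator is at most of order \<open>sqrt V\<close>. This crude bound gives
  integrability for each fixed smooth regulator, but nothing uniform in
  \<open>\<eta>\<close>.\<close>

lemma salg_growth: "D \<in> salg \<Longrightarrow> \<exists>C d. 0 \<le> C \<and> (\<forall>x. cmod (D x) \<le> C * (1 + V x) ^ d)"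
proof (induction rule: salg.induct)
  case (const w)
  then show ?case by (intro exI[of _ "cmod w"] exI[of _ 0]) auto
next
  case (tinv a)
  have "cmod (inverse (pos z x a - pos z x p)) \<le> 1 + V x" for x
    using inverse_dist_le_V[OF tinv(1) p tinv(2), of x]
    by (intro sqrt_le_1_plus) (auto simp: norm_inverse power_inverse divide_inverse)
  then show ?case by (intro exI[of _ 1] exI[of _ 1]) auto
next
  case center
  have "\<exists>C\<ge>0. \<forall>x. cmod (pos z x p - z j1) \<le> C * (1 + V x)"
  proof (cases p)
    case (Inl q)
    then have "q \<in> I" using p by auto
    then show ?thesis using dist_le_V Inl by (intro exI[of _ 1]) (auto intro!: sqrt_le_1_plus)
  next
    case (Inr k)
    have "cmod (z k - z j1) * 1 \<le> cmod (z k - z j1) * (1 + V x)" for x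
      using V_nonneg[of x] by (intro mult_left_mono) auto
    then show ?thesis using Inr by (intro exI[of _ "cmod (z k - z j1)"]) auto
  qed
  then obtain C where "C \<ge> 0" "\<And>x. cmod (pos z x p - z j1) \<le> C * (1 + V x)" by blast
  then show ?case by (intro exI[of _ C] exI[of _ 1]) auto
next
  case (add A B)
  then obtain C d C' d' where *: "0 \<le> C" "\<And>x. cmod (A x) \<le> C * (1 + V x) ^ d"
    "0 \<le> C'" "\<And>x. cmod (B x) \<le> C' * (1 + V x) ^ d'" by blast
  show ?case
  proof (intro exI[of _ "C + C'"] exI[of _ "max d d'"] conjI allI)
    fix x
    have "cmod (A x) \<le> C * (1 + V x) ^ max d d'" "cmod (B x) \<le> C' * (1 + V x) ^ max d d'"
      using * V_nonneg[of x] by (auto intro!: order_trans[OF *(2)] order_trans[OF *(4)] mult_left_mono power_increasing)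
    then show "cmod (A x + B x) \<le> (C + C') * (1 + V x) ^ max d d'"
      using norm_triangle_ineq[of "A x" "B x"] by (simp add: algebra_simps)
  qed (use * in auto)
next
  case (mult A B)
  then obtain C d C' d' where *: "0 \<le> C" "\<And>x. cmod (A x) \<le> C * (1 + V x) ^ d"
    "0 \<le> C'" "\<And>x. cmod (B x) \<le> C' * (1 + V x) ^ d'" by blast
  show ?case
  proof (intro exI[of _ "C * C'"] exI[of _ "d + d'"] conjI allI)
    fix x
    have "cmod (A x * B x) \<le> (C * (1 + V x) ^ d) * (C' * (1 + V x) ^ d')"
      unfolding norm_mult using * V_nonneg[of x] by (intro mult_mono) auto
    then show "cmod (A x * B x) \<le> C * C' * (1 + V x) ^ (d + d')"
      by (simp add: power_add mult_ac)
  qed (use * in auto)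
qed

text \<open>With a fixed center, the balls of the sharp cutoff bound every inverse distance to an
  integration variable; distances between fixed points are constants.\<close>

lemma salg_bounded_away:
  assumes "D \<in> salg" "p = Inr k" "\<epsilon> > 0"
  shows "\<exists>C. \<forall>x. (\<forall>q\<in>I. \<epsilon> \<le> cmod (x q - z k)) \<longrightarrow> cmod (D x) \<le> C"
  using assms(1)
proof (induction rule: salg.induct)
  case (tinv a)
  show ?case
  proof (cases a)
    case (Inl q)
    then have "cmod (inverse (x q - z k)) \<le> inverse \<epsilon>" if "\<epsilon> \<le> cmod (x q - z k)" for x :: "'i \<Rightarrow> complex"
      using that assms(3) by (simp add: norm_inverse le_imp_inverse_le)
    then show ?thesis using Inl tinv assms(2) by (intro exI[of _ "inverse \<epsilon>"]) auto
  qed (use assms(2) in auto)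
next
  case (add A B)
  then obtain C C' where *: "\<And>x. (\<forall>q\<in>I. \<epsilon> \<le> cmod (x q - z k)) \<Longrightarrow> cmod (A x) \<le> C"
    "\<And>x. (\<forall>q\<in>I. \<epsilon> \<le> cmod (x q - z k)) \<Longrightarrow> cmod (B x) \<le> C'" by blast
  show ?case by (intro exI[of _ "C + C'"]) (auto intro!: norm_triangle_mono *)
next
  case (mult A B)
  then obtain C C' where *: "\<And>x. (\<forall>q\<in>I. \<epsilon> \<le> cmod (x q - z k)) \<Longrightarrow> cmod (A x) \<le> C"
    "\<And>x. (\<forall>q\<in>I. \<epsilon> \<le> cmod (x q - z k)) \<Longrightarrow> cmod (B x) \<le> C'" by blast
  have "cmod (A x * B x) \<le> \<bar>C\<bar> * \<bar>C'\<bar>" if "\<forall>q\<in>I. \<epsilon> \<le> cmod (x q - z k)" for x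
    unfolding norm_mult using *(1)[OF that] *(2)[OF that] by (intro mult_mono) auto
  then show ?case by blast
qed (use assms(2) in auto)

section \<open>The smooth regulator and the sharp cutoff\<close>

definition gcut :: "real \<Rightarrow> ('i \<Rightarrow> complex) \<Rightarrow> complex" where
  "gcut \<eta> x = exp (- of_real \<eta> * of_real (V x))"

lemma measurable_gcut [measurable]: "gcut \<eta> \<in> borel_measurable (config_measure I)"
  unfolding gcut_def by measurable

lemma gcut_growth:
  assumes "\<eta> > 0"
  shows "\<exists>C. \<forall>x. (1 + V x) ^ d * cmod (gcut \<eta> x) \<le> C"
proof -
  have "((\<lambda>t::real. t ^ d / exp t) \<longlongrightarrow> 0) at_top" by (rule tendsto_power_div_exp_0)
  then have "eventually (\<lambda>t::real. t ^ d / exp t < 1) at_top" by (rule order_tendstoD) simp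
  then obtain T where T: "\<And>t::real. t \<ge> T \<Longrightarrow> t ^ d / exp t < 1"
    unfolding eventually_at_top_linorder by blast
  \<comment> \<open>Put \<open>t = \<eta> * (1 + V x)\<close>: the power costs
    \<open>\<eta> ^ d\<close> in the denominator and the shift by 1 the factor
    \<open>exp \<eta>\<close>.\<close>
  define C where "C = (1 + (max 1 \<bar>T\<bar>) ^ d) * exp \<eta> / \<eta> ^ d"
  have b: "t ^ d * exp (- t) \<le> 1 + (max 1 \<bar>T\<bar>) ^ d" if "t \<ge> 0" for t
  proof (cases "t \<ge> T")
    case True
    then show ?thesis using T[of t] by (simp add: exp_minus divide_inverse add_increasing2)
  next
    case False
    then have "t ^ d * exp (- t) \<le> (max 1 \<bar>T\<bar>) ^ d * 1"
      using that by (intro mult_mono power_mono) auto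
    then show ?thesis by simp
  qed
  have "(1 + V x) ^ d * cmod (gcut \<eta> x) \<le> C" for x
  proof -
    have "(1 + V x) ^ d * cmod (gcut \<eta> x) = ((\<eta> * (1 + V x)) ^ d * exp (- (\<eta> * (1 + V x)))) * exp \<eta> / \<eta> ^ d"
    proof -
      have "cmod (gcut \<eta> x) = exp (- (\<eta> * V x))" by (simp add: gcut_def norm_exp_eq_Re)
      also have "\<dots> = exp (- (\<eta> * (1 + V x))) * exp \<eta>" by (simp add: algebra_simps flip: exp_add)
      finally show ?thesis using assms by (simp add: power_mult_distrib)
    qed
    also have "\<dots> \<le> C" unfolding C_def
      using assms V_nonneg[of x] by (intro divide_right_mono mult_right_mono b) auto
    finally show ?thesis .
  qed
  then show ?thesis by blast
qed

lemma integrable_gcut: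
  assumes "\<eta> > 0" and [measurable]: "D \<in> borel_measurable (config_measure I)"
    and D: "\<And>x. x \<in> Dst \<Longrightarrow> cmod (D x) \<le> C * (1 + V x) ^ d" and "0 \<le> C"
  shows "integrable (config_measure I) (\<lambda>x. gcut \<eta> x * D x * F x)"
proof -
  obtain C' where C': "\<And>x. (1 + V x) ^ d * cmod (gcut \<eta> x) \<le> C'" using gcut_growth[OF assms(1)] by blast
  show ?thesis
  proof (rule Bochner_Integration.integrable_bound[of _ "\<lambda>x. C * C' * cmod (F x)"])
    show "integrable (config_measure I) (\<lambda>x. C * C' * cmod (F x))"
      using F_integrable by auto
    show "AE x in config_measure I. norm (gcut \<eta> x * D x * F x) \<le> norm (C * C' * cmod (F x))"
    proof (rule AE_I2)
      fix x assume x: "x \<in> space (config_measure I)"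
      show "norm (gcut \<eta> x * D x * F x) \<le> norm (C * C' * cmod (F x))"
      proof (cases "x \<in> Dst")
        case True
        have "cmod (gcut \<eta> x) * cmod (D x) \<le> cmod (gcut \<eta> x) * (C * (1 + V x) ^ d)"
          using D[OF True] by (intro mult_left_mono) auto
        also have "\<dots> \<le> C * C'"
          using mult_left_mono[OF C'[of x] \<open>0 \<le> C\<close>] by (simp add: mult_ac)
        finally have "cmod (gcut \<eta> x) * cmod (D x) * cmod (F x) \<le> \<bar>C * C'\<bar> * cmod (F x)"
          by (intro mult_right_mono) auto
        then show ?thesis by (simp add: norm_mult abs_mult)
      qed (simp add: F_Dst[OF x])
    qed
  qed measurable
qed

lemma integrable_gcut_salg:
  assumes "\<eta> > 0" "D \<in> salg"
  shows "integrable (config_measure I) (\<lambda>x. gcut \<eta> x * D x * F x)"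
  using salg_growth[OF assms(2)] integrable_gcut[OF assms(1) salg_measurable[OF assms(2)]] by metis

text \<open>Error of the smooth regulator: for \<open>\<eta>\<close> tending to 0 the integrand
  tends to 0 pointwise and stays below \<open>9 * cmod (F x)\<close>.\<close>

definition rest :: "real \<Rightarrow> real" where
  "rest \<eta> = (\<integral> x. min 9 (2 * \<eta> * V x) * cmod (F x) \<partial>config_measure I)"

lemma integrable_rest:
  assumes "\<eta> \<ge> 0"
  shows "integrable (config_measure I) (\<lambda>x. min 9 (2 * \<eta> * V x) * cmod (F x))"
proof (rule Bochner_Integration.integrable_bound[of _ "\<lambda>x. 9 * cmod (F x)"])
  show "AE x in config_measure I. norm (min 9 (2 * \<eta> * V x) * cmod (F x)) \<le> norm (9 * cmod (F x))"
  proof (rule AE_I2)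
    fix x
    have "0 \<le> 2 * \<eta> * V x" using assms V_nonneg[of x] by simp
    then have "\<bar>min 9 (2 * \<eta> * V x)\<bar> * cmod (F x) \<le> 9 * cmod (F x)"
      by (intro mult_right_mono) auto
    then show "norm (min 9 (2 * \<eta> * V x) * cmod (F x)) \<le> norm (9 * cmod (F x))"
      by (simp add: abs_mult)
  qed
qed (use F_integrable in auto)

lemma rest_tendsto_0: "(\<lambda>n. rest (1 / real (Suc n))) \<longlonglongrightarrow> 0"
proof -
  have "(\<lambda>n. rest (1 / real (Suc n))) \<longlonglongrightarrow> (\<integral> x. 0 \<partial>config_measure I)"
    unfolding rest_def
  proof (rule integral_dominated_convergence[where w = "\<lambda>x. 9 * cmod (F x)"])
    show "AE x in config_measure I. (\<lambda>n. min 9 (2 * (1 / real (Suc n)) * V x) * cmod (F x)) \<longlonglongrightarrow> 0"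
    proof (rule AE_I2)
      fix x
      have "(\<lambda>n. 1 / real (Suc n)) \<longlonglongrightarrow> 0" using LIMSEQ_inverse_real_of_nat by (simp add: inverse_eq_divide)
      then have "(\<lambda>n. min 9 (2 * (1 / real (Suc n)) * V x) * cmod (F x)) \<longlonglongrightarrow> min 9 (2 * 0 * V x) * cmod (F x)"
        by (intro tendsto_intros)
      then show "(\<lambda>n. min 9 (2 * (1 / real (Suc n)) * V x) * cmod (F x)) \<longlonglongrightarrow> 0" by simp
    qed
    show "AE x in config_measure I. norm (min 9 (2 * (1 / real (Suc n)) * V x) * cmod (F x)) \<le> 9 * cmod (F x)" for n
    proof (rule AE_I2)
      fix x
      have "0 \<le> 2 * (1 / real (Suc n)) * V x" using V_nonneg[of x] by simp
      then have "\<bar>min 9 (2 * (1 / real (Suc n)) * V x)\<bar> * cmod (F x) \<le> 9 * cmod (F x)"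
        by (intro mult_right_mono) auto
      then show "norm (min 9 (2 * (1 / real (Suc n)) * V x) * cmod (F x)) \<le> 9 * cmod (F x)"
        by (simp only: real_norm_def abs_mult abs_norm_cancel)
    qed
  qed (use F_integrable in auto)
  then show ?thesis by simp
qed

lemma gcut_ext:
  assumes "adm x Y" "\<eta> \<ge> 0"
  shows "annulus_ext (\<lambda>u. 1 - gcut \<eta> (cfg (Y u))) (min 9 (2 * \<eta> * V x))"
    and "pos_ext (\<lambda>u. complex_of_real (v (cfg (Y u)))) w \<Longrightarrow> w \<le> V x \<Longrightarrow>
      annulus_ext (\<lambda>u. of_real \<eta> * of_real (v (cfg (Y u))) * gcut \<eta> (cfg (Y u))) (min 9 (2 * \<eta> * V x))"
  using annulus_ext_exp[OF pos_ext_V[OF assms(1)] assms(2) V_nonneg[of x]]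
  unfolding gcut_def by blast+

text \<open>Derivatives of the regulator produce \<open>\<eta>\<close> times a singular factor
  \<open>v\<close>. As \<open>v \<le> V\<close>, this factor together with the regulator has the
  majorant of \<open>rest\<close> after rotation, while \<open>D\<close> stays bounded.\<close>

lemma small_integral:
  assumes D: "D \<in> salg" and v: "(\<exists>a\<in>Pts. a \<noteq> p \<and> v = (\<lambda>x. 1 / (cmod (pos z x a - pos z x p))\<^sup>2))
     \<or> (\<exists>q\<in>I. p = Inl q \<and> v = (\<lambda>x. (cmod (pos z x p - z j1))\<^sup>2))"
  shows "(\<lambda>n. \<integral> x. of_real (1 / real (Suc n)) * of_real (v x) * gcut (1 / real (Suc n)) x * D x * F x \<partial>config_measure I) \<longlonglongrightarrow> 0"
proof -
  have vV: "v x \<le> V x" "v x \<ge> 0" for x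
    using v inverse_dist_le_V[OF _ p] dist_le_V by auto
  have vm: "v \<in> borel_measurable (config_measure I)"
    using v
  proof (elim disjE bexE conjE)
    fix a assume a: "a \<in> Pts" "v = (\<lambda>x. 1 / (cmod (pos z x a - pos z x p))\<^sup>2)"
    note [measurable] = measurable_pos[OF a(1)] measurable_pos[OF p]
    show ?thesis unfolding a(2) by measurable
  next
    assume a: "v = (\<lambda>x. (cmod (pos z x p - z j1))\<^sup>2)"
    note [measurable] = measurable_pos[OF p]
    show ?thesis unfolding a by measurable
  qed
  have ve: "pos_ext (\<lambda>u. complex_of_real (v (cfg (Y u)))) (v x)" if Y: "adm x Y" for x Y
    using v
  proof (elim disjE bexE conjE)
    fix a assume a: "a \<in> Pts" "a \<noteq> p" "v = (\<lambda>x. 1 / (cmod (pos z x a - pos z x p))\<^sup>2)"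
    show ?thesis unfolding a(3) by (rule pos_ext_pair(1)[OF Y a(1) p a(2)])
  next
    fix q assume q: "q \<in> I" "p = Inl q" and a: "v = (\<lambda>x. (cmod (pos z x p - z j1))\<^sup>2)"
    have "Inr j1 \<in> Pts" "p \<noteq> Inr j1" using j1 q by auto
    from pos_ext_pair(2)[OF Y p this] show ?thesis unfolding a by simp
  qed
  obtain C where C: "\<And>x Y. x \<in> Dst \<Longrightarrow> adm x Y \<Longrightarrow> annulus_ext (\<lambda>u. D (cfg (Y u))) C"
    using salg_ext[OF D] by blast
  obtain CD d where CD: "0 \<le> CD" "\<And>x. cmod (D x) \<le> CD * (1 + V x) ^ d" using salg_growth[OF D] by blast
  note [measurable] = salg_measurable[OF D] vm
  have bound: "norm (\<integral> x. of_real \<eta> * of_real (v x) * gcut \<eta> x * D x * F x \<partial>config_measure I)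
      \<le> \<bar>C\<bar> * F_const * rest \<eta>" if \<eta>: "\<eta> > 0" for \<eta>
  proof -
    have "norm (\<integral> x. of_real \<eta> * of_real (v x) * gcut \<eta> x * D x * F x \<partial>config_measure I)
        \<le> (\<integral> x. \<bar>C\<bar> * F_const * (min 9 (2 * \<eta> * V x) * cmod (F x)) \<partial>config_measure I)"
    proof (rule star_estimate)
      have "integrable (config_measure I) (\<lambda>x. gcut \<eta> x * (of_real (v x) * D x) * F x)"
      proof (rule integrable_gcut[OF \<eta>, of _ CD "Suc d"])
        fix x
        have "v x * cmod (D x) \<le> (1 + V x) * (CD * (1 + V x) ^ d)"
          using vV[of x] CD V_nonneg[of x] by (intro mult_mono) auto
        then show "cmod (of_real (v x) * D x) \<le> CD * (1 + V x) ^ Suc d"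
          using vV[of x] by (simp add: norm_mult mult_ac)
      qed (use CD in \<open>auto\<close>)
      then have "integrable (config_measure I) (\<lambda>x. of_real \<eta> * (gcut \<eta> x * (of_real (v x) * D x) * F x))"
        by (rule integrable_mult_right)
      then show "integrable (config_measure I) (\<lambda>x. of_real \<eta> * of_real (v x) * gcut \<eta> x * D x * F x)"
        by (simp add: mult_ac)
      show "integrable (config_measure I) (\<lambda>x. \<bar>C\<bar> * F_const * (min 9 (2 * \<eta> * V x) * cmod (F x)))"
        using integrable_rest[of \<eta>] \<eta> by auto
      show "0 \<le> \<bar>C\<bar> * F_const * (min 9 (2 * \<eta> * V x) * cmod (F x))" for x
        using F_const_pos V_nonneg[of x] \<eta> by (intro mult_nonneg_nonneg) auto
      show "of_real \<eta> * of_real (v x) * gcut \<eta> x * D x * F x = 0"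
        if "x \<in> space (config_measure I)" "x \<notin> Dst" for x using F_Dst[OF that] by simp
      fix x Y assume x: "x \<in> Dst" and Y: "adm x Y"
      have "annulus_ext (\<lambda>u. of_real \<eta> * of_real (v (cfg (Y u))) * gcut \<eta> (cfg (Y u)) * D (cfg (Y u)) * F (cfg (Y u)))
         (min 9 (2 * \<eta> * V x) * C * (F_const * cmod (F x)))"
        using \<eta> by (intro annulus_ext_mult gcut_ext(2)[OF Y _ ve[OF Y]] C[OF x Y] annulus_ext_F[OF x Y] vV) auto
      then show "annulus_ext (\<lambda>u. of_real \<eta> * of_real (v (\<lambda>q\<in>I. Y u (Inl q))) * gcut \<eta> (\<lambda>q\<in>I. Y u (Inl q))
          * D (\<lambda>q\<in>I. Y u (Inl q)) * F (\<lambda>q\<in>I. Y u (Inl q)))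
         (\<bar>C\<bar> * F_const * (min 9 (2 * \<eta> * V x) * cmod (F x)))"
        using annulus_ext_nonneg[OF C[OF x Y]] unfolding cfg_def by (simp add: mult_ac)
    qed
    also have "\<dots> = \<bar>C\<bar> * F_const * rest \<eta>" unfolding rest_def by simp
    finally show ?thesis .
  qed
  have "(\<lambda>n. \<bar>C\<bar> * F_const * rest (1 / real (Suc n))) \<longlonglongrightarrow> \<bar>C\<bar> * F_const * 0"
    by (intro tendsto_mult_left rest_tendsto_0)
  then have lim: "(\<lambda>n. \<bar>C\<bar> * F_const * rest (1 / real (Suc n))) \<longlonglongrightarrow> 0" by simp
  show ?thesis
  proof (rule Lim_null_comparison[OF _ lim], rule always_eventually, rule allI)
    fix n
    show "norm (\<integral> x. of_real (1 / real (Suc n)) * of_real (v x) * gcut (1 / real (Suc n)) x * D x * F x \<partial>config_measure I)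
      \<le> \<bar>C\<bar> * F_const * rest (1 / real (Suc n))" by (rule bound) simp
  qed
qed

lemma measurable_cut_set [measurable]: "cut_set I J z \<epsilon> \<in> sets (config_measure I)"
proof -
  have "closed (- (\<Union>l\<in>J. ball (z l) \<epsilon>))" by (intro closed_Compl open_UN) auto
  then have B: "- (\<Union>l\<in>J. ball (z l) \<epsilon>) \<in> sets borel" by simp
  have "cut_set I J z \<epsilon> = {x \<in> space (config_measure I). \<forall>q\<in>I. x q \<in> - (\<Union>l\<in>J. ball (z l) \<epsilon>)}"
    by (auto simp: cut_set_def)
  also have "\<dots> \<in> sets (config_measure I)"
  proof (intro sets.sets_Collect_finite_All finite_I)
    fix q assume "q \<in> I"
    then show "{x \<in> space (config_measure I). x q \<in> - (\<Union>l\<in>J. ball (z l) \<epsilon>)} \<in> sets (config_measure I)"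
      using B by measurable
  qed
  finally show ?thesis .
qed

lemma integrable_uncut:
  "integrable (config_measure I) (\<lambda>x. (1 - indicator (cut_set I J z \<epsilon>) x) * cmod (F x))"
proof -
  have "integrable (config_measure I) (\<lambda>x. cmod (F x) - indicator (cut_set I J z \<epsilon>) x * cmod (F x))"
    by (intro Bochner_Integration.integrable_diff integrable_indicator_mult measurable_cut_set
        integrable_norm F_integrable)
  then show ?thesis by (simp add: algebra_simps)
qed

lemma cut_integrable:
  assumes D: "D \<in> salg" and k: "p = Inr k" and \<epsilon>: "\<epsilon> > 0"
  shows "integrable (config_measure I) (\<lambda>x. indicator (cut_set I J z \<epsilon>) x * D x * F x)"
proof -
  obtain C where C: "\<And>x. (\<forall>q\<in>I. \<epsilon> \<le> cmod (x q - z k)) \<Longrightarrow> cmod (D x) \<le> C"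
    using salg_bounded_away[OF D k \<epsilon>] by blast
  have kJ: "k \<in> J" using p k by auto
  note [measurable] = salg_measurable[OF D]
  show ?thesis
  proof (rule Bochner_Integration.integrable_bound[of _ "\<lambda>x. \<bar>C\<bar> * cmod (F x)"])
    show "AE x in config_measure I. norm (indicator (cut_set I J z \<epsilon>) x * D x * F x) \<le> norm (\<bar>C\<bar> * cmod (F x))"
    proof (rule AE_I2)
      fix x
      show "norm (indicator (cut_set I J z \<epsilon>) x * D x * F x) \<le> norm (\<bar>C\<bar> * cmod (F x))"
      proof (cases "x \<in> cut_set I J z \<epsilon>")
        case True
        then have "\<forall>q\<in>I. \<epsilon> \<le> cmod (x q - z k)"
          using kJ by (auto simp: cut_set_def dist_norm norm_minus_commute not_less)
        from C[OF this] show ?thesis using True by (auto simp: norm_mult intro!: mult_right_mono)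
      qed simp
    qed
  qed (use F_integrable in auto)
qed

text \<open>Balls about \<open>z k\<close> are invariant, since distances from \<open>z k\<close>
  are preserved. Points that move stay within \<open>\<delta>\<close> of \<open>z k\<close>, hence
  outside the balls about other fixed points, whose centers are more than
  \<open>4 * \<delta>\<close> away.\<close>

lemma cut_indicator_adm:
  assumes Y: "adm x Y" and k: "p = Inr k" and \<epsilon>: "0 < \<epsilon>" "\<epsilon> \<le> \<delta>" and u: "cmod u = 1" and x: "x \<in> Dst"
  shows "cfg (Y u) \<in> cut_set I J z \<epsilon> \<longleftrightarrow> x \<in> cut_set I J z \<epsilon>"
proof -
  have kJ: "k \<in> J" using p k by auto
  have *: "Y u (Inl q) \<in> ball (z l) \<epsilon> \<longleftrightarrow> x q \<in> ball (z l) \<epsilon>" if q: "q \<in> I" and l: "l \<in> J" for q l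
  proof -
    have Yq: "cmod (Y u (Inl q) - z k) = cmod (x q - z k)"
      "Y u (Inl q) = x q \<or> cmod (x q - z k) \<le> \<delta>"
    proof -
      have "\<forall>a\<in>Pts. cmod (Y u a - z k) = cmod (pos z x a - z k) \<and> (Y u a = pos z x a \<or> cmod (pos z x a - z k) \<le> \<delta>)"
        using Y k u unfolding adm_def by blast
      from bspec[OF this, of "Inl q"] show "cmod (Y u (Inl q) - z k) = cmod (x q - z k)"
        "Y u (Inl q) = x q \<or> cmod (x q - z k) \<le> \<delta>" using q by auto
    qed
    show ?thesis
    proof (cases "l = k")
      case True
      then show ?thesis using Yq by (simp add: dist_norm norm_minus_commute)
    next
      case False
      have out: "w \<notin> ball (z l) \<epsilon>" if "cmod (w - z k) \<le> \<delta>" for w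
      proof
        assume "w \<in> ball (z l) \<epsilon>"
        then have "cmod (z l - w) < \<delta>" using \<epsilon> by (simp add: dist_norm)
        moreover have "4 * \<delta> < cmod (z l - z k)" using \<delta>_sep l kJ False by blast
        ultimately show False using that \<delta> norm_triangle_ineq[of "z l - w" "w - z k"] by simp
      qed
      from Yq(2) show ?thesis
      proof
        assume "cmod (x q - z k) \<le> \<delta>"
        then show ?thesis using out Yq(1) by metis
      qed simp
    qed
  qed
  have "x \<in> space (config_measure I)" using x by (simp add: Dst_def)
  moreover have "cfg (Y u) \<in> space (config_measure I)" by (simp add: cfg_def space_PiM)
  ultimately show ?thesis using * unfolding cut_set_def cfg_def by auto
qed

text \<open>The difference of the two cutoffs is \<open>- (1 - indicator) + (1 - gcut)\<close>: the
  first term is constant along orbits, and the second has the majorant of \<open>rest\<close>.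
  Estimating the two integrals separately by absolute values would not give a uniform bound.\<close>

lemma cut_gcut_close:
  assumes D: "D \<in> salg" and k: "p = Inr k"
  shows "\<exists>C\<ge>0. \<forall>\<epsilon> \<eta>. 0 < \<epsilon> \<longrightarrow> \<epsilon> \<le> \<delta> \<longrightarrow> 0 < \<eta> \<longrightarrow>
    norm ((\<integral> x. indicator (cut_set I J z \<epsilon>) x * D x * F x \<partial>config_measure I)
      - (\<integral> x. gcut \<eta> x * D x * F x \<partial>config_measure I))
    \<le> C * ((\<integral> x. (1 - indicator (cut_set I J z \<epsilon>) x) * cmod (F x) \<partial>config_measure I) + rest \<eta>)"
proof -
  obtain C where C: "\<And>x Y. x \<in> Dst \<Longrightarrow> adm x Y \<Longrightarrow> annulus_ext (\<lambda>u. D (cfg (Y u))) C"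
    using salg_ext[OF D] by blast
  show ?thesis
  proof (intro exI[of _ "\<bar>C\<bar> * F_const"] conjI allI impI)
    show "0 \<le> \<bar>C\<bar> * F_const" using F_const_pos by simp
    fix \<epsilon> \<eta> :: real assume \<epsilon>: "0 < \<epsilon>" "\<epsilon> \<le> \<delta>" and \<eta>: "0 < \<eta>"
    let ?M = "config_measure I" and ?c = "indicator (cut_set I J z \<epsilon>)"
    have i1: "integrable ?M (\<lambda>x. (1 - ?c x) * cmod (F x))"
      by (rule integrable_uncut)
    have i2: "integrable ?M (\<lambda>x. min 9 (2 * \<eta> * V x) * cmod (F x))"
      using integrable_rest[of \<eta>] \<eta> by simp
    have diff: "(\<integral> x. ?c x * D x * F x \<partial>?M) - (\<integral> x. gcut \<eta> x * D x * F x \<partial>?M)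
        = (\<integral> x. ?c x * D x * F x - gcut \<eta> x * D x * F x \<partial>?M)"
      by (rule Bochner_Integration.integral_diff[symmetric, OF cut_integrable[OF D k \<epsilon>(1)] integrable_gcut_salg[OF \<eta> D]])
    have "norm (\<integral> x. ?c x * D x * F x - gcut \<eta> x * D x * F x \<partial>?M) \<le> (\<integral> x. \<bar>C\<bar> * F_const * ((1 - ?c x) * cmod (F x) + min 9 (2 * \<eta> * V x) * cmod (F x)) \<partial>?M)"
    proof (rule star_estimate)
      show "integrable ?M (\<lambda>x. ?c x * D x * F x - gcut \<eta> x * D x * F x)"
        by (rule Bochner_Integration.integrable_diff[OF cut_integrable[OF D k \<epsilon>(1)] integrable_gcut_salg[OF \<eta> D]])
      show "integrable ?M (\<lambda>x. \<bar>C\<bar> * F_const * ((1 - ?c x) * cmod (F x) + min 9 (2 * \<eta> * V x) * cmod (F x)))"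
        by (intro integrable_mult_right Bochner_Integration.integrable_add i1 i2)
      show "0 \<le> \<bar>C\<bar> * F_const * ((1 - ?c x) * cmod (F x) + min 9 (2 * \<eta> * V x) * cmod (F x))" for x
        using F_const_pos V_nonneg[of x] \<eta>
        by (intro mult_nonneg_nonneg add_nonneg_nonneg) (auto simp: indicator_def)
      show "?c x * D x * F x - gcut \<eta> x * D x * F x = 0" if "x \<in> space ?M" "x \<notin> Dst" for x
        using F_Dst[OF that] by simp
      fix x Y assume x: "x \<in> Dst" and Y: "adm x Y"
      have "annulus_ext (\<lambda>u. - (1 - ?c x) + (1 - gcut \<eta> (cfg (Y u)))) ((1 - ?c x) + min 9 (2 * \<eta> * V x))"
        by (intro annulus_ext_add annulus_ext_const gcut_ext(1)[OF Y]) (use \<eta> in \<open>auto simp: indicator_def\<close>)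
      then have "annulus_ext (\<lambda>u. (- (1 - ?c x) + (1 - gcut \<eta> (cfg (Y u)))) * D (cfg (Y u)) * F (cfg (Y u)))
          (((1 - ?c x) + min 9 (2 * \<eta> * V x)) * C * (F_const * cmod (F x)))"
        by (intro annulus_ext_mult C[OF x Y] annulus_ext_F[OF x Y])
      then have "annulus_ext (\<lambda>u. ?c (cfg (Y u)) * D (cfg (Y u)) * F (cfg (Y u)) - gcut \<eta> (cfg (Y u)) * D (cfg (Y u)) * F (cfg (Y u)))
          (((1 - ?c x) + min 9 (2 * \<eta> * V x)) * C * (F_const * cmod (F x)))"
      proof (rule annulus_ext_cong)
        fix u :: complex assume u: "cmod u = 1"
        have "?c (cfg (Y u)) = (?c x :: complex)"
          using cut_indicator_adm[OF Y k \<epsilon> u x] by (simp add: indicator_def)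
        then show "(- (1 - ?c x) + (1 - gcut \<eta> (cfg (Y u)))) * D (cfg (Y u)) * F (cfg (Y u))
            = ?c (cfg (Y u)) * D (cfg (Y u)) * F (cfg (Y u)) - gcut \<eta> (cfg (Y u)) * D (cfg (Y u)) * F (cfg (Y u))"
          by (simp add: algebra_simps)
      qed
      note ext = this[unfolded cfg_def]
      have "((1 - ?c x) + min 9 (2 * \<eta> * V x)) * C * (F_const * cmod (F x))
          = \<bar>C\<bar> * F_const * ((1 - ?c x) * cmod (F x) + min 9 (2 * \<eta> * V x) * cmod (F x))"
        unfolding distrib_right[symmetric] abs_of_nonneg[OF annulus_ext_nonneg[OF C[OF x Y]]]
        by (simp only: mult_ac)
      from annulus_ext_mono[OF ext eq_refl[OF this]]
      show "annulus_ext (\<lambda>u. ?c (\<lambda>q\<in>I. Y u (Inl q)) * D (\<lambda>q\<in>I. Y u (Inl q)) * F (\<lambda>q\<in>I. Y u (Inl q))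
          - gcut \<eta> (\<lambda>q\<in>I. Y u (Inl q)) * D (\<lambda>q\<in>I. Y u (Inl q)) * F (\<lambda>q\<in>I. Y u (Inl q)))
          (\<bar>C\<bar> * F_const * ((1 - ?c x) * cmod (F x) + min 9 (2 * \<eta> * V x) * cmod (F x)))" .
    qed
    also have "\<dots> = \<bar>C\<bar> * F_const * ((\<integral> x. (1 - ?c x) * cmod (F x) \<partial>?M) + rest \<eta>)"
      unfolding rest_def Bochner_Integration.integral_add[OF i1 i2, symmetric]
      by (rule integral_mult_right_zero)
    finally show "norm ((\<integral> x. ?c x * D x * F x \<partial>?M) - (\<integral> x. gcut \<eta> x * D x * F x \<partial>?M))
      \<le> \<bar>C\<bar> * F_const * ((\<integral> x. (1 - ?c x) * cmod (F x) \<partial>?M) + rest \<eta>)" unfolding diff .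
  qed
qed

lemma uncut_tendsto_0:
  "((\<lambda>\<epsilon>. \<integral> x. (1 - indicator (cut_set I J z \<epsilon>) x) * cmod (F x) \<partial>config_measure I) \<longlongrightarrow> 0) (at_right 0)"
proof -
  let ?M = "config_measure I"
  define e where "e \<epsilon> = (\<integral> x. (1 - indicator (cut_set I J z \<epsilon>) x) * cmod (F x) \<partial>?M)" for \<epsilon>
  note i1 = integrable_uncut
  have lim: "(\<lambda>n. e (1 / real (Suc n))) \<longlonglongrightarrow> (\<integral> x. 0 \<partial>?M)"
    unfolding e_def
  proof (rule integral_dominated_convergence[where w = "\<lambda>x. cmod (F x)"])
    show "AE x in ?M. (\<lambda>n. (1 - indicator (cut_set I J z (1 / real (Suc n))) x) * cmod (F x)) \<longlonglongrightarrow> 0"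
    proof (rule AE_I2)
      fix x assume x: "x \<in> space ?M"
      show "(\<lambda>n. (1 - indicator (cut_set I J z (1 / real (Suc n))) x) * cmod (F x)) \<longlonglongrightarrow> 0"
      proof (cases "x \<in> Dst")
        case True
        have pos: "0 < dist (z l) (x q)" if "q \<in> I" "l \<in> J" for q l
        proof -
          have "Inl q \<in> Pts" "Inr l \<in> Pts" using that by auto
          then have "pos z x (Inl q) \<noteq> pos z x (Inr l)"
            using True inj_onD[of "pos z x" Pts "Inl q" "Inr l"] unfolding Dst_def by blast
          then show ?thesis by auto
        qed
        have "finite (I \<times> J)" using finite_I finite_J by simp
        then have "eventually (\<lambda>n. \<forall>ql\<in>I \<times> J. 1 / real (Suc n) \<le> dist (z (snd ql)) (x (fst ql))) sequentially"
        proof (intro eventually_ball_finite ballI)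
          fix ql assume "ql \<in> I \<times> J"
          then have "0 < dist (z (snd ql)) (x (fst ql))" using pos by auto
          then have "eventually (\<lambda>n. inverse (real (Suc n)) < dist (z (snd ql)) (x (fst ql))) sequentially"
            by (intro order_tendstoD(2)[OF LIMSEQ_inverse_real_of_nat])
          then show "eventually (\<lambda>n. 1 / real (Suc n) \<le> dist (z (snd ql)) (x (fst ql))) sequentially"
            by eventually_elim (simp add: inverse_eq_divide)
        qed
        then have "eventually (\<lambda>n. x \<in> cut_set I J z (1 / real (Suc n))) sequentially"
          by eventually_elim (use x in \<open>fastforce simp: cut_set_def\<close>)
        then show ?thesis
          by (intro tendsto_eventually) (auto elim!: eventually_mono)
      qed (simp add: F_Dst[OF x])
    qed
    show "integrable ?M (\<lambda>x. cmod (F x))" by (intro integrable_norm F_integrable)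
    show "(\<lambda>x. (1 - indicator (cut_set I J z (1 / real (Suc n))) x) * cmod (F x)) \<in> borel_measurable ?M" for n
      using integrable_uncut by (rule borel_measurable_integrable)
    show "AE x in ?M. norm ((1 - indicator (cut_set I J z (1 / real (Suc n))) x) * cmod (F x)) \<le> cmod (F x)" for n
      by (rule AE_I2) (simp add: indicator_def)
  qed simp
  \<comment> \<open>Monotonicity passes from the sequence \<open>1 / Suc n\<close> to all small
    \<open>\<epsilon>\<close>.\<close>
  have mono: "e \<epsilon> \<le> e \<epsilon>'" if "\<epsilon> \<le> \<epsilon>'" for \<epsilon> \<epsilon>'
  proof -
    have "cut_set I J z \<epsilon>' \<subseteq> cut_set I J z \<epsilon>" using that unfolding cut_set_def by fastforce
    then show ?thesis unfolding e_def
      by (intro integral_mono i1 mult_right_mono) (auto simp: indicator_def)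
  qed
  have e0: "0 \<le> e \<epsilon>" for \<epsilon>
    unfolding e_def by (intro integral_nonneg_AE AE_I2) (auto simp: indicator_def)
  have "(e \<longlongrightarrow> 0) (at_right 0)"
  proof (rule tendstoI)
    fix r :: real assume "r > 0"
    then obtain n where n: "e (1 / real (Suc n)) < r"
      using order_tendstoD(2)[OF lim, of r] by (auto simp: eventually_sequentially)
    have "eventually (\<lambda>\<epsilon>. \<epsilon> \<in> {0<..<1 / real (Suc n)}) (at_right 0)"
      by (rule eventually_at_right_real) simp
    then show "eventually (\<lambda>\<epsilon>. dist (e \<epsilon>) 0 < r) (at_right 0)"
    proof eventually_elim
      case (elim \<epsilon>)
      then show ?case using mono[of \<epsilon> "1 / real (Suc n)"] n e0[of \<epsilon>] by simp
    qed
  qed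
  then show ?thesis unfolding e_def .
qed

theorem star_limit:
  assumes D: "D \<in> salg" and k: "p = Inr k"
  shows "\<exists>L. ((\<lambda>\<epsilon>. \<integral> x. indicator (cut_set I J z \<epsilon>) x * D x * F x \<partial>config_measure I) \<longlongrightarrow> L) (at_right 0)
    \<and> (\<lambda>n. \<integral> x. gcut (1 / real (Suc n)) x * D x * F x \<partial>config_measure I) \<longlonglongrightarrow> L"
  using cut_gcut_close[OF D k]
proof (elim exE conjE)
  fix C assume C: "\<forall>\<epsilon> \<eta>. 0 < \<epsilon> \<longrightarrow> \<epsilon> \<le> \<delta> \<longrightarrow> 0 < \<eta> \<longrightarrow>
    norm ((\<integral> x. indicator (cut_set I J z \<epsilon>) x * D x * F x \<partial>config_measure I)
      - (\<integral> x. gcut \<eta> x * D x * F x \<partial>config_measure I))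
    \<le> C * ((\<integral> x. (1 - indicator (cut_set I J z \<epsilon>) x) * cmod (F x) \<partial>config_measure I) + rest \<eta>)"
  show ?thesis
    by (rule common_limit[OF \<delta> _ uncut_tendsto_0 rest_tendsto_0], unfold dist_norm, rule C[rule_format]) auto
qed

end

section \<open>The algebra of differential polynomials\<close>

lemma lookup_partial:
  "Poly_Mapping.lookup (partial v F) m =
     of_nat (Poly_Mapping.lookup m v + 1) * Poly_Mapping.lookup F (m + Poly_Mapping.single v 1)"
proof -
  let ?e = "Poly_Mapping.single v (1::nat)"
  have sub: "(k - ?e = m \<and> Poly_Mapping.lookup k v \<noteq> 0) \<longleftrightarrow> k = m + ?e" for k
  proof
    assume a: "k - ?e = m \<and> Poly_Mapping.lookup k v \<noteq> 0"
    have "k = (k - ?e) + ?e"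
    proof (rule poly_mapping_eqI)
      fix w show "Poly_Mapping.lookup k w = Poly_Mapping.lookup (k - ?e + ?e) w"
        using conjunct2[OF a] by (cases "w = v") (simp_all add: lookup_add lookup_minus lookup_single when_def)
    qed
    with a show "k = m + ?e" by simp
  next
    assume "k = m + ?e" then show "k - ?e = m \<and> Poly_Mapping.lookup k v \<noteq> 0"
      by (simp add: lookup_add)
  qed
  have "Poly_Mapping.lookup (partial v F) m =
      (\<Sum>k\<in>Poly_Mapping.keys F. (of_nat (Poly_Mapping.lookup k v) * Poly_Mapping.lookup F k when k - ?e = m))"
    by (simp add: partial_def lookup_sum lookup_single)
  also have "\<dots> = (\<Sum>k\<in>Poly_Mapping.keys F. (of_nat (Poly_Mapping.lookup k v) * Poly_Mapping.lookup F k when k = m + ?e))"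
    by (intro sum.cong refl) (use sub in \<open>force simp: when_def\<close>)
  also have "\<dots> = (\<Sum>k\<in>{m + ?e}. (of_nat (Poly_Mapping.lookup k v) * Poly_Mapping.lookup F k when k = m + ?e))"
    by (rule sum.mono_neutral_cong) (auto simp: when_def in_keys_iff)
  finally show ?thesis by (simp add: lookup_add)
qed

lemma cst_hom [simp]:
  "cst 0 = 0" "cst 1 = 1" "cst (a + b) = cst a + cst b" "cst (a * b) = cst a * cst b" "cst (- a) = - cst a"
  by (simp_all add: cst_def single_add mult_single single_uminus)

lemma cst_of_nat: "cst (of_nat n) = of_nat n"
  by (simp add: cst_def)

lemma lookup_cst_mult: "Poly_Mapping.lookup (cst c * F) m = c * Poly_Mapping.lookup F m"
proof -
  have "Poly_Mapping.lookup (Poly_Mapping.map ((*) c) F) m = c * Poly_Mapping.lookup F m"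
    by (simp add: Poly_Mapping.map.rep_eq when_def)
  then show ?thesis
    unfolding cst_def mult_map_scale_conv_mult[symmetric] .
qed

lemma partial_add: "partial v (F + G) = partial v F + partial v G"
  by (rule poly_mapping_eqI) (simp add: lookup_partial lookup_add algebra_simps)

lemma partial_zero [simp]: "partial v 0 = 0"
  by (simp add: partial_def)

lemma partial_sum: "partial v (\<Sum>i\<in>A. F i) = (\<Sum>i\<in>A. partial v (F i))"
  by (induction A rule: infinite_finite_induct) (simp_all add: partial_add)

lemma partial_cst_mult: "partial v (cst c * F) = cst c * partial v F"
  by (rule poly_mapping_eqI) (simp add: lookup_partial lookup_cst_mult)

lemma partial_one [simp]: "partial v 1 = 0"
  by (simp add: partial_def)

lemma partial_commute: "partial v (partial w F) = partial w (partial v F)"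
proof (rule poly_mapping_eqI)
  fix m
  show "Poly_Mapping.lookup (partial v (partial w F)) m = Poly_Mapping.lookup (partial w (partial v F)) m"
    by (cases "v = w") (simp_all add: lookup_partial lookup_add lookup_single add_ac)
qed

definition vars :: "'r dpoly \<Rightarrow> (nat \<times> 'r) set" where
  "vars F = (\<Union>m\<in>Poly_Mapping.keys F. Poly_Mapping.keys m)"

lemma finite_vars: "finite (vars F)"
  by (simp add: vars_def)

lemma partial_eq_0: "v \<notin> vars F \<Longrightarrow> partial v F = 0"
  unfolding partial_def vars_def
  by (rule sum.neutral) (auto simp: in_keys_iff)

lemma partial_dir_add: "partial_dir u n (F + G) = partial_dir u n F + partial_dir u n G"
  by (simp add: partial_dir_def partial_add distrib_left sum.distrib)

lemma partial_dir_zero [simp]: "partial_dir u n 0 = 0"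
  by (simp add: partial_dir_def)

lemma partial_dir_cst_mult: "partial_dir u n (cst c * F) = cst c * partial_dir u n F"
  by (simp add: partial_dir_def partial_cst_mult sum_distrib_left mult.left_commute)

lemma partial_dir_commute: "partial_dir u n (partial_dir w m F) = partial_dir w m (partial_dir u n F)"
  unfolding partial_dir_def
  by (simp add: partial_sum partial_cst_mult sum_distrib_left)
     (subst sum.swap, simp add: mult_ac partial_commute)

section \<open>Evaluation of differential polynomials\<close>

text \<open>The structure map is a parameter because the same polynomial is evaluated at numbers, at
  polynomials in a shift parameter, and at power series.\<close>

locale coefficient_hom =
  fixes c :: "complex \<Rightarrow> 'b::comm_ring_1"
  assumes c_add: "c (x + y) = c x + c y" and c_mult: "c (x * y) = c x * c y" and c_one: "c 1 = 1"
begin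

lemma c_zero [simp]: "c 0 = 0"
  using c_add[of 0 0] by simp

abbreviation monom_val :: "(nat \<times> 'r \<Rightarrow> 'b) \<Rightarrow> ((nat \<times> 'r) \<Rightarrow>\<^sub>0 nat) \<Rightarrow> 'b" where
  "monom_val f m \<equiv> (\<Prod>v\<in>Poly_Mapping.keys m. f v ^ Poly_Mapping.lookup m v)"

lemma monom_val_superset:
  "finite V \<Longrightarrow> Poly_Mapping.keys m \<subseteq> V \<Longrightarrow> monom_val f m = (\<Prod>v\<in>V. f v ^ Poly_Mapping.lookup m v)"
  by (rule prod.mono_neutral_left) (auto simp: in_keys_iff)

lemma monom_val_add: "monom_val f (m + m') = monom_val f m * monom_val f m'"
proof -
  let ?V = "Poly_Mapping.keys m \<union> Poly_Mapping.keys m'"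
  have "monom_val f (m + m') = (\<Prod>v\<in>?V. f v ^ Poly_Mapping.lookup (m + m') v)"
    by (rule monom_val_superset) (auto dest: subsetD[OF keys_add])
  also have "\<dots> = (\<Prod>v\<in>?V. f v ^ Poly_Mapping.lookup m v) * (\<Prod>v\<in>?V. f v ^ Poly_Mapping.lookup m' v)"
    by (simp add: lookup_add power_add prod.distrib)
  finally show ?thesis by (simp add: monom_val_superset[of ?V])
qed

lemma peval_superset:
  "finite K \<Longrightarrow> Poly_Mapping.keys F \<subseteq> K \<Longrightarrow> peval c f F = (\<Sum>m\<in>K. c (Poly_Mapping.lookup F m) * monom_val f m)"
  unfolding peval_def by (rule sum.mono_neutral_left) (auto simp: in_keys_iff)

lemma peval_zero [simp]: "peval c f 0 = 0"
  by (simp add: peval_def)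

lemma peval_single: "peval c f (Poly_Mapping.single m x) = c x * monom_val f m"
  by (cases "x = 0") (simp_all add: peval_def)

lemma peval_cst [simp]: "peval c f (cst x) = c x"
  by (simp add: cst_def peval_single)

lemma peval_one [simp]: "peval c f 1 = 1"
  using peval_cst[of f 1] by (simp add: c_one del: peval_cst)

lemma peval_phi [simp]: "peval c f (phi v) = f v"
  by (simp add: phi_def peval_single c_one)

lemma peval_add: "peval c f (F + G) = peval c f F + peval c f G"
proof -
  let ?K = "Poly_Mapping.keys F \<union> Poly_Mapping.keys G"
  have "peval c f (F + G) = (\<Sum>m\<in>?K. c (Poly_Mapping.lookup (F + G) m) * monom_val f m)"
    by (rule peval_superset) (auto dest: subsetD[OF keys_add])
  then show ?thesis
    by (simp add: peval_superset[of ?K] lookup_add c_add distrib_right sum.distrib)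
qed

lemma peval_sum: "peval c f (\<Sum>i\<in>A. F i) = (\<Sum>i\<in>A. peval c f (F i))"
  by (induction A rule: infinite_finite_induct) (simp_all add: peval_add)

end

lemma dpoly_expand: "F = (\<Sum>m\<in>Poly_Mapping.keys F. Poly_Mapping.single m (Poly_Mapping.lookup F m))"
  for F :: "'r dpoly"
proof (rule poly_mapping_eqI)
  fix k
  have "Poly_Mapping.lookup F k = (\<Sum>m\<in>Poly_Mapping.keys F. if m = k then Poly_Mapping.lookup F m else 0)"
    by (simp add: in_keys_iff)
  then show "Poly_Mapping.lookup F k
      = Poly_Mapping.lookup (\<Sum>m\<in>Poly_Mapping.keys F. Poly_Mapping.single m (Poly_Mapping.lookup F m)) k"
    by (simp add: lookup_sum lookup_single when_def)
qed

lemma (in coefficient_hom) peval_mult: "peval c f (F * G) = peval c f F * peval c f G"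
proof -
  let ?s = "\<lambda>F m. Poly_Mapping.single m (Poly_Mapping.lookup F m)"
  have "F * G = (\<Sum>m\<in>Poly_Mapping.keys F. \<Sum>m'\<in>Poly_Mapping.keys G. ?s F m * ?s G m')"
    by (subst dpoly_expand[of F], subst dpoly_expand[of G]) (simp add: sum_product)
  then have "peval c f (F * G) = (\<Sum>m\<in>Poly_Mapping.keys F. \<Sum>m'\<in>Poly_Mapping.keys G.
      peval c f (?s F m) * peval c f (?s G m'))"
    by (simp add: peval_sum mult_single peval_single monom_val_add c_mult mult_ac)
  also have "\<dots> = (\<Sum>m\<in>Poly_Mapping.keys F. peval c f (?s F m)) * (\<Sum>m'\<in>Poly_Mapping.keys G. peval c f (?s G m'))"
    by (simp add: sum_product)
  finally show ?thesis
    by (simp only: peval_sum[symmetric] dpoly_expand[symmetric])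
qed

lemma peval_hom:
  assumes "\<And>x y. h (x + y) = h x + h y" "\<And>x y. h (x * y) = h x * h y" "h 1 = 1" "h 0 = 0"
  shows "h (peval c f F) = peval (\<lambda>a. h (c a)) (\<lambda>v. h (f v)) F"
proof -
  have e: "h (x ^ n) = h x ^ n" for x n
    by (induction n) (simp_all add: assms)
  show ?thesis
    unfolding peval_def
  proof -
    have S: "h (\<Sum>i\<in>A. g i) = (\<Sum>i\<in>A. h (g i))" for A and g :: "(nat \<times> 'c \<Rightarrow>\<^sub>0 nat) \<Rightarrow> 'a"
      by (induction A rule: infinite_finite_induct) (simp_all add: assms)
    have P: "h (\<Prod>i\<in>A. g i) = (\<Prod>i\<in>A. h (g i))" for A and g :: "nat \<times> 'c \<Rightarrow> 'a"
      by (induction A rule: infinite_finite_induct) (simp_all add: assms)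
    show "h (\<Sum>m\<in>Poly_Mapping.keys F. c (Poly_Mapping.lookup F m)
        * (\<Prod>v\<in>Poly_Mapping.keys m. f v ^ Poly_Mapping.lookup m v)) =
      (\<Sum>m\<in>Poly_Mapping.keys F. h (c (Poly_Mapping.lookup F m))
        * (\<Prod>v\<in>Poly_Mapping.keys m. h (f v) ^ Poly_Mapping.lookup m v))"
      by (simp add: S P e assms)
  qed
qed

lemma peval_cong:
  "(\<And>v. v \<in> vars F \<Longrightarrow> f v = g v) \<Longrightarrow> peval c f F = peval c g F"
  unfolding peval_def vars_def
  by (intro sum.cong prod.cong refl arg_cong2[where f = "(*)"] arg_cong2[where f = "(^)"]) blast

lemma Vplus_vars: "F \<in> Vplus \<longleftrightarrow> (\<forall>v\<in>vars F. 1 \<le> fst v)"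
  by (auto simp: Vplus_def vars_def)

text \<open>Used with \<open>t\<close> a local coordinate or the formal Laurent variable, to collect
  poles, and with \<open>t = 1 / \<zeta>^2\<close>, to obtain the decay at infinity.\<close>

lemma peval_weighted:
  assumes "weighted_homogeneous s F"
  shows "peval c (\<lambda>v. t ^ fst v * f v) F = t ^ s * peval c f F"
  unfolding peval_def sum_distrib_left
proof (intro sum.cong refl)
  fix m assume m: "m \<in> Poly_Mapping.keys F"
  have "(\<Prod>v\<in>Poly_Mapping.keys m. (t ^ fst v * f v) ^ Poly_Mapping.lookup m v)
      = t ^ (\<Sum>v\<in>Poly_Mapping.keys m. fst v * Poly_Mapping.lookup m v)
        * (\<Prod>v\<in>Poly_Mapping.keys m. f v ^ Poly_Mapping.lookup m v)"
    by (simp add: power_mult_distrib prod.distrib power_sum power_mult)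
  then show "c (Poly_Mapping.lookup F m) * (\<Prod>v\<in>Poly_Mapping.keys m. (t ^ fst v * f v) ^ Poly_Mapping.lookup m v)
     = t ^ s * (c (Poly_Mapping.lookup F m) * (\<Prod>v\<in>Poly_Mapping.keys m. f v ^ Poly_Mapping.lookup m v))"
    using assms m unfolding weighted_homogeneous_def by (simp add: mult_ac)
qed

interpretation peval_id: coefficient_hom "id :: complex \<Rightarrow> complex"
  by standard auto

interpretation peval_poly: coefficient_hom "\<lambda>x :: complex. [:x:]"
  by standard (auto simp: one_pCons)

lemma poly_peval: "poly (peval (\<lambda>x. [:x:]) f F) t = peval id (\<lambda>v. poly (f v) t) F"
  by (subst peval_hom[where h = "\<lambda>p. poly p t"]) (simp_all add: id_def)

lemma pderiv_sum: "pderiv (\<Sum>i\<in>A. f i) = (\<Sum>i\<in>A. pderiv (f i))"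
  by (induction A rule: infinite_finite_induct) (simp_all add: pderiv_add)

text \<open>The chain rule. Summing over a superset of the variables allows rectangular index ranges
  later.\<close>

lemma pderiv_peval:
  assumes "finite V" "vars F \<subseteq> V"
  shows "pderiv (peval (\<lambda>x. [:x:]) f F) = (\<Sum>v\<in>V. pderiv (f v) * peval (\<lambda>x. [:x:]) f (partial v F))"
proof -
  let ?ev = "peval (\<lambda>x. [:x:]) f"
  let ?M = "peval_poly.monom_val f"
  have partial_expand: "?ev (partial v F) =
      (\<Sum>m\<in>Poly_Mapping.keys F. [:of_nat (Poly_Mapping.lookup m v) * Poly_Mapping.lookup F m:] * ?M (m - Poly_Mapping.single v 1))"
    for v by (simp add: partial_def peval_poly.peval_sum peval_poly.peval_single)
  have M: "pderiv (?M m) = (\<Sum>v\<in>V. pderiv (f v) * (of_nat (Poly_Mapping.lookup m v) * ?M (m - Poly_Mapping.single v 1)))"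
    if m: "m \<in> Poly_Mapping.keys F" for m
  proof -
    have sub: "Poly_Mapping.keys m \<subseteq> V" using assms(2) m by (auto simp: vars_def)
    have part: "?M (m - Poly_Mapping.single v 1)
        = f v ^ (Poly_Mapping.lookup m v - 1) * (\<Prod>w\<in>V - {v}. f w ^ Poly_Mapping.lookup m w)" if "v \<in> V" for v
    proof -
      have k: "Poly_Mapping.keys (m - Poly_Mapping.single v 1) \<subseteq> V"
        using sub by (auto simp: in_keys_iff lookup_minus)
      have "?M (m - Poly_Mapping.single v 1)
          = (\<Prod>w\<in>V. f w ^ Poly_Mapping.lookup (m - Poly_Mapping.single v 1) w)"
        by (rule peval_poly.monom_val_superset[OF assms(1) k])
      also have "\<dots> = f v ^ (Poly_Mapping.lookup m v - 1) * (\<Prod>w\<in>V - {v}. f w ^ Poly_Mapping.lookup m w)"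
        using assms(1) that
        by (auto simp: prod.remove[of V v] lookup_minus lookup_single when_def
            intro!: arg_cong2[where f = "(*)"] prod.cong)
      finally show ?thesis .
    qed
    have "?M m = (\<Prod>v\<in>V. f v ^ Poly_Mapping.lookup m v)"
      by (rule peval_poly.monom_val_superset[OF assms(1) sub])
    then have "pderiv (?M m) = (\<Sum>v\<in>V. (\<Prod>w\<in>V - {v}. f w ^ Poly_Mapping.lookup m w) * pderiv (f v ^ Poly_Mapping.lookup m v))"
      by (simp add: pderiv_prod)
    also have "\<dots> = (\<Sum>v\<in>V. pderiv (f v) * (of_nat (Poly_Mapping.lookup m v) * ?M (m - Poly_Mapping.single v 1)))"
      by (intro sum.cong refl) (simp add: part[unfolded One_nat_def] pderiv_power mult_ac of_nat_poly)
    finally show ?thesis .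
  qed
  have "pderiv (?ev F) = (\<Sum>m\<in>Poly_Mapping.keys F. [:Poly_Mapping.lookup F m:] * pderiv (?M m))"
    by (simp add: peval_def pderiv_sum pderiv_mult pderiv_smult)
  also have "\<dots> = (\<Sum>m\<in>Poly_Mapping.keys F. \<Sum>v\<in>V. pderiv (f v) *
      ([:of_nat (Poly_Mapping.lookup m v) * Poly_Mapping.lookup F m:] * ?M (m - Poly_Mapping.single v 1)))"
    by (intro sum.cong refl) (simp add: M sum_distrib_left of_nat_poly mult_ac)
  finally show ?thesis
    by (subst (asm) sum.swap) (simp add: partial_expand sum_distrib_left)
qed

section \<open>Exponentials of commuting operators and Taylor's formula\<close>

locale commuting_operators =
  fixes T :: "nat \<Rightarrow> 'r dpoly \<Rightarrow> 'r dpoly"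
  assumes T_add: "T n (F + G) = T n F + T n G"
    and T_scale: "T n (cst c * F) = cst c * T n F"
    and T_commute: "T n (T m F) = T m (T n F)"
begin

lemma T_zero [simp]: "T n 0 = 0"
  using T_add[of n 0 0] by simp

lemma T_sum: "T n (\<Sum>i\<in>A. F i) = (\<Sum>i\<in>A. T n (F i))"
  by (induction A rule: infinite_finite_induct) (simp_all add: T_add)

lemma T_of_nat: "T n (of_nat k * F) = of_nat k * T n F"
  using T_scale[of n "of_nat k" F] by (simp add: cst_of_nat)

lemma series_power_commute: "series_power T k m (T n F) = T n (series_power T k m F)"
  by (induction k arbitrary: m) (simp_all add: T_sum T_commute)

lemma series_power_eq_0: "m < k \<Longrightarrow> series_power T k m F = 0"
proof (induction k arbitrary: m)
  case (Suc k)
  then show ?case by (auto intro!: sum.neutral)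
qed simp

text \<open>With \<open>S\<close> the series of the \<open>T j t^j\<close>, this is the coefficient
  of \<open>t^m\<close> in \<open>t d/dt S^(k+1) = (k+1) (t S') S^k\<close>, where commutativity
  lets one factor be pulled to the front.\<close>

lemma series_power_recursion:
  "of_nat m * series_power T (Suc k) m F
     = of_nat (Suc k) * (\<Sum>n=1..m. of_nat n * T n (series_power T k (m - n) F))"
proof (induction k arbitrary: m)
  case 0
  then show ?case
    by (simp add: sum_distrib_left)
       (rule sum.cong, auto simp: le_antisym)
next
  case (Suc k)
  have swap: "(\<Sum>j=1..m. \<Sum>n=1..m - j. h j n) = (\<Sum>n=1..m. \<Sum>j=1..m - n. h j n)"
    for h :: "nat \<Rightarrow> nat \<Rightarrow> 'r dpoly"
  proof -
    have "(\<Sum>j\<in>{1..m}. \<Sum>n\<in>{n \<in> {1..m}. j + n \<le> m}. h j n) = (\<Sum>n\<in>{1..m}. \<Sum>j\<in>{j \<in> {1..m}. j + n \<le> m}. h j n)"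
      by (rule sum.swap_restrict) auto
    moreover have "{n \<in> {1..m}. j + n \<le> m} = {1..m - j}" "{n \<in> {1..m}. n + j \<le> m} = {1..m - j}" for j
      by auto
    ultimately show ?thesis by simp
  qed
  have "of_nat m * series_power T (Suc (Suc k)) m F
      = (\<Sum>j=1..m. of_nat m * T j (series_power T (Suc k) (m - j) F))"
    by (simp only: series_power.simps(2)[of T "Suc k"] sum_distrib_left)
  also have "\<dots> = (\<Sum>j=1..m. of_nat j * T j (series_power T (Suc k) (m - j) F)
      + T j (of_nat (m - j) * series_power T (Suc k) (m - j) F))"
  proof (rule sum.cong[OF refl])
    fix j assume "j \<in> {1..m}"
    then have "of_nat m = (of_nat j + of_nat (m - j) :: 'r dpoly)"
      by (simp flip: of_nat_add)
    then show "of_nat m * T j (series_power T (Suc k) (m - j) F) = of_nat j * T j (series_power T (Suc k) (m - j) F)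
      + T j (of_nat (m - j) * series_power T (Suc k) (m - j) F)"
      by (simp only: T_of_nat distrib_right)
  qed
  also have "\<dots> = (\<Sum>j=1..m. of_nat j * T j (series_power T (Suc k) (m - j) F))
      + (\<Sum>j=1..m. \<Sum>n=1..m - j. of_nat (Suc k) * (of_nat n * T n (T j (series_power T k (m - n - j) F))))"
    by (simp only: Suc.IH T_of_nat T_sum sum.distrib sum_distrib_left T_commute diff_diff_add add.commute)
  also have "\<dots> = (\<Sum>j=1..m. of_nat j * T j (series_power T (Suc k) (m - j) F))
      + of_nat (Suc k) * (\<Sum>n=1..m. of_nat n * T n (series_power T (Suc k) (m - n) F))"
    by (subst swap) (simp only: series_power.simps(2) T_sum sum_distrib_left)
  finally show ?case
    by (simp only: of_nat_Suc[of "Suc k"] distrib_right mult_1 add.commute)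
qed

lemma series_exp_bound: "m \<le> K \<Longrightarrow> series_exp T m F = (\<Sum>k\<le>K. cst (1 / fact k) * series_power T k m F)"
  unfolding series_exp_def by (rule sum.mono_neutral_left) (auto simp: series_power_eq_0)

lemma series_exp_0 [simp]: "series_exp T 0 F = F"
  by (simp add: series_exp_def)

text \<open>The identity \<open>t d/dt exp S = (t S') exp S\<close>. Together with
  \<open>series_exp_0\<close> it determines the exponential, which is how different descriptions of
  it are compared.\<close>

lemma series_exp_recursion:
  "of_nat m * series_exp T m F = (\<Sum>n=1..m. of_nat n * series_exp T (m - n) (T n F))"
proof (cases m)
  case (Suc l)
  have "of_nat m * series_exp T m F = (\<Sum>k\<le>Suc l. cst (1 / fact k) * (of_nat m * series_power T k m F))"
    unfolding series_exp_def Suc sum_distrib_left by (rule sum.cong[OF refl]) (simp only: mult.left_commute)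
  also have "\<dots> = (\<Sum>k\<le>l. cst (1 / fact (Suc k)) * (of_nat m * series_power T (Suc k) m F))"
    by (subst sum.atMost_Suc_shift) (simp add: Suc del: series_power.simps(2) of_nat_Suc fact_Suc)
  also have "\<dots> = (\<Sum>k\<le>l. \<Sum>n=1..m. of_nat n * (cst (1 / fact k) * series_power T k (m - n) (T n F)))"
  proof (rule sum.cong[OF refl])
    fix k
    have c: "cst (1 / fact (Suc k)) * of_nat (Suc k) = cst (1 / fact k)"
      unfolding cst_of_nat[symmetric] cst_hom(4)[symmetric] by (simp del: of_nat_Suc)
    show "cst (1 / fact (Suc k)) * (of_nat m * series_power T (Suc k) m F)
        = (\<Sum>n=1..m. of_nat n * (cst (1 / fact k) * series_power T k (m - n) (T n F)))"
      unfolding series_power_recursion mult.assoc[symmetric] c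
      by (simp add: sum_distrib_left series_power_commute mult_ac)
  qed
  also have "\<dots> = (\<Sum>n=1..m. of_nat n * series_exp T (m - n) (T n F))"
    by (subst sum.swap, intro sum.cong refl, subst series_exp_bound[of _ l])
       (auto simp: Suc sum_distrib_left)
  finally show ?thesis .
qed simp

end

lemma commuting_partial_dir:
  "commuting_operators (\<lambda>n G. cst (1 / (2 * of_nat n)) * partial_dir u n G)"
  by standard (simp_all add: partial_dir_add distrib_left partial_dir_cst_mult mult.left_commute
      partial_dir_commute[of u _ u] del: cst_hom(4))

lemma commuting_phi_dir: "commuting_operators (\<lambda>n G. phi_dir u n * G)"
  by standard (simp_all add: distrib_left mult_ac)

text \<open>Taylor's formula: the exponential of the derivations shifts
  \<open>\<phi>\<^sub>n\<close> by \<open>u t^n / (2 n)\<close>. Both sides obey the same recursion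
  in \<open>m\<close>, the left by the chain rule in \<open>t\<close>, the right by
  \<open>series_exp_recursion\<close>.\<close>

lemma peval_taylor:
  "poly.coeff (peval (\<lambda>x. [:x:]) (\<lambda>v. [:f v:] + monom (u $ snd v / (2 * of_nat (fst v))) (fst v)) P) m
     = peval id f (series_exp (\<lambda>n G. cst (1 / (2 * of_nat n)) * partial_dir u n G) m P)"
proof (induction m arbitrary: P rule: less_induct)
  case (less m)
  let ?T = "\<lambda>n G. cst (1 / (2 * of_nat n)) * partial_dir u n G"
  let ?g = "\<lambda>v. [:f v:] + monom (u $ snd v / (2 * of_nat (fst v))) (fst v)"
  let ?\<Theta> = "peval (\<lambda>x. [:x:]) ?g"
  interpret commuting_operators ?T by (rule commuting_partial_dir)
  show ?case
  proof (cases m)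
    case 0
    have "poly.coeff (?\<Theta> P) 0 = poly (?\<Theta> P) 0"
      by (simp add: poly_0_coeff_0)
    also have "\<dots> = peval id (\<lambda>v. poly (?g v) 0) P"
      by (rule poly_peval)
    also have "\<dots> = peval id f P"
      by (rule peval_cong) (simp add: poly_monom power_0_left)
    finally show ?thesis by (simp only: 0 series_exp_0)
  next
    case (Suc l)
    define K where "K = Max (insert m (fst ` vars P))"
    let ?V = "{..K} \<times> (UNIV :: 'a set)"
    have K: "m \<le> K" "fst v \<le> K" if "v \<in> vars P" for v
      unfolding K_def using that by (auto intro!: Max_ge finite_vars)
    have mK: "m \<le> K"
      unfolding K_def by (auto intro!: Max_ge finite_vars)
    have V: "vars P \<subseteq> ?V"
      using K by (auto simp: mem_Times_iff)
    have "of_nat m * poly.coeff (?\<Theta> P) m = poly.coeff (pderiv (?\<Theta> P)) l"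
      by (simp add: Suc coeff_pderiv)
    also have "\<dots> = (\<Sum>v\<in>?V. poly.coeff (pderiv (?g v) * ?\<Theta> (partial v P)) l)"
      by (subst pderiv_peval[OF _ V]) (simp_all add: coeff_sum)
    also have "\<dots> = (\<Sum>n\<le>K. \<Sum>i\<in>UNIV. poly.coeff (pderiv (?g (n, i)) * ?\<Theta> (partial (n, i) P)) l)"
      by (simp add: sum.cartesian_product case_prod_unfold)
    also have "\<dots> = (\<Sum>n=1..m. \<Sum>i\<in>UNIV. u $ i / 2 * poly.coeff (?\<Theta> (partial (n, i) P)) (m - n))"
    proof (rule sum.mono_neutral_cong_right)
      show "{1..m} \<subseteq> {..K}" using mK by auto
      show "\<forall>n\<in>{..K} - {1..m}. (\<Sum>i\<in>UNIV. poly.coeff (pderiv (?g (n, i)) * ?\<Theta> (partial (n, i) P)) l) = 0"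
        by (auto simp: pderiv_add pderiv_pCons pderiv_monom coeff_monom_mult Suc intro!: sum.neutral)
      fix n assume "n \<in> {1..m}"
      then show "(\<Sum>i\<in>UNIV. poly.coeff (pderiv (?g (n, i)) * ?\<Theta> (partial (n, i) P)) l)
         = (\<Sum>i\<in>UNIV. u $ i / 2 * poly.coeff (?\<Theta> (partial (n, i) P)) (m - n))"
        by (auto simp: pderiv_add pderiv_pCons pderiv_monom coeff_monom_mult Suc intro!: sum.cong)
    qed auto
    also have "\<dots> = (\<Sum>n=1..m. of_nat n * poly.coeff (?\<Theta> (?T n P)) (m - n))"
      by (intro sum.cong refl)
         (auto simp: partial_dir_def peval_poly.peval_mult peval_poly.peval_sum coeff_sum sum_distrib_left mult_ac)
    also have "\<dots> = (\<Sum>n=1..m. of_nat n * peval id f (series_exp ?T (m - n) (?T n P)))"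
      by (intro sum.cong refl arg_cong2[where f = "(*)"] less.IH) auto
    also have "\<dots> = peval id f (of_nat m * series_exp ?T m P)"
      unfolding series_exp_recursion peval_id.peval_sum
      by (simp add: peval_id.peval_mult flip: cst_of_nat)
    also have "\<dots> = of_nat m * peval id f (series_exp ?T m P)"
      by (simp add: peval_id.peval_mult flip: cst_of_nat)
    finally have "of_nat m * poly.coeff (?\<Theta> P) m = of_nat m * peval id f (series_exp ?T m P)" .
    moreover have "of_nat m \<noteq> (0 :: complex)"
      by (simp only: Suc of_nat_eq_0_iff)
    ultimately show ?thesis
      by (simp only: mult_cancel_left simp_thms)
  qed
qed

definition mweight :: "((nat \<times> 'r) \<Rightarrow>\<^sub>0 nat) \<Rightarrow> nat" where
  "mweight m = (\<Sum>v\<in>Poly_Mapping.keys m. fst v * Poly_Mapping.lookup m v)"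

lemma mweight_add_single: "mweight (m + Poly_Mapping.single v 1) = mweight m + fst v"
proof -
  let ?V = "insert v (Poly_Mapping.keys m)"
  have *: "mweight k = (\<Sum>w\<in>?V. fst w * Poly_Mapping.lookup k w)" if "Poly_Mapping.keys k \<subseteq> ?V" for k
    unfolding mweight_def by (rule sum.mono_neutral_left) (use that in \<open>auto simp: in_keys_iff\<close>)
  have "Poly_Mapping.keys (m + Poly_Mapping.single v 1) \<subseteq> ?V"
    using keys_add by fastforce
  then have "mweight (m + Poly_Mapping.single v 1)
     = (\<Sum>w\<in>?V. fst w * Poly_Mapping.lookup m w) + (\<Sum>w\<in>?V. fst w * (if w = v then 1 else 0))"
    by (subst *) (auto simp: lookup_add lookup_single when_def distrib_left sum.distrib intro!: sum.cong)
  also have "(\<Sum>w\<in>?V. fst w * (if w = v then 1 else 0)) = fst v"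
    by (subst sum.remove[of _ v]) (auto intro!: sum.neutral)
  finally show ?thesis by (subst (2) *) auto
qed

text \<open>The degree is an integer so that derivations may lower it below 0, which forces the
  polynomial to vanish; this truncates the exponential of derivations.\<close>

definition has_weight :: "int \<Rightarrow> 'r dpoly \<Rightarrow> bool" where
  "has_weight d F \<longleftrightarrow> (\<forall>m. Poly_Mapping.lookup F m \<noteq> 0 \<longrightarrow> int (mweight m) = d)"

lemma has_weight_neg: "has_weight d F \<Longrightarrow> d < 0 \<Longrightarrow> F = 0"
  by (rule poly_mapping_eqI) (force simp: has_weight_def)

lemma has_weight_add: "has_weight d F \<Longrightarrow> has_weight d G \<Longrightarrow> has_weight d (F + G)"
  unfolding has_weight_def by (metis add_0 lookup_add)

lemma has_weight_zero: "has_weight d 0"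
  by (simp add: has_weight_def)

lemma has_weight_sum: "(\<And>i. i \<in> A \<Longrightarrow> has_weight d (F i)) \<Longrightarrow> has_weight d (\<Sum>i\<in>A. F i)"
  by (induction A rule: infinite_finite_induct) (auto intro: has_weight_add has_weight_zero)

lemma has_weight_cst_mult: "has_weight d F \<Longrightarrow> has_weight d (cst c * F)"
  by (simp add: has_weight_def lookup_cst_mult)

lemma has_weight_partial: "has_weight d F \<Longrightarrow> has_weight (d - int (fst v)) (partial v F)"
  unfolding has_weight_def lookup_partial
  by (metis add_diff_cancel_right' mult_zero_right mweight_add_single of_nat_add)

lemma weighted_homogeneous_iff: "weighted_homogeneous s F \<longleftrightarrow> has_weight (int s) F"
  unfolding weighted_homogeneous_def has_weight_def mweight_def of_nat_eq_iff Ball_def in_keys_iff ..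

lemma series_exp_partial_dir_eq_0:
  assumes "weighted_homogeneous s P" "s < m"
  shows "series_exp (\<lambda>n G. cst (1 / (2 * of_nat n)) * partial_dir u n G) m P = 0"
proof -
  let ?T = "\<lambda>n G. cst (1 / (2 * of_nat n)) * partial_dir u n G"
  have T: "has_weight (d - int n) (?T n F)" if "has_weight d F" for d n F
    unfolding partial_dir_def
    by (intro has_weight_cst_mult has_weight_sum) (use has_weight_partial[OF that] in fastforce)
  have "has_weight (int s - int m) (series_power ?T k m P)" for k m
  proof (induction k arbitrary: m)
    case 0
    then show ?case using assms(1) by (simp add: weighted_homogeneous_iff has_weight_zero)
  next
    case (Suc k)
    show ?case unfolding series_power.simps
    proof (rule has_weight_sum)
      fix j assume "j \<in> {1..m}"
      then show "has_weight (int s - int m) (?T j (series_power ?T k (m - j) P))"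
        using T[OF Suc.IH[of "m - j"], of j] by (simp add: of_nat_diff algebra_simps)
    qed
  qed
  then have "has_weight (int s - int m) (series_exp ?T m P)"
    unfolding series_exp_def by (intro has_weight_sum has_weight_cst_mult)
  then show ?thesis using has_weight_neg assms(2) by force
qed

lemma series_exp_phi_dir:
  "series_exp (\<lambda>n G. phi_dir u n * G) b F = series_exp (\<lambda>n G. phi_dir u n * G) b 1 * F"
proof -
  have p: "series_power (\<lambda>n G. phi_dir u n * G) k b F = series_power (\<lambda>n G. phi_dir u n * G) k b 1 * F" for k b F
    by (induction k arbitrary: b) (simp_all add: sum_distrib_left sum_distrib_right mult_ac)
  show ?thesis
    unfolding series_exp_def by (subst p) (simp add: sum_distrib_left sum_distrib_right mult_ac)
qed

text \<open>Terms with \<open>Suc b > s\<close> vanish by degree, so \<open>Sum_any\<close> is a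
  finite sum; the first exponential is multiplication by its value at 1.\<close>

lemma screening_eq:
  assumes "weighted_homogeneous s P"
  shows "screening u P = (\<Sum>b<s. series_exp (\<lambda>n G. phi_dir u n * G) b 1
     * series_exp (\<lambda>n G. cst (1 / (2 * of_nat n)) * partial_dir u n G) (Suc b) P)"
proof -
  have e: "series_exp (\<lambda>n G. phi_dir u n * G) b F = series_exp (\<lambda>n G. phi_dir u n * G) b 1 * F" for b F
    by (rule series_exp_phi_dir)
  show ?thesis
    unfolding screening_def
  proof (subst Sum_any.expand_superset[of "{..<s}"])
    let ?g = "\<lambda>b. series_exp (\<lambda>n G. phi_dir u n * G) b
        (series_exp (\<lambda>n G. cst (1 / (2 * of_nat n)) * partial_dir u n G) (Suc b) P)"
    have g: "?g b = 0" if "s \<le> b" for b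
      by (subst e) (use that in \<open>simp add: series_exp_partial_dir_eq_0[OF assms]\<close>)
    show "{b. ?g b \<noteq> 0} \<subseteq> {..<s}"
    proof
      fix b assume b: "b \<in> {b. ?g b \<noteq> 0}"
      have "\<not> s \<le> b" using g[of b] b by (elim CollectE) (rule notI, erule notE)
      then show "b \<in> {..<s}" by simp
    qed
    show "sum ?g {..<s} = (\<Sum>b<s. series_exp (\<lambda>n G. phi_dir u n * G) b 1
      * series_exp (\<lambda>n G. cst (1 / (2 * of_nat n)) * partial_dir u n G) (Suc b) P)"
      by (rule sum.cong[OF refl e])
  qed simp
qed

section \<open>Modes of the currents\<close>

lemma mode_superset:
  "finite K \<Longrightarrow> Poly_Mapping.keys P \<subseteq> K \<Longrightarrow> mode a P m F = (\<Sum>M\<in>K. cst (Poly_Mapping.lookup P M)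
     * normal_ordered a (SOME vs. \<forall>v. count_list vs v = Poly_Mapping.lookup M v) m F)"
  unfolding mode_def by (rule sum.mono_neutral_left) (auto simp: in_keys_iff)

lemma mode_add: "mode a (P + R) m F = mode a P m F + mode a R m F"
proof -
  let ?K = "Poly_Mapping.keys P \<union> Poly_Mapping.keys R"
  have "Poly_Mapping.keys (P + R) \<subseteq> ?K" by (rule keys_add)
  then show ?thesis
    by (simp add: mode_superset[of ?K] lookup_add distrib_right sum.distrib)
qed

lemma mode_zero [simp]: "mode a 0 m F = 0"
  by (simp add: mode_def)

lemma mode_sum: "mode a (\<Sum>i\<in>A. P i) m F = (\<Sum>i\<in>A. mode a (P i) m F)"
  by (induction A rule: infinite_finite_induct) (simp_all add: mode_add)

lemma mode_single:
  "mode a (Poly_Mapping.single M c) m F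
     = cst c * normal_ordered a (SOME vs. \<forall>v. count_list vs v = Poly_Mapping.lookup M v) m F"
  by (cases "c = 0") (simp_all add: mode_def)

lemma some_list_single:
  "(SOME vs. \<forall>w. count_list vs w = Poly_Mapping.lookup (Poly_Mapping.single v k) w) = replicate k v"
proof (rule some_equality)
  show "\<forall>w. count_list (replicate k v) w = Poly_Mapping.lookup (Poly_Mapping.single v k) w"
    by (induction k) (auto simp: lookup_single when_def split: if_splits)
next
  fix vs assume vs: "\<forall>w. count_list vs w = Poly_Mapping.lookup (Poly_Mapping.single v k) w"
  have "w = v" if "w \<in> set vs" for w
    using vs that by (metis count_list_0_iff lookup_single_not_eq)
  then have r: "vs = replicate (length vs) v"
    by (auto intro!: replicate_eqI)
  have "count_list (replicate n v) v = n" for n by (induction n) auto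
  then have "length vs = k" using vs r by (metis lookup_single_eq)
  then show "vs = replicate k v" using r by simp
qed

text \<open>The list chosen in \<open>mode\<close> exists because a finitely supported multiplicity
  function is a multiset; afterwards only its multiplicities are used.\<close>

lemma some_list:
  "count_list (SOME vs. \<forall>v. count_list vs v = Poly_Mapping.lookup M v) v = Poly_Mapping.lookup M v"
proof -
  obtain vs where vs: "mset vs = Abs_multiset (Poly_Mapping.lookup M)"
    using ex_mset by blast
  have "\<forall>v. count_list vs v = Poly_Mapping.lookup M v"
    by (simp add: vs Abs_multiset_inverse flip: count_mset)
  then show ?thesis
    by (rule someI2) simp
qed

lemma sum_list_single:
  fixes M :: "'a \<Rightarrow>\<^sub>0 nat"
  assumes "\<And>v. count_list vs v = Poly_Mapping.lookup M v"
  shows "(\<Sum>v\<leftarrow>vs. Poly_Mapping.single v 1) = M"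
proof (rule poly_mapping_eqI)
  fix w :: 'a
  have "Poly_Mapping.lookup (\<Sum>v\<leftarrow>us. Poly_Mapping.single v (1::nat)) w = count_list us w" for us
    by (induction us) (auto simp: lookup_add lookup_single when_def)
  then show "Poly_Mapping.lookup (\<Sum>v\<leftarrow>vs. Poly_Mapping.single v 1) w = Poly_Mapping.lookup M w"
    using assms by metis
qed

lemma prod_list_phi: "(\<Prod>v\<leftarrow>vs. phi v) = Poly_Mapping.single (\<Sum>v\<leftarrow>vs. Poly_Mapping.single v 1) 1"
  by (induction vs) (simp_all add: phi_def mult_single add.commute)

lemma mweight_sum_list: "mweight (\<Sum>v\<leftarrow>vs. Poly_Mapping.single v 1) = sum_list (map fst vs)"
  by (induction vs)
     (simp add: mweight_def, simp add: add.commute[of "Poly_Mapping.single _ _"] mweight_add_single[simplified])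

lemma field_mode_zero [simp]: "field_mode a v k 0 = 0"
  by (simp add: field_mode_def heisenberg_def)

lemma normal_ordered_zero [simp]: "normal_ordered a vs m 0 = 0"
  by (induction vs arbitrary: m) (simp_all cong: if_cong)

lemma normal_ordered_single: "normal_ordered a [v] m F = field_mode a v m F"
proof -
  have "normal_ordered a [v] m F = (\<Sum>k\<in>{m}. if k \<le> 0 then field_mode a v k (if m - k = 0 then F else 0)
     else if m - k = 0 then field_mode a v k F else 0)"
    unfolding normal_ordered.simps
    by (rule Sum_any.expand_superset) (auto split: if_splits)
  then show ?thesis by simp
qed

lemma field_mode_pos_one: "k > 0 \<Longrightarrow> field_mode a v k 1 = 0"
  by (simp add: field_mode_def heisenberg_def)

text \<open>For \<open>k = - p - 1\<close> the coefficient contains \<open>p choose (n - 1)\<close>,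
  which vanishes if \<open>p < n - 1\<close>, and at \<open>k = 0\<close> the charge is 0. So
  \<open>k = - n\<close> is the first creating mode, and it creates \<open>\<phi>\<^sub>n\<close>
  with the factor \<open>(\<i> / n) * (\<i> * (- n)) = 1\<close>.\<close>

lemma field_mode_creation:
  assumes "1 \<le> fst v" "- int (fst v) \<le> k" "k \<le> 0"
  shows "field_mode 0 v k F = (if k = - int (fst v) then phi v * F else 0)"
proof (cases "k = 0")
  case True
  then show ?thesis using assms by (simp add: field_mode_def heisenberg_def)
next
  case False
  define p where "p = nat (- k - 1)"
  have k: "k = - int p - 1" using False assms(3) by (simp add: p_def)
  have c: "(- of_int k - 1 :: complex) gchoose (fst v - 1) = of_nat (p choose (fst v - 1))"
    by (simp add: k binomial_gbinomial)
  show ?thesis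
  proof (cases "p = fst v - 1")
    case True
    then have k': "k = - int (fst v)" using assms(1) k by simp
    have "field_mode 0 v k F = cst (\<i> / of_nat (fst v)) * (cst (\<i> * of_int k) * phi v * F)"
      using assms(1) unfolding field_mode_def c by (simp add: True heisenberg_def k' del: cst_hom)
    also have "\<dots> = cst (\<i> / of_nat (fst v) * (\<i> * of_int k)) * (phi v * F)"
      by (simp only: cst_hom(4) mult_ac)
    also have "\<i> / of_nat (fst v) * (\<i> * of_int k) = 1"
      using assms(1) by (simp add: k')
    finally show ?thesis by (simp add: k')
  next
    case False
    then have "p < fst v - 1" using assms k by linarith
    then show ?thesis using assms k False unfolding field_mode_def c by (simp add: binomial_eq_0)
  qed
qed

text \<open>State-field correspondence for monomials: at or above minus the total weight, only the
  leading creation mode of each factor can contribute, and only when all of them are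
  leading.\<close>

lemma normal_ordered_vacuum:
  assumes "\<And>v. v \<in> set vs \<Longrightarrow> 1 \<le> fst v" "m \<ge> - int (sum_list (map fst vs))"
  shows "normal_ordered 0 vs m 1 = (if m = - int (sum_list (map fst vs)) then \<Prod>v\<leftarrow>vs. phi v else 0)"
  using assms
proof (induction vs arbitrary: m)
  case Nil
  then show ?case by simp
next
  case (Cons v vs)
  let ?g = "\<lambda>k. if k \<le> 0 then field_mode 0 v k (normal_ordered 0 vs (m - k) 1)
     else normal_ordered 0 vs (m - k) (field_mode 0 v k 1)"
  have v: "1 \<le> fst v" using Cons.prems by simp
  have g: "?g k = 0" if "k \<noteq> - int (fst v)" for k
  proof -
    consider "k > 0" | "k \<le> 0" "- int (fst v) \<le> k" | "k < - int (fst v)" by linarith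
    then show ?thesis
    proof cases
      case 3
      then have "normal_ordered 0 vs (m - k) 1 = 0"
        using Cons.prems by (subst Cons.IH) auto
      then show ?thesis using 3 by simp
    qed (simp_all add: field_mode_pos_one field_mode_creation[OF v] that)
  qed
  have "normal_ordered 0 (v # vs) m 1 = (\<Sum>k\<in>{- int (fst v)}. ?g k)"
    unfolding normal_ordered.simps
  proof (rule Sum_any.expand_superset)
    show "{k. ?g k \<noteq> 0} \<subseteq> {- int (fst v)}"
    proof
      fix k assume "k \<in> {k. ?g k \<noteq> 0}"
      then have "?g k \<noteq> 0" by (elim CollectE)
      then have "k = - int (fst v)" using g[of k] by argo
      then show "k \<in> {- int (fst v)}" by simp
    qed
  qed simp
  also have "\<dots> = phi v * normal_ordered 0 vs (m + int (fst v)) 1"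
    by (simp add: field_mode_creation[OF v])
  also have "\<dots> = (if m = - int (sum_list (map fst (v # vs))) then \<Prod>v\<leftarrow>v # vs. phi v else 0)"
    using Cons.prems by (subst Cons.IH) auto
  finally show ?case .
qed

lemma mode_vacuum:
  assumes "P \<in> Vplus" "weighted_homogeneous s P" "m \<ge> - int s"
  shows "mode 0 P m 1 = (if m = - int s then P else 0)"
proof -
  let ?vs = "\<lambda>M. SOME vs. \<forall>v. count_list vs v = Poly_Mapping.lookup M v"
  have "normal_ordered 0 (?vs M) m 1 = (if m = - int s then Poly_Mapping.single M 1 else 0)"
    if M: "M \<in> Poly_Mapping.keys P" for M
  proof -
    define vs where "vs = ?vs M"
    have cl: "count_list vs v = Poly_Mapping.lookup M v" for v
      unfolding vs_def by (rule some_list)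
    have S: "(\<Sum>v\<leftarrow>vs. Poly_Mapping.single v 1) = M"
      by (rule sum_list_single) (rule cl)
    have "mweight M = s"
      using assms(2) M by (simp add: weighted_homogeneous_def mweight_def)
    then have w: "sum_list (map fst vs) = s"
      using mweight_sum_list[of vs] S by simp
    have pos: "1 \<le> fst v" if "v \<in> set vs" for v
    proof -
      have "v \<in> Poly_Mapping.keys M" using that unfolding in_keys_iff cl[symmetric] count_list_0_iff by simp
      then show ?thesis using assms(1) M by (auto simp: Vplus_def)
    qed
    show ?thesis
      unfolding vs_def[symmetric]
      by (subst normal_ordered_vacuum[OF pos]) (use S in \<open>simp_all add: w assms(3) prod_list_phi\<close>)
  qed
  then have "mode 0 P m 1 = (\<Sum>M\<in>Poly_Mapping.keys P. if m = - int s then Poly_Mapping.single M (Poly_Mapping.lookup P M) else 0)"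
    unfolding mode_def by (intro sum.cong refl) (simp add: cst_def mult_single)
  then show ?thesis by (simp flip: dpoly_expand)
qed

section \<open>The first mode of the stress tensor\<close>

lemma stress_expand:
  "stress Q = (\<Sum>i\<in>UNIV. Poly_Mapping.single (Poly_Mapping.single (2, i) 1) (2 * Q $ i)
     + Poly_Mapping.single (Poly_Mapping.single (1, i) 2) (-1))"
proof -
  have "2 * phi_dir Q 2 = (\<Sum>i\<in>UNIV. Poly_Mapping.single (Poly_Mapping.single (2, i) 1) (2 * Q $ i))"
    unfolding phi_dir_def sum_distrib_left
    by (intro sum.cong refl) (simp add: cst_def phi_def mult_single mult.assoc flip: single_numeral)
  moreover have "phi (1, i) * phi (1, i) = - Poly_Mapping.single (Poly_Mapping.single (1, i) 2) (-1)" for i :: 'a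
    by (simp add: phi_def mult_single single_uminus flip: single_add) (simp add: numeral_2_eq_2)
  ultimately show ?thesis
    by (simp only: stress_def sum.distrib sum_negf diff_minus_eq_add)
qed

lemma field_mode_one: "field_mode a (1, i) k F = cst \<i> * heisenberg a i k F"
  by (simp add: field_mode_def)

text \<open>Action of \<open>L\<^sub>1\<close> on the Fock space of charge 0 as a first-order
  differential operator; \<open>K\<close> bounds the indices of the variables that occur.\<close>

definition l_one :: "complex^'r \<Rightarrow> nat \<Rightarrow> 'r dpoly \<Rightarrow> 'r dpoly" where
  "l_one Q K F = (\<Sum>l=1..K. \<Sum>i\<in>UNIV.
     (if l = 1 then cst (Q $ i) else of_nat (l - 1) * phi (l - 1, i)) * partial (l, i) F)"

text \<open>Modes adding up to 1 are \<open>l\<close> and \<open>1 - l\<close>, in both orders, so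
  each product occurs twice. For \<open>l = 1\<close> the partner is \<open>A\<^sub>0\<close>, which
  acts as 0.\<close>

lemma normal_ordered_square_one:
  assumes "\<And>v. v \<in> vars F \<Longrightarrow> fst v \<le> K"
  shows "normal_ordered 0 [(1, i), (1, i)] 1 F
    = - (\<Sum>l=2..K. of_nat (l - 1) * phi (l - 1, i) * partial (l, i) F)"
proof -
  let ?v = "(1, i) :: nat \<times> 'a"
  let ?h = "\<lambda>l. field_mode 0 ?v (1 - l) (field_mode 0 ?v l F)"
  let ?g = "\<lambda>k. if k \<le> 0 then field_mode 0 ?v k (field_mode 0 ?v (1 - k) F) else ?h k"
  let ?J = "{1..int K}"
  have h0: "?h l = 0" if "l > int K" "l > 0" for l
  proof -
    have "(nat l, i) \<notin> vars F" using assms that by force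
    then show ?thesis unfolding field_mode_one heisenberg_def using that by (simp add: partial_eq_0)
  qed
  have "normal_ordered 0 [?v, ?v] 1 F = Sum_any ?g"
    unfolding normal_ordered.simps(2)[of 0 ?v "[?v]"] normal_ordered_single ..
  also have "\<dots> = (\<Sum>k\<in>?J \<union> (\<lambda>l. 1 - l) ` ?J. ?g k)"
  proof (rule Sum_any.expand_superset)
    show "{k. ?g k \<noteq> 0} \<subseteq> ?J \<union> (\<lambda>l. 1 - l) ` ?J"
    proof
      fix k assume "k \<in> {k. ?g k \<noteq> 0}"
      then have k: "?g k \<noteq> 0" by (elim CollectE)
      show "k \<in> ?J \<union> (\<lambda>l. 1 - l) ` ?J"
      proof (cases "k \<le> 0")
        case True
        then have "1 - k \<le> int K" using h0[of "1 - k"] k by (cases "1 - k \<le> int K") auto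
        then show ?thesis using True by (intro UnI2 image_eqI[of _ _ "1 - k"]) auto
      next
        case False
        then show ?thesis using h0[of k] k by (cases "k \<le> int K") auto
      qed
    qed
  qed simp
  also have "\<dots> = (\<Sum>k\<in>?J. ?g k) + (\<Sum>l\<in>?J. ?g (1 - l))"
  proof -
    have "?J \<inter> (\<lambda>l. 1 - l) ` ?J = {}" by auto
    moreover have "(\<Sum>k\<in>(\<lambda>l. 1 - l) ` ?J. ?g k) = (\<Sum>l\<in>?J. ?g (1 - l))"
      by (subst sum.reindex) (simp_all add: inj_on_def)
    ultimately show ?thesis by (simp only: sum.union_disjoint finite_imageI finite_atLeastAtMost_int)
  qed
  also have "\<dots> = (\<Sum>l\<in>?J. ?h l + ?h l)"
    unfolding sum.distrib[symmetric] by (intro sum.cong refl) auto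
  also have "\<dots> = (\<Sum>l\<in>{1..K}. ?h (int l) + ?h (int l))"
    by (rule sum.reindex_bij_witness[of _ int nat]) auto
  also have "\<dots> = (\<Sum>l\<in>{2..K}. - (of_nat (l - 1) * phi (l - 1, i) * partial (l, i) F))"
  proof (rule sum.mono_neutral_cong_right)
    show "\<forall>l\<in>{1..K} - {2..K}. ?h (int l) + ?h (int l) = 0"
    proof
      fix l assume "l \<in> {1..K} - {2..K}"
      then have "l = 1" by auto
      then show "?h (int l) + ?h (int l) = 0"
        unfolding field_mode_one heisenberg_def by simp
    qed
    fix l assume l: "l \<in> {2..K}"
    have n: "nat (- (1 - int l)) = l - 1" "\<not> 1 - int l = 0" "1 - int l < 0" "\<not> int l < 0" "\<not> int l = 0" using l by auto
    have "?h (int l) = cst (\<i> * (\<i> * of_int (1 - int l)) * (\<i> * (\<i> / 2))) * (phi (l - 1, i) * partial (l, i) F)"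
      by (simp only: field_mode_one heisenberg_def n nat_int if_True if_False cst_hom(4) mult_ac simp_thms)
    moreover have "\<i> * (\<i> * of_int (1 - int l)) * (\<i> * (\<i> / 2)) = - (of_nat (l - 1) / 2)"
      using l by (simp add: of_nat_diff field_simps)
    moreover have "cst (- (of_nat (l - 1) / 2)) + cst (- (of_nat (l - 1) / 2)) = - (of_nat (l - 1) :: 'a dpoly)"
      by (simp only: cst_hom(3)[symmetric] cst_of_nat[symmetric] cst_hom(5)[symmetric]) simp
    ultimately show "?h (int l) + ?h (int l) = - (of_nat (l - 1) * phi (l - 1, i) * partial (l, i) F)"
      by (simp only: distrib_right[symmetric] mult_minus_left mult.assoc[of "of_nat (l - 1) :: 'a dpoly"])
  qed auto
  finally show ?thesis by (simp add: sum_negf)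
qed

lemma mode_stress_one:
  assumes "\<And>v. v \<in> vars F \<Longrightarrow> fst v \<le> K"
  shows "mode 0 (stress Q) 1 F = l_one Q K F"
proof -
  have two: "normal_ordered 0 [(2, i)] 1 F = cst (1 / 2) * partial (1, i) F" for i
  proof -
    have "normal_ordered 0 [(2, i)] 1 F = cst (\<i> / 2 * (- 2)) * (cst (\<i> / 2) * partial (1, i) F)"
      unfolding normal_ordered_single field_mode_def heisenberg_def by (simp del: cst_hom)
    also have "\<dots> = cst (\<i> / 2 * (- 2) * (\<i> / 2)) * partial (1, i) F"
      by (simp only: cst_hom mult.assoc)
    finally show ?thesis by simp
  qed
  have r2: "replicate 1 w = [w]" "replicate 2 w = [w, w]" for w :: "nat \<times> 'a"
    by (simp_all add: numeral_2_eq_2)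
  have "mode 0 (stress Q) 1 F = (\<Sum>i\<in>UNIV. cst (2 * Q $ i) * (cst (1 / 2) * partial (1, i) F)
      + (\<Sum>l=2..K. of_nat (l - 1) * phi (l - 1, i) * partial (l, i) F))"
    unfolding stress_expand mode_sum mode_add mode_single some_list_single r2
    by (simp add: two normal_ordered_square_one[OF assms] del: normal_ordered.simps cst_hom(3,4) One_nat_def)
  also have "\<dots> = (\<Sum>i\<in>UNIV. (\<Sum>l=1..K.
     (if l = 1 then cst (Q $ i) else of_nat (l - 1) * phi (l - 1, i)) * partial (l, i) F))"
  proof (intro sum.cong refl)
    fix i
    have c: "cst (2 * Q $ i) * (cst (1 / 2) * partial (1, i) F) = cst (Q $ i) * partial (1, i) F"
      unfolding mult.assoc[symmetric] cst_hom(4)[symmetric] by simp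
    show "cst (2 * Q $ i) * (cst (1 / 2) * partial (1, i) F)
      + (\<Sum>l=2..K. of_nat (l - 1) * phi (l - 1, i) * partial (l, i) F)
      = (\<Sum>l=1..K. (if l = 1 then cst (Q $ i) else of_nat (l - 1) * phi (l - 1, i)) * partial (l, i) F)"
    proof (cases "K \<ge> 1")
      case True
      then show ?thesis
        unfolding c by (subst sum.atLeast_Suc_atMost[of 1 K]) (auto simp: numeral_2_eq_2 intro!: sum.cong)
    next
      case False
      then have "(1, i) \<notin> vars F" using assms by force
      then show ?thesis using False by (simp add: partial_eq_0)
    qed
  qed
  finally show ?thesis
    unfolding l_one_def by (subst sum.swap)
qed

lemma partial_single:
  "partial v (Poly_Mapping.single (Poly_Mapping.single w k) c)
     = (if v = w then Poly_Mapping.single (Poly_Mapping.single w (k - 1)) (of_nat k * c) else 0)"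
  by (cases "c = 0") (auto simp: partial_def lookup_single when_def simp flip: single_diff)

text \<open>Spin 2 is checked by hand, because the commutator of the stress tensor with itself has a
  central term and does not obey the relation assumed for the other generators. Its linear and
  quadratic parts give opposite multiples of
  \<open>\<langle>Q, \<phi>\<^sub>1\<rangle>\<close>.\<close>

lemma l_one_stress: "K \<ge> 2 \<Longrightarrow> l_one Q K (stress Q) = 0"
proof -
  assume K: "K \<ge> 2"
  have p: "partial (l, i) (stress Q) = (if l = 2 then cst (2 * Q $ i) else if l = 1 then - 2 * phi (1, i) else 0)" for l i
  proof -
    have "partial (l, i) (stress Q) = (\<Sum>j\<in>UNIV. if j = i then
        (if l = 2 then cst (2 * Q $ i) else if l = 1 then Poly_Mapping.single (Poly_Mapping.single (1, i) 1) (-2) else 0) else 0)"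
      unfolding stress_expand partial_sum partial_add partial_single
      by (intro sum.cong refl) (auto simp: cst_def)
    moreover have "Poly_Mapping.single (Poly_Mapping.single (1, i) 1) (-2) = - 2 * phi (1, i)"
      by (simp add: phi_def single_uminus mult_single flip: single_numeral)
    ultimately show ?thesis by simp
  qed
  have "l_one Q K (stress Q) = (\<Sum>l\<in>{1, 2}. \<Sum>i\<in>UNIV.
     (if l = 1 then cst (Q $ i) else of_nat (l - 1) * phi (l - 1, i)) * partial (l, i) (stress Q))"
    unfolding l_one_def by (rule sum.mono_neutral_right) (use K in \<open>auto simp: p\<close>)
  also have "\<dots> = (\<Sum>i\<in>UNIV. cst (Q $ i) * (- 2 * phi (1, i)) + phi (1, i) * cst (2 * Q $ i))"
    by (simp add: p sum_subtractf sum_negf)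
  also have "\<dots> = 0"
  proof (rule sum.neutral, rule ballI)
    fix i :: 'a
    have "cst 2 = (2 :: 'a dpoly)" using cst_of_nat[of 2] by simp
    then show "cst (Q $ i) * (- 2 * phi (1, i)) + phi (1, i) * cst (2 * Q $ i) = 0"
      by simp
  qed
  finally show ?thesis .
qed

lemma W_current_l_one:
  assumes "W_currents e \<gamma> spin P" "a \<in> {1..CARD('r)}" "K \<ge> 2"
    and K: "\<And>v. v \<in> vars (P a) \<Longrightarrow> fst v \<le> K"
  shows "l_one (background e \<gamma>) K (P a) = (0 :: 'r::finite dpoly)"
proof (cases "spin a = 2")
  case True
  then have "P a = stress (background e \<gamma>)"
    using assms unfolding W_currents_def by simp
  then show ?thesis using l_one_stress[OF assms(3)] by simp
next
  case False
  let ?T = "mode 0 (stress (background e \<gamma>)) 1"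
  let ?s = "int (spin a)"
  have P: "P a \<in> Vplus" "weighted_homogeneous (spin a) (P a)"
    using assms unfolding W_currents_def Mplus_def by simp_all
  have one: "(1 :: 'r dpoly) \<in> Vplus" by (simp add: Vplus_def)
  have "?T (mode 0 (P a) (- ?s) 1) - mode 0 (P a) (- ?s) (?T 1)
      = cst (of_int ((?s - 1) * 1 - (- ?s))) * mode 0 (P a) (1 + - ?s) 1"
    using assms(1,2) False one unfolding W_currents_def by blast
  moreover have "mode 0 (P a) (- ?s) 1 = P a" "mode 0 (P a) (1 + - ?s) 1 = 0"
    by (simp_all add: mode_vacuum[OF P])
  moreover have "?T 1 = 0"
    by (subst mode_stress_one[of _ K]) (simp_all add: l_one_def vars_def)
  moreover have "mode 0 (P a) (- ?s) 0 = 0"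
    by (simp add: mode_def)
  ultimately have "?T (P a) = 0" by simp
  then show ?thesis by (simp add: mode_stress_one[OF K])
qed

lemma smult_sum: "smult c (\<Sum>i\<in>A. p i) = (\<Sum>i\<in>A. smult c (p i))"
  by (induction A rule: infinite_finite_induct) (simp_all add: smult_add_right)

lemma pderiv_power_linear:
  "pderiv ([:y, 1:] ^ n) = smult (of_nat n) ([:y, 1:] ^ (n - 1))" for y :: complex
  by (cases n) (simp_all only: pderiv_power_Suc pderiv_pCons, simp_all)

text \<open>The mode \<open>L\<^sub>1\<close> generates the translations of the inverse distances \<open>y b\<close>.\<close>

lemma W_current_translation:
  fixes \<beta> :: "'k \<Rightarrow> complex^'r"
  assumes W: "W_currents e \<gamma> spin P" "a \<in> {1..CARD('r)}"
    and neutral: "(\<Sum>b\<in>B. \<beta> b) = 2 *s background e \<gamma>"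
  shows "peval id (\<lambda>(n, i). \<Sum>b\<in>B. \<beta> b $ i / (2 * of_nat n) * (y b + t) ^ n) (P a)
       = peval id (\<lambda>(n, i). \<Sum>b\<in>B. \<beta> b $ i / (2 * of_nat n) * y b ^ n) (P a)"
proof -
  define K where "K = Max (insert 2 (fst ` vars (P a)))"
  have K: "fst v \<le> K" if "v \<in> vars (P a)" for v
    unfolding K_def using that by (auto intro!: Max_ge finite_vars)
  have K2: "K \<ge> 2"
    unfolding K_def by (auto intro!: Max_ge finite_vars)
  let ?Q = "background e \<gamma>"
  let ?V = "{1..K} \<times> (UNIV :: 'r set)"
  define f where "f = (\<lambda>(n, i). \<Sum>b\<in>B. smult (\<beta> b $ i / (2 * of_nat n)) ([:y b, 1:] ^ n))"
  have V: "vars (P a) \<subseteq> ?V"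
    using W K unfolding W_currents_def Mplus_def Vplus_vars by (force simp: mem_Times_iff)
  \<comment> \<open>Neutrality enters here: the derivative of the value of
    \<open>\<phi>\<^sub>1\<close> in the shift parameter is the constant that \<open>l_one\<close>
    assigns to this variable.\<close>
  have Q: "(\<Sum>b\<in>B. \<beta> b $ i / 2) = ?Q $ i" for i
    using arg_cong[OF neutral, of "\<lambda>v. v $ i"] by (simp flip: sum_divide_distrib)
  have d: "pderiv (f (l, i)) = peval (\<lambda>x. [:x:]) f (if l = 1 then cst (?Q $ i) else of_nat (l - 1) * phi (l - 1, i))"
    if l: "l \<in> {1..K}" for l i
  proof (cases "l = 1")
    case True
    have "pderiv (f (l, i)) = (\<Sum>b\<in>B. [:\<beta> b $ i / 2:])"
      by (simp add: f_def True pderiv_sum pderiv_smult pderiv_pCons)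
    also have "\<dots> = [:?Q $ i:]"
      by (simp add: poly_eq_iff coeff_sum Q[symmetric] coeff_pCons split: nat.splits)
    finally show ?thesis by (simp add: True)
  next
    case False
    then obtain k where k: "l = Suc (Suc k)"
      using l by (cases l; cases "l - 1") auto
    have "pderiv (f (l, i)) = (\<Sum>b\<in>B. smult (\<beta> b $ i / (2 * of_nat l) * of_nat l) ([:y b, 1:] ^ (l - 1)))"
      unfolding f_def prod.case by (simp only: pderiv_sum pderiv_smult pderiv_power_linear smult_smult)
    also have "\<dots> = smult (of_nat (l - 1)) (f (l - 1, i))"
    proof -
      have "\<beta> b $ i / (2 * of_nat l) * of_nat l = of_nat (l - 1) * (\<beta> b $ i / (2 * of_nat (l - 1)))" for b
        unfolding k by (simp del: of_nat_Suc)
      then show ?thesis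
        by (simp only: f_def prod.case) (simp add: smult_sum smult_smult)
    qed
    also have "\<dots> = peval (\<lambda>x. [:x:]) f (of_nat (l - 1) * phi (l - 1, i))"
      by (simp add: peval_poly.peval_mult flip: cst_of_nat)
    finally show ?thesis using False by simp
  qed
  have "pderiv (peval (\<lambda>x. [:x:]) f (P a))
      = (\<Sum>l=1..K. \<Sum>i\<in>UNIV. pderiv (f (l, i)) * peval (\<lambda>x. [:x:]) f (partial (l, i) (P a)))"
    by (subst pderiv_peval[OF _ V]) (simp_all add: sum.cartesian_product case_prod_unfold)
  also have "\<dots> = peval (\<lambda>x. [:x:]) f (l_one ?Q K (P a))"
    unfolding l_one_def by (simp add: d peval_poly.peval_sum peval_poly.peval_mult)
  also have "\<dots> = 0"
    by (simp add: W_current_l_one[OF W K2 K])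
  \<comment> \<open>The derivative in the shift parameter vanishes identically, so the polynomial is
    constant and can be compared at \<open>t\<close> and at 0.\<close>
  finally obtain c where "peval (\<lambda>x. [:x:]) f (P a) = [:c:]"
    by (metis degree_eq_zeroE pderiv_eq_0_iff)
  then have "peval id (\<lambda>v. poly (f v) t) (P a) = peval id (\<lambda>v. poly (f v) 0) (P a)"
    by (simp flip: poly_peval)
  moreover have "poly (f v) t = (case v of (n, i) \<Rightarrow> \<Sum>b\<in>B. \<beta> b $ i / (2 * of_nat n) * (y b + t) ^ n)" for v t
    by (cases v) (simp add: f_def poly_sum)
  ultimately show ?thesis by simp
qed

section \<open>The current as a function of its position\<close>

text \<open>The negative binomial series, by induction on the coefficient index: differentiation
  raises the exponent by one and lowers the index by one.\<close>

lemma fps_nth_inverse_linear_power: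
  assumes "(c :: complex) \<noteq> 0"
  shows "(inverse (fps_const c - fps_X) ^ Suc n) $ l = of_nat ((n + l) choose l) * inverse c ^ (Suc n + l)"
proof (induction l arbitrary: n)
  case 0
  then show ?case using assms by (simp add: fps_power_zeroth flip: power_Suc)
next
  case (Suc l)
  let ?F = "\<lambda>n. inverse (fps_const c - fps_X) ^ n"
  have "fps_deriv (inverse (fps_const c - fps_X)) = (inverse (fps_const c - fps_X))\<^sup>2"
    using assms by (subst fps_inverse_deriv) simp_all
  then have d: "fps_deriv (?F (Suc n)) = of_nat (Suc n) * ?F (Suc (Suc n))"
    by (subst fps_deriv_power') (simp add: power2_eq_square mult_ac)
  have "of_nat (Suc l) * (?F (Suc n) $ Suc l) = fps_deriv (?F (Suc n)) $ l"
    unfolding fps_deriv_nth by simp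
  also have "\<dots> = of_nat (Suc n) * (of_nat ((Suc n + l) choose l) * inverse c ^ (Suc (Suc n) + l))"
    unfolding d Suc.IH[symmetric] fps_of_nat[symmetric] fps_mult_left_const_nth ..
  also have "\<dots> = of_nat (Suc n * ((Suc n + l) choose l)) * inverse c ^ (Suc n + Suc l)"
    by (simp only: of_nat_mult mult.assoc add_Suc_right add_Suc)
  also have "Suc n * ((Suc n + l) choose l) = Suc l * ((n + Suc l) choose Suc l)"
    using Suc_times_binomial_add[of l n] by (simp add: mult_ac add.commute)
  finally have "of_nat (Suc l) * (?F (Suc n) $ Suc l) = of_nat (Suc l) * (of_nat ((n + Suc l) choose Suc l) * inverse c ^ (Suc n + Suc l))"
    by (simp only: of_nat_mult mult.assoc)
  then show ?case by (simp only: mult_cancel_left of_nat_eq_0_iff) simp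
qed

lemma fps_hom_coeffs:
  fixes h :: "'a::comm_ring_1 \<Rightarrow> 'b::comm_ring_1"
  assumes "\<And>x y. h (x + y) = h x + h y" "\<And>x y. h (x * y) = h x * h y" "h 1 = 1" "h 0 = 0"
  defines "H \<equiv> \<lambda>F. Abs_fps (\<lambda>n. h (F $ n))"
  shows "H (F + G) = H F + H G" "H (F * G) = H F * H G" "H 1 = 1" "H 0 = 0"
proof -
  have S: "h (\<Sum>i\<in>A. g i) = (\<Sum>i\<in>A. h (g i))" for A :: "nat set" and g
    by (induction A rule: infinite_finite_induct) (simp_all add: assms)
  show "H (F + G) = H F + H G" "H (F * G) = H F * H G" "H 1 = 1" "H 0 = 0"
    by (auto simp: fps_eq_iff H_def fps_mult_nth S assms)
qed

interpretation cst_fps: coefficient_hom "\<lambda>c. fps_const (cst c)"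
  by standard simp_all

interpretation fps_const: coefficient_hom "fps_const :: complex \<Rightarrow> complex fps"
  by standard simp_all

text \<open>The series \<open>shifted_phi\<close> times \<open>(z - w)^n\<close>, free of poles. By
  weighted homogeneity these factors combine to \<open>(z - w)^s\<close>, so power series can
  replace Laurent series.\<close>

definition shifted_fps :: "complex^'r \<Rightarrow> (nat \<times> 'r \<Rightarrow> 'b::comm_ring_1) \<Rightarrow> (complex \<Rightarrow> 'b) \<Rightarrow> nat \<times> 'r \<Rightarrow> 'b fps" where
  "shifted_fps \<alpha> f c v = fps_X ^ fst v * Abs_fps (\<lambda>l. of_nat ((fst v + l) choose fst v) * f (fst v + l, snd v))
     + fps_const (c ((-1) ^ fst v / (2 * of_nat (fst v)) * vec_nth \<alpha> (snd v)))"

lemma descendant_fps: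
  assumes "weighted_homogeneous s P"
  shows "descendant s P j \<alpha> = peval (\<lambda>c. fps_const (cst c)) (shifted_fps \<alpha> phi cst) P $ j"
proof -
  let ?F = "peval (\<lambda>c. fps_const (cst c)) (shifted_fps \<alpha> phi cst) P"
  have e: "shifted_phi \<alpha> = (\<lambda>v. fls_X_inv ^ fst v * fps_to_fls (shifted_fps \<alpha> phi cst v))"
    by (rule ext, rule fls_eqI)
       (auto simp: shifted_phi_def shifted_fps_def fls_X_inv_power_times_conv_shift fps_X_power_mult_nth
          fls_X_intpow_times_conv_shift nat_add_distrib intro!: arg_cong[where f = "\<lambda>x. _ x * _ x"])
  have "peval (\<lambda>c. fls_const (cst c)) (shifted_phi \<alpha>) P
     = fls_X_inv ^ s * peval (\<lambda>c. fls_const (cst c)) (\<lambda>v. fps_to_fls (shifted_fps \<alpha> phi cst v)) P"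
    unfolding e by (rule peval_weighted[OF assms])
  also have "peval (\<lambda>c. fls_const (cst c)) (\<lambda>v. fps_to_fls (shifted_fps \<alpha> phi cst v)) P = fps_to_fls ?F"
    by (subst peval_hom[where h = fps_to_fls]) (simp_all add: fls_times_fps_to_fls)
  finally show ?thesis
    by (simp add: descendant_def fls_X_inv_power_times_conv_shift)
qed

lemma peval_descendant:
  assumes "weighted_homogeneous s P"
  shows "peval id f (descendant s P j \<alpha>) = peval fps_const (shifted_fps \<alpha> f id) P $ j"
proof -
  let ?H = "\<lambda>F. Abs_fps (\<lambda>n. peval id f (F $ n))"
  note h = fps_hom_coeffs[where h = "peval id f", OF peval_id.peval_add peval_id.peval_mult peval_id.peval_one peval_id.peval_zero]
  have c: "?H (fps_const x) = fps_const (peval id f x)" for x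
    by (auto simp: fps_eq_iff)
  have "?H (peval (\<lambda>c. fps_const (cst c)) (shifted_fps \<alpha> phi cst) P)
      = peval (\<lambda>a. ?H (fps_const (cst a))) (\<lambda>v. ?H (shifted_fps \<alpha> phi cst v)) P"
    by (rule peval_hom) (rule h)+
  also have "(\<lambda>a. ?H (fps_const (cst a))) = fps_const"
    by (rule ext) (simp only: c peval_id.peval_cst id_apply)
  also have "(\<lambda>v. ?H (shifted_fps \<alpha> phi cst v)) = shifted_fps \<alpha> f id"
  proof
    fix v :: "nat \<times> 'a"
    have "?H (fps_X ^ fst v * G) = fps_X ^ fst v * ?H G" for G
      by (simp add: fps_eq_iff fps_X_power_mult_nth)
    moreover have "?H (Abs_fps (\<lambda>l. of_nat ((fst v + l) choose fst v) * phi (fst v + l, snd v)))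
        = Abs_fps (\<lambda>l. of_nat ((fst v + l) choose fst v) * f (fst v + l, snd v))"
      by (simp add: fps_eq_iff peval_id.peval_mult flip: cst_of_nat)
    ultimately show "?H (shifted_fps \<alpha> phi cst v) = shifted_fps \<alpha> f id v"
      unfolding shifted_fps_def h(1) c by (simp add: peval_id.peval_cst)
  qed
  finally have "?H (peval (\<lambda>c. fps_const (cst c)) (shifted_fps \<alpha> phi cst) P) $ j = peval fps_const (shifted_fps \<alpha> f id) P $ j"
    by (rule arg_cong)
  then show ?thesis by (simp add: descendant_fps[OF assms])
qed

text \<open>The values of the \<open>\<phi>\<^sub>n\<close> produced at \<open>\<zeta>\<close> by charges \<open>\<beta> b\<close> at the points \<open>X b\<close>.\<close>

definition profile :: "'k set \<Rightarrow> ('k \<Rightarrow> complex^'r) \<Rightarrow> ('k \<Rightarrow> complex) \<Rightarrow> complex \<Rightarrow> nat \<times> 'r \<Rightarrow> complex" where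
  "profile B \<beta> X \<zeta> v = (\<Sum>b\<in>B. \<beta> b $ snd v / (2 * of_nat (fst v)) * inverse (X b - \<zeta>) ^ fst v)"

lemma profile_remove:
  "finite B \<Longrightarrow> a \<in> B \<Longrightarrow> profile B \<beta> X \<zeta> v
     = \<beta> a $ snd v / (2 * of_nat (fst v)) * inverse (X a - \<zeta>) ^ fst v + profile (B - {a}) \<beta> X \<zeta> v"
  unfolding profile_def by (rule sum.remove)

lemma peval_holomorphic:
  assumes "\<And>v. v \<in> vars P \<Longrightarrow> (\<lambda>\<zeta>. f \<zeta> v) holomorphic_on A"
  shows "(\<lambda>\<zeta>. peval id (f \<zeta>) P) holomorphic_on A"
  unfolding peval_def using assms
  by (intro holomorphic_intros) (auto simp: vars_def)

lemma profile_holomorphic: "(\<lambda>\<zeta>. profile B \<beta> X \<zeta> v) holomorphic_on - X ` B"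
  unfolding profile_def by (intro holomorphic_intros) auto

lemma current_holomorphic: "(\<lambda>\<zeta>. peval id (profile B \<beta> X \<zeta>) P) holomorphic_on - X ` B"
  by (intro peval_holomorphic profile_holomorphic)

lemma peval_has_fps_expansion:
  assumes "\<And>v. v \<in> vars P \<Longrightarrow> (\<lambda>t. f t v) has_fps_expansion F v"
  shows "(\<lambda>t. peval id (f t) P) has_fps_expansion peval fps_const F P"
  unfolding peval_def using assms
  by (intro fps_expansion_intros) (auto simp: vars_def)

text \<open>Near \<open>X a\<close> the profile is the pole of the charge there plus the Taylor
  series of the field of the others, which is the substitution that defines descendants. So the
  descendants are the Laurent coefficients of the current.\<close>

lemma current_laurent:
  assumes B: "finite B" "inj_on X B" "a \<in> B" and P: "P \<in> Vplus" "weighted_homogeneous s P"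
  shows "(\<lambda>t. peval id (profile B \<beta> X (X a + t)) P) has_laurent_expansion fls_X_inv ^ s
    * fps_to_fls (Abs_fps (\<lambda>j. peval id (profile (B - {a}) \<beta> X (X a)) (descendant s P j (\<beta> a))))"
proof -
  let ?f = "profile (B - {a}) \<beta> X (X a)"
  let ?F = "shifted_fps (\<beta> a) ?f id"
  let ?D = "Abs_fps (\<lambda>j. peval id ?f (descendant s P j (\<beta> a)))"
  have F: "(\<lambda>t. t ^ fst v * profile (B - {a}) \<beta> X (X a + t) v + (-1) ^ fst v / (2 * of_nat (fst v)) * \<beta> a $ snd v)
      has_fps_expansion ?F v" if v: "v \<in> vars P" for v
  proof -
    obtain n where n: "fst v = Suc n" using P(1) v by (metis Suc_le_D Vplus_vars One_nat_def)
    have c: "X b - X a \<noteq> 0" if "b \<in> B - {a}" for b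
      using B that by (auto dest: inj_onD)
    have "(\<lambda>t. profile (B - {a}) \<beta> X (X a + t) v) has_fps_expansion
       (\<Sum>b\<in>B - {a}. fps_const (\<beta> b $ snd v / (2 * of_nat (Suc n))) * inverse (fps_const (X b - X a) - fps_X) ^ Suc n)"
      unfolding profile_def n
      unfolding diff_diff_eq[symmetric]
      by (intro fps_expansion_intros has_fps_expansion_inverse) (use c in auto)
    also have "(\<Sum>b\<in>B - {a}. fps_const (\<beta> b $ snd v / (2 * of_nat (Suc n))) * inverse (fps_const (X b - X a) - fps_X) ^ Suc n)
       = Abs_fps (\<lambda>l. of_nat ((fst v + l) choose fst v) * ?f (fst v + l, snd v))"
    proof (rule fps_ext)
      fix l
      \<comment> \<open>Matches the expansion of a profile value at a shifted point with multiples
        of the values whose index is increased by \<open>l\<close>.\<close>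
      have k: "of_nat ((n + l) choose l) / of_nat (Suc n) = (of_nat ((Suc n + l) choose Suc n) / of_nat (Suc n + l) :: complex)"
      proof -
        have "Suc n * ((Suc n + l) choose Suc n) = Suc (n + l) * ((n + l) choose n)"
          using binomial_absorption[of n "Suc (n + l)"] by simp
        then have "of_nat (Suc n) * (of_nat ((Suc n + l) choose Suc n) :: complex) = of_nat (Suc n + l) * of_nat ((n + l) choose l)"
          by (simp only: of_nat_mult[symmetric] binomial_symmetric[of l "n + l"]) simp
        then show ?thesis
          by (simp add: divide_simps del: of_nat_Suc binomial_Suc_Suc) (simp add: mult_ac)
      qed
      have "(\<Sum>b\<in>B - {a}. fps_const (\<beta> b $ snd v / (2 * of_nat (Suc n))) * inverse (fps_const (X b - X a) - fps_X) ^ Suc n) $ l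
        = (\<Sum>b\<in>B - {a}. \<beta> b $ snd v / 2 * (of_nat ((n + l) choose l) / of_nat (Suc n)) * inverse (X b - X a) ^ (Suc n + l))"
        unfolding fps_sum_nth fps_mult_left_const_nth
        by (intro sum.cong refl) (simp add: fps_nth_inverse_linear_power[OF c] del: power_Suc of_nat_Suc)
      then show "(\<Sum>b\<in>B - {a}. fps_const (\<beta> b $ snd v / (2 * of_nat (Suc n))) * inverse (fps_const (X b - X a) - fps_X) ^ Suc n) $ l
         = Abs_fps (\<lambda>l. of_nat ((fst v + l) choose fst v) * ?f (fst v + l, snd v)) $ l"
        unfolding k by (simp add: n profile_def sum_distrib_left mult_ac del: binomial_Suc_Suc of_nat_Suc)
    qed
    finally show ?thesis
      unfolding shifted_fps_def id_def by (intro fps_expansion_intros)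
  qed
  have "(\<lambda>t. peval id (\<lambda>v. t ^ fst v * profile (B - {a}) \<beta> X (X a + t) v + (-1) ^ fst v / (2 * of_nat (fst v)) * \<beta> a $ snd v) P)
      has_fps_expansion peval fps_const ?F P"
    by (rule peval_has_fps_expansion[OF F])
  also have "peval fps_const ?F P = ?D"
    by (simp add: fps_eq_iff peval_descendant[OF P(2)])
  finally have "(\<lambda>t. inverse t ^ s * peval id (\<lambda>v. t ^ fst v * profile (B - {a}) \<beta> X (X a + t) v
      + (-1) ^ fst v / (2 * of_nat (fst v)) * \<beta> a $ snd v) P) has_laurent_expansion fls_X_inv ^ s * fps_to_fls ?D"
    by (intro laurent_expansion_intros has_laurent_expansion_fps)
  moreover have "inverse t ^ s * peval id (\<lambda>v. t ^ fst v * profile (B - {a}) \<beta> X (X a + t) v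
      + (-1) ^ fst v / (2 * of_nat (fst v)) * \<beta> a $ snd v) P = peval id (profile B \<beta> X (X a + t)) P" if "t \<noteq> 0" for t
  proof -
    \<comment> \<open>The sign \<open>(-1) ^ fst v\<close> arises because the profile contains
      \<open>X a - \<zeta> = - t\<close>.\<close>
    have "t ^ fst v * profile (B - {a}) \<beta> X (X a + t) v + (-1) ^ fst v / (2 * of_nat (fst v)) * \<beta> a $ snd v
        = t ^ fst v * profile B \<beta> X (X a + t) v" for v
    proof -
      have "t ^ fst v * inverse (- t) ^ fst v = (-1) ^ fst v"
        using that by (simp add: power_mult_distrib[symmetric])
      then show ?thesis
        by (simp add: profile_remove[OF B(1,3)] distrib_left mult_ac)
    qed
    then have "inverse t ^ s * peval id (\<lambda>v. t ^ fst v * profile (B - {a}) \<beta> X (X a + t) v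
      + (-1) ^ fst v / (2 * of_nat (fst v)) * \<beta> a $ snd v) P = inverse t ^ s * (t ^ s * peval id (profile B \<beta> X (X a + t)) P)"
      by (simp only: peval_weighted[OF P(2)])
    then show ?thesis using that by (simp add: mult.assoc[symmetric] power_mult_distrib[symmetric])
  qed
  ultimately show ?thesis
    by (subst has_laurent_expansion_cong) (auto simp: eventually_at_filter)
qed

text \<open>Up to \<open>2 \<pi> \<i>\<close> the sum is the integral over any large circle, which
  the decay makes arbitrarily small.\<close>

lemma sum_residues_zero:
  assumes "finite S" "G holomorphic_on - S" "((\<lambda>\<zeta>. \<zeta> * G \<zeta>) \<longlongrightarrow> 0) at_infinity"
  shows "(\<Sum>p\<in>S. residue G p) = 0"
proof -
  have "norm (\<Sum>p\<in>S. residue G p) \<le> \<epsilon>" if "\<epsilon> > 0" for \<epsilon>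
  proof -
    have "\<forall>\<^sub>F \<zeta> in at_infinity. norm (\<zeta> * G \<zeta>) < \<epsilon>"
      using tendstoD[OF assms(3) that] by simp
    then obtain b where b: "norm (\<zeta> * G \<zeta>) < \<epsilon>" if "norm \<zeta> \<ge> b" for \<zeta>
      unfolding eventually_at_infinity by blast
    \<comment> \<open>Beyond every pole by at least 1, and beyond the radius from which the decay
      estimate holds.\<close>
    define R where "R = Max (insert (max 1 b) ((\<lambda>p. norm p + 1) ` S))"
    have R: "max 1 b \<le> R" "\<And>p. p \<in> S \<Longrightarrow> norm p + 1 \<le> R"
      unfolding R_def by (rule Max_ge; use assms(1) in simp)+
    have p: "norm p < R" if "p \<in> S" for p using R(2)[OF that] by simp
    have "contour_integral (circlepath 0 R) G
        = 2 * pi * \<i> * (\<Sum>p\<in>S. winding_number (circlepath 0 R) p * residue G p)"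
    proof (rule Residue_theorem[of UNIV])
      show "path_image (circlepath 0 R) \<subseteq> UNIV - S"
        using p R(1) by (auto simp: path_image_circlepath sphere_def)
    qed (use assms in \<open>auto simp: Compl_eq_Diff_UNIV\<close>)
    also have "(\<Sum>p\<in>S. winding_number (circlepath 0 R) p * residue G p) = (\<Sum>p\<in>S. residue G p)"
      by (intro sum.cong refl) (simp add: winding_number_circlepath p)
    finally have eq: "contour_integral (circlepath 0 R) G = 2 * pi * \<i> * (\<Sum>p\<in>S. residue G p)" .
    have "norm (contour_integral (circlepath 0 R) G) \<le> (\<epsilon> / R) * (2 * pi * R)"
    proof (rule has_contour_integral_bound_circlepath)
      have "G contour_integrable_on circlepath 0 R"
      proof (rule contour_integrable_holomorphic_simple[of _ "- S"])
        show "path_image (circlepath 0 R) \<subseteq> - S"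
          using p R(1) by (auto simp: path_image_circlepath sphere_def)
      qed (use assms in \<open>auto intro: finite_imp_closed\<close>)
      then show "(G has_contour_integral contour_integral (circlepath 0 R) G) (circlepath 0 R)"
        by (rule has_contour_integral_integral)
      fix \<zeta> :: complex assume "norm (\<zeta> - 0) = R"
      then have "R * norm (G \<zeta>) < \<epsilon>" using b[of \<zeta>] R(1) by (simp add: norm_mult)
      then show "norm (G \<zeta>) \<le> \<epsilon> / R" using R(1) by (simp add: field_simps)
    qed (use that R(1) in auto)
    then have "2 * pi * norm (\<Sum>p\<in>S. residue G p) \<le> 2 * pi * \<epsilon>"
      unfolding eq using R(1) by (simp add: norm_mult mult_ac)
    then show ?thesis by simp
  qed
  then have "norm (\<Sum>p\<in>S. residue G p) \<le> 0"
    by (rule field_le_epsilon[of _ 0, simplified])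
  then show ?thesis by simp
qed

lemma tendsto_peval:
  "(\<And>v. v \<in> vars P \<Longrightarrow> ((\<lambda>x. f x v) \<longlongrightarrow> g v) L) \<Longrightarrow> ((\<lambda>x. peval id (f x) P) \<longlongrightarrow> peval id g P) L"
  unfolding peval_def by (intro tendsto_intros) (auto simp: vars_def)

text \<open>Adding \<open>1 / \<zeta>\<close> to all inverse distances changes nothing by
  \<open>W_current_translation\<close>, and turns \<open>1 / (X b - \<zeta>)\<close> into a quantity
  of order \<open>1 / \<zeta>^2\<close>. Weighted homogeneity raises this to
  \<open>\<zeta>^(- 2 s)\<close>.\<close>

lemma current_decay:
  assumes W: "W_currents e \<gamma> spin P" "a \<in> {1..CARD('r)}"
    and B: "finite B" and neutral: "(\<Sum>b\<in>B. \<beta> b) = 2 *s background e \<gamma>"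
  shows "((\<lambda>\<zeta>. \<zeta> ^ (2 * spin a) * peval id (profile B \<beta> X \<zeta>) (P a :: 'r::finite dpoly)) \<longlongrightarrow>
    peval id (\<lambda>v. \<Sum>b\<in>B. \<beta> b $ snd v / (2 * of_nat (fst v)) * (- X b) ^ fst v) (P a)) at_infinity"
proof -
  have P: "weighted_homogeneous (spin a) (P a)"
    using W unfolding W_currents_def by simp
  let ?f = "\<lambda>\<zeta> v. \<Sum>b\<in>B. \<beta> b $ snd v / (2 * of_nat (fst v)) * (X b / (X b * inverse \<zeta> - 1)) ^ fst v"
  have lim: "((\<lambda>\<zeta>. peval id (?f \<zeta>) (P a)) \<longlongrightarrow>
    peval id (\<lambda>v. \<Sum>b\<in>B. \<beta> b $ snd v / (2 * of_nat (fst v)) * (- X b) ^ fst v) (P a)) at_infinity"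
  proof (rule tendsto_peval)
    fix v :: "nat \<times> 'r"
    have "((\<lambda>\<zeta>. X b / (X b * inverse \<zeta> - 1)) \<longlongrightarrow> X b / (X b * 0 - 1)) at_infinity" for b
      by (intro tendsto_intros tendsto_inverse_0) auto
    then show "((\<lambda>\<zeta>. ?f \<zeta> v) \<longlongrightarrow> (\<Sum>b\<in>B. \<beta> b $ snd v / (2 * of_nat (fst v)) * (- X b) ^ fst v)) at_infinity"
      by (intro tendsto_intros) simp
  qed
  define R where "R = Max (insert 1 ((\<lambda>b. norm (X b) + 1) ` B))"
  have R: "1 \<le> R" "\<And>b. b \<in> B \<Longrightarrow> norm (X b) + 1 \<le> R"
    unfolding R_def using B by (auto intro!: Max_ge)
  have "\<forall>\<^sub>F \<zeta> in at_infinity. peval id (?f \<zeta>) (P a) = \<zeta> ^ (2 * spin a) * peval id (profile B \<beta> X \<zeta>) (P a)"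
    unfolding eventually_at_infinity
  proof (intro exI allI impI)
    fix \<zeta> :: complex assume \<zeta>: "R \<le> norm \<zeta>"
    have z0: "\<zeta> \<noteq> 0" and X: "X b - \<zeta> \<noteq> 0" if "b \<in> B" for b
      using \<zeta> R(1) R(2)[OF that] by auto
    have z0: "\<zeta> \<noteq> 0" using \<zeta> R(1) by auto
    have "inverse (X b - \<zeta>) + inverse \<zeta> = inverse \<zeta> ^ 2 * (X b / (X b * inverse \<zeta> - 1))" if "b \<in> B" for b
    proof -
      have "X b * inverse \<zeta> - 1 = (X b - \<zeta>) * inverse \<zeta>" using z0 by (simp add: field_simps)
      then show ?thesis using z0 X[OF that]
        by (simp add: divide_simps power2_eq_square)
    qed
    then have f: "(\<Sum>b\<in>B. \<beta> b $ i / (2 * of_nat n) * (inverse (X b - \<zeta>) + inverse \<zeta>) ^ n)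
        = (inverse \<zeta> ^ 2) ^ n * ?f \<zeta> (n, i)" for n i
      by (simp add: sum_distrib_left power_mult_distrib mult_ac times_divide_eq_right[symmetric]
          del: times_divide_eq_right)
    have "peval id (profile B \<beta> X \<zeta>) (P a)
        = peval id (\<lambda>(n, i). \<Sum>b\<in>B. \<beta> b $ i / (2 * of_nat n) * inverse (X b - \<zeta>) ^ n) (P a)"
      by (rule peval_cong) (simp add: profile_def case_prod_unfold)
    also have "\<dots> = peval id (\<lambda>(n, i). (inverse \<zeta> ^ 2) ^ n * ?f \<zeta> (n, i)) (P a)"
      unfolding f[symmetric] by (rule W_current_translation[OF W neutral, symmetric])
    also have "\<dots> = (inverse \<zeta> ^ 2) ^ spin a * peval id (?f \<zeta>) (P a)"
      by (simp add: case_prod_unfold flip: peval_weighted[OF P])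
    finally show "peval id (?f \<zeta>) (P a) = \<zeta> ^ (2 * spin a) * peval id (profile B \<beta> X \<zeta>) (P a)"
      using z0 by (simp add: power_mult[symmetric] mult.assoc[symmetric] power_mult_distrib[symmetric])
  qed
  then show ?thesis using Lim_transform_eventually[OF lim] by simp
qed

text \<open>The pole of order \<open>s\<close> pairs the Taylor coefficient \<open>m\<close> of the
  test function with the descendant of index \<open>s - 1 - m\<close>.\<close>

lemma current_residue_regular:
  assumes B: "finite B" "inj_on X B" "a \<in> B" and P: "P \<in> Vplus" "weighted_homogeneous s P"
    and f: "(\<lambda>t. f (X a + t)) has_fps_expansion F"
  shows "residue (\<lambda>\<zeta>. f \<zeta> * peval id (profile B \<beta> X \<zeta>) P) (X a)
    = (\<Sum>m<s. F $ m * peval id (profile (B - {a}) \<beta> X (X a)) (descendant s P (s - 1 - m) (\<beta> a)))"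
proof -
  let ?D = "Abs_fps (\<lambda>j. peval id (profile (B - {a}) \<beta> X (X a)) (descendant s P j (\<beta> a)))"
  have "(\<lambda>t. f (X a + t) * peval id (profile B \<beta> X (X a + t)) P) has_laurent_expansion
      fps_to_fls F * (fls_X_inv ^ s * fps_to_fls ?D)"
    by (intro laurent_expansion_intros has_laurent_expansion_fps f current_laurent B P)
  then have "residue (\<lambda>\<zeta>. f \<zeta> * peval id (profile B \<beta> X \<zeta>) P) (X a)
     = fls_residue (fps_to_fls F * (fls_X_inv ^ s * fps_to_fls ?D))"
    by (rule has_laurent_expansion_residue)
  also have "fps_to_fls F * (fls_X_inv ^ s * fps_to_fls ?D) = fls_shift (int s) (fps_to_fls (F * ?D))"
    by (subst mult.left_commute) (simp add: fls_X_inv_power_times_conv_shift fls_times_fps_to_fls)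
  also have "fls_residue \<dots> = (if s = 0 then 0 else (F * ?D) $ (s - 1))"
    by (auto simp: fls_residue_def nat_diff_distrib)
  also have "\<dots> = (\<Sum>m<s. F $ m * ?D $ (s - 1 - m))"
    by (cases s) (auto simp: fps_mult_nth atLeast0AtMost lessThan_Suc_atMost)
  finally show ?thesis by (simp only: fps_nth_Abs_fps)
qed

text \<open>The additional simple pole of the test function selects the descendant of index
  \<open>s\<close>; the sign comes from \<open>X a - \<zeta> = - t\<close>.\<close>

lemma current_residue_pole:
  assumes B: "finite B" "inj_on X B" "a \<in> B" and P: "P \<in> Vplus" "weighted_homogeneous s P"
  shows "residue (\<lambda>\<zeta>. inverse (X a - \<zeta>) * peval id (profile B \<beta> X \<zeta>) P) (X a)
    = - peval id (profile (B - {a}) \<beta> X (X a)) (descendant s P s (\<beta> a))"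
proof -
  let ?D = "Abs_fps (\<lambda>j. peval id (profile (B - {a}) \<beta> X (X a)) (descendant s P j (\<beta> a)))"
  have "(\<lambda>t. - (inverse t * peval id (profile B \<beta> X (X a + t)) P)) has_laurent_expansion
      - (fls_X_inv * (fls_X_inv ^ s * fps_to_fls ?D))"
    by (intro laurent_expansion_intros current_laurent B P)
  then have "residue (\<lambda>\<zeta>. inverse (X a - \<zeta>) * peval id (profile B \<beta> X \<zeta>) P) (X a)
     = fls_residue (- (fls_X_inv ^ Suc s * fps_to_fls ?D))"
    by (intro has_laurent_expansion_residue) (simp add: mult.assoc inverse_minus_eq)
  then show ?thesis
    unfolding fls_X_inv_power_times_conv_shift by (simp add: fls_residue_def)
qed

text \<open>Expansion in the inverse distance from one charge; \<open>peval_taylor\<close>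
  identifies the coefficients with the operators that occur in the screening condition.\<close>

lemma current_split:
  assumes B: "finite B" "a \<in> B" and P: "weighted_homogeneous s P"
  shows "peval id (profile B \<beta> X \<zeta>) P = (\<Sum>j\<le>s. inverse (X a - \<zeta>) ^ j * peval id (profile (B - {a}) \<beta> X \<zeta>)
     (series_exp (\<lambda>n G. cst (1 / (2 * of_nat n)) * partial_dir (\<beta> a) n G) j P))"
proof -
  let ?f = "profile (B - {a}) \<beta> X \<zeta>" and ?t = "inverse (X a - \<zeta>)"
  let ?c = "\<lambda>j. peval id ?f (series_exp (\<lambda>n G. cst (1 / (2 * of_nat n)) * partial_dir (\<beta> a) n G) j P)"
  let ?p = "peval (\<lambda>x. [:x:]) (\<lambda>v. [:?f v:] + monom (\<beta> a $ snd v / (2 * of_nat (fst v))) (fst v)) P"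
  have "peval id (profile B \<beta> X \<zeta>) P = poly ?p ?t"
    unfolding poly_peval by (rule peval_cong) (simp add: profile_remove[OF B] poly_monom)
  also have "\<dots> = (\<Sum>j\<le>degree ?p. ?c j * ?t ^ j)"
    by (simp only: poly_altdef peval_taylor)
  also have "\<dots> = (\<Sum>j\<in>{..degree ?p} \<union> {..s}. ?c j * ?t ^ j)"
    by (rule sum.mono_neutral_left)
       (auto simp: peval_taylor[symmetric] coeff_eq_0 simp del: mult_eq_0_iff)
  also have "\<dots> = (\<Sum>j\<le>s. ?c j * ?t ^ j)"
    by (rule sum.mono_neutral_right) (auto simp: series_exp_partial_dir_eq_0[OF P])
  finally show ?thesis by (simp add: mult.commute)
qed

text \<open>Unlike at an insertion, the residue is wanted as a sum of derivatives of functions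
  regular at \<open>X a\<close>, so that the derivatives can be moved onto the Coulomb
  weight.\<close>

lemma current_residue_screening:
  fixes \<beta> :: "'k \<Rightarrow> complex^'r::finite"
  assumes B: "finite B" "inj_on X B" "a \<in> B" and P: "weighted_homogeneous s P"
    and f: "f analytic_on {X a}"
  defines "g \<equiv> \<lambda>j \<zeta>. f \<zeta> * peval id (profile (B - {a}) \<beta> X \<zeta>)
     (series_exp (\<lambda>n G. cst (1 / (2 * of_nat n)) * partial_dir (\<beta> a) n G) j P)"
  shows "residue (\<lambda>\<zeta>. f \<zeta> * peval id (profile B \<beta> X \<zeta>) P) (X a)
    = (\<Sum>j=1..s. (-1) ^ j * (deriv ^^ (j - 1)) (g j) (X a) / fact (j - 1))"
proof -
  have an: "g j analytic_on {X a}" for j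
  proof -
    have "X a \<notin> X ` (B - {a})" using B by (auto dest: inj_onD)
    moreover have "open (- X ` (B - {a}))" using B by (intro open_Compl finite_imp_closed) auto
    ultimately have "(\<lambda>\<zeta>. peval id (profile (B - {a}) \<beta> X \<zeta>) R) analytic_on {X a}" for R
      using current_holomorphic by (metis ComplI analytic_at)
    then show ?thesis unfolding g_def by (intro analytic_intros f)
  qed
  have "(\<lambda>t. \<Sum>j\<le>s. (-1) ^ j * inverse t ^ j * g j (X a + t)) has_laurent_expansion
      (\<Sum>j\<le>s. fls_const ((-1) ^ j) * fls_X_inv ^ j * fps_to_fls (fps_expansion (g j) (X a)))"
    by (intro laurent_expansion_intros has_laurent_expansion_fps analytic_at_imp_has_fps_expansion an)
  moreover have "f (X a + t) * peval id (profile B \<beta> X (X a + t)) P = (\<Sum>j\<le>s. (-1) ^ j * inverse t ^ j * g j (X a + t))" for t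
    unfolding current_split[OF B(1,3) P] g_def sum_distrib_left
    by (intro sum.cong refl) (simp add: inverse_minus_eq power_minus[of "inverse t"] mult_ac)
  ultimately have "residue (\<lambda>\<zeta>. f \<zeta> * peval id (profile B \<beta> X \<zeta>) P) (X a) =
      fls_residue (\<Sum>j\<le>s. fls_const ((-1) ^ j) * fls_X_inv ^ j * fps_to_fls (fps_expansion (g j) (X a)))"
    by (intro has_laurent_expansion_residue) simp
  also have "\<dots> = (\<Sum>j\<le>s. if j = 0 then 0 else (-1) ^ j * (deriv ^^ (j - 1)) (g j) (X a) / fact (j - 1))"
    unfolding fls_residue_def fls_nth_sum mult.assoc fls_X_inv_power_times_conv_shift(1)
    by (intro sum.cong refl) (auto simp: fps_expansion_def nat_diff_distrib)
  also have "\<dots> = (\<Sum>j=1..s. (-1) ^ j * (deriv ^^ (j - 1)) (g j) (X a) / fact (j - 1))"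
    by (rule sum.mono_neutral_cong_right) auto
  finally show ?thesis .
qed

text \<open>For \<open>n = 0\<close> the profile is constantly 0, since its coefficients are divided
  by \<open>2 * 0\<close>; from \<open>n = 1\<close> on differentiation raises the index.\<close>

lemma profile_has_derivative:
  assumes "\<zeta> \<notin> X ` B"
  shows "((\<lambda>\<zeta>. profile B \<beta> X \<zeta> (n, i)) has_field_derivative
    (if n = 0 then 0 else of_nat (Suc n) * profile B \<beta> X \<zeta> (Suc n, i))) (at \<zeta>)"
proof (cases n)
  case (Suc m)
  have "((\<lambda>\<zeta>. profile B \<beta> X \<zeta> (n, i)) has_field_derivative
      (\<Sum>b\<in>B. \<beta> b $ i / (2 * of_nat n) * (of_nat n * inverse (X b - \<zeta>) ^ (n - 1) * inverse (X b - \<zeta>) ^ 2))) (at \<zeta>)"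
    unfolding profile_def fst_conv snd_conv
  proof (rule DERIV_sum)
    fix b assume "b \<in> B"
    then have "X b - \<zeta> \<noteq> 0" using assms by auto
    then show "((\<lambda>\<zeta>. \<beta> b $ i / (2 * of_nat n) * inverse (X b - \<zeta>) ^ n) has_field_derivative
      \<beta> b $ i / (2 * of_nat n) * (of_nat n * inverse (X b - \<zeta>) ^ (n - 1) * inverse (X b - \<zeta>) ^ 2)) (at \<zeta>)"
      by (auto intro!: derivative_eq_intros simp: power2_eq_square mult_ac)
  qed
  also have "(\<Sum>b\<in>B. \<beta> b $ i / (2 * of_nat n) * (of_nat n * inverse (X b - \<zeta>) ^ (n - 1) * inverse (X b - \<zeta>) ^ 2))
     = of_nat (Suc n) * profile B \<beta> X \<zeta> (Suc n, i)"
    unfolding profile_def fst_conv snd_conv sum_distrib_left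
  proof (rule sum.cong[OF refl])
    fix b
    have "inverse (X b - \<zeta>) ^ (n - 1) * inverse (X b - \<zeta>) ^ 2 = inverse (X b - \<zeta>) ^ Suc n"
      using Suc by (simp flip: power_add)
    then show "\<beta> b $ i / (2 * of_nat n) * (of_nat n * inverse (X b - \<zeta>) ^ (n - 1) * inverse (X b - \<zeta>) ^ 2)
       = of_nat (Suc n) * (\<beta> b $ i / (2 * of_nat (Suc n)) * inverse (X b - \<zeta>) ^ Suc n)"
      using Suc by (simp add: mult.assoc del: power_Suc of_nat_Suc)
  qed
  finally show ?thesis using Suc by simp
qed (simp add: profile_def)

section \<open>From the screening condition to a total derivative\<close>

text \<open>A coefficient of the creation exponential of the screening operator, evaluated on the
  field of the other charges. It equals \<open>E\<^sup>(\<^sup>b\<^sup>) / (b! E)\<close> for the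
  multivalued function \<open>E\<close> that is the holomorphic factor, in \<open>\<zeta>\<close>,
  of the Coulomb weight.\<close>

definition dressing :: "complex^'r \<Rightarrow> 'k set \<Rightarrow> ('k \<Rightarrow> complex^'r) \<Rightarrow> ('k \<Rightarrow> complex) \<Rightarrow> nat \<Rightarrow> complex \<Rightarrow> complex" where
  "dressing u B \<beta> X b \<zeta> = peval id (profile B \<beta> X \<zeta>) (series_exp (\<lambda>n G. phi_dir u n * G) b 1)"

lemma dressing_0: "dressing u B \<beta> X 0 \<zeta> = 1"
  by (simp add: dressing_def series_exp_def peval_id.peval_one)

text \<open>The \<open>n\<close>-th derivative of \<open>log E\<close>, divided by
  \<open>(n - 1)!\<close>; in particular \<open>n = 1\<close> is the logarithmic derivative of
  \<open>E\<close>.\<close>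

definition force :: "complex^'r \<Rightarrow> 'k set \<Rightarrow> ('k \<Rightarrow> complex^'r) \<Rightarrow> ('k \<Rightarrow> complex) \<Rightarrow> nat \<Rightarrow> complex \<Rightarrow> complex" where
  "force u B \<beta> X n \<zeta> = of_nat n * peval id (profile B \<beta> X \<zeta>) (phi_dir u n)"

lemma dressing_recursion:
  "of_nat b * dressing u B \<beta> X b \<zeta> = (\<Sum>n=1..b. force u B \<beta> X n \<zeta> * dressing u B \<beta> X (b - n) \<zeta>)"
proof -
  interpret commuting_operators "\<lambda>n G. phi_dir u n * G" by (rule commuting_phi_dir)
  have "of_nat b * dressing u B \<beta> X b \<zeta>
      = peval id (profile B \<beta> X \<zeta>) (of_nat b * series_exp (\<lambda>n G. phi_dir u n * G) b 1)"
    by (simp add: dressing_def peval_id.peval_mult flip: cst_of_nat)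
  also have "\<dots> = (\<Sum>n=1..b. force u B \<beta> X n \<zeta> * dressing u B \<beta> X (b - n) \<zeta>)"
    unfolding series_exp_recursion peval_id.peval_sum
  proof (rule sum.cong[OF refl])
    fix n
    have "peval id (profile B \<beta> X \<zeta>) (of_nat n * series_exp (\<lambda>n G. phi_dir u n * G) (b - n) (phi_dir u n * 1))
       = of_nat n * (dressing u B \<beta> X (b - n) \<zeta> * peval id (profile B \<beta> X \<zeta>) (phi_dir u n))"
      by (subst series_exp_phi_dir) (simp add: dressing_def peval_id.peval_mult flip: cst_of_nat)
    then show "peval id (profile B \<beta> X \<zeta>) (of_nat n * series_exp (\<lambda>n G. phi_dir u n * G) (b - n) (phi_dir u n * 1))
       = force u B \<beta> X n \<zeta> * dressing u B \<beta> X (b - n) \<zeta>"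
      by (simp add: force_def mult_ac)
  qed
  finally show ?thesis .
qed

lemma force_eq: "force u B \<beta> X n \<zeta> = of_nat n * (\<Sum>i\<in>UNIV. u $ i * profile B \<beta> X \<zeta> (n, i))"
  by (simp add: force_def phi_dir_def peval_id.peval_sum peval_id.peval_mult peval_id.peval_phi peval_id.peval_cst)

lemma force_has_derivative:
  assumes "\<zeta> \<notin> X ` B" "n \<ge> 1"
  shows "((\<lambda>\<zeta>. force u B \<beta> X n \<zeta>) has_field_derivative of_nat n * force u B \<beta> X (Suc n) \<zeta>) (at \<zeta>)"
proof -
  have "((\<lambda>\<zeta>. force u B \<beta> X n \<zeta>) has_field_derivative
      of_nat n * (\<Sum>i\<in>UNIV. u $ i * (if n = 0 then 0 else of_nat (Suc n) * profile B \<beta> X \<zeta> (Suc n, i)))) (at \<zeta>)"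
    unfolding force_eq by (intro DERIV_cmult DERIV_sum profile_has_derivative assms)
  then show ?thesis
    using assms(2) by (simp add: force_eq sum_distrib_left mult_ac del: of_nat_Suc)
qed

text \<open>The derivative of \<open>E\<^sup>(\<^sup>b\<^sup>) / (b! E)\<close>, obtained from
  \<open>dressing_recursion\<close> by strong induction, which avoids choosing a branch of
  \<open>E\<close>.\<close>

lemma dressing_has_derivative:
  assumes "\<zeta> \<notin> X ` B"
  shows "(dressing u B \<beta> X b has_field_derivative
    of_nat (Suc b) * dressing u B \<beta> X (Suc b) \<zeta> - force u B \<beta> X 1 \<zeta> * dressing u B \<beta> X b \<zeta>) (at \<zeta>)"
proof (induction b rule: less_induct)
  case (less b)
  let ?s = "dressing u B \<beta> X" and ?p = "force u B \<beta> X"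
  show ?case
  proof (cases b)
    case 0
    have "?s 1 \<zeta> = ?p 1 \<zeta>"
      using dressing_recursion[of 1 u B \<beta> X \<zeta>] by (simp add: dressing_0)
    moreover have "?s 0 = (\<lambda>\<zeta>. 1)" by (simp add: fun_eq_iff dressing_0)
    ultimately show ?thesis by (simp add: 0)
  next
    case (Suc k)
    have "((\<lambda>\<zeta>. \<Sum>n=1..b. ?p n \<zeta> * ?s (b - n) \<zeta>) has_field_derivative
       (\<Sum>n=1..b. ?p n \<zeta> * (of_nat (Suc (b - n)) * ?s (Suc (b - n)) \<zeta> - ?p 1 \<zeta> * ?s (b - n) \<zeta>)
          + of_nat n * ?p (Suc n) \<zeta> * ?s (b - n) \<zeta>)) (at \<zeta>)"
      by (intro DERIV_sum DERIV_mult' force_has_derivative less.IH assms) auto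
    also have "(\<Sum>n=1..b. ?p n \<zeta> * (of_nat (Suc (b - n)) * ?s (Suc (b - n)) \<zeta> - ?p 1 \<zeta> * ?s (b - n) \<zeta>)
          + of_nat n * ?p (Suc n) \<zeta> * ?s (b - n) \<zeta>)
       = (\<Sum>n=1..b. of_nat (Suc b - n) * (?p n \<zeta> * ?s (Suc b - n) \<zeta>))
         + (\<Sum>n=1..b. of_nat n * (?p (Suc n) \<zeta> * ?s (Suc b - Suc n) \<zeta>))
         - ?p 1 \<zeta> * (\<Sum>n=1..b. ?p n \<zeta> * ?s (b - n) \<zeta>)"
      unfolding sum_distrib_left sum.distrib[symmetric] sum_subtractf[symmetric]
      by (intro sum.cong refl) (simp add: Suc_diff_le algebra_simps del: of_nat_Suc)
    also have "(\<Sum>n=1..b. of_nat n * (?p (Suc n) \<zeta> * ?s (Suc b - Suc n) \<zeta>))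
        = (\<Sum>n\<in>{Suc 1..Suc b}. of_nat (n - 1) * (?p n \<zeta> * ?s (Suc b - n) \<zeta>))"
      by (subst sum.shift_bounds_cl_Suc_ivl) simp
    also have "\<dots> = (\<Sum>n=1..Suc b. of_nat (n - 1) * (?p n \<zeta> * ?s (Suc b - n) \<zeta>))"
      by (rule sum.mono_neutral_left) auto
    also have "(\<Sum>n=1..b. of_nat (Suc b - n) * (?p n \<zeta> * ?s (Suc b - n) \<zeta>))
        = (\<Sum>n=1..Suc b. of_nat (Suc b - n) * (?p n \<zeta> * ?s (Suc b - n) \<zeta>))"
      by (rule sum.mono_neutral_left) (auto simp: le_Suc_eq)
    also have "(\<Sum>n=1..Suc b. of_nat (Suc b - n) * (?p n \<zeta> * ?s (Suc b - n) \<zeta>))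
          + (\<Sum>n=1..Suc b. of_nat (n - 1) * (?p n \<zeta> * ?s (Suc b - n) \<zeta>))
        = (\<Sum>n=1..Suc b. of_nat b * (?p n \<zeta> * ?s (Suc b - n) \<zeta>))"
      unfolding sum.distrib[symmetric] distrib_right[symmetric]
      by (intro sum.cong refl arg_cong2[where f = "(*)"]) (auto simp flip: of_nat_add)
    also have "\<dots> = of_nat b * (of_nat (Suc b) * ?s (Suc b) \<zeta>)"
      unfolding dressing_recursion sum_distrib_left ..
    finally have "((\<lambda>\<zeta>. of_nat b * ?s b \<zeta>) has_field_derivative
        of_nat b * (of_nat (Suc b) * ?s (Suc b) \<zeta>) - ?p 1 \<zeta> * (of_nat b * ?s b \<zeta>)) (at \<zeta>)"
      unfolding dressing_recursion[symmetric] .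
    then have "((\<lambda>\<zeta>. (of_nat b * ?s b \<zeta>) / of_nat b) has_field_derivative
        (of_nat b * (of_nat (Suc b) * ?s (Suc b) \<zeta>) - ?p 1 \<zeta> * (of_nat b * ?s b \<zeta>)) / of_nat b) (at \<zeta>)"
      by (rule DERIV_cdivide)
    moreover have b: "of_nat b \<noteq> (0 :: complex)" using Suc by (simp del: of_nat_Suc)
    have "(\<lambda>\<zeta>. (of_nat b * ?s b \<zeta>) / of_nat b) = ?s b"
      by (rule ext) (rule nonzero_mult_div_cancel_left[OF b])
    moreover have "(of_nat b * (of_nat (Suc b) * ?s (Suc b) \<zeta>) - ?p 1 \<zeta> * (of_nat b * ?s b \<zeta>)) / of_nat b
       = of_nat (Suc b) * ?s (Suc b) \<zeta> - ?p 1 \<zeta> * ?s b \<zeta>"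
      using b by (simp add: field_simps del: of_nat_Suc)
    ultimately show ?thesis by simp
  qed
qed

lemma screening_dressing:
  assumes "weighted_homogeneous s P" "screening u P = 0"
  shows "(\<Sum>b<s. dressing u B \<beta> X b \<zeta> * peval id (profile B \<beta> X \<zeta>)
     (series_exp (\<lambda>n G. cst (1 / (2 * of_nat n)) * partial_dir u n G) (Suc b) P)) = 0"
proof -
  have "peval id (profile B \<beta> X \<zeta>) (screening u P) = 0"
    using assms(2) by (simp add: peval_id.peval_zero)
  then show ?thesis
    unfolding screening_eq[OF assms(1)] peval_id.peval_sum peval_id.peval_mult dressing_def .
qed

text \<open>Moving the derivatives of \<open>g j\<close> onto the factor \<open>E\<close> with \<open>E\<^sup>(\<^sup>b\<^sup>) = b! * s b * E\<close>, \<open>h = E' / E\<close>,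
  reduces the residue to the screening condition.\<close>

definition primitive_factor :: "nat \<Rightarrow> (nat \<Rightarrow> complex \<Rightarrow> complex) \<Rightarrow> (nat \<Rightarrow> complex \<Rightarrow> complex) \<Rightarrow> complex \<Rightarrow> complex" where
  "primitive_factor m g s \<zeta> = (\<Sum>j=1..m. (-1) ^ j / fact (j - 1) *
     (\<Sum>i<j - 1. (-1) ^ i * fact i * (deriv ^^ (j - 2 - i)) (g j) \<zeta> * s i \<zeta>))"

text \<open>Equivalently, \<open>primitive_factor\<close> times \<open>E\<close> is a primitive of
  the residue sum times \<open>E\<close>: integration by parts moves all derivatives off the
  \<open>g j\<close>, and what is left at the end is \<open>E\<close> times the screening sum, which
  vanishes.\<close>

lemma primitive_factor_derivative:
  assumes A: "open A" "\<zeta> \<in> A" and g: "\<And>j. g j holomorphic_on A"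
    and s: "\<And>b. (s b has_field_derivative of_nat (Suc b) * s (Suc b) \<zeta> - h * s b \<zeta>) (at \<zeta>)"
    and s0: "s 0 \<zeta> = 1"
    and screen: "(\<Sum>b<m. s b \<zeta> * g (Suc b) \<zeta>) = 0"
  shows "(primitive_factor m g s has_field_derivative
    (\<Sum>j=1..m. (-1) ^ j * (deriv ^^ (j - 1)) (g j) \<zeta> / fact (j - 1)) - h * primitive_factor m g s \<zeta>) (at \<zeta>)"
proof -
  have d: "((deriv ^^ k) (g j) has_field_derivative (deriv ^^ Suc k) (g j) \<zeta>) (at \<zeta>)" for k j
    using holomorphic_higher_deriv[OF g A(1), of k j] A by (simp add: holomorphic_derivI)
  have "(primitive_factor m g s has_field_derivative (\<Sum>j=1..m. (-1) ^ j / fact (j - 1) *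
     (\<Sum>i<j - 1. (-1) ^ i * fact i * (deriv ^^ (j - 2 - i)) (g j) \<zeta> * (of_nat (Suc i) * s (Suc i) \<zeta> - h * s i \<zeta>)
        + (-1) ^ i * fact i * (deriv ^^ Suc (j - 2 - i)) (g j) \<zeta> * s i \<zeta>))) (at \<zeta>)"
    unfolding primitive_factor_def by (intro DERIV_sum DERIV_cmult DERIV_mult' d s)
  moreover have "(\<Sum>i<j - 1. (-1) ^ i * fact i * (deriv ^^ (j - 2 - i)) (g j) \<zeta> * (of_nat (Suc i) * s (Suc i) \<zeta> - h * s i \<zeta>)
        + (-1) ^ i * fact i * (deriv ^^ Suc (j - 2 - i)) (g j) \<zeta> * s i \<zeta>)
      = (deriv ^^ (j - 1)) (g j) \<zeta> - (-1) ^ (j - 1) * fact (j - 1) * g j \<zeta> * s (j - 1) \<zeta>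
        - h * (\<Sum>i<j - 1. (-1) ^ i * fact i * (deriv ^^ (j - 2 - i)) (g j) \<zeta> * s i \<zeta>)" for j
  proof -
    \<comment> \<open>Stages of the integration by parts: stage 0 is the residue term, and stage
      \<open>j - 1\<close> has no derivative of \<open>g j\<close> left and feeds the screening
      sum.\<close>
    let ?F = "\<lambda>i. (-1) ^ i * fact i * (deriv ^^ (j - 1 - i)) (g j) \<zeta> * s i \<zeta>"
    have "(\<Sum>i<j - 1. (-1) ^ i * fact i * (deriv ^^ (j - 2 - i)) (g j) \<zeta> * (of_nat (Suc i) * s (Suc i) \<zeta> - h * s i \<zeta>)
        + (-1) ^ i * fact i * (deriv ^^ Suc (j - 2 - i)) (g j) \<zeta> * s i \<zeta>)
      = (\<Sum>i<j - 1. (?F i - ?F (Suc i)) - h * ((-1) ^ i * fact i * (deriv ^^ (j - 2 - i)) (g j) \<zeta> * s i \<zeta>))"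
    proof (rule sum.cong[OF refl])
      fix i assume "i \<in> {..<j - 1}"
      then have k: "j - 1 - i = Suc (j - 2 - i)" "j - 1 - Suc i = j - 2 - i" by auto
      show "(-1) ^ i * fact i * (deriv ^^ (j - 2 - i)) (g j) \<zeta> * (of_nat (Suc i) * s (Suc i) \<zeta> - h * s i \<zeta>)
        + (-1) ^ i * fact i * (deriv ^^ Suc (j - 2 - i)) (g j) \<zeta> * s i \<zeta>
        = (?F i - ?F (Suc i)) - h * ((-1) ^ i * fact i * (deriv ^^ (j - 2 - i)) (g j) \<zeta> * s i \<zeta>)"
        unfolding k by (simp add: algebra_simps)
    qed
    also have "\<dots> = (?F 0 - ?F (j - 1)) - h * (\<Sum>i<j - 1. (-1) ^ i * fact i * (deriv ^^ (j - 2 - i)) (g j) \<zeta> * s i \<zeta>)"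
      unfolding sum_subtractf[of _ "\<lambda>i. h * _ i"] sum_distrib_left[symmetric] sum_lessThan_telescope'[of ?F] ..
    finally show ?thesis by (simp add: s0)
  qed
  moreover define S where "S = (\<lambda>j. \<Sum>i<j - 1. (-1) ^ i * fact i * (deriv ^^ (j - 2 - i)) (g j) \<zeta> * s i \<zeta>)"
  ultimately have "(primitive_factor m g s has_field_derivative (\<Sum>j=1..m. (-1) ^ j / fact (j - 1) *
     ((deriv ^^ (j - 1)) (g j) \<zeta> - (-1) ^ (j - 1) * fact (j - 1) * g j \<zeta> * s (j - 1) \<zeta> - h * S j))) (at \<zeta>)"
    by simp
  also have "(\<Sum>j=1..m. (-1) ^ j / fact (j - 1) *
     ((deriv ^^ (j - 1)) (g j) \<zeta> - (-1) ^ (j - 1) * fact (j - 1) * g j \<zeta> * s (j - 1) \<zeta> - h * S j))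
     = (\<Sum>j=1..m. (-1) ^ j * (deriv ^^ (j - 1)) (g j) \<zeta> / fact (j - 1) + g j \<zeta> * s (j - 1) \<zeta>
       - h * ((-1) ^ j / fact (j - 1) * S j))"
  proof (rule sum.cong[OF refl])
    fix j assume "j \<in> {1..m}"
    then obtain k where k: "j = Suc k" by (cases j) auto
    have sq: "(-1) ^ k * (-1) ^ k = (1 :: complex)" by (simp flip: power_mult_distrib)
    have "(-1) ^ j / fact (j - 1) * ((-1) ^ (j - 1) * fact (j - 1) * g j \<zeta> * s (j - 1) \<zeta>) = - (g j \<zeta> * s (j - 1) \<zeta>)"
      using sq by (simp add: k mult.assoc[symmetric])
    then show "(-1) ^ j / fact (j - 1) *
     ((deriv ^^ (j - 1)) (g j) \<zeta> - (-1) ^ (j - 1) * fact (j - 1) * g j \<zeta> * s (j - 1) \<zeta> - h * S j)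
     = (-1) ^ j * (deriv ^^ (j - 1)) (g j) \<zeta> / fact (j - 1) + g j \<zeta> * s (j - 1) \<zeta>
       - h * ((-1) ^ j / fact (j - 1) * S j)"
      unfolding right_diff_distrib by simp
  qed
  also have "\<dots> = (\<Sum>j=1..m. (-1) ^ j * (deriv ^^ (j - 1)) (g j) \<zeta> / fact (j - 1))
       + (\<Sum>j=1..m. g j \<zeta> * s (j - 1) \<zeta>) - h * primitive_factor m g s \<zeta>"
  proof -
    have "primitive_factor m g s \<zeta> = (\<Sum>j=1..m. (-1) ^ j / fact (j - 1) * S j)"
      unfolding primitive_factor_def S_def ..
    then show ?thesis by (simp only: sum_subtractf sum.distrib sum_distrib_left)
  qed
  also have "(\<Sum>j=1..m. g j \<zeta> * s (j - 1) \<zeta>) = 0"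
  proof -
    have "(\<Sum>j=1..m. g j \<zeta> * s (j - 1) \<zeta>) = (\<Sum>b<m. s b \<zeta> * g (Suc b) \<zeta>)"
      by (rule sum.reindex_bij_witness[of _ Suc "\<lambda>j. j - 1"]) (auto simp: mult.commute)
    then show ?thesis using screen by simp
  qed
  finally show ?thesis by simp
qed

section \<open>Integration by parts over a screening charge\<close>

text \<open>No decay is assumed. Integrability of \<open>v'\<close> gives limits of \<open>v\<close>
  at both ends, and integrability of \<open>v\<close> forces these limits to be 0.\<close>

lemma integral_derivative_eq_0:
  fixes v v' :: "real \<Rightarrow> complex"
  assumes d: "\<And>t. (v has_vector_derivative v' t) (at t)"
    and int: "integrable lborel v" "integrable lborel v'"
  shows "integral\<^sup>L lborel v' = 0"
proof -
  have ftc: "(LINT t:{a..b}|lborel. v' t) = v b - v a" if "a \<le> b" for a b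
  proof -
    have "set_integrable lborel {a..b} v'"
      unfolding set_integrable_def by (rule integrable_mult_indicator[OF _ int(2)]) simp
    then have "(LINT t:{a..b}|lborel. v' t) = integral {a..b} v'"
      by (rule set_borel_integral_eq_integral)
    also have "\<dots> = v b - v a"
      using fundamental_theorem_of_calculus[OF that, of v v'] d
      by (auto intro: integral_unique has_vector_derivative_at_within)
    finally show ?thesis .
  qed
  have lim0: "c = 0" if c: "((\<lambda>t. v (\<sigma> * t)) \<longlongrightarrow> c) at_top" and \<sigma>: "\<bar>\<sigma>\<bar> = 1" for c \<sigma>
  proof (rule ccontr)
    assume "c \<noteq> 0"
    then have "\<forall>\<^sub>F t in at_top. dist (v (\<sigma> * t)) c < norm c / 2"
      using tendstoD[OF c, of "norm c / 2"] by simp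
    then obtain T where T: "dist (v (\<sigma> * t)) c < norm c / 2" if "T \<le> t" for t
      unfolding eventually_at_top_linorder by blast
    have big: "norm c / 2 \<le> norm (v (\<sigma> * t))" if "T \<le> t" for t
      using T[OF that] norm_triangle_ineq2[of c "v (\<sigma> * t)"] by (simp add: dist_norm norm_minus_commute)
    have int\<sigma>: "integrable lborel (\<lambda>t. v (\<sigma> * t))" "(LBINT t. norm (v (\<sigma> * t))) = (LBINT t. norm (v t))"
      using lborel_integrable_real_affine[OF int(1), of \<sigma> 0] \<sigma>
        lborel_integral_real_affine[of \<sigma> "\<lambda>t. norm (v t)" 0] by auto
    have "norm c / 2 * K \<le> (LBINT t. norm (v t))" if K: "K \<ge> 0" for K
    proof -
      have "norm c / 2 * K = (LBINT t. indicator {T..T + K} t *\<^sub>R (norm c / 2))"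
        using K by simp
      also have "\<dots> \<le> (LBINT t. norm (v (\<sigma> * t)))"
      proof (rule integral_mono)
        show "integrable lborel (\<lambda>t. norm (v (\<sigma> * t)))" using int\<sigma>(1) by (rule integrable_norm)
        show "indicator {T..T + K} t *\<^sub>R (norm c / 2) \<le> norm (v (\<sigma> * t))" for t
          using big[of t] by (simp split: split_indicator)
        show "integrable lborel (\<lambda>t. indicator {T..T + K} t *\<^sub>R (norm c / 2))"
          by (intro integrable_scaleR_left integrable_real_indicator) (simp_all add: emeasure_lborel_Icc_eq)
      qed
      finally show ?thesis using int\<sigma>(2) by simp
    qed
    \<comment> \<open>With interval length \<open>S / (norm c / 2) + 1\<close> the lower bound is
      \<open>S + norm c / 2\<close>, more than the whole integral.\<close>
    define S where "S = (LBINT t. norm (v t))"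
    have "norm c / 2 * (S / (norm c / 2) + 1) = S + norm c / 2"
      using \<open>c \<noteq> 0\<close> by (simp add: distrib_left)
    moreover have "0 \<le> S / (norm c / 2) + 1" by (simp add: S_def)
    ultimately show False
      using \<open>\<And>K. 0 \<le> K \<Longrightarrow> norm c / 2 * K \<le> (LBINT t. norm (v t))\<close>[of "S / (norm c / 2) + 1"] \<open>c \<noteq> 0\<close>
      unfolding S_def[symmetric] by simp
  qed
  have meas: "v' \<in> borel_measurable lborel" using int(2) by simp
  have top: "((\<lambda>t. v t) \<longlongrightarrow> v 0 + (LINT t:{0..}|lborel. v' t)) at_top"
  proof -
    have "((\<lambda>b. LINT t:{0..b}|lborel. v' t) \<longlongrightarrow> (LINT t:{0..}|lborel. v' t)) at_top"
      by (rule tendsto_set_lebesgue_integral_at_top)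
         (auto simp: set_integrable_def intro!: integrable_mult_indicator int)
    then have "((\<lambda>b. v 0 + (LINT t:{0..b}|lborel. v' t)) \<longlongrightarrow> v 0 + (LINT t:{0..}|lborel. v' t)) at_top"
      by (intro tendsto_intros)
    then show ?thesis
      by (rule Lim_transform_eventually) (use eventually_ge_at_top[of 0] in eventually_elim, simp add: ftc)
  qed
  have bot: "((\<lambda>t. v (- t)) \<longlongrightarrow> v 0 - (LINT t:{..0}|lborel. v' t)) at_top"
  proof -
    have "((\<lambda>a. LINT t:{a..0}|lborel. v' t) \<longlongrightarrow> (LINT t:{..0}|lborel. v' t)) at_bot"
      by (rule tendsto_set_lebesgue_integral_at_bot)
         (auto simp: set_integrable_def intro!: integrable_mult_indicator int)
    then have "((\<lambda>a. v 0 - (LINT t:{- a..0}|lborel. v' t)) \<longlongrightarrow> v 0 - (LINT t:{..0}|lborel. v' t)) at_top"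
      by (intro tendsto_intros) (simp add: filterlim_at_bot_mirror filterlim_compose[OF _ filterlim_uminus_at_bot_at_top])
    then show ?thesis
      by (rule Lim_transform_eventually) (use eventually_ge_at_top[of 0] in eventually_elim, simp add: ftc)
  qed
  have z: "v 0 + (LINT t:{0..}|lborel. v' t) = 0" "v 0 - (LINT t:{..0}|lborel. v' t) = 0"
    using lim0[of 1, simplified, OF top] lim0[of "-1", simplified, OF bot] by simp_all
  have "integral\<^sup>L lborel v' = (LINT t:{..0} \<union> {0..}|lborel. v' t)"
    unfolding set_lebesgue_integral_def by (rule Bochner_Integration.integral_cong) (auto split: split_indicator)
  also have "\<dots> = (LINT t:{..0}|lborel. v' t) + (LINT t:{0..}|lborel. v' t)"
  proof (rule set_integral_Un_AE)
    show "AE t in lborel. \<not> (t \<in> {..0} \<and> t \<in> {0 :: real ..})"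
      using AE_lborel_singleton[of "0 :: real"] by eventually_elim auto
  qed (auto simp: set_integrable_def intro!: integrable_mult_indicator int)
  finally show ?thesis using z by (simp add: algebra_simps eq_neg_iff_add_eq_0)
qed


text \<open>Here \<open>a\<close> and \<open>b\<close> are the two Wirtinger derivatives. Almost
  every horizontal and vertical line misses \<open>E\<close>, so one-dimensional integration shows
  that \<open>a + b\<close> and \<open>a - b\<close> both integrate to 0.\<close>

lemma plane_integral_eq_0:
  fixes v a b :: "complex \<Rightarrow> complex"
  assumes d: "\<And>w. w \<notin> E \<Longrightarrow> (v has_derivative (\<lambda>h. a w * h + b w * cnj h)) (at w)"
    and E: "finite E"
    and int: "integrable lborel v" "integrable lborel a" "integrable lborel b"
  shows "integral\<^sup>L lborel a = 0"
proof -
  let ?c = "\<lambda>p. Complex (fst p) (snd p)"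
  have [measurable]: "?c \<in> borel_measurable (lborel \<Otimes>\<^sub>M lborel)"
    unfolding Complex_eq by measurable
  have distr: "(lborel :: complex measure) = distr (lborel \<Otimes>\<^sub>M lborel) borel ?c"
    by (rule lborel_complex_eq_distr[unfolded case_prod_beta])
  have pint: "integrable (lborel \<Otimes>\<^sub>M lborel) (\<lambda>(x, y). f (Complex x y))" if "integrable lborel f" for f :: "complex \<Rightarrow> complex"
  proof -
    have [measurable]: "f \<in> borel_measurable borel" using that by simp
    show ?thesis using that by (subst (asm) distr) (simp add: integrable_distr_eq case_prod_unfold)
  qed
  have pintegral: "integral\<^sup>L lborel f = integral\<^sup>L (lborel \<Otimes>\<^sub>M lborel) (\<lambda>(x, y). f (Complex x y))"
    if "integrable lborel f" for f :: "complex \<Rightarrow> complex"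
  proof -
    have [measurable]: "f \<in> borel_measurable borel" using that by simp
    show ?thesis by (subst distr) (simp add: integral_distr case_prod_unfold)
  qed
  have AE_finite: "AE t in lborel. t \<notin> A" if "finite A" for A :: "real set"
    by (rule AE_not_in[OF finite_imp_null_set_lborel[OF that]])
  have x: "integral\<^sup>L lborel (\<lambda>w. a w + b w) = 0"
  proof -
    have i: "integrable lborel (\<lambda>w. a w + b w)" using int by simp
    have "AE y in lborel. (LBINT x. a (Complex x y) + b (Complex x y)) = 0"
      using lborel_pair.AE_integrable_snd[OF pint[OF i]] lborel_pair.AE_integrable_snd[OF pint[OF int(1)]]
        AE_finite[OF finite_imageI[OF E, of Im]]
    proof eventually_elim
      case (elim y)
      have "((\<lambda>x. v (Complex x y)) has_vector_derivative a (Complex x y) + b (Complex x y)) (at x)" for x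
      proof -
        have "Complex x y \<notin> E" using elim(3) by force
        have "((\<lambda>x. v (Complex x y)) has_derivative (\<lambda>h. a (Complex x y) * of_real h + b (Complex x y) * cnj (of_real h))) (at x)"
          by (rule has_derivative_compose[of "\<lambda>x. Complex x y" of_real, OF _ d[OF \<open>Complex x y \<notin> E\<close>]])
             (auto simp: Complex_eq intro!: derivative_eq_intros)
        then show ?thesis
          by (simp add: has_vector_derivative_def scaleR_conv_of_real algebra_simps)
      qed
      then show ?case by (rule integral_derivative_eq_0) (use elim in auto)
    qed
    then have "(LBINT y. LBINT x. a (Complex x y) + b (Complex x y)) = 0"
      by (rule integral_eq_zero_AE)
    then show ?thesis
      by (simp add: pintegral[OF i] lborel_pair.integral_snd[OF pint[OF i], symmetric])
  qed
  have y: "integral\<^sup>L lborel (\<lambda>w. \<i> * a w - \<i> * b w) = 0"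
  proof -
    have i: "integrable lborel (\<lambda>w. \<i> * a w - \<i> * b w)" using int by simp
    have "AE x in lborel. (LBINT y. \<i> * a (Complex x y) - \<i> * b (Complex x y)) = 0"
      using lborel_pair.AE_integrable_fst[OF pint[OF i]] lborel_pair.AE_integrable_fst[OF pint[OF int(1)]]
        AE_finite[OF finite_imageI[OF E, of Re]]
    proof eventually_elim
      case (elim x)
      have "((\<lambda>y. v (Complex x y)) has_vector_derivative \<i> * a (Complex x y) - \<i> * b (Complex x y)) (at y)" for y
      proof -
        have "Complex x y \<notin> E" using elim(3) by force
        have "((\<lambda>y. v (Complex x y)) has_derivative (\<lambda>h. a (Complex x y) * (\<i> * of_real h) + b (Complex x y) * cnj (\<i> * of_real h))) (at y)"
          by (rule has_derivative_compose[of "\<lambda>y. Complex x y" "\<lambda>h. \<i> * of_real h", OF _ d[OF \<open>Complex x y \<notin> E\<close>]])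
             (auto simp: Complex_eq intro!: derivative_eq_intros)
        then show ?thesis
          by (simp add: has_vector_derivative_def scaleR_conv_of_real algebra_simps)
      qed
      then show ?case by (rule integral_derivative_eq_0) (use elim in auto)
    qed
    then have "(LBINT x. LBINT y. \<i> * a (Complex x y) - \<i> * b (Complex x y)) = 0"
      by (rule integral_eq_zero_AE)
    then show ?thesis
      by (simp add: pintegral[OF i] lborel_pair.integral_fst[OF pint[OF i], symmetric])
  qed
  have "integral\<^sup>L lborel a + integral\<^sup>L lborel b = 0" "\<i> * integral\<^sup>L lborel a - \<i> * integral\<^sup>L lborel b = 0"
    using x y int by simp_all
  then show ?thesis by (simp add: add_eq_0_iff)
qed

lemma config_integral_eq_0:
  fixes v a b :: "('i \<Rightarrow> complex) \<Rightarrow> complex"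
  assumes I: "finite I" "q \<in> I"
    and d: "\<And>x w. x \<in> space (config_measure I) \<Longrightarrow> w \<notin> E x \<Longrightarrow>
        ((\<lambda>w. v (x(q := w))) has_derivative (\<lambda>h. a (x(q := w)) * h + b (x(q := w)) * cnj h)) (at w)"
    and E: "\<And>x. finite (E x)"
    and int: "integrable (config_measure I) v" "integrable (config_measure I) a" "integrable (config_measure I) b"
  shows "integral\<^sup>L (config_measure I) a = 0"
proof -
  let ?K = "I - {q}" and ?L = "\<lambda>_. lborel :: complex measure"
  have K: "finite ?K" "q \<notin> ?K" "insert q ?K = I" using I by auto
  have AE: "AE x in PiM ?K ?L. integrable lborel (\<lambda>w. f (x(q := w)))" if f: "integrable (config_measure I) f" for f :: "_ \<Rightarrow> complex"
  proof -
    have m [measurable]: "f \<in> borel_measurable (PiM (insert q ?K) ?L)"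
      using f unfolding K(3) by simp
    have "(\<integral>\<^sup>+ x. (\<integral>\<^sup>+ w. ennreal (norm (f (x(q := w)))) \<partial>lborel) \<partial>PiM ?K ?L)
       = (\<integral>\<^sup>+ x. ennreal (norm (f x)) \<partial>PiM (insert q ?K) ?L)"
      by (rule lborel_product.product_nn_integral_insert[OF K(1,2), symmetric]) measurable
    also have "\<dots> < \<infinity>"
      using f unfolding K(3) integrable_iff_bounded by simp
    finally have "(\<integral>\<^sup>+ x. (\<integral>\<^sup>+ w. ennreal (norm (f (x(q := w)))) \<partial>lborel) \<partial>PiM ?K ?L) \<noteq> \<infinity>" by simp
    moreover have "(\<lambda>x. \<integral>\<^sup>+ w. ennreal (norm (f (x(q := w)))) \<partial>lborel) \<in> borel_measurable (PiM ?K ?L)"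
      by measurable
    ultimately have "AE x in PiM ?K ?L. (\<integral>\<^sup>+ w. ennreal (norm (f (x(q := w)))) \<partial>lborel) \<noteq> \<infinity>"
      by (rule nn_integral_PInf_AE[rotated])
    then show ?thesis
      using AE_space
    proof eventually_elim
      case (elim x)
      have "(\<lambda>w. f (x(q := w))) \<in> borel_measurable lborel"
        using elim(2) by measurable
      then show ?case using elim(1) unfolding integrable_iff_bounded by (simp add: top.not_eq_extremum)
    qed
  qed
  have "AE x in PiM ?K ?L. (LBINT w. a (x(q := w))) = 0"
    using AE[OF int(1)] AE[OF int(2)] AE[OF int(3)] AE_space
  proof eventually_elim
    case (elim x)
    let ?x = "x(q := 0)"
    have "?x \<in> space (config_measure I)"
      using elim(4) I(2) by (auto simp: space_PiM PiE_def extensional_def)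
    from d[OF this] have "((\<lambda>w. v (x(q := w))) has_derivative (\<lambda>h. a (x(q := w)) * h + b (x(q := w)) * cnj h)) (at w)"
      if "w \<notin> E ?x" for w using that by simp
    then show ?case by (rule plane_integral_eq_0[OF _ E]) (use elim in auto)
  qed
  have a: "integrable (PiM (insert q ?K) ?L) a"
    using int(2) unfolding K(3) .
  have "integral\<^sup>L (config_measure I) a = (\<integral>x. (LBINT w. a (x(q := w))) \<partial>PiM ?K ?L)"
    using lborel_product.product_integral_insert[OF K(1,2) a] unfolding K(3) .
  also have "\<dots> = 0"
    by (rule integral_eq_zero_AE) fact
  finally show ?thesis .
qed

lemma has_derivative_prod_log:
  fixes f :: "'a \<Rightarrow> 'b::real_normed_vector \<Rightarrow> 'c::real_normed_field"
  assumes "finite I" "\<And>i. i \<in> I \<Longrightarrow> (f i has_derivative (\<lambda>h. f i x * g i h)) (at x)"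
  shows "((\<lambda>y. \<Prod>i\<in>I. f i y) has_derivative (\<lambda>h. (\<Prod>i\<in>I. f i x) * (\<Sum>i\<in>I. g i h))) (at x)"
proof -
  have "((\<lambda>y. \<Prod>i\<in>I. f i y) has_derivative (\<lambda>h. \<Sum>i\<in>I. f i x * g i h * (\<Prod>j\<in>I - {i}. f j x))) (at x)"
    by (rule has_derivative_prod[OF assms(2)])
  moreover have "(\<Sum>i\<in>I. f i x * g i h * (\<Prod>j\<in>I - {i}. f j x)) = (\<Prod>i\<in>I. f i x) * (\<Sum>i\<in>I. g i h)" for h
    unfolding sum_distrib_left
    by (intro sum.cong refl) (use assms(1) in \<open>simp add: prod.remove mult_ac\<close>)
  ultimately show ?thesis by simp
qed

text \<open>For derivatives in the position of one point, to which only the pairs containing that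
  point contribute.\<close>

lemma pairsum_split:
  fixes h :: "'a \<Rightarrow> 'a \<Rightarrow> 'b::comm_monoid_add"
  assumes "distinct as" "a \<in> set as" "\<And>b. h b a = h a b" "\<And>b b'. b \<noteq> a \<Longrightarrow> b' \<noteq> a \<Longrightarrow> h b b' = 0"
  shows "pairsum h as = (\<Sum>b\<in>set as - {a}. h a b)"
proof -
  obtain k where k: "k < length as" "as ! k = a" using assms(2) by (auto simp: in_set_conv_nth)
  have ne: "as ! l \<noteq> a" if "l < length as" "l \<noteq> k" for l
    using assms(1) k that nth_eq_iff_index_eq by blast
  have inner: "(\<Sum>m<l. h (as ! m) (as ! l)) = (if k < l then h a (as ! l) else 0)" if l: "l < length as" "l \<noteq> k" for l
  proof -
    have "(\<Sum>m<l. h (as ! m) (as ! l)) = (\<Sum>m<l. if m = k then h a (as ! l) else 0)"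
      using l k ne assms(4) by (intro sum.cong refl) auto
    then show ?thesis by simp
  qed
  have "pairsum h as = (\<Sum>m<k. h (as ! m) (as ! k)) + (\<Sum>l\<in>{..<length as} - {k}. \<Sum>m<l. h (as ! m) (as ! l))"
    unfolding pairsum_def using k by (subst sum.remove[of _ k]) auto
  also have "(\<Sum>m<k. h (as ! m) (as ! k)) = (\<Sum>l\<in>{..<length as} - {k}. if l < k then h a (as ! l) else 0)"
    by (rule sum.mono_neutral_cong_left) (use k assms(3) in auto)
  also have "(\<Sum>l\<in>{..<length as} - {k}. \<Sum>m<l. h (as ! m) (as ! l)) = (\<Sum>l\<in>{..<length as} - {k}. if k < l then h a (as ! l) else 0)"
    by (intro sum.cong refl inner) auto
  also have "(\<Sum>l\<in>{..<length as} - {k}. if l < k then h a (as ! l) else 0) + \<dots> = (\<Sum>l\<in>{..<length as} - {k}. h a (as ! l))"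
    unfolding sum.distrib[symmetric] by (intro sum.cong refl) auto
  also have "\<dots> = (\<Sum>b\<in>set as - {a}. h a b)"
  proof (rule sum.reindex_cong[symmetric, of "nth as"])
    show "inj_on ((!) as) ({..<length as} - {k})"
      using assms(1) by (auto simp: inj_on_def nth_eq_iff_index_eq)
    show "set as - {a} = (!) as ` ({..<length as} - {k})"
      using ne k by (auto simp: in_set_conv_nth image_iff)
  qed simp
  finally show ?thesis .
qed

section \<open>Wirtinger derivatives in the position of a screening charge\<close>

locale coulomb_screening = coulomb_star I J z j1 \<delta> R "Inl q" as c
  for I :: "'i set" and J :: "'j set" and z j1 \<delta> R q as c +
  assumes c_sym: "c a b = c b a"
begin

abbreviation "others \<equiv> Pts - {Inl q}"

lemma q: "q \<in> I" using p by auto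

lemma pos_upd: "b \<in> others \<Longrightarrow> pos z (x(q := w)) b = pos z x b"
  by (cases b) auto

text \<open>An inverse distance from \<open>q\<close>, differentiated in the position of
  \<open>q\<close>, becomes its square; the product rule does the rest.\<close>

lemma salg_derivative:
  assumes "D \<in> salg"
  shows "\<exists>D'\<in>salg. \<forall>x. x q \<notin> pos z x ` others \<longrightarrow> ((\<lambda>w. D (x(q := w))) has_field_derivative D' x) (at (x q))"
  using assms
proof induction
  case (const w)
  show ?case by (rule bexI[OF _ salg.const[of 0]]) simp
next
  case (tinv a)
  show ?case
  proof (rule bexI[OF _ salg.mult[OF salg.tinv[OF tinv] salg.tinv[OF tinv]]], intro allI impI)
    fix x assume "x q \<notin> pos z x ` others"
    moreover have "pos z x a \<in> pos z x ` others" using tinv by (intro imageI) simp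
    ultimately have "pos z x a - x q \<noteq> 0" by (metis eq_iff_diff_eq_0)
    moreover have "pos z (x(q := w)) a = pos z x a" for w using tinv by (simp add: pos_upd)
    ultimately show "((\<lambda>w. inverse (pos z (x(q := w)) a - pos z (x(q := w)) (Inl q))) has_field_derivative
        inverse (pos z x a - pos z x (Inl q)) * inverse (pos z x a - pos z x (Inl q))) (at (x q))"
      by (auto intro!: derivative_eq_intros)
  qed
next
  case center
  show ?case by (rule bexI[OF _ salg.const[of 1]]) (auto intro!: derivative_eq_intros)
next
  case (add A B)
  then obtain A' B' where "A' \<in> salg" "B' \<in> salg"
    "\<forall>x. x q \<notin> pos z x ` others \<longrightarrow> ((\<lambda>w. A (x(q := w))) has_field_derivative A' x) (at (x q))"
    "\<forall>x. x q \<notin> pos z x ` others \<longrightarrow> ((\<lambda>w. B (x(q := w))) has_field_derivative B' x) (at (x q))" by blast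
  then show ?case
    by (intro bexI[OF _ salg.add[of A' B']]) (auto intro!: DERIV_add simp del: fun_upd_apply)
next
  case (mult A B)
  then obtain A' B' where *: "A' \<in> salg" "B' \<in> salg"
    "\<forall>x. x q \<notin> pos z x ` others \<longrightarrow> ((\<lambda>w. A (x(q := w))) has_field_derivative A' x) (at (x q))"
    "\<forall>x. x q \<notin> pos z x ` others \<longrightarrow> ((\<lambda>w. B (x(q := w))) has_field_derivative B' x) (at (x q))" by blast
  show ?case
  proof (rule bexI[OF _ salg.add[OF salg.mult[OF mult.hyps(1) *(2)] salg.mult[OF *(1) mult.hyps(2)]]], intro allI impI)
    fix x assume x: "x q \<notin> pos z x ` others"
    have "((\<lambda>w. A (x(q := w)) * B (x(q := w))) has_field_derivative
        A (x(q := x q)) * B' x + A' x * B (x(q := x q))) (at (x q))"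
      using *(3,4) x by (intro DERIV_mult') auto
    then show "((\<lambda>w. A (x(q := w)) * B (x(q := w))) has_field_derivative A x * B' x + A' x * B x) (at (x q))"
      by simp
  qed
qed

text \<open>The derivative of a difference of positions with respect to that of \<open>q\<close>. It
  is real, so the holomorphic and the antiholomorphic derivative share it.\<close>

definition sgn_pair :: "'i + 'j \<Rightarrow> 'i + 'j \<Rightarrow> complex" where
  "sgn_pair a b = (if a = Inl q then 1 else 0) - (if b = Inl q then 1 else 0)"

lemma diff_has_derivative:
  "((\<lambda>w. pos z (x(q := w)) a - pos z (x(q := w)) b) has_derivative (\<lambda>h. sgn_pair a b * h)) (at w)"
proof -
  have "((\<lambda>w. pos z (x(q := w)) a) has_derivative (\<lambda>h. (if a = Inl q then 1 else 0) * h)) (at w)" for a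
  proof (cases "a = Inl q")
    case False
    then have "(\<lambda>w. pos z (x(q := w)) a) = (\<lambda>w. pos z x a)" by (cases a) (auto simp: pos_def)
    then show ?thesis using False by simp
  qed simp
  from has_derivative_diff[OF this[of a] this[of b]] show ?thesis
    by (simp add: sgn_pair_def left_diff_distrib)
qed

lemma pair_derivatives:
  assumes ab: "a \<in> Pts" "b \<in> Pts" "a \<noteq> b" and w: "w \<notin> pos z x ` others"
  defines "d \<equiv> \<lambda>w. pos z (x(q := w)) a - pos z (x(q := w)) b"
  shows "((\<lambda>w. complex_of_real (cmod (d w)) powr e) has_derivative (\<lambda>h. complex_of_real (cmod (d w)) powr e
      * (e / 2 * sgn_pair a b / d w * h + e / 2 * sgn_pair a b / cnj (d w) * cnj h))) (at w)"
    and "((\<lambda>w. complex_of_real (1 / (cmod (d w))\<^sup>2)) has_derivative (\<lambda>h. - (1 / (cmod (d w))\<^sup>2)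
      * (sgn_pair a b / d w) * h + - (1 / (cmod (d w))\<^sup>2) * (sgn_pair a b / cnj (d w)) * cnj h)) (at w)"
proof -
  have D: "(d has_derivative (\<lambda>h. sgn_pair a b * h)) (at w)"
    unfolding d_def by (rule diff_has_derivative)
  have "((\<lambda>w. complex_of_real (cmod (d w)) powr e) has_derivative (\<lambda>h. complex_of_real (cmod (d w)) powr e
      * (e / 2 * sgn_pair a b / d w * h + e / 2 * sgn_pair a b / cnj (d w) * cnj h))) (at w) \<and>
    ((\<lambda>w. complex_of_real (1 / (cmod (d w))\<^sup>2)) has_derivative (\<lambda>h. - (1 / (cmod (d w))\<^sup>2)
      * (sgn_pair a b / d w) * h + - (1 / (cmod (d w))\<^sup>2) * (sgn_pair a b / cnj (d w)) * cnj h)) (at w)"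
  proof (cases "sgn_pair a b = 0")
    case True
    then have "a \<noteq> Inl q" "b \<noteq> Inl q" using ab by (auto simp: sgn_pair_def split: if_splits)
    then have "d = (\<lambda>w. pos z x a - pos z x b)"
      using ab by (auto simp: d_def pos_upd)
    then show ?thesis using True by simp
  next
    case False
    have d0: "d w \<noteq> 0"
    proof -
      have "a = Inl q \<and> b \<in> others \<or> b = Inl q \<and> a \<in> others"
        using False ab by (auto simp: sgn_pair_def split: if_splits)
      then show ?thesis using w unfolding d_def by (elim disjE conjE) (auto simp: pos_upd)
    qed
    have sq: "1 / (complex_of_real (cmod y))\<^sup>2 = inverse (y * cnj y)" for y
      by (simp add: divide_inverse flip: complex_norm_square)
    have lg: "((\<lambda>w. complex_of_real (ln (cmod (d w)))) has_derivative
      (\<lambda>h. 1 / 2 * sgn_pair a b / d w * h + 1 / 2 * sgn_pair a b / cnj (d w) * cnj h)) (at w)"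
    proof -
      have "((\<lambda>w. complex_of_real (ln (cmod (d w)))) has_derivative
        (\<lambda>h. of_real (inverse (cmod (d w)) * (inner (sgn (d w)) (sgn_pair a b * h))))) (at w)"
      proof -
        have "((\<lambda>w. cmod (d w)) has_derivative (\<lambda>h. inner (sgn_pair a b * h) (sgn (d w)))) (at w)"
          by (rule has_derivative_compose[OF D has_derivative_norm[OF d0]])
        then show ?thesis
          using d0 by (auto intro!: derivative_eq_intros simp: mult_ac inner_commute)
      qed
      moreover have "complex_of_real (inverse (cmod (d w)) * (inner (sgn (d w)) (sgn_pair a b * h)))
          = 1 / 2 * sgn_pair a b / d w * h + 1 / 2 * sgn_pair a b / cnj (d w) * cnj h" for h
      proof -
        define y k where "y = d w" and "k = sgn_pair a b * h"
        have "cnj k = sgn_pair a b * cnj h" by (simp add: k_def sgn_pair_def)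
        moreover have y0: "y \<noteq> 0" using d0 by (simp add: y_def)
        have "inverse (cmod y) * inner (sgn y) k = Re (k / y)"
        proof -
          have "inverse (cmod y) * inner (sgn y) k = inner y k / (cmod y)\<^sup>2"
            by (simp add: sgn_div_norm power2_eq_square divide_inverse)
          also have "\<dots> = Re (k / y)"
            by (simp add: inner_complex_def Re_divide cmod_power2 mult.commute)
          finally show ?thesis .
        qed
        moreover have "complex_of_real (Re (k / y)) = 1 / 2 * (k / y) + 1 / 2 * (cnj k / cnj y)"
          using complex_add_cnj[of "k / y"] by (simp flip: complex_cnj_divide add: field_simps)
        ultimately show ?thesis by (simp add: y_def k_def mult_ac)
      qed
      ultimately show ?thesis by simp
    qed
    have ev: "\<forall>\<^sub>F v in at w. d v \<noteq> 0"
      using has_derivative_continuous[OF D] d0 by (intro tendsto_imp_eventually_ne) (auto simp: isCont_def)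
    \<comment> \<open>The power of a modulus is differentiated as \<open>exp (e ln |d|)\<close>,
      which agrees with it near \<open>w\<close> because \<open>d\<close> stays nonzero
      there.\<close>
    have expd: "((\<lambda>w. exp (e * complex_of_real (ln (cmod (d w))))) has_derivative
       (\<lambda>h. exp (e * complex_of_real (ln (cmod (d w)))) * (e * (1 / 2 * sgn_pair a b / d w * h + 1 / 2 * sgn_pair a b / cnj (d w) * cnj h)))) (at w)"
      by (rule has_derivative_eq_rhs[OF has_derivative_compose[OF has_derivative_mult_right[where x = e, OF lg] DERIV_exp[unfolded has_field_derivative_def]]])
         simp
    have pw: "complex_of_real (cmod (d v)) powr e = exp (e * complex_of_real (ln (cmod (d v))))" if "d v \<noteq> 0" for v
      using that by (simp add: powr_def Ln_of_real)
    have 1: "((\<lambda>w. complex_of_real (cmod (d w)) powr e) has_derivative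
       (\<lambda>h. complex_of_real (cmod (d w)) powr e * (e * (1 / 2 * sgn_pair a b / d w * h + 1 / 2 * sgn_pair a b / cnj (d w) * cnj h)))) (at w)"
      unfolding pw[OF d0] by (rule has_derivative_transform_eventually[OF expd])
        (use ev pw d0 in \<open>auto elim: eventually_mono\<close>)
    have 2: "((\<lambda>w. inverse (d w * cnj (d w))) has_derivative
       (\<lambda>h. - (inverse (d w * cnj (d w)) * (sgn_pair a b * h * cnj (d w) + d w * cnj (sgn_pair a b * h)) * inverse (d w * cnj (d w))))) (at w)"
      using d0 by (auto intro!: derivative_eq_intros D has_derivative_cnj simp: field_simps)
    have sc: "cnj (sgn_pair a b) = sgn_pair a b" by (simp add: sgn_pair_def)
    show ?thesis
    proof
      show "((\<lambda>w. complex_of_real (cmod (d w)) powr e) has_derivative (\<lambda>h. complex_of_real (cmod (d w)) powr e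
        * (e / 2 * sgn_pair a b / d w * h + e / 2 * sgn_pair a b / cnj (d w) * cnj h))) (at w)"
        using 1 by (simp add: distrib_left mult.assoc)
      have "- (inverse (d w * cnj (d w)) * (sgn_pair a b * h * cnj (d w) + d w * cnj (sgn_pair a b * h)) * inverse (d w * cnj (d w)))
         = - inverse (d w * cnj (d w)) * (sgn_pair a b / d w) * h + - inverse (d w * cnj (d w)) * (sgn_pair a b / cnj (d w)) * cnj h" for h
        using d0 by (simp add: sc divide_simps distrib_left)
      then have eq: "(\<lambda>h. - (inverse (d w * cnj (d w)) * (sgn_pair a b * h * cnj (d w) + d w * cnj (sgn_pair a b * h)) * inverse (d w * cnj (d w))))
         = (\<lambda>h. - inverse (d w * cnj (d w)) * (sgn_pair a b / d w) * h + - inverse (d w * cnj (d w)) * (sgn_pair a b / cnj (d w)) * cnj h)"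
        by (rule ext)
      show "((\<lambda>w. complex_of_real (1 / (cmod (d w))\<^sup>2)) has_derivative (\<lambda>h. - (1 / (cmod (d w))\<^sup>2)
        * (sgn_pair a b / d w) * h + - (1 / (cmod (d w))\<^sup>2) * (sgn_pair a b / cnj (d w)) * cnj h)) (at w)"
        unfolding of_real_minus of_real_divide of_real_1 of_real_power sq using 2 unfolding eq .
    qed
  qed
  then show "((\<lambda>w. complex_of_real (cmod (d w)) powr e) has_derivative (\<lambda>h. complex_of_real (cmod (d w)) powr e
      * (e / 2 * sgn_pair a b / d w * h + e / 2 * sgn_pair a b / cnj (d w) * cnj h))) (at w)"
    "((\<lambda>w. complex_of_real (1 / (cmod (d w))\<^sup>2)) has_derivative (\<lambda>h. - (1 / (cmod (d w))\<^sup>2)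
      * (sgn_pair a b / d w) * h + - (1 / (cmod (d w))\<^sup>2) * (sgn_pair a b / cnj (d w)) * cnj h)) (at w)"
    by auto
qed

end

context coulomb_screening
begin

text \<open>The holomorphic logarithmic derivative of the weight in the position of
  \<open>q\<close>; \<open>logF'\<close> is the antiholomorphic one.\<close>

definition logF :: "('i \<Rightarrow> complex) \<Rightarrow> complex" where
  "logF x = (\<Sum>b\<in>others. - (c (Inl q) b / 2) * inverse (pos z x b - x q))"

definition logF' :: "('i \<Rightarrow> complex) \<Rightarrow> complex" where
  "logF' x = (\<Sum>b\<in>others. - (c (Inl q) b / 2) * cnj (inverse (pos z x b - x q)))"

text \<open>Each term is a nonnegative weight below \<open>V\<close> times an element of the star
  algebra, the shape required by \<open>small_integral\<close>; the last term is
  \<open>cnj (x q - z j1)\<close> in disguise.\<close>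

definition dV :: "('i \<Rightarrow> complex) \<Rightarrow> complex" where
  "dV x = (\<Sum>b\<in>others. of_real (1 / (cmod (pos z x b - x q))\<^sup>2) * inverse (pos z x b - x q))
     + of_real ((cmod (x q - z j1))\<^sup>2) * (- inverse (z j1 - x q))"

lemma coulomb_has_derivative:
  assumes "w \<notin> pos z x ` others"
  shows "((\<lambda>w. F (x(q := w))) has_derivative
    (\<lambda>h. F (x(q := w)) * (logF (x(q := w)) * h + logF' (x(q := w)) * cnj h))) (at w)"
proof -
  let ?d = "\<lambda>a b. pos z (x(q := w)) a - pos z (x(q := w)) b"
  let ?g = "\<lambda>a b h. c a b / 2 * sgn_pair a b / ?d a b * h + c a b / 2 * sgn_pair a b / cnj (?d a b) * cnj h"
  have "((\<lambda>w. F (x(q := w))) has_derivative (\<lambda>h. F (x(q := w)) * (\<Sum>l<length as. \<Sum>k<l. ?g (as ! k) (as ! l) h))) (at w)"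
    unfolding coulomb_def pairprod_def
  proof (intro has_derivative_prod_log finite_lessThan)
    fix l k assume "l \<in> {..<length as}" "k \<in> {..<l}"
    then have "as ! k \<in> Pts" "as ! l \<in> Pts" "as ! k \<noteq> as ! l"
      using as(2) as_nth by (auto simp: nth_eq_iff_index_eq)
    then show "((\<lambda>w. complex_of_real (cmod (pos z (x(q := w)) (as ! k) - pos z (x(q := w)) (as ! l))) powr c (as ! k) (as ! l))
      has_derivative (\<lambda>h. complex_of_real (cmod (?d (as ! k) (as ! l))) powr c (as ! k) (as ! l) * ?g (as ! k) (as ! l) h)) (at w)"
      by (rule pair_derivatives(1)) (rule assms)
  qed
  moreover have "(\<Sum>l<length as. \<Sum>k<l. ?g (as ! k) (as ! l) h) = logF (x(q := w)) * h + logF' (x(q := w)) * cnj h" for h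
  proof -
    have "(\<Sum>l<length as. \<Sum>k<l. ?g (as ! k) (as ! l) h) = pairsum (\<lambda>a b. ?g a b h) as"
      by (simp add: pairsum_def)
    also have "\<dots> = (\<Sum>b\<in>set as - {Inl q}. ?g (Inl q) b h)"
    proof (rule pairsum_split[OF as(2)])
      show "Inl q \<in> set as" using q by (simp add: as)
      show "?g b (Inl q) h = ?g (Inl q) b h" for b
      proof -
        have "sgn_pair b (Inl q) = - sgn_pair (Inl q) b" "?d b (Inl q) = - ?d (Inl q) b" by (simp_all add: sgn_pair_def)
        then show ?thesis by (simp only: c_sym[of b] complex_cnj_minus minus_divide_divide mult_minus_right)
      qed
    qed (simp add: sgn_pair_def)
    also have "\<dots> = (\<Sum>b\<in>others. - (c (Inl q) b / 2) * inverse (pos z (x(q := w)) b - w) * h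
        + - (c (Inl q) b / 2) * cnj (inverse (pos z (x(q := w)) b - w)) * cnj h)"
      unfolding as(1)
    proof (rule sum.cong[OF refl])
      fix b assume "b \<in> others"
      define Y where "Y = pos z (x(q := w)) b - w"
      have D: "?d (Inl q) b = - Y" by (simp add: Y_def)
      show "?g (Inl q) b h = - (c (Inl q) b / 2) * inverse (pos z (x(q := w)) b - w) * h
        + - (c (Inl q) b / 2) * cnj (inverse (pos z (x(q := w)) b - w)) * cnj h"
        using \<open>b \<in> others\<close> unfolding D Y_def[symmetric] by (simp add: sgn_pair_def inverse_eq_divide)
    qed
    finally show ?thesis
      unfolding logF_def logF'_def sum_distrib_right sum.distrib fun_upd_same .
  qed
  ultimately show ?thesis by simp
qed

lemma cutoff_has_derivative:
  assumes "w \<notin> pos z x ` others"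
  shows "((\<lambda>w. complex_of_real (V (x(q := w)))) has_derivative
    (\<lambda>h. dV (x(q := w)) * h + cnj (dV (x(q := w))) * cnj h)) (at w)"
proof -
  let ?d = "\<lambda>a b. pos z (x(q := w)) a - pos z (x(q := w)) b"
  let ?g = "\<lambda>a b h. - (1 / (cmod (?d a b))\<^sup>2) * (sgn_pair a b / ?d a b) * h
    + - (1 / (cmod (?d a b))\<^sup>2) * (sgn_pair a b / cnj (?d a b)) * cnj h"
  have D1: "((\<lambda>w. complex_of_real (pairsum (\<lambda>a b. 1 / (cmod (pos z (x(q := w)) a - pos z (x(q := w)) b))\<^sup>2) as))
      has_derivative (\<lambda>h. \<Sum>l<length as. \<Sum>k<l. ?g (as ! k) (as ! l) h)) (at w)"
    unfolding pairsum_def of_real_sum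
  proof (intro has_derivative_sum)
    fix l k assume "l \<in> {..<length as}" "k \<in> {..<l}"
    then have "as ! k \<in> Pts" "as ! l \<in> Pts" "as ! k \<noteq> as ! l"
      using as(2) as_nth by (auto simp: nth_eq_iff_index_eq)
    then show "((\<lambda>w. complex_of_real (1 / (cmod (pos z (x(q := w)) (as ! k) - pos z (x(q := w)) (as ! l)))\<^sup>2)) has_derivative
        ?g (as ! k) (as ! l)) (at w)"
      by (rule pair_derivatives(2)) (rule assms)
  qed
  have g: "(\<Sum>l<length as. \<Sum>k<l. ?g (as ! k) (as ! l) h)
     = (\<Sum>b\<in>others. of_real (1 / (cmod (pos z (x(q := w)) b - w))\<^sup>2) * inverse (pos z (x(q := w)) b - w)) * h
     + (\<Sum>b\<in>others. of_real (1 / (cmod (pos z (x(q := w)) b - w))\<^sup>2) * cnj (inverse (pos z (x(q := w)) b - w))) * cnj h" for h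
  proof -
    have "(\<Sum>l<length as. \<Sum>k<l. ?g (as ! k) (as ! l) h) = pairsum (\<lambda>a b. ?g a b h) as"
      by (simp add: pairsum_def)
    also have "\<dots> = (\<Sum>b\<in>set as - {Inl q}. ?g (Inl q) b h)"
    proof (rule pairsum_split[OF as(2)])
      show "Inl q \<in> set as" using q by (simp add: as)
      show "?g b (Inl q) h = ?g (Inl q) b h" for b
      proof -
        have "sgn_pair b (Inl q) = - sgn_pair (Inl q) b" "?d b (Inl q) = - ?d (Inl q) b" by (simp_all add: sgn_pair_def)
        then show ?thesis by (simp only: complex_cnj_minus minus_divide_divide norm_minus_cancel)
      qed
    qed (simp add: sgn_pair_def)
    also have "\<dots> = (\<Sum>b\<in>others. of_real (1 / (cmod (pos z (x(q := w)) b - w))\<^sup>2) * inverse (pos z (x(q := w)) b - w) * h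
        + of_real (1 / (cmod (pos z (x(q := w)) b - w))\<^sup>2) * cnj (inverse (pos z (x(q := w)) b - w)) * cnj h)"
      unfolding as(1)
    proof (rule sum.cong[OF refl])
      fix b assume "b \<in> others"
      define Y where "Y = pos z (x(q := w)) b - w"
      have D: "?d (Inl q) b = - Y" by (simp add: Y_def)
      show "?g (Inl q) b h = of_real (1 / (cmod (pos z (x(q := w)) b - w))\<^sup>2) * inverse (pos z (x(q := w)) b - w) * h
        + of_real (1 / (cmod (pos z (x(q := w)) b - w))\<^sup>2) * cnj (inverse (pos z (x(q := w)) b - w)) * cnj h"
        using \<open>b \<in> others\<close> unfolding D Y_def[symmetric] by (simp add: sgn_pair_def divide_inverse)
    qed
    finally show ?thesis unfolding sum_distrib_right sum.distrib .
  qed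
  have wz: "w \<noteq> z j1"
  proof -
    have "pos z x (Inr j1) \<in> pos z x ` others" using j1 by (intro imageI) simp
    then show ?thesis using assms by auto
  qed
  have sq: "complex_of_real ((cmod y)\<^sup>2) = y * cnj y" for y
    by (rule complex_norm_square)
  have D2: "((\<lambda>w. complex_of_real (\<Sum>q'\<in>I. (cmod ((x(q := w)) q' - z j1))\<^sup>2)) has_derivative
     (\<lambda>h. of_real ((cmod (w - z j1))\<^sup>2) * (- inverse (z j1 - w)) * h + of_real ((cmod (w - z j1))\<^sup>2) * cnj (- inverse (z j1 - w)) * cnj h)) (at w)"
  proof -
    have "(\<lambda>w. complex_of_real (\<Sum>q'\<in>I. (cmod ((x(q := w)) q' - z j1))\<^sup>2))
       = (\<lambda>w. (w - z j1) * cnj (w - z j1) + complex_of_real (\<Sum>q'\<in>I - {q}. (cmod (x q' - z j1))\<^sup>2))"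
      using finite_I q by (simp add: sum.remove[of I q] sq del: of_real_power of_real_sum)
    moreover have "((\<lambda>w. (w - z j1) * cnj (w - z j1) + complex_of_real (\<Sum>q'\<in>I - {q}. (cmod (x q' - z j1))\<^sup>2)) has_derivative
       (\<lambda>h. cnj (w - z j1) * h + (w - z j1) * cnj h)) (at w)"
      by (auto intro!: derivative_eq_intros has_derivative_cnj)
    moreover have "of_real ((cmod (w - z j1))\<^sup>2) * (- inverse (z j1 - w)) = cnj (w - z j1)"
      "of_real ((cmod (w - z j1))\<^sup>2) * cnj (- inverse (z j1 - w)) = w - z j1"
      using wz unfolding sq by (simp_all add: divide_simps) (simp_all add: algebra_simps)
    ultimately show ?thesis by simp
  qed
  show ?thesis
    unfolding cutoff_def of_real_add
    by (rule has_derivative_eq_rhs[OF has_derivative_add[OF D1 D2]])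
       (rule ext, unfold g dV_def, simp add: distrib_right left_diff_distrib cnj_sum)
qed

section \<open>Vanishing of total derivatives in the limit\<close>

text \<open>Unlike the star algebra this class is closed under conjugation: antiholomorphic
  derivatives must be integrable as well, although only the holomorphic one enters the
  conclusion.\<close>

definition tame :: "(('i \<Rightarrow> complex) \<Rightarrow> complex) \<Rightarrow> bool" where
  "tame D \<longleftrightarrow> D \<in> borel_measurable (config_measure I) \<and> (\<exists>C d. 0 \<le> C \<and> (\<forall>x. cmod (D x) \<le> C * (1 + V x) ^ d))"

lemma tame_salg: "D \<in> salg \<Longrightarrow> tame D"
  using salg_growth salg_measurable by (auto simp: tame_def)

lemma tame_cnj: "tame D \<Longrightarrow> tame (\<lambda>x. cnj (D x))"
proof -
  have "(\<lambda>x. cnj (D x)) \<in> borel_measurable (config_measure I)" if "D \<in> borel_measurable (config_measure I)"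
    by (rule measurable_compose[OF that]) (intro borel_measurable_continuous_onI continuous_intros)
  then show "tame D \<Longrightarrow> tame (\<lambda>x. cnj (D x))"
    by (simp add: tame_def)
qed

lemma tame_add: "tame D \<Longrightarrow> tame D' \<Longrightarrow> tame (\<lambda>x. D x + D' x)"
proof -
  assume "tame D" "tame D'"
  then obtain C d C' d' where *: "0 \<le> C" "\<And>x. cmod (D x) \<le> C * (1 + V x) ^ d" "0 \<le> C'" "\<And>x. cmod (D' x) \<le> C' * (1 + V x) ^ d'"
    and m: "D \<in> borel_measurable (config_measure I)" "D' \<in> borel_measurable (config_measure I)"
    unfolding tame_def by blast
  have "cmod (D x + D' x) \<le> (C + C') * (1 + V x) ^ (d + d')" for x
  proof -
    have "cmod (D x + D' x) \<le> C * (1 + V x) ^ d + C' * (1 + V x) ^ d'"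
      using norm_triangle_ineq[of "D x" "D' x"] *(2)[of x] *(4)[of x] by linarith
    also have "\<dots> \<le> C * (1 + V x) ^ (d + d') + C' * (1 + V x) ^ (d + d')"
      using *(1,3) V_nonneg[of x] by (intro add_mono mult_left_mono power_increasing) auto
    finally show ?thesis by (simp add: distrib_right)
  qed
  then show ?thesis using m *(1,3) unfolding tame_def by (intro conjI exI[of _ "C + C'"] exI[of _ "d + d'"]) auto
qed

lemma tame_mult: "tame D \<Longrightarrow> tame D' \<Longrightarrow> tame (\<lambda>x. D x * D' x)"
proof -
  assume "tame D" "tame D'"
  then obtain C d C' d' where *: "0 \<le> C" "\<And>x. cmod (D x) \<le> C * (1 + V x) ^ d" "0 \<le> C'" "\<And>x. cmod (D' x) \<le> C' * (1 + V x) ^ d'"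
    and m: "D \<in> borel_measurable (config_measure I)" "D' \<in> borel_measurable (config_measure I)"
    unfolding tame_def by blast
  have "cmod (D x * D' x) \<le> (C * C') * (1 + V x) ^ (d + d')" for x
    using mult_mono[OF *(2)[of x] *(4)[of x]] *(1,3) V_nonneg[of x] by (simp add: norm_mult power_add mult_ac)
  then show ?thesis using m *(1,3) unfolding tame_def by (intro conjI exI[of _ "C * C'"] exI[of _ "d + d'"]) auto
qed

lemma tame_const: "tame (\<lambda>x. w)"
  by (rule tame_salg) (rule salg.const)

lemma tame_sum: "(\<And>i. i \<in> S \<Longrightarrow> tame (f i)) \<Longrightarrow> tame (\<lambda>x. \<Sum>i\<in>S. f i x)"
  by (induction S rule: infinite_finite_induct) (auto intro: tame_add tame_const)

lemma tame_tinv: "b \<in> others \<Longrightarrow> tame (\<lambda>x. inverse (pos z x b - x q))"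
  using tame_salg[OF salg.tinv[of b]] by simp

lemma tame_weights:
  shows "b \<in> others \<Longrightarrow> tame (\<lambda>x. of_real (1 / (cmod (pos z x b - x q))\<^sup>2))"
    and "tame (\<lambda>x. of_real ((cmod (x q - z j1))\<^sup>2))"
proof -
  have sq: "complex_of_real ((cmod y)\<^sup>2) = y * cnj y" for y
    by (rule complex_norm_square)
  have sq': "complex_of_real (1 / (cmod y)\<^sup>2) = inverse y * cnj (inverse y)" for y
    using complex_norm_square[of y] by (simp add: divide_inverse)
  show "tame (\<lambda>x. of_real (1 / (cmod (pos z x b - x q))\<^sup>2))" if "b \<in> others"
    unfolding sq' by (intro tame_mult tame_cnj tame_tinv that)
  have "tame (\<lambda>x. x q - z j1)" using tame_salg[OF salg.center] by simp
  then show "tame (\<lambda>x. of_real ((cmod (x q - z j1))\<^sup>2))"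
    unfolding sq by (intro tame_mult tame_cnj)
qed

lemma zj1_others: "Inr j1 \<in> others" using j1 by auto

lemma tame_logF: "tame logF" "tame logF'" "tame dV"
proof -
  show "tame logF" unfolding logF_def by (intro tame_sum tame_mult tame_const tame_tinv)
  show "tame logF'" unfolding logF'_def by (intro tame_sum tame_mult tame_const tame_cnj tame_tinv)
  have "tame (\<lambda>x. - inverse (z j1 - x q))"
    using tame_mult[OF tame_const[of "-1"] tame_tinv[OF zj1_others]] by simp
  then show "tame dV"
    unfolding dV_def by (intro tame_add tame_sum tame_mult tame_tinv tame_weights)
qed

lemma integrable_tame: "tame D \<Longrightarrow> \<eta> > 0 \<Longrightarrow> integrable (config_measure I) (\<lambda>x. gcut \<eta> x * D x * F x)"
  unfolding tame_def using integrable_gcut by blast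

text \<open>The holomorphic derivative of \<open>gcut * A * F\<close> integrates to 0; the two sides
  are the parts in which it hits \<open>A * F\<close> and the regulator.\<close>

lemma integral_derivative_parts:
  assumes A: "A \<in> salg" "A' \<in> salg"
    and d: "\<And>x. x q \<notin> pos z x ` others \<Longrightarrow> ((\<lambda>w. A (x(q := w))) has_field_derivative A' x) (at (x q))"
    and \<eta>: "\<eta> > 0"
  shows "(\<integral>x. gcut \<eta> x * (A' x + logF x * A x) * F x \<partial>config_measure I)
     = (\<integral>x. gcut \<eta> x * (of_real \<eta> * dV x * A x) * F x \<partial>config_measure I)"
proof -
  let ?a = "\<lambda>x. A' x + logF x * A x + (- of_real \<eta>) * (dV x * A x)"
  let ?b = "\<lambda>x. logF' x * A x + (- of_real \<eta>) * (cnj (dV x) * A x)"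
  have t: "tame A" "tame ?a" "tame ?b" "tame (\<lambda>x. A' x + logF x * A x)" "tame (\<lambda>x. of_real \<eta> * dV x * A x)"
    by (rule tame_salg[OF A(1)])
       (intro tame_add tame_mult tame_const tame_logF tame_cnj tame_salg[OF A(1)] tame_salg[OF A(2)])+
  have "integral\<^sup>L (config_measure I) (\<lambda>x. gcut \<eta> x * ?a x * F x) = 0"
  proof (rule config_integral_eq_0[OF finite_I q, where E = "\<lambda>x. pos z x ` others" and v = "\<lambda>x. gcut \<eta> x * A x * F x"
        and b = "\<lambda>x. gcut \<eta> x * ?b x * F x"])
    fix x w assume w: "w \<notin> pos z x ` others"
    have w': "(x(q := w)) q \<notin> pos z (x(q := w)) ` others"
      using w by (auto simp: pos_upd image_iff)
    have DA: "((\<lambda>w. A (x(q := w))) has_derivative (\<lambda>h. A' (x(q := w)) * h)) (at w)"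
      using d[OF w'] unfolding has_field_derivative_def fun_upd_upd fun_upd_same .
    have DF: "((\<lambda>w. F (x(q := w))) has_derivative
      (\<lambda>h. F (x(q := w)) * (logF (x(q := w)) * h + logF' (x(q := w)) * cnj h))) (at w)"
      by (rule coulomb_has_derivative[OF w])
    have DG: "((\<lambda>w. gcut \<eta> (x(q := w))) has_derivative
      (\<lambda>h. gcut \<eta> (x(q := w)) * (- of_real \<eta> * (dV (x(q := w)) * h + cnj (dV (x(q := w))) * cnj h)))) (at w)"
      unfolding gcut_def
      by (rule has_derivative_eq_rhs[OF has_derivative_compose[OF has_derivative_mult_right[where x = "- of_real \<eta>",
            OF cutoff_has_derivative[OF w]] DERIV_exp[unfolded has_field_derivative_def]]]) simp
    show "((\<lambda>w. gcut \<eta> (x(q := w)) * A (x(q := w)) * F (x(q := w))) has_derivative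
       (\<lambda>h. gcut \<eta> (x(q := w)) * ?a (x(q := w)) * F (x(q := w)) * h + gcut \<eta> (x(q := w)) * ?b (x(q := w)) * F (x(q := w)) * cnj h)) (at w)"
      by (rule has_derivative_eq_rhs[OF has_derivative_mult[OF has_derivative_mult[OF DG DA] DF]])
         (simp add: algebra_simps fun_eq_iff)
  qed (use t \<eta> finite_I finite_J in \<open>auto intro: integrable_tame\<close>)
  moreover have "(\<lambda>x. gcut \<eta> x * ?a x * F x) = (\<lambda>x. gcut \<eta> x * (A' x + logF x * A x) * F x - gcut \<eta> x * (of_real \<eta> * dV x * A x) * F x)"
    by (simp add: algebra_simps fun_eq_iff)
  ultimately show ?thesis
    using integrable_tame[OF t(4) \<eta>] integrable_tame[OF t(5) \<eta>] by simp
qed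


text \<open>What remains of a total derivative comes from the regulator; by the form of
  \<open>dV\<close> it is a finite sum of integrals covered by
  \<open>small_integral\<close>.\<close>

theorem integral_total_derivative_tendsto_0:
  assumes A: "A \<in> salg" "A' \<in> salg"
    and d: "\<And>x. x q \<notin> pos z x ` others \<Longrightarrow> ((\<lambda>w. A (x(q := w))) has_field_derivative A' x) (at (x q))"
  shows "(\<lambda>n. \<integral>x. gcut (1 / real (Suc n)) x * (A' x + logF x * A x) * F x \<partial>config_measure I) \<longlonglongrightarrow> 0"
proof -
  let ?M = "config_measure I"
  let ?v = "\<lambda>b x. 1 / (cmod (pos z x b - x q))\<^sup>2" and ?v' = "\<lambda>x. (cmod (x q - z j1))\<^sup>2"
  let ?B = "\<lambda>b x. inverse (pos z x b - x q) * A x" and ?B' = "\<lambda>x. - inverse (z j1 - x q) * A x"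
  let ?f = "\<lambda>v B n x. of_real (1 / real (Suc n)) * of_real (v x) * gcut (1 / real (Suc n)) x * B x * F x"
  have B: "?B b \<in> salg" if "b \<in> others" for b
    using salg.mult[OF salg.tinv[of b] A(1)] that by simp
  have B': "?B' \<in> salg"
    using salg.mult[OF salg.const[of "-1"] B[OF zj1_others]] by simp
  have lim: "(\<lambda>n. integral\<^sup>L ?M (?f (?v b) (?B b) n)) \<longlonglongrightarrow> 0" if "b \<in> others" for b
    by (rule small_integral[OF B[OF that]]) (use that in auto)
  have lim': "(\<lambda>n. integral\<^sup>L ?M (?f ?v' ?B' n)) \<longlonglongrightarrow> 0"
    by (rule small_integral[OF B']) (use q in auto)
  have int: "integrable ?M (?f (?v b) (?B b) n)" if "b \<in> others" for b n
  proof -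
    have "tame (\<lambda>x. of_real (1 / real (Suc n)) * of_real (?v b x) * ?B b x)"
      by (intro tame_mult[OF tame_mult] tame_const tame_weights that tame_salg[OF B[OF that]])
    then have "integrable ?M (\<lambda>x. gcut (1 / real (Suc n)) x * (of_real (1 / real (Suc n)) * of_real (?v b x) * ?B b x) * F x)"
      by (rule integrable_tame) simp
    then show ?thesis by (simp only: mult_ac)
  qed
  have int': "integrable ?M (?f ?v' ?B' n)" for n
  proof -
    have "tame (\<lambda>x. of_real (1 / real (Suc n)) * of_real (?v' x) * ?B' x)"
      by (intro tame_mult[OF tame_mult] tame_const tame_weights tame_salg[OF B'])
    then have "integrable ?M (\<lambda>x. gcut (1 / real (Suc n)) x * (of_real (1 / real (Suc n)) * of_real (?v' x) * ?B' x) * F x)"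
      by (rule integrable_tame) simp
    then show ?thesis by (simp only: mult_ac)
  qed
  have "(\<integral>x. gcut (1 / real (Suc n)) x * (A' x + logF x * A x) * F x \<partial>?M)
     = (\<Sum>b\<in>others. integral\<^sup>L ?M (?f (?v b) (?B b) n)) + integral\<^sup>L ?M (?f ?v' ?B' n)" for n
  proof -
    have "(\<integral>x. gcut (1 / real (Suc n)) x * (A' x + logF x * A x) * F x \<partial>?M)
       = (\<integral>x. gcut (1 / real (Suc n)) x * (of_real (1 / real (Suc n)) * dV x * A x) * F x \<partial>?M)"
      by (rule integral_derivative_parts[OF A d]) auto
    also have "(\<lambda>x. gcut (1 / real (Suc n)) x * (of_real (1 / real (Suc n)) * dV x * A x) * F x)
       = (\<lambda>x. (\<Sum>b\<in>others. ?f (?v b) (?B b) n x) + ?f ?v' ?B' n x)"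
      unfolding dV_def distrib_left distrib_right sum_distrib_left sum_distrib_right by (simp only: mult_ac)
    also have "integral\<^sup>L ?M \<dots> = (\<Sum>b\<in>others. integral\<^sup>L ?M (?f (?v b) (?B b) n)) + integral\<^sup>L ?M (?f ?v' ?B' n)"
      by (subst Bochner_Integration.integral_add[OF Bochner_Integration.integrable_sum[OF int] int'])
         (simp_all only: Bochner_Integration.integral_sum[OF int])
    finally show ?thesis .
  qed
  moreover have "(\<lambda>n. (\<Sum>b\<in>others. integral\<^sup>L ?M (?f (?v b) (?B b) n)) + integral\<^sup>L ?M (?f ?v' ?B' n)) \<longlonglongrightarrow> (\<Sum>b\<in>others. 0) + 0"
    by (intro tendsto_add tendsto_sum lim lim')
  ultimately show ?thesis by simp
qed

text \<open>Collisions with the point \<open>q\<close> do not matter since the Coulomb weight vanishes there.\<close>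

definition nsalg :: "(('i \<Rightarrow> complex) \<Rightarrow> complex) set" where
  "nsalg = {D. \<exists>D'\<in>salg. \<forall>x. x q \<notin> pos z x ` others \<longrightarrow> D x = D' x}"

lemma nsalg_salg: "D \<in> salg \<Longrightarrow> D \<in> nsalg"
  by (auto simp: nsalg_def)

lemma nsalg_add: "A \<in> nsalg \<Longrightarrow> B \<in> nsalg \<Longrightarrow> (\<lambda>x. A x + B x) \<in> nsalg"
  unfolding nsalg_def mem_Collect_eq
proof (elim bexE)
  fix A1 B1 assume "A1 \<in> salg" "B1 \<in> salg"
    "\<forall>x. x q \<notin> pos z x ` others \<longrightarrow> A x = A1 x" "\<forall>x. x q \<notin> pos z x ` others \<longrightarrow> B x = B1 x"
  then show "\<exists>D'\<in>salg. \<forall>x. x q \<notin> pos z x ` others \<longrightarrow> A x + B x = D' x"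
    by (intro bexI[OF _ salg.add[of A1 B1]]) auto
qed

lemma nsalg_mult: "A \<in> nsalg \<Longrightarrow> B \<in> nsalg \<Longrightarrow> (\<lambda>x. A x * B x) \<in> nsalg"
  unfolding nsalg_def mem_Collect_eq
proof (elim bexE)
  fix A1 B1 assume "A1 \<in> salg" "B1 \<in> salg"
    "\<forall>x. x q \<notin> pos z x ` others \<longrightarrow> A x = A1 x" "\<forall>x. x q \<notin> pos z x ` others \<longrightarrow> B x = B1 x"
  then show "\<exists>D'\<in>salg. \<forall>x. x q \<notin> pos z x ` others \<longrightarrow> A x * B x = D' x"
    by (intro bexI[OF _ salg.mult[of A1 B1]]) auto
qed

lemma nsalg_const: "(\<lambda>x. w) \<in> nsalg"
  by (intro nsalg_salg salg.const)

lemma nsalg_sum: "(\<And>i. i \<in> S \<Longrightarrow> f i \<in> nsalg) \<Longrightarrow> (\<lambda>x. \<Sum>i\<in>S. f i x) \<in> nsalg"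
  by (induction S rule: infinite_finite_induct) (auto intro: nsalg_add nsalg_const)

lemma eventually_ok:
  assumes "x q \<notin> pos z x ` others"
  shows "\<forall>\<^sub>F w in nhds (x q). (x(q := w)) q \<notin> pos z (x(q := w)) ` others"
proof -
  have "open (- (pos z x ` others))"
    using finite_I finite_J by (intro open_Compl finite_imp_closed) auto
  then have "\<forall>\<^sub>F w in nhds (x q). w \<in> - (pos z x ` others)"
    using assms by (intro eventually_nhds_in_open) auto
  then show ?thesis
    by (rule eventually_mono) (auto simp: pos_upd image_iff)
qed

lemma nsalg_has_derivative:
  assumes "D \<in> nsalg"
  shows "\<exists>D1\<in>salg. \<exists>D2\<in>salg. (\<forall>x. x q \<notin> pos z x ` others \<longrightarrow> D x = D1 x
    \<and> ((\<lambda>w. D1 (x(q := w))) has_field_derivative D2 x) (at (x q))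
    \<and> ((\<lambda>w. D (x(q := w))) has_field_derivative D2 x) (at (x q)))"
proof -
  obtain D1 where D1: "D1 \<in> salg" "\<forall>x. x q \<notin> pos z x ` others \<longrightarrow> D x = D1 x"
    using assms unfolding nsalg_def by blast
  obtain D2 where D2: "D2 \<in> salg" "\<forall>x. x q \<notin> pos z x ` others \<longrightarrow> ((\<lambda>w. D1 (x(q := w))) has_field_derivative D2 x) (at (x q))"
    using salg_derivative[OF D1(1)] by blast
  have "((\<lambda>w. D (x(q := w))) has_field_derivative D2 x) (at (x q))" if x: "x q \<notin> pos z x ` others" for x
  proof -
    have "\<forall>\<^sub>F w in nhds (x q). D1 (x(q := w)) = D (x(q := w))"
      using eventually_ok[OF x] by (rule eventually_mono) (use D1(2) in auto)
    then show ?thesis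
      using D2(2) x by (subst DERIV_cong_ev[OF refl _ refl, where g = "\<lambda>w. D1 (x(q := w))"])
        (auto elim: eventually_mono)
  qed
  then show ?thesis using D1 D2 by blast
qed

definition dq :: "(('i \<Rightarrow> complex) \<Rightarrow> complex) \<Rightarrow> ('i \<Rightarrow> complex) \<Rightarrow> complex" where
  "dq D x = deriv (\<lambda>w. D (x(q := w))) (x q)"

lemma nsalg_dq: "D \<in> nsalg \<Longrightarrow> dq D \<in> nsalg"
  using nsalg_has_derivative[of D] unfolding nsalg_def dq_def by (blast intro: DERIV_imp_deriv)

lemma nsalg_dq_power: "D \<in> nsalg \<Longrightarrow> (dq ^^ k) D \<in> nsalg"
  by (induction k) (auto intro: nsalg_dq)

lemma dq_power_upd: "(dq ^^ k) D (x(q := w)) = (deriv ^^ k) (\<lambda>w. D (x(q := w))) w"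
proof (induction k arbitrary: w)
  case (Suc k)
  have "(dq ^^ Suc k) D (x(q := w)) = deriv (\<lambda>w. (dq ^^ k) D (x(q := w))) w"
    by (simp add: dq_def)
  then show ?case unfolding Suc.IH funpow.simps o_apply .
qed simp

lemma F_not_ok:
  assumes "x \<in> space (config_measure I)" "x q \<in> pos z x ` others"
  shows "F x = 0"
proof (rule F_Dst[OF assms(1)])
  obtain b where b: "b \<in> others" "pos z x b = x q"
    using assms(2) by (elim imageE) (use that in metis)
  show "x \<notin> Dst"
  proof
    assume "x \<in> Dst"
    then have inj: "inj_on (pos z x) Pts" by (simp add: Dst_def)
    have "Inl q \<in> Pts" "b \<in> Pts" using q b by auto
    then have "b = Inl q" using inj_onD[OF inj, of b "Inl q"] b(2) by simp
    then show False using b by auto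
  qed
qed

text \<open>The hypothesis says that \<open>T * F\<close> is the derivative of \<open>A * F\<close>
  in the position of \<open>q\<close>. Off collisions, uniqueness of derivatives identifies
  \<open>T\<close> with an expression from the star algebra and \<open>logF\<close>; at collisions
  \<open>F\<close> is 0.\<close>

theorem nsalg_integral_tendsto_0:
  assumes A: "A \<in> nsalg"
    and d: "\<And>x. x \<in> space (config_measure I) \<Longrightarrow> x q \<notin> pos z x ` others \<Longrightarrow>
      ((\<lambda>w. A (x(q := w))) has_field_derivative T x - logF x * A x) (at (x q))"
  shows "(\<lambda>n. \<integral>x. gcut (1 / real (Suc n)) x * T x * F x \<partial>config_measure I) \<longlonglongrightarrow> 0"
proof -
  obtain A1 A2 where A12: "A1 \<in> salg" "A2 \<in> salg"
    and *: "\<And>x. x q \<notin> pos z x ` others \<Longrightarrow> A x = A1 x"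
      "\<And>x. x q \<notin> pos z x ` others \<Longrightarrow> ((\<lambda>w. A1 (x(q := w))) has_field_derivative A2 x) (at (x q))"
      "\<And>x. x q \<notin> pos z x ` others \<Longrightarrow> ((\<lambda>w. A (x(q := w))) has_field_derivative A2 x) (at (x q))"
    using nsalg_has_derivative[OF A] by blast
  have T: "(A2 x + logF x * A1 x) * F x = T x * F x" if x: "x \<in> space (config_measure I)" for x
  proof (cases "x q \<in> pos z x ` others")
    case True
    then show ?thesis using F_not_ok[OF x] by simp
  next
    case False
    then have "A2 x = T x - logF x * A x" using DERIV_unique[OF *(3) d[OF x]] by blast
    then show ?thesis using *(1)[OF False] by simp
  qed
  have "(\<integral>x. gcut (1 / real (Suc n)) x * (A2 x + logF x * A1 x) * F x \<partial>config_measure I)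
     = (\<integral>x. gcut (1 / real (Suc n)) x * T x * F x \<partial>config_measure I)" for n
    unfolding mult.assoc by (rule Bochner_Integration.integral_cong[OF refl]) (simp add: T del: of_nat_Suc)
  then show ?thesis
    using integral_total_derivative_tendsto_0[OF A12 *(2)] by simp
qed

end

section \<open>Ward identities\<close>

lemma (in coulomb_star) salg_peval:
  "(\<And>v. (\<lambda>x. f x v) \<in> salg) \<Longrightarrow> (\<lambda>x. peval id (f x) D) \<in> salg"
  unfolding peval_def id_apply by (intro salg_sum salg.mult salg.const salg_prod salg_power)

lemma (in coulomb_star) salg_profile:
  "(\<lambda>x. profile (Pts - {p}) \<beta> (pos z x) (pos z x p) v) \<in> salg"
  unfolding profile_def by (intro salg_sum salg.mult salg.const salg_power salg.tinv) auto

lemma (in coulomb_screening) nsalg_integrable: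
  assumes "T \<in> nsalg" "\<eta> > 0"
  shows "integrable (config_measure I) (\<lambda>x. gcut \<eta> x * T x * F x)"
proof -
  obtain T' where T': "T' \<in> salg" "\<forall>x. x q \<notin> pos z x ` others \<longrightarrow> T x = T' x"
    using assms(1) unfolding nsalg_def by blast
  have "gcut \<eta> x * T x * F x = gcut \<eta> x * T' x * F x" if "x \<in> space (config_measure I)" for x
    using T'(2) F_not_ok[OF that] by (cases "x q \<in> pos z x ` others") auto
  then show ?thesis
    using integrable_gcut_salg[OF assms(2) T'(1)] by (subst Bochner_Integration.integrable_cong[OF refl])
qed

lemma bil_commute: "bil u v = bil v u"
  by (simp add: bil_def mult.commute)

text \<open>One choice of \<open>\<delta>\<close>, \<open>R\<close> and \<open>j1\<close> serves
  every center \<open>p\<close>, so that weight and regulator are common to all residues.\<close>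

locale ward_setup =
  fixes I :: "'i set" and J :: "'j set" and z :: "'j \<Rightarrow> complex" and j1 :: 'j and \<delta> R :: real
    and as :: "('i + 'j) list" and \<beta> :: "'i + 'j \<Rightarrow> complex^'r::finite" and P :: "'r dpoly" and s :: nat
  assumes stars: "p \<in> Inl ` I \<union> Inr ` J \<Longrightarrow> coulomb_star I J z j1 \<delta> R p as (\<lambda>a b. - bil (\<beta> a) (\<beta> b))"
    and J: "J \<noteq> {}"
    and P: "P \<in> Vplus" "weighted_homogeneous s P"
    and screened: "q \<in> I \<Longrightarrow> screening (\<beta> (Inl q)) P = 0"
begin

abbreviation "Points \<equiv> Inl ` I \<union> Inr ` J :: ('i + 'j) set"
abbreviation "weight \<equiv> coulomb z (\<lambda>a b. - bil (\<beta> a) (\<beta> b)) as"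
abbreviation "reg \<equiv> coulomb_star.gcut I z j1 as"

lemma screens: "q \<in> I \<Longrightarrow> coulomb_screening I J z j1 \<delta> R q as (\<lambda>a b. - bil (\<beta> a) (\<beta> b))"
  by (intro coulomb_screening.intro stars coulomb_screening_axioms.intro) (simp_all add: bil_commute)

lemma finite_Points: "finite Points"
proof -
  obtain k where k: "k \<in> J" using J by blast
  interpret coulomb_star I J z j1 \<delta> R "Inr k" as "\<lambda>a b. - bil (\<beta> a) (\<beta> b)" by (rule stars) (use k in simp)
  show ?thesis by (rule finite_Pts)
qed

definition desc_value :: "'j \<Rightarrow> nat \<Rightarrow> ('i \<Rightarrow> complex) \<Rightarrow> complex" where
  "desc_value k j x = peval id (profile (Points - {Inr k}) \<beta> (pos z x) (z k)) (descendant s P j (\<beta> (Inr k)))"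

definition desc_limit :: "'j \<Rightarrow> nat \<Rightarrow> complex" where
  "desc_limit k j = Lim (at_right 0)
     (\<lambda>\<epsilon>. \<integral>x. indicator (cut_set I J z \<epsilon>) x * desc_value k j x * weight x \<partial>config_measure I)"

lemma desc_value_salg: "desc_value k j \<in> coulomb_star.salg I J z j1 (Inr k)" if "k \<in> J"
proof -
  interpret coulomb_star I J z j1 \<delta> R "Inr k" as "\<lambda>a b. - bil (\<beta> a) (\<beta> b)" by (rule stars) (use that in simp)
  show ?thesis
    unfolding desc_value_def using salg_peval[OF salg_profile] by simp
qed

lemma desc_limits:
  assumes "k \<in> J"
  shows "((\<lambda>\<epsilon>. \<integral>x. indicator (cut_set I J z \<epsilon>) x * desc_value k j x * weight x \<partial>config_measure I) \<longlongrightarrow> desc_limit k j) (at_right 0)"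
    and "(\<lambda>n. \<integral>x. reg (1 / real (Suc n)) x * desc_value k j x * weight x \<partial>config_measure I) \<longlonglongrightarrow> desc_limit k j"
    and "\<epsilon> > 0 \<Longrightarrow> integrable (config_measure I) (\<lambda>x. indicator (cut_set I J z \<epsilon>) x * desc_value k j x * weight x)"
    and "\<eta> > 0 \<Longrightarrow> integrable (config_measure I) (\<lambda>x. reg \<eta> x * desc_value k j x * weight x)"
proof -
  interpret coulomb_star I J z j1 \<delta> R "Inr k" as "\<lambda>a b. - bil (\<beta> a) (\<beta> b)" by (rule stars) (use assms in simp)
  obtain L where L: "((\<lambda>\<epsilon>. \<integral>x. indicator (cut_set I J z \<epsilon>) x * desc_value k j x * weight x \<partial>config_measure I) \<longlongrightarrow> L) (at_right 0)"
     "(\<lambda>n. \<integral>x. reg (1 / real (Suc n)) x * desc_value k j x * weight x \<partial>config_measure I) \<longlonglongrightarrow> L"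
    using star_limit[OF desc_value_salg[OF assms] refl] by blast
  have "desc_limit k j = L"
    unfolding desc_limit_def by (rule tendsto_Lim[OF _ L(1)]) simp
  then show "((\<lambda>\<epsilon>. \<integral>x. indicator (cut_set I J z \<epsilon>) x * desc_value k j x * weight x \<partial>config_measure I) \<longlongrightarrow> desc_limit k j) (at_right 0)"
    "(\<lambda>n. \<integral>x. reg (1 / real (Suc n)) x * desc_value k j x * weight x \<partial>config_measure I) \<longlonglongrightarrow> desc_limit k j"
    using L by simp_all
  show "\<epsilon> > 0 \<Longrightarrow> integrable (config_measure I) (\<lambda>x. indicator (cut_set I J z \<epsilon>) x * desc_value k j x * weight x)"
    by (rule cut_integrable[OF desc_value_salg[OF assms] refl])
  show "\<eta> > 0 \<Longrightarrow> integrable (config_measure I) (\<lambda>x. reg \<eta> x * desc_value k j x * weight x)"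
    by (rule integrable_gcut_salg[OF _ desc_value_salg[OF assms]])
qed

definition scr_integrand :: "(complex \<Rightarrow> complex) \<Rightarrow> 'i \<Rightarrow> nat \<Rightarrow> ('i \<Rightarrow> complex) \<Rightarrow> complex \<Rightarrow> complex" where
  "scr_integrand f q j x \<zeta> = f \<zeta> * peval id (profile (Points - {Inl q}) \<beta> (pos z x) \<zeta>)
     (series_exp (\<lambda>n G. cst (1 / (2 * of_nat n)) * partial_dir (\<beta> (Inl q)) n G) j P)"

definition scr_residue :: "(complex \<Rightarrow> complex) \<Rightarrow> 'i \<Rightarrow> ('i \<Rightarrow> complex) \<Rightarrow> complex" where
  "scr_residue f q x = (\<Sum>j=1..s. (-1) ^ j * (deriv ^^ (j - 1)) (scr_integrand f q j x) (x q) / fact (j - 1))"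

text \<open>With \<open>dressing\<close> in the role of \<open>s\<close> and \<open>logF\<close> in
  the role of \<open>h\<close>, \<open>primitive_factor_derivative\<close> exhibits residue times
  weight as a total derivative in the position of \<open>q\<close>.\<close>

lemma scr_residue_limit:
  assumes q: "q \<in> I" and f: "f holomorphic_on - z ` J"
    and fs: "(\<lambda>x. f (x q)) \<in> coulomb_star.salg I J z j1 (Inl q)"
  shows "(\<lambda>n. \<integral>x. reg (1 / real (Suc n)) x * scr_residue f q x * weight x \<partial>config_measure I) \<longlonglongrightarrow> 0"
    and "\<eta> > 0 \<Longrightarrow> integrable (config_measure I) (\<lambda>x. reg \<eta> x * scr_residue f q x * weight x)"
proof -
  interpret coulomb_screening I J z j1 \<delta> R q as "\<lambda>a b. - bil (\<beta> a) (\<beta> b)" by (rule screens[OF q])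
  let ?u = "\<beta> (Inl q)"
  have prof_upd: "profile others \<beta> (pos z (x(q := w))) \<zeta> = profile others \<beta> (pos z x) \<zeta>" for x w \<zeta>
    unfolding profile_def by (intro ext sum.cong refl) (simp only: pos_upd)
  have prof: "(\<lambda>x. peval id (profile others \<beta> (pos z x) (x q)) D) \<in> salg" for D
    using salg_peval[OF salg_profile] by simp
  let ?g = "\<lambda>j x. scr_integrand f q j x (x q)"
  have g: "?g j \<in> nsalg" for j
    unfolding scr_integrand_def by (intro nsalg_salg salg.mult fs prof)
  have upd: "scr_integrand f q j (x(q := w)) = scr_integrand f q j x" for j x w
    unfolding scr_integrand_def prof_upd ..
  have dg: "(deriv ^^ k) (scr_integrand f q j x) (x q) = (dq ^^ k) (?g j) x" for k j x
    using dq_power_upd[of k "?g j" x "x q"] by (simp add: upd)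
  have T: "scr_residue f q \<in> nsalg"
    unfolding scr_residue_def dg divide_inverse by (intro nsalg_sum nsalg_mult nsalg_const nsalg_dq_power g)
  show "\<eta> > 0 \<Longrightarrow> integrable (config_measure I) (\<lambda>x. reg \<eta> x * scr_residue f q x * weight x)"
    by (rule nsalg_integrable[OF T])
  let ?s = "\<lambda>x. dressing ?u others \<beta> (pos z x)"
  let ?A = "\<lambda>x. primitive_factor s (\<lambda>j. scr_integrand f q j x) (?s x) (x q)"
  have A: "?A \<in> nsalg"
    unfolding primitive_factor_def dg divide_inverse dressing_def
    by (intro nsalg_sum nsalg_mult nsalg_const nsalg_dq_power g nsalg_salg[OF prof])
  show "(\<lambda>n. \<integral>x. reg (1 / real (Suc n)) x * scr_residue f q x * weight x \<partial>config_measure I) \<longlonglongrightarrow> 0"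
  proof (rule nsalg_integral_tendsto_0[OF A])
    fix x assume x: "x \<in> space (config_measure I)" "x q \<notin> pos z x ` others"
    let ?O = "- (pos z x ` others)"
    have O: "open ?O"
      using finite_I finite_J by (intro open_Compl finite_imp_closed) auto
    have "z ` J \<subseteq> pos z x ` others" by (force simp: image_iff)
    then have fO: "f holomorphic_on ?O" by (intro holomorphic_on_subset[OF f]) auto
    have hol: "scr_integrand f q j x holomorphic_on ?O" for j
      unfolding scr_integrand_def by (intro holomorphic_on_mult fO current_holomorphic)
    \<comment> \<open>The first force is the logarithmic derivative of the weight: the exponent
      \<open>- bil\<close> and the factor -1 / 2 in \<open>logF\<close> combine to
      \<open>bil / 2\<close>.\<close>
    have force: "force ?u others \<beta> (pos z x) 1 (x q) = logF x"
    proof -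
      have "force ?u others \<beta> (pos z x) 1 (x q)
          = (\<Sum>i\<in>UNIV. \<Sum>b\<in>others. ?u $ i * \<beta> b $ i / 2 * inverse (pos z x b - x q))"
        by (simp add: force_eq profile_def sum_distrib_left mult.assoc)
      also have "\<dots> = (\<Sum>b\<in>others. \<Sum>i\<in>UNIV. ?u $ i * \<beta> b $ i / 2 * inverse (pos z x b - x q))"
        by (rule sum.swap)
      also have "\<dots> = (\<Sum>b\<in>others. bil ?u (\<beta> b) / 2 * inverse (pos z x b - x q))"
        unfolding bil_def sum_divide_distrib sum_distrib_right ..
      finally show ?thesis unfolding logF_def by simp
    qed
    have "(primitive_factor s (\<lambda>j. scr_integrand f q j x) (?s x) has_field_derivative
       (\<Sum>j=1..s. (-1) ^ j * (deriv ^^ (j - 1)) (scr_integrand f q j x) (x q) / fact (j - 1))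
         - force ?u others \<beta> (pos z x) 1 (x q) * ?A x) (at (x q))"
    proof (rule primitive_factor_derivative[OF O _ hol])
      show "(\<Sum>b<s. ?s x b (x q) * scr_integrand f q (Suc b) x (x q)) = 0"
      proof -
        have "(\<Sum>b<s. ?s x b (x q) * scr_integrand f q (Suc b) x (x q)) =
          f (x q) * (\<Sum>b<s. ?s x b (x q) * peval id (profile others \<beta> (pos z x) (x q))
           (series_exp (\<lambda>n G. cst (1 / (2 * of_nat n)) * partial_dir ?u n G) (Suc b) P))"
          unfolding scr_integrand_def sum_distrib_left by (simp only: mult_ac)
        then show ?thesis unfolding screening_dressing[OF P(2) screened[OF q]] by simp
      qed
      show "x q \<in> ?O" using x(2) by simp
    qed (rule dressing_has_derivative[OF x(2)], rule dressing_0)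
    then show "((\<lambda>w. primitive_factor s (\<lambda>j. scr_integrand f q j (x(q := w))) (?s (x(q := w))) ((x(q := w)) q)) has_field_derivative
       scr_residue f q x - logF x * ?A x) (at (x q))"
      unfolding upd force fun_upd_same scr_residue_def dressing_def prof_upd .
  qed
qed

text \<open>The residue theorem holds configuration by configuration. Times weight and regulator it
  becomes a relation between absolutely convergent integrals, in which the screening terms tend to 0
  and the others to the descendant limits.\<close>

theorem ward_limit:
  assumes f: "f holomorphic_on - z ` J"
    and fs: "\<And>q. q \<in> I \<Longrightarrow> (\<lambda>x. f (x q)) \<in> coulomb_star.salg I J z j1 (Inl q)"
    and ward: "\<And>x. x \<in> space (config_measure I) \<Longrightarrow> inj_on (pos z x) Points \<Longrightarrow>
       (\<Sum>b\<in>Points. residue (\<lambda>\<zeta>. f \<zeta> * peval id (profile Points \<beta> (pos z x) \<zeta>) P) (pos z x b)) = 0"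
    and res: "\<And>x k. x \<in> space (config_measure I) \<Longrightarrow> inj_on (pos z x) Points \<Longrightarrow> k \<in> J \<Longrightarrow>
       residue (\<lambda>\<zeta>. f \<zeta> * peval id (profile Points \<beta> (pos z x) \<zeta>) P) (z k) = (\<Sum>j\<le>s. C k j * desc_value k j x)"
  shows "(\<Sum>k\<in>J. \<Sum>j\<le>s. C k j * desc_limit k j) = 0"
proof -
  obtain k0 where k0: "k0 \<in> J" using J by blast
  interpret star: coulomb_star I J z j1 \<delta> R "Inr k0" as "\<lambda>a b. - bil (\<beta> a) (\<beta> b)" by (rule stars) (use k0 in simp)
  let ?M = "config_measure I"
  \<comment> \<open>At coincidences the residue theorem does not apply, but the weight is 0.\<close>
  have pointwise: "((\<Sum>k\<in>J. \<Sum>j\<le>s. C k j * desc_value k j x) + (\<Sum>q\<in>I. scr_residue f q x)) * weight x = 0"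
    if x: "x \<in> space ?M" for x
  proof (cases "inj_on (pos z x) Points")
    case False
    then have "x \<notin> star.Dst" by (simp add: star.Dst_def)
    then show ?thesis using star.F_Dst[OF x] by simp
  next
    case True
    have "residue (\<lambda>\<zeta>. f \<zeta> * peval id (profile Points \<beta> (pos z x) \<zeta>) P) (x q) = scr_residue f q x" if q: "q \<in> I" for q
    proof -
      have qP: "Inl q \<in> Points" using q by simp
      have "x q \<notin> z ` J"
      proof
        assume "x q \<in> z ` J"
        then obtain l where "l \<in> J" "pos z x (Inl q) = pos z x (Inr l)" by auto
        then show False using inj_onD[OF True, of "Inl q" "Inr l"] q by simp
      qed
      moreover have "open (- z ` J)" using star.finite_J by (intro open_Compl finite_imp_closed) auto
      ultimately have "f analytic_on {pos z x (Inl q)}"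
        using f by (metis ComplI analytic_at pos_simps(1))
      from current_residue_screening[OF finite_Points True qP P(2) this]
      show ?thesis by (simp add: scr_residue_def scr_integrand_def[abs_def])
    qed
    moreover have "(\<Sum>b\<in>Points. residue (\<lambda>\<zeta>. f \<zeta> * peval id (profile Points \<beta> (pos z x) \<zeta>) P) (pos z x b))
      = (\<Sum>q\<in>I. residue (\<lambda>\<zeta>. f \<zeta> * peval id (profile Points \<beta> (pos z x) \<zeta>) P) (x q))
       + (\<Sum>k\<in>J. residue (\<lambda>\<zeta>. f \<zeta> * peval id (profile Points \<beta> (pos z x) \<zeta>) P) (z k))"
      by (subst sum.union_disjoint) (auto simp: star.finite_I star.finite_J sum.reindex)
    ultimately show ?thesis using ward[OF x True] res[OF x True] by (simp add: add.commute)
  qed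
  let ?D = "\<lambda>n k j. \<integral>x. reg (1 / real (Suc n)) x * desc_value k j x * weight x \<partial>?M"
  let ?S = "\<lambda>n q. \<integral>x. reg (1 / real (Suc n)) x * scr_residue f q x * weight x \<partial>?M"
  have zero: "(\<Sum>k\<in>J. \<Sum>j\<le>s. C k j * ?D n k j) + (\<Sum>q\<in>I. ?S n q) = 0" for n
  proof -
    have pos: "0 < 1 / real (Suc n)" by simp
    have i1: "integrable ?M (\<lambda>x. C k j * (reg (1 / real (Suc n)) x * desc_value k j x * weight x))" if "k \<in> J" for k j
      by (intro integrable_mult_right desc_limits(4)[OF that pos])
    have i2: "integrable ?M (\<lambda>x. reg (1 / real (Suc n)) x * scr_residue f q x * weight x)" if "q \<in> I" for q
      by (rule scr_residue_limit(2)[OF that f fs[OF that] pos])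
    have i3: "integrable ?M (\<lambda>x. \<Sum>j\<le>s. C k j * (reg (1 / real (Suc n)) x * desc_value k j x * weight x))" if "k \<in> J" for k
      by (rule Bochner_Integration.integrable_sum) (rule i1[OF that])
    have "0 = (\<integral>x. (\<Sum>k\<in>J. \<Sum>j\<le>s. C k j * (reg (1 / real (Suc n)) x * desc_value k j x * weight x))
       + (\<Sum>q\<in>I. reg (1 / real (Suc n)) x * scr_residue f q x * weight x) \<partial>?M)"
    proof (rule integral_eq_zero_AE[symmetric], rule AE_I2)
      fix x assume x: "x \<in> space ?M"
      have "(\<Sum>k\<in>J. \<Sum>j\<le>s. C k j * (reg (1 / real (Suc n)) x * desc_value k j x * weight x))
       + (\<Sum>q\<in>I. reg (1 / real (Suc n)) x * scr_residue f q x * weight x)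
       = reg (1 / real (Suc n)) x * (((\<Sum>k\<in>J. \<Sum>j\<le>s. C k j * desc_value k j x) + (\<Sum>q\<in>I. scr_residue f q x)) * weight x)"
        unfolding distrib_right distrib_left sum_distrib_left sum_distrib_right by (simp only: mult_ac)
      then show "(\<Sum>k\<in>J. \<Sum>j\<le>s. C k j * (reg (1 / real (Suc n)) x * desc_value k j x * weight x))
       + (\<Sum>q\<in>I. reg (1 / real (Suc n)) x * scr_residue f q x * weight x) = 0"
        unfolding pointwise[OF x] by simp
    qed
    also have "\<dots> = (\<integral>x. (\<Sum>k\<in>J. \<Sum>j\<le>s. C k j * (reg (1 / real (Suc n)) x * desc_value k j x * weight x)) \<partial>?M)
       + (\<integral>x. (\<Sum>q\<in>I. reg (1 / real (Suc n)) x * scr_residue f q x * weight x) \<partial>?M)"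
      by (rule Bochner_Integration.integral_add) (intro Bochner_Integration.integrable_sum i3 i2, assumption)+
    also have "(\<integral>x. (\<Sum>q\<in>I. reg (1 / real (Suc n)) x * scr_residue f q x * weight x) \<partial>?M) = (\<Sum>q\<in>I. ?S n q)"
      by (rule Bochner_Integration.integral_sum) (rule i2)
    also have "(\<integral>x. (\<Sum>k\<in>J. \<Sum>j\<le>s. C k j * (reg (1 / real (Suc n)) x * desc_value k j x * weight x)) \<partial>?M)
       = (\<Sum>k\<in>J. \<integral>x. (\<Sum>j\<le>s. C k j * (reg (1 / real (Suc n)) x * desc_value k j x * weight x)) \<partial>?M)"
      by (rule Bochner_Integration.integral_sum) (rule i3)
    also have "\<dots> = (\<Sum>k\<in>J. \<Sum>j\<le>s. \<integral>x. C k j * (reg (1 / real (Suc n)) x * desc_value k j x * weight x) \<partial>?M)"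
      by (intro sum.cong refl Bochner_Integration.integral_sum i1)
    also have "\<dots> = (\<Sum>k\<in>J. \<Sum>j\<le>s. C k j * ?D n k j)"
      by (intro sum.cong refl integral_mult_right_zero)
    finally show ?thesis by simp
  qed
  have "(\<lambda>n. (\<Sum>k\<in>J. \<Sum>j\<le>s. C k j * ?D n k j) + (\<Sum>q\<in>I. ?S n q)) \<longlonglongrightarrow>
      (\<Sum>k\<in>J. \<Sum>j\<le>s. C k j * desc_limit k j) + (\<Sum>q\<in>I. 0)"
    by (intro tendsto_add tendsto_sum tendsto_mult tendsto_const desc_limits(2) scr_residue_limit(1) f fs)
  then have "(\<lambda>n. 0) \<longlonglongrightarrow> (\<Sum>k\<in>J. \<Sum>j\<le>s. C k j * desc_limit k j) + (\<Sum>q\<in>I. 0)"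
    unfolding zero .
  then show ?thesis by (simp add: LIMSEQ_const_iff)
qed

end

section \<open>Test functions and their residues\<close>

lemma ward_residues:
  assumes W: "W_currents e \<gamma> spin P" "a \<in> {1..CARD('r)}"
    and B: "finite B" "inj_on X B" and neutral: "(\<Sum>b\<in>B. \<beta> b) = 2 *s background e \<gamma>"
    and f: "f holomorphic_on - X ` B" "((\<lambda>\<zeta>. \<zeta> * f \<zeta> / \<zeta> ^ (2 * spin a)) \<longlongrightarrow> 0) at_infinity"
  shows "(\<Sum>b\<in>B. residue (\<lambda>\<zeta>. f \<zeta> * peval id (profile B \<beta> X \<zeta>) (P a :: 'r::finite dpoly)) (X b)) = 0"
proof -
  let ?W = "\<lambda>\<zeta>. peval id (profile B \<beta> X \<zeta>) (P a)"
  have lim: "((\<lambda>\<zeta>. (\<zeta> * f \<zeta> / \<zeta> ^ (2 * spin a)) * (\<zeta> ^ (2 * spin a) * ?W \<zeta>)) \<longlongrightarrow> 0 *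
    peval id (\<lambda>v. \<Sum>b\<in>B. \<beta> b $ snd v / (2 * of_nat (fst v)) * (- X b) ^ fst v) (P a)) at_infinity"
    by (intro tendsto_mult f(2) current_decay[OF W B(1) neutral])
  have "((\<lambda>\<zeta>. \<zeta> * (f \<zeta> * ?W \<zeta>)) \<longlongrightarrow> 0) at_infinity"
  proof (rule Lim_transform_eventually[OF lim[unfolded mult_zero_left]])
    show "\<forall>\<^sub>F \<zeta> in at_infinity. (\<zeta> * f \<zeta> / \<zeta> ^ (2 * spin a)) * (\<zeta> ^ (2 * spin a) * ?W \<zeta>) = \<zeta> * (f \<zeta> * ?W \<zeta>)"
      unfolding eventually_at_infinity
    proof (intro exI[of _ 1] allI impI)
      fix \<zeta> :: complex assume "1 \<le> norm \<zeta>"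
      then have "\<zeta> \<noteq> 0" by auto
      then show "(\<zeta> * f \<zeta> / \<zeta> ^ (2 * spin a)) * (\<zeta> ^ (2 * spin a) * ?W \<zeta>) = \<zeta> * (f \<zeta> * ?W \<zeta>)" by simp
    qed
  qed
  moreover have "(\<lambda>\<zeta>. f \<zeta> * ?W \<zeta>) holomorphic_on - X ` B"
    by (intro holomorphic_on_mult f(1) current_holomorphic)
  ultimately have "(\<Sum>p\<in>X ` B. residue (\<lambda>\<zeta>. f \<zeta> * ?W \<zeta>) p) = 0"
    by (intro sum_residues_zero finite_imageI B(1))
  then show ?thesis by (simp add: sum.reindex B(2))
qed

lemma tendsto_power_ratio:
  assumes "m < n" shows "((\<lambda>\<zeta>. \<zeta> ^ m / \<zeta> ^ n) \<longlongrightarrow> (0 :: complex)) at_infinity"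
proof -
  have "((\<lambda>\<zeta>. inverse \<zeta> ^ (n - m)) \<longlongrightarrow> (0 :: complex) ^ (n - m)) at_infinity"
    by (intro tendsto_power tendsto_inverse_0)
  then have "((\<lambda>\<zeta>. inverse \<zeta> ^ (n - m)) \<longlongrightarrow> (0 :: complex)) at_infinity"
    using assms by (simp add: power_0_left)
  then show ?thesis
  proof (rule Lim_transform_eventually)
    show "\<forall>\<^sub>F \<zeta> in at_infinity. inverse \<zeta> ^ (n - m) = \<zeta> ^ m / (\<zeta> :: complex) ^ n"
      unfolding eventually_at_infinity
    proof (intro exI[of _ 1] allI impI)
      fix \<zeta> :: complex assume "1 \<le> norm \<zeta>"
      then have "\<zeta> \<noteq> 0" by auto
      then show "inverse \<zeta> ^ (n - m) = \<zeta> ^ m / \<zeta> ^ n"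
        using assms by (simp add: power_diff divide_simps)
    qed
  qed
qed

lemma reverse_sum:
  "(\<Sum>m<s. a m * d (s - 1 - m)) = (\<Sum>j\<le>s. (if j < s then a (s - 1 - j) else 0) * d j)" for d :: "nat \<Rightarrow> complex"
proof -
  have "(\<Sum>m<s. a m * d (s - 1 - m)) = (\<Sum>j<s. a (s - 1 - j) * d j)"
    by (rule sum.reindex_bij_witness[of _ "\<lambda>j. s - 1 - j" "\<lambda>j. s - 1 - j"]) auto
  also have "\<dots> = (\<Sum>j\<le>s. (if j < s then a (s - 1 - j) else 0) * d j)"
    by (rule sum.mono_neutral_cong_left) auto
  finally show ?thesis .
qed

lemma fps_nth_shifted_power: "((fps_const c + fps_X) ^ n) $ m = of_nat (n choose m) * c ^ (n - m)" for c :: complex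
proof -
  have "(fps_X + fps_const c) ^ n = (\<Sum>k\<le>n. of_nat (n choose k) * fps_X ^ k * fps_const c ^ (n - k))"
    by (rule binomial_ring)
  then have "((fps_const c + fps_X) ^ n) $ m = (\<Sum>k\<le>n. (of_nat (n choose k) * fps_X ^ k * fps_const c ^ (n - k)) $ m)"
    by (simp add: add.commute fps_sum_nth)
  also have "\<dots> = (\<Sum>k\<le>n. if k = m then of_nat (n choose m) * c ^ (n - m) else 0)"
  proof (rule sum.cong[OF refl])
    fix k
    have "of_nat (n choose k) * fps_X ^ k * fps_const c ^ (n - k) = fps_const (of_nat (n choose k) * c ^ (n - k)) * fps_X ^ k"
      by (simp add: fps_of_nat[symmetric] fps_const_power mult_ac)
    then show "(of_nat (n choose k) * fps_X ^ k * fps_const c ^ (n - k)) $ m = (if k = m then of_nat (n choose m) * c ^ (n - m) else 0)"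
      by (auto simp: fps_mult_left_const_nth)
  qed
  also have "\<dots> = of_nat (n choose m) * c ^ (n - m)"
    by (simp add: binomial_eq_0)
  finally show ?thesis .
qed

context ward_setup
begin

lemma residue_desc:
  assumes "inj_on (pos z x) Points" "k \<in> J" "(\<lambda>t. f (z k + t)) has_fps_expansion A"
  shows "residue (\<lambda>\<zeta>. f \<zeta> * peval id (profile Points \<beta> (pos z x) \<zeta>) P) (z k)
     = (\<Sum>j\<le>s. (if j < s then A $ (s - 1 - j) else 0) * desc_value k j x)"
proof -
  have k: "Inr k \<in> Points" using assms(2) by simp
  have "(\<lambda>t. f (pos z x (Inr k) + t)) has_fps_expansion A" using assms(3) by simp
  from current_residue_regular[OF finite_Points assms(1) k P this]
  show ?thesis
    unfolding reverse_sum[of "\<lambda>m. A $ m" "\<lambda>j. desc_value k j x" s, symmetric] by (simp add: desc_value_def)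
qed

lemma ward_identities:
  assumes W: "W_currents e \<gamma> spin Pf" "a \<in> {1..CARD('r)}" "P = Pf a" "s = spin a" "s \<ge> 1"
    and neutral: "(\<Sum>b\<in>Points. \<beta> b) = 2 *s background e \<gamma>"
    and z: "inj_on z J"
  shows "k1 \<in> J \<Longrightarrow> desc_limit k1 s = (\<Sum>k\<in>J - {k1}. \<Sum>i=1..s. 1 / (z k1 - z k) ^ i * desc_limit k (s - i))"
    and "n \<le> 2 * s - 2 \<Longrightarrow> (\<Sum>k\<in>J. \<Sum>i=0..s - 1. of_nat (n choose i) * z k ^ (n - i) * desc_limit k (s - 1 - i)) = 0"
proof -
  obtain k0 where k0: "k0 \<in> J" using J by blast
  interpret star: coulomb_star I J z j1 \<delta> R "Inr k0" as "\<lambda>a b. - bil (\<beta> a) (\<beta> b)" by (rule stars) (use k0 in simp)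
  have sub: "- pos z x ` Points \<subseteq> - z ` J" for x
    by (force simp: image_iff)
  note wr = ward_residues[OF W(1,2) finite_Points _ neutral, folded W(3) W(4)]
  show "desc_limit k1 s = (\<Sum>k\<in>J - {k1}. \<Sum>i=1..s. 1 / (z k1 - z k) ^ i * desc_limit k (s - i))" if k1: "k1 \<in> J"
  proof -
    let ?f = "\<lambda>\<zeta>. inverse (z k1 - \<zeta>)"
    \<comment> \<open>At \<open>z k1\<close> only the descendant of index \<open>s\<close> occurs,
      with sign -1; at the other points these are the Taylor coefficients of the geometric series of
      the test function, in reverse order.\<close>
    let ?C = "\<lambda>k j. if k = k1 then (if j = s then - 1 else 0) else if j < s then inverse (z k1 - z k) ^ (s - j) else 0"
    have f: "?f holomorphic_on - z ` J"
      by (intro holomorphic_intros) (use k1 in auto)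
    have "(\<Sum>k\<in>J. \<Sum>j\<le>s. ?C k j * desc_limit k j) = 0"
    proof (rule ward_limit[OF f])
      fix q assume q: "q \<in> I"
      interpret coulomb_screening I J z j1 \<delta> R q as "\<lambda>a b. - bil (\<beta> a) (\<beta> b)" by (rule screens[OF q])
      show "(\<lambda>x. inverse (z k1 - x q)) \<in> salg"
        using salg.tinv[of "Inr k1"] k1 by simp
    next
      fix x assume x: "inj_on (pos z x) Points"
      have "((\<lambda>\<zeta>. inverse (z k1 * inverse \<zeta> - 1) * (\<zeta> ^ 0 / \<zeta> ^ (2 * s))) \<longlongrightarrow> inverse (z k1 * 0 - 1) * 0) at_infinity"
        by (intro tendsto_intros tendsto_inverse_0 tendsto_power_ratio) (use W(5) in auto)
      then have lim: "((\<lambda>\<zeta>. inverse (z k1 * inverse \<zeta> - 1) * (\<zeta> ^ 0 / \<zeta> ^ (2 * s))) \<longlongrightarrow> 0) at_infinity" by simp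
      have "((\<lambda>\<zeta>. \<zeta> * ?f \<zeta> / \<zeta> ^ (2 * s)) \<longlongrightarrow> 0) at_infinity"
      proof (rule Lim_transform_eventually[OF lim])
        show "\<forall>\<^sub>F \<zeta> in at_infinity. inverse (z k1 * inverse \<zeta> - 1) * (\<zeta> ^ 0 / \<zeta> ^ (2 * s)) = \<zeta> * ?f \<zeta> / \<zeta> ^ (2 * s)"
          unfolding eventually_at_infinity
        proof (intro exI[of _ 1] allI impI)
          fix \<zeta> :: complex assume "1 \<le> norm \<zeta>"
          then have "\<zeta> \<noteq> 0" by auto
          then have "z k1 * inverse \<zeta> - 1 = (z k1 - \<zeta>) * inverse \<zeta>" by (simp add: field_simps)
          then have "inverse (z k1 * inverse \<zeta> - 1) = \<zeta> * ?f \<zeta>" by simp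
          then show "inverse (z k1 * inverse \<zeta> - 1) * (\<zeta> ^ 0 / \<zeta> ^ (2 * s)) = \<zeta> * ?f \<zeta> / \<zeta> ^ (2 * s)" by simp
        qed
      qed
      then show "(\<Sum>b\<in>Points. residue (\<lambda>\<zeta>. ?f \<zeta> * peval id (profile Points \<beta> (pos z x) \<zeta>) P) (pos z x b)) = 0"
        by (intro wr x holomorphic_on_subset[OF f sub])
      fix k assume k: "k \<in> J"
      show "residue (\<lambda>\<zeta>. ?f \<zeta> * peval id (profile Points \<beta> (pos z x) \<zeta>) P) (z k) = (\<Sum>j\<le>s. ?C k j * desc_value k j x)"
      proof (cases "k = k1")
        case True
        have "Inr k1 \<in> Points" using k1 by simp
        from current_residue_pole[OF finite_Points x this P]
        have "residue (\<lambda>\<zeta>. ?f \<zeta> * peval id (profile Points \<beta> (pos z x) \<zeta>) P) (z k) = - desc_value k1 s x"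
          by (simp add: True desc_value_def)
        also have "\<dots> = (\<Sum>j\<le>s. if j = s then - desc_value k1 s x else 0)"
          by simp
        also have "\<dots> = (\<Sum>j\<le>s. ?C k j * desc_value k j x)"
          by (intro sum.cong refl) (simp add: True)
        finally show ?thesis .
      next
        case False
        then have c: "z k1 - z k \<noteq> 0" using z k k1 by (auto dest: inj_onD)
        have "(\<lambda>t. inverse (z k1 - z k - t)) has_fps_expansion inverse (fps_const (z k1 - z k) - fps_X)"
          by (intro fps_expansion_intros has_fps_expansion_inverse) (use c in auto)
        then have "(\<lambda>t. ?f (z k + t)) has_fps_expansion inverse (fps_const (z k1 - z k) - fps_X)"
          by (simp add: diff_diff_eq)
        from residue_desc[OF x k this]
        have "residue (\<lambda>\<zeta>. ?f \<zeta> * peval id (profile Points \<beta> (pos z x) \<zeta>) P) (z k)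
            = (\<Sum>j\<le>s. (if j < s then inverse (fps_const (z k1 - z k) - fps_X) $ (s - 1 - j) else 0) * desc_value k j x)" .
        also have "\<dots> = (\<Sum>j\<le>s. ?C k j * desc_value k j x)"
        proof (intro sum.cong refl arg_cong2[where f = "(*)"])
          fix j assume "j \<in> {..s}"
          have "inverse (fps_const (z k1 - z k) - fps_X) $ l = inverse (z k1 - z k) ^ Suc l" for l
            using fps_nth_inverse_linear_power[OF c, of 0 l] by simp
          then show "(if j < s then inverse (fps_const (z k1 - z k) - fps_X) $ (s - 1 - j) else 0) = ?C k j"
            using False by (auto simp: Suc_diff_Suc simp del: power_Suc)
        qed
        finally show ?thesis .
      qed
    qed
    moreover have "(\<Sum>k\<in>J. \<Sum>j\<le>s. ?C k j * desc_limit k j) = - desc_limit k1 s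
       + (\<Sum>k\<in>J - {k1}. \<Sum>i=1..s. 1 / (z k1 - z k) ^ i * desc_limit k (s - i))"
    proof -
      have "(\<Sum>j\<le>s. ?C k1 j * desc_limit k1 j) = (\<Sum>j\<le>s. if j = s then - desc_limit k1 s else 0)"
        by (intro sum.cong refl) simp
      moreover have "(\<Sum>j\<le>s. ?C k j * desc_limit k j) = (\<Sum>i=1..s. 1 / (z k1 - z k) ^ i * desc_limit k (s - i))"
        if "k \<in> J - {k1}" for k
      proof -
        have "(\<Sum>j\<le>s. ?C k j * desc_limit k j) = (\<Sum>j<s. inverse (z k1 - z k) ^ (s - j) * desc_limit k j)"
          by (rule sum.mono_neutral_cong_right) (use that in auto)
        also have "\<dots> = (\<Sum>i=1..s. 1 / (z k1 - z k) ^ i * desc_limit k (s - i))"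
          by (rule sum.reindex_bij_witness[of _ "\<lambda>i. s - i" "\<lambda>j. s - j"]) (auto simp: inverse_eq_divide power_one_over)
        finally show ?thesis .
      qed
      ultimately show ?thesis
        by (simp add: sum.remove[OF star.finite_J k1])
    qed
    ultimately show ?thesis by simp
  qed
  show "(\<Sum>k\<in>J. \<Sum>i=0..s - 1. of_nat (n choose i) * z k ^ (n - i) * desc_limit k (s - 1 - i)) = 0" if n: "n \<le> 2 * s - 2"
  proof -
    let ?f = "\<lambda>\<zeta> :: complex. \<zeta> ^ n"
    let ?a = "\<lambda>k i. of_nat (n choose i) * z k ^ (n - i)"
    let ?C = "\<lambda>k j. if j < s then ?a k (s - 1 - j) else 0"
    have f: "?f holomorphic_on A" for A by (intro holomorphic_intros)
    have "(\<Sum>k\<in>J. \<Sum>j\<le>s. ?C k j * desc_limit k j) = 0"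
    proof (rule ward_limit[OF f])
      fix q assume q: "q \<in> I"
      interpret coulomb_screening I J z j1 \<delta> R q as "\<lambda>a b. - bil (\<beta> a) (\<beta> b)" by (rule screens[OF q])
      \<comment> \<open>The position of \<open>q\<close> is the generator \<open>center\<close> plus
        the constant \<open>z j1\<close>.\<close>
      show "(\<lambda>x. x q ^ n) \<in> salg"
        using salg_power[OF salg.add[OF salg.center salg.const[of "z j1"]], of n] by simp
    next
      fix x assume x: "inj_on (pos z x) Points"
      \<comment> \<open>Needs \<open>n + 1 < 2 * s\<close>; with truncated subtraction this follows
        from \<open>n \<le> 2 * s - 2\<close> because \<open>s \<ge> 1\<close>.\<close>
      have "((\<lambda>\<zeta>. \<zeta> * ?f \<zeta> / \<zeta> ^ (2 * s)) \<longlongrightarrow> 0) at_infinity"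
        using tendsto_power_ratio[of "Suc n" "2 * s"] n W(5) by simp
      then show "(\<Sum>b\<in>Points. residue (\<lambda>\<zeta>. ?f \<zeta> * peval id (profile Points \<beta> (pos z x) \<zeta>) P) (pos z x b)) = 0"
        by (intro wr x f)
      fix k assume k: "k \<in> J"
      have "(\<lambda>t. ?f (z k + t)) has_fps_expansion (fps_const (z k) + fps_X) ^ n"
        by (intro fps_expansion_intros)
      from residue_desc[OF x k this]
      show "residue (\<lambda>\<zeta>. ?f \<zeta> * peval id (profile Points \<beta> (pos z x) \<zeta>) P) (z k) = (\<Sum>j\<le>s. ?C k j * desc_value k j x)"
        unfolding fps_nth_shifted_power .
    qed
    moreover have "(\<Sum>j\<le>s. ?C k j * desc_limit k j) = (\<Sum>i=0..s - 1. ?a k i * desc_limit k (s - 1 - i))" for k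
    proof -
      have "{..<s} = {0..s - 1}" using W(5) by auto
      then show ?thesis using reverse_sum[of "?a k" "desc_limit k" s] by simp
    qed
    ultimately show ?thesis by simp
  qed
qed

end

section \<open>Correlation functions with descendants\<close>

lemma pairprod_snoc: "pairprod h (as @ [a]) = pairprod h as * (\<Prod>b\<leftarrow>as. h b a)" for h :: "'a \<Rightarrow> 'a \<Rightarrow> 'b::comm_monoid_mult"
proof -
  have "(\<Prod>l<length as. \<Prod>k<l. h ((as @ [a]) ! k) ((as @ [a]) ! l)) = pairprod h as"
    unfolding pairprod_def by (intro prod.cong refl) (simp add: nth_append)
  moreover have "(\<Prod>k<length as. h ((as @ [a]) ! k) a) = (\<Prod>b\<leftarrow>as. h b a)"
    by (simp add: prod.list_conv_set_nth nth_append atLeast0LessThan)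
  ultimately show ?thesis by (simp add: pairprod_def nth_append)
qed

lemma pairprod_insert:
  assumes "\<And>a b. h a b = h b a"
  shows "pairprod h (as @ a # bs) = pairprod h (as @ bs) * (\<Prod>b\<leftarrow>as @ bs. h b a)"
proof (induction bs rule: rev_induct)
  case Nil
  then show ?case by (simp add: pairprod_snoc)
next
  case (snoc b bs)
  have "pairprod h (as @ a # bs @ [b]) = pairprod h (as @ a # bs) * (\<Prod>c\<leftarrow>as @ a # bs. h c b)"
    using pairprod_snoc[of h "as @ a # bs" b] by simp
  also have "\<dots> = pairprod h (as @ bs) * (\<Prod>c\<leftarrow>as @ bs. h c b) * (\<Prod>c\<leftarrow>as @ bs @ [b]. h c a)"
    using assms[of a b] by (simp add: snoc mult_ac)
  also have "pairprod h (as @ bs) * (\<Prod>c\<leftarrow>as @ bs. h c b) = pairprod h (as @ bs @ [b])"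
    using pairprod_snoc[of h "as @ bs" b] by simp
  finally show ?case .
qed

text \<open>The integrand with a descendant lists the distinguished insertion first and the
  screening charges last, the plain one starts with the screening charges; symmetry of the pair
  factor makes the orders equivalent.\<close>

lemma pairprod_permutation:
  assumes "\<And>a b. h a b = h b a" "mset as = mset bs"
  shows "pairprod h as = pairprod h bs"
  using assms(2)
proof (induction as arbitrary: bs rule: rev_induct)
  case (snoc a as)
  then have "a \<in> set bs" by (metis in_set_conv_decomp set_mset_mset)
  then obtain b1 b2 where bs: "bs = b1 @ a # b2" by (meson split_list)
  then have m: "mset as = mset (b1 @ b2)" using snoc.prems by simp
  have "(\<Prod>b\<leftarrow>as. h b a) = (\<Prod>b\<leftarrow>b1 @ b2. h b a)"
    using m by (metis mset_map prod_mset_prod_list)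
  then show ?case
    unfolding bs pairprod_snoc pairprod_insert[OF assms(1)] using snoc.IH[OF m] by simp
qed simp

text \<open>Field and profile disagree at index 0, where one gives the potential itself and the
  other 0; descendants contain only derivatives of positive order.\<close>

lemma peval_descendant_cong:
  assumes P: "P \<in> Vplus" "weighted_homogeneous s P" and fg: "\<And>n i. 1 \<le> n \<Longrightarrow> f (n, i) = g (n, i)"
  shows "peval id f (descendant s P j \<alpha>) = peval id g (descendant s P j \<alpha>)"
proof -
  have "shifted_fps \<alpha> f id v = shifted_fps \<alpha> g id v" if "v \<in> vars P" for v
  proof -
    have "1 \<le> fst v" using P(1) that by (simp add: Vplus_vars)
    then show ?thesis by (simp add: shifted_fps_def fg)
  qed
  then show ?thesis
    unfolding peval_descendant[OF P(2)] by (metis peval_cong)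
qed

lemma wirtinger_eq:
  assumes "(f has_derivative (\<lambda>h. A * h + B * cnj h)) (at x)"
  shows "wirtinger f x = A"
  unfolding wirtinger_def frechet_derivative_at[OF assms, symmetric]
  by (simp add: algebra_simps)

lemma log_potential_nth:
  "distinct bs \<Longrightarrow> log_potential (map (\<lambda>b. (\<beta> b, X b)) bs) y $ i = (\<Sum>b\<in>set bs. complex_of_real (ln (1 / cmod (y - X b))) * \<beta> b $ i)"
  unfolding log_potential_def
  by (simp add: sum_list_distinct_conv_sum_set o_def vec_eq_iff)

text \<open>The first derivative of \<open>- ln |y - X|\<close> is \<open>1 / (2 (X - y))\<close>,
  which is holomorphic; from then on Wirtinger derivatives are complex derivatives.\<close>

lemma wirtinger_log_potential:
  assumes bs: "distinct bs" and w: "w \<notin> X ` set bs"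
  shows "(wirtinger ^^ Suc n) (\<lambda>y. log_potential (map (\<lambda>b. (\<beta> b, X b)) bs) y $ i) w
     = fact (Suc n) * profile (set bs) \<beta> X w (Suc n, i)"
  using w
proof (induction n arbitrary: w)
  case 0
  have "((\<lambda>y. \<Sum>b\<in>set bs. complex_of_real (ln (1 / cmod (y - X b))) * \<beta> b $ i) has_derivative
     (\<lambda>h. \<Sum>b\<in>set bs. (\<beta> b $ i / 2 * inverse (X b - w)) * h + (\<beta> b $ i / 2 * cnj (inverse (X b - w))) * cnj h)) (at w)"
  proof (rule has_derivative_sum)
    fix b assume "b \<in> set bs"
    then have y0: "w - X b \<noteq> 0" using 0 by auto
    have "((\<lambda>y. cmod (y - X b)) has_derivative (\<lambda>h. inner h (sgn (w - X b)))) (at w)"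
    proof -
      have "((\<lambda>y. y - X b) has_derivative (\<lambda>h. h)) (at w)" by (auto intro!: derivative_eq_intros)
      from has_derivative_compose[OF this has_derivative_norm[OF y0]] show ?thesis .
    qed
    then have "((\<lambda>y. - ln (cmod (y - X b))) has_derivative (\<lambda>h. - (inner h (sgn (w - X b)) / cmod (w - X b)))) (at w)"
      using y0 by (auto intro!: derivative_eq_intros simp: divide_inverse)
    then have D: "((\<lambda>y. complex_of_real (ln (1 / cmod (y - X b))) * \<beta> b $ i) has_derivative
        (\<lambda>h. complex_of_real (- (inner h (sgn (w - X b)) / cmod (w - X b))) * \<beta> b $ i)) (at w)"
      by (intro has_derivative_mult_left has_derivative_of_real) (simp add: ln_div ln_inverse divide_inverse)
    have "complex_of_real (- (inner h (sgn (w - X b)) / cmod (w - X b))) * \<beta> b $ i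
      = (\<beta> b $ i / 2 * inverse (X b - w)) * h + (\<beta> b $ i / 2 * cnj (inverse (X b - w))) * cnj h" for h
    proof -
      define y where "y = w - X b"
      have "inner h (sgn y) / cmod y = inner h y / (cmod y)\<^sup>2"
        by (simp add: sgn_div_norm power2_eq_square divide_inverse)
      also have "\<dots> = Re (h / y)"
        by (simp add: inner_complex_def Re_divide cmod_power2)
      finally have e1: "inner h (sgn y) / cmod y = Re (h / y)" .
      have e2: "complex_of_real (Re (h / y)) = 1 / 2 * (h / y) + 1 / 2 * (cnj h / cnj y)"
        using complex_add_cnj[of "h / y"] by (simp flip: complex_cnj_divide add: field_simps)
      have e3: "inverse (X b - w) = - inverse y" by (simp add: y_def flip: inverse_minus_eq)
      show ?thesis
        unfolding y_def[symmetric] e1 e3 of_real_minus e2 by (simp add: inverse_eq_divide ring_distribs mult.commute)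
    qed
    then show "((\<lambda>y. complex_of_real (ln (1 / cmod (y - X b))) * \<beta> b $ i) has_derivative
        (\<lambda>h. (\<beta> b $ i / 2 * inverse (X b - w)) * h + (\<beta> b $ i / 2 * cnj (inverse (X b - w))) * cnj h)) (at w)"
      using D by simp
  qed
  then have "wirtinger (\<lambda>y. \<Sum>b\<in>set bs. complex_of_real (ln (1 / cmod (y - X b))) * \<beta> b $ i) w
     = (\<Sum>b\<in>set bs. \<beta> b $ i / 2 * inverse (X b - w))"
    unfolding sum.distrib sum_distrib_right[symmetric] by (rule wirtinger_eq)
  then show ?case
    unfolding log_potential_nth[OF bs] by (simp add: profile_def)
next
  case (Suc n)
  let ?F = "(wirtinger ^^ Suc n) (\<lambda>y. log_potential (map (\<lambda>b. (\<beta> b, X b)) bs) y $ i)"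
  let ?G = "\<lambda>w. fact (Suc n) * profile (set bs) \<beta> X w (Suc n, i)"
  have "open (- X ` set bs)" by (intro open_Compl finite_imp_closed) auto
  then have "\<forall>\<^sub>F v in nhds w. v \<in> - X ` set bs"
    using Suc.prems by (intro eventually_nhds_in_open) auto
  then have ev: "\<forall>\<^sub>F v in nhds w. ?F v = ?G v"
    by (rule eventually_mono) (use Suc.IH in auto)
  have "(?G has_field_derivative fact (Suc n) * (of_nat (Suc (Suc n)) * profile (set bs) \<beta> X w (Suc (Suc n), i))) (at w)"
    using profile_has_derivative[OF Suc.prems, of \<beta> "Suc n" i] by (intro DERIV_cmult) simp
  then have "(?F has_field_derivative fact (Suc n) * (of_nat (Suc (Suc n)) * profile (set bs) \<beta> X w (Suc (Suc n), i))) (at w)"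
    by (subst DERIV_cong_ev[OF refl ev refl])
  then have "(?F has_derivative (\<lambda>h. fact (Suc n) * (of_nat (Suc (Suc n)) * profile (set bs) \<beta> X w (Suc (Suc n), i)) * h + 0 * cnj h)) (at w)"
    by (simp add: has_field_derivative_def)
  from wirtinger_eq[OF this]
  have "wirtinger ?F w = fact (Suc n) * (of_nat (Suc (Suc n)) * profile (set bs) \<beta> X w (Suc (Suc n), i))" .
  then show ?case by (simp add: mult_ac)
qed

lemma eval_field_descendant:
  assumes P: "P \<in> Vplus" "weighted_homogeneous s P" and bs: "distinct bs" and w: "w \<notin> X ` set bs"
  shows "eval_field (descendant s P j \<alpha>) (log_potential (map (\<lambda>b. (\<beta> b, X b)) bs)) w
     = peval id (profile (set bs) \<beta> X w) (descendant s P j \<alpha>)"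
  unfolding eval_field_def
proof (rule peval_descendant_cong[OF P])
  fix n :: nat and i assume "1 \<le> n"
  then obtain m where "n = Suc m" by (cases n) auto
  then show "(wirtinger ^^ fst (n, i)) (\<lambda>y. log_potential (map (\<lambda>b. (\<beta> b, X b)) bs) y $ snd (n, i)) w / fact (fst (n, i))
     = profile (set bs) \<beta> X w (n, i)"
    using wirtinger_log_potential[OF bs w, of m \<beta> i] by (simp del: funpow.simps fact_Suc)
qed

lemma free_corr_pairprod:
  "free_corr (map (\<lambda>a. (\<beta> a, X a)) as)
     = pairprod (\<lambda>a b. complex_of_real (cmod (X a - X b)) powr (- bil (\<beta> a) (\<beta> b))) as"
  unfolding free_corr_def pairprod_def by (intro prod.cong) auto

lemma star_config_exists:
  assumes "finite I" "finite J" "j1 \<in> J" "inj_on z J"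
  shows "\<exists>\<delta> R. \<forall>p\<in>Inl ` I \<union> Inr ` J. star_config I J z j1 \<delta> R p"
proof -
  \<comment> \<open>An eighth of the smallest distance leaves room for the strict bound
    \<open>4 * \<delta>\<close>; the inserted 1 keeps \<open>Min\<close> meaningful for a single
    point.\<close>
  define \<delta> where "\<delta> = Min (insert 1 ((\<lambda>(l, m). cmod (z l - z m)) ` {lm \<in> J \<times> J. fst lm \<noteq> snd lm})) / 8"
  define R where "R = 2 * \<delta> + 1 + (\<Sum>l\<in>J. 2 * cmod (z l - z j1))"
  let ?D = "insert 1 ((\<lambda>(l, m). cmod (z l - z m)) ` {lm \<in> J \<times> J. fst lm \<noteq> snd lm})"
  have fin: "finite ?D" using assms(2) by (auto intro: finite_subset[OF _ finite_cartesian_product])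
  have pos: "d > 0" if "d \<in> ?D" for d
    using that assms(4) by (auto dest: inj_onD)
  have "Min ?D > 0" using fin pos by (subst Min_gr_iff) auto
  then have \<delta>0: "\<delta> > 0" by (simp add: \<delta>_def)
  have sep: "4 * \<delta> < cmod (z l - z m)" if "l \<in> J" "m \<in> J" "l \<noteq> m" for l m
  proof -
    have "cmod (z l - z m) \<in> ?D" using that by force
    then have "8 * \<delta> \<le> cmod (z l - z m)" using fin by (simp add: \<delta>_def)
    then show ?thesis using \<delta>0 by linarith
  qed
  have "2 * cmod (z l - z j1) < R" if "l \<in> J" for l
  proof -
    have "2 * cmod (z l - z j1) \<le> (\<Sum>l\<in>J. 2 * cmod (z l - z j1))"
      by (rule member_le_sum[OF that]) (use assms in auto)
    then show ?thesis using \<delta>0 by (simp add: R_def)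
  qed
  moreover have "2 * \<delta> \<le> R" by (simp add: R_def sum_nonneg)
  ultimately show ?thesis
    using assms sep \<delta>0 by (intro exI[of _ \<delta>] exI[of _ R] ballI star_config.intro) auto
qed

section \<open>Enumeration of the insertions\<close>

definition screening_list :: "nat \<Rightarrow> (nat \<Rightarrow> nat) \<Rightarrow> (nat \<times> nat) list" where
  "screening_list r ns = concat (map (\<lambda>i. map (Pair i) [1..<Suc (ns i)]) [1..<Suc r])"

lemma set_screening_list: "set (screening_list r ns) = screening_index r ns"
  by (force simp: screening_list_def screening_index_def image_iff less_Suc_eq_le simp del: upt_Suc)

lemma distinct_screening_list: "distinct (screening_list r ns)"
proof -
  have "distinct (concat (map (\<lambda>i. map (Pair i) [1..<Suc (ns i)]) is))" if "distinct is" for "is"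
    using that by (induction "is") (auto simp: distinct_map inj_on_def simp del: upt_Suc)
  from this[OF distinct_upt] show ?thesis unfolding screening_list_def .
qed

definition insertion_charge :: "(nat \<Rightarrow> real^'r) \<Rightarrow> complex \<Rightarrow> (nat \<Rightarrow> complex^'r) \<Rightarrow> (nat \<times> nat) + nat \<Rightarrow> complex^'r" where
  "insertion_charge e \<gamma> \<alpha> = case_sum (\<lambda>q. \<gamma> *s cvec (e (fst q))) \<alpha>"

lemma screening_charges_eq:
  fixes e :: "nat \<Rightarrow> real^'r::finite"
  shows "screening_charges e \<gamma> ns x = map (\<lambda>a. (insertion_charge e \<gamma> \<alpha> a, pos z x a)) (map Inl (screening_list CARD('r) ns))"
  by (simp add: screening_charges_def screening_list_def map_concat o_def insertion_charge_def del: upt_Suc)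

definition insertion_list :: "nat \<Rightarrow> (nat \<Rightarrow> nat) \<Rightarrow> nat \<Rightarrow> ((nat \<times> nat) + nat) list" where
  "insertion_list r ns N = map Inl (screening_list r ns) @ map Inr [1..<Suc N]"

lemma set_insertion_list: "set (insertion_list r ns N) = Inl ` screening_index r ns \<union> Inr ` {1..N}"
  by (auto simp: insertion_list_def set_screening_list less_Suc_eq_le simp del: upt_Suc)

lemma distinct_insertion_list: "distinct (insertion_list r ns N)"
  by (auto simp: insertion_list_def distinct_map distinct_screening_list simp del: upt_Suc)

lemma corr_integrand_eq:
  fixes e :: "nat \<Rightarrow> real^'r::finite" and \<gamma> :: complex and \<alpha> :: "nat \<Rightarrow> complex^'r"
  defines "\<beta> \<equiv> insertion_charge e \<gamma> \<alpha>"
  shows "corr_integrand e \<gamma> ns N \<alpha> z x = coulomb z (\<lambda>a b. - bil (\<beta> a) (\<beta> b)) (insertion_list CARD('r) ns N) x"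
proof -
  have "screening_charges e \<gamma> ns x @ map (\<lambda>k. (\<alpha> k, z k)) [1..<Suc N]
     = map (\<lambda>a. (\<beta> a, pos z x a)) (insertion_list CARD('r) ns N)"
    unfolding screening_charges_eq[where \<alpha> = \<alpha> and z = z] insertion_list_def \<beta>_def
    by (simp add: insertion_charge_def del: upt_Suc)
  then show ?thesis by (simp add: corr_integrand_def free_corr_pairprod coulomb_def)
qed

lemma corr_desc_integrand_eq:
  fixes e :: "nat \<Rightarrow> real^'r::finite" and \<gamma> :: complex and \<alpha> :: "nat \<Rightarrow> complex^'r"
    and ns :: "nat \<Rightarrow> nat" and N :: nat
  defines "\<beta> \<equiv> insertion_charge e \<gamma> \<alpha>" and "B \<equiv> Inl ` screening_index CARD('r) ns \<union> Inr ` {1..N}"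
  assumes P: "P \<in> Vplus" "weighted_homogeneous s P" and k: "k \<in> {1..N}"
    and away: "z k \<notin> pos z x ` (B - {Inr k})"
  shows "corr_desc_integrand e \<gamma> ns N \<alpha> z s P j k x
     = peval id (profile (B - {Inr k}) \<beta> (pos z x) (z k)) (descendant s P j (\<beta> (Inr k)))
       * coulomb z (\<lambda>a b. - bil (\<beta> a) (\<beta> b)) (insertion_list CARD('r) ns N) x"
proof -
  define bs where "bs = map Inr (filter (\<lambda>l. l \<noteq> k) [1..<Suc N]) @ map Inl (screening_list CARD('r) ns)"
  have sbs: "set bs = B - {Inr k}" by (auto simp: bs_def B_def set_screening_list less_Suc_eq_le simp del: upt_Suc)
  have dbs: "distinct bs" by (auto simp: bs_def distinct_map distinct_screening_list simp del: upt_Suc)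
  have "set (Inr k # bs) = set (insertion_list CARD('r) ns N)"
    using k by (auto simp: sbs set_insertion_list B_def)
  moreover have "distinct (Inr k # bs)" using dbs by (simp add: sbs)
  ultimately have m: "mset (Inr k # bs) = mset (insertion_list CARD('r) ns N)"
    using distinct_insertion_list by (metis set_eq_iff_mset_eq_distinct)
  have ys: "map (\<lambda>l. (\<alpha> l, z l)) (filter (\<lambda>l. l \<noteq> k) [1..<Suc N]) @ screening_charges e \<gamma> ns x
      = map (\<lambda>a. (\<beta> a, pos z x a)) bs"
    unfolding screening_charges_eq[where \<alpha> = \<alpha> and z = z] bs_def \<beta>_def by (simp add: insertion_charge_def o_def del: upt_Suc)
  have y: "(\<alpha> k, z k) = (\<beta> (Inr k), pos z x (Inr k))" by (simp add: \<beta>_def insertion_charge_def)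
  have "z k \<notin> pos z x ` set bs" using away by (simp add: sbs)
  note ev = eval_field_descendant[OF P dbs this, of j "\<alpha> k" \<beta>]
  have "free_corr ((\<alpha> k, z k) # map (\<lambda>a. (\<beta> a, pos z x a)) bs) = free_corr (map (\<lambda>a. (\<beta> a, pos z x a)) (Inr k # bs))"
    by (simp add: \<beta>_def insertion_charge_def)
  also have "\<dots> = coulomb z (\<lambda>a b. - bil (\<beta> a) (\<beta> b)) (insertion_list CARD('r) ns N) x"
    unfolding free_corr_pairprod coulomb_def
    by (rule pairprod_permutation[OF _ m]) (simp add: norm_minus_commute bil_commute)
  finally show ?thesis
    unfolding corr_desc_integrand_def free_corr_desc_def ys using ev
    by (simp add: sbs \<beta>_def insertion_charge_def)
qed

lemma sum_insertion_charge:
  fixes e :: "nat \<Rightarrow> real^'r::finite"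
  shows "(\<Sum>b\<in>Inl ` screening_index CARD('r) ns \<union> Inr ` {1..N}. insertion_charge e \<gamma> \<alpha> b)
     = (\<Sum>i=1..CARD('r). of_nat (ns i) *s (\<gamma> *s cvec (e i))) + (\<Sum>k=1..N. \<alpha> k)"
proof -
  have "(\<Sum>b\<in>Inl ` screening_index CARD('r) ns \<union> Inr ` {1..N}. insertion_charge e \<gamma> \<alpha> b)
     = (\<Sum>q\<in>screening_index CARD('r) ns. \<gamma> *s cvec (e (fst q))) + (\<Sum>k=1..N. \<alpha> k)"
    by (subst sum.union_disjoint) (auto simp: screening_index_def sum.reindex insertion_charge_def)
  also have "(\<Sum>q\<in>screening_index CARD('r) ns. \<gamma> *s cvec (e (fst q)))
     = (\<Sum>i=1..CARD('r). \<Sum>j=1..ns i. \<gamma> *s cvec (e i))"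
    unfolding screening_index_def by (subst sum.Sigma) (auto simp: case_prod_unfold)
  also have "\<dots> = (\<Sum>i=1..CARD('r). of_nat (ns i) *s (\<gamma> *s cvec (e i)))"
    unfolding vec_eq_iff sum_component vector_smult_component by simp
  finally show ?thesis .
qed

theorem theorem1p2:
  fixes scale :: "complex \<Rightarrow> 'g::ab_group_add \<Rightarrow> 'g"
    and bracket :: "'g \<Rightarrow> 'g \<Rightarrow> 'g"
    and H :: "'g set"
    and \<iota> :: "'g \<Rightarrow> complex^'r"
    and e :: "nat \<Rightarrow> real^'r"
    and \<gamma> :: complex
    and spin :: "nat \<Rightarrow> nat"
    and P :: "nat \<Rightarrow> 'r dpoly"
    and N :: nat
    and \<alpha> :: "nat \<Rightarrow> complex^'r"
    and z :: "nat \<Rightarrow> complex"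
    and ns :: "nat \<Rightarrow> nat"
    and a s :: nat
  assumes "simple_lie_data scale bracket H \<iota> e"
    and "\<gamma> \<noteq> 0"
    and "generic_charge e (central_charge e \<gamma>)"
    and "W_currents e \<gamma> spin P"
    and "N \<ge> 1"
    and "(\<Sum>k=1..N. \<alpha> k) - 2 *s background e \<gamma>
           = - (\<Sum>i=1..CARD('r). of_nat (ns i) *s (\<gamma> *s cvec (e i)))"
    and "inj_on z {1..N}"
    and "integrable (screening_measure CARD('r) ns) (corr_integrand e \<gamma> ns N \<alpha> z)"
    and "a \<in> {1..CARD('r)}" and "s = spin a"
  shows "(\<forall>k\<in>{1..N}. \<forall>j\<in>{0..s}.
             corr_desc_exists e \<gamma> ns N \<alpha> z s (P a) j k)
       \<and> corr_desc e \<gamma> ns N \<alpha> z s (P a) s 1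
           = (\<Sum>k=2..N. \<Sum>i=1..s. 1 / (z 1 - z k) ^ i * corr_desc e \<gamma> ns N \<alpha> z s (P a) (s - i) k)
       \<and> (\<forall>n\<in>{0..2 * s - 2}.
             (\<Sum>k=1..N. \<Sum>i=0..s - 1. of_nat (n choose i) * z k ^ (n - i)
                * corr_desc e \<gamma> ns N \<alpha> z s (P a) (s - 1 - i) k) = 0)"
proof -
  let ?I = "screening_index CARD('r) ns" and ?J = "{1..N}"
  let ?as = "insertion_list CARD('r) ns N"
  define \<beta> where "\<beta> = insertion_charge e \<gamma> \<alpha>"
  have PM: "P a \<in> Mplus e \<gamma>" "weighted_homogeneous s (P a)"
    using assms(4,9,10) unfolding W_currents_def by simp_all
  then have PV: "P a \<in> Vplus" by (simp add: Mplus_def)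
  \<comment> \<open>For \<open>s = 0\<close> truncated subtraction gives \<open>s - 1 = 0\<close>,
    and \<open>exponent_mult e 0 = 0\<close> contradicts the presence of \<open>a\<close>.\<close>
  have s1: "s \<ge> 1"
  proof -
    have "card {j \<in> {1..CARD('r)}. spin j = s} = exponent_mult e (s - 1)"
      using assms(4) unfolding W_currents_def by blast
    moreover have "a \<in> {j \<in> {1..CARD('r)}. spin j = s}" using assms(9,10) by simp
    then have "card {j \<in> {1..CARD('r)}. spin j = s} \<noteq> 0" by (auto simp: card_eq_0_iff)
    ultimately show ?thesis by (auto simp: exponent_mult_def split: if_splits)
  qed
  have finI: "finite ?I" by (simp add: screening_index_def)
  have one: "1 \<in> ?J" using assms(5) by simp
  obtain \<delta> R where \<delta>R: "\<And>p. p \<in> Inl ` ?I \<union> Inr ` ?J \<Longrightarrow> star_config ?I ?J z 1 \<delta> R p"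
    using star_config_exists[OF finI _ one assms(7)] by blast
  have int: "integrable (PiM ?I (\<lambda>_. lborel)) (coulomb z (\<lambda>a b. - bil (\<beta> a) (\<beta> b)) ?as)"
    using assms(8) unfolding screening_measure_def \<beta>_def corr_integrand_eq[abs_def] .
  interpret ward_setup ?I ?J z 1 \<delta> R ?as \<beta> "P a" s
  proof (rule ward_setup.intro)
    show "coulomb_star ?I ?J z 1 \<delta> R p ?as (\<lambda>a b. - bil (\<beta> a) (\<beta> b))" if "p \<in> Inl ` ?I \<union> Inr ` ?J" for p
      by (intro coulomb_star.intro \<delta>R that coulomb_star_axioms.intro set_insertion_list distinct_insertion_list int)
    show "screening (\<beta> (Inl q)) (P a) = 0" if "q \<in> ?I" for q
      using PM(1) that by (auto simp: Mplus_def \<beta>_def insertion_charge_def screening_index_def)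
  qed (use one PV PM in auto)
  have neutral: "(\<Sum>b\<in>Points. \<beta> b) = 2 *s background e \<gamma>"
    unfolding \<beta>_def sum_insertion_charge using assms(6) by (simp add: algebra_simps)
  have cut: "cut_domain CARD('r) ns N z \<epsilon> = cut_set ?I ?J z \<epsilon>" for \<epsilon>
    by (simp add: cut_domain_def cut_set_def screening_measure_def)
  \<comment> \<open>In the cut domain no integration variable sits at \<open>z k\<close>, so the
    iterated Wirtinger derivatives of the potential are given by the profile; elsewhere the
    indicator is 0.\<close>
  have integrand: "corr_desc_integrand e \<gamma> ns N \<alpha> z s (P a) j k x = desc_value k j x * weight x"
    if k: "k \<in> ?J" and \<epsilon>: "\<epsilon> > 0" and x: "x \<in> cut_set ?I ?J z \<epsilon>" for j k x \<epsilon>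
  proof -
    have "z k \<notin> pos z x ` (Points - {Inr k})"
    proof
      assume "z k \<in> pos z x ` (Points - {Inr k})"
      then obtain b where b: "b \<in> Points" "b \<noteq> Inr k" "z k = pos z x b" by auto
      show False
      proof (cases b)
        case (Inl q)
        then have "q \<in> ?I" using b by auto
        then have "x q \<notin> ball (z k) \<epsilon>" using x k unfolding cut_set_def by blast
        then show False using b Inl \<epsilon> by simp
      next
        case (Inr l)
        then show False using b k inj_onD[OF assms(7), of k l] by auto
      qed
    qed
    from corr_desc_integrand_eq[OF PV PM(2) k this]
    show ?thesis unfolding desc_value_def unfolding \<beta>_def .
  qed
  have ind: "indicator (cut_set ?I ?J z \<epsilon>) x *\<^sub>R corr_desc_integrand e \<gamma> ns N \<alpha> z s (P a) j k x
      = indicator (cut_set ?I ?J z \<epsilon>) x * desc_value k j x * weight x" if "k \<in> ?J" "\<epsilon> > 0" for j k x \<epsilon>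
    using integrand[OF that] by (auto split: split_indicator)
  have reg: "corr_desc_reg e \<gamma> ns N \<alpha> z s (P a) j k \<epsilon>
      = (\<integral>x. indicator (cut_set ?I ?J z \<epsilon>) x * desc_value k j x * weight x \<partial>config_measure ?I)" if "k \<in> ?J" "\<epsilon> > 0" for j k \<epsilon>
    unfolding corr_desc_reg_def set_lebesgue_integral_def cut screening_measure_def ind[OF that] ..
  have lim: "(corr_desc_reg e \<gamma> ns N \<alpha> z s (P a) j k \<longlongrightarrow> desc_limit k j) (at_right 0)" if "k \<in> ?J" for j k
  proof (rule Lim_transform_eventually[OF desc_limits(1)[OF that]])
    show "\<forall>\<^sub>F \<epsilon> in at_right 0. (\<integral>x. indicator (cut_set ?I ?J z \<epsilon>) x * desc_value k j x * weight x \<partial>config_measure ?I)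
       = corr_desc_reg e \<gamma> ns N \<alpha> z s (P a) j k \<epsilon>"
      using eventually_at_right_less by eventually_elim (simp add: reg[OF that])
  qed
  have desc: "corr_desc e \<gamma> ns N \<alpha> z s (P a) j k = desc_limit k j" if "k \<in> ?J" for j k
    unfolding corr_desc_def by (rule tendsto_Lim[OF _ lim[OF that]]) simp
  have exists: "corr_desc_exists e \<gamma> ns N \<alpha> z s (P a) j k" if "k \<in> ?J" for j k
    unfolding corr_desc_exists_def set_integrable_def cut screening_measure_def
  proof (intro conjI allI impI exI)
    show "integrable (config_measure ?I) (\<lambda>x. indicator (cut_set ?I ?J z \<epsilon>) x *\<^sub>R corr_desc_integrand e \<gamma> ns N \<alpha> z s (P a) j k x)"
      if "\<epsilon> > 0" for \<epsilon>
      unfolding ind[OF \<open>k \<in> ?J\<close> that] by (rule desc_limits(3)[OF \<open>k \<in> ?J\<close> that])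
  qed (rule lim[OF that])
  note W = ward_identities[OF assms(4,9) refl assms(10) s1 neutral assms(7)]
  have "desc_limit 1 s = (\<Sum>k=2..N. \<Sum>i=1..s. 1 / (z 1 - z k) ^ i * desc_limit k (s - i))"
  proof -
    have "?J - {1} = {2..N}" by auto
    then show ?thesis using W(1)[OF one] by simp
  qed
  moreover have "(\<Sum>k=1..N. \<Sum>i=0..s - 1. of_nat (n choose i) * z k ^ (n - i)
      * corr_desc e \<gamma> ns N \<alpha> z s (P a) (s - 1 - i) k) = 0" if "n \<in> {0..2 * s - 2}" for n
    using W(2)[of n] that by (simp add: desc)
  ultimately show ?thesis
    using exists one by (simp add: desc)
qed

end
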